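(* Let $\varphi:G\to\mathrm{Homeo}(X)$ be an action of a discrete group $G$ on a second countable locally compact Hausdorff space $X$, with corresponding action $\alpha$ on $C_0(X)$. The action $\varphi$ is residually topologically free if and only if for every residually reduced crossed product $F_{\mathcal R}(\alpha,u)$, $u\in Z^2(G,C_u(X))$, the quasi-orbit map is a homeomorphism $\mathrm{Prime}(F_{\mathcal R}(\alpha,u))\cong\mathcal O(X)$.
   Context: Setting: $\alpha_s(a)=a\circ\varphi_{s^{-1}}$ for $a\in C_0(X)$, and also for $a\in C_b(X)$. $C_u(X)=\{a\in C_b(X):|a(x)|=1\ \forall x\}$. $Z^2(G,C_u(X))$: normalised $2$-cocycles, i.e. maps $u:G\times G\to C_u(X)$ with $\alpha_r(u(s,t))u(r,st)=u(r,s)u(rs,t)$ and $u(1,1)=1$. A set $V\subseteq X$ is $\varphi$-invariant if $\varphi_t(V)=V$ for all $t$; for invariant open or closed $V$, $(\alpha^V,u^V)$ is the twisted action on $C_0(V)$ given by $\varphi_t^V=\varphi_t|_V$, $u^V(s,t)=u(s,t)|_V$. An action is topologically free if for each $t\neq1$ the fixed point set of $\varphi_t$ has empty interior; $\varphi$ is residually topologically free if $\varphi^Y$ is topologically free on $Y$ for every closed $\varphi$-invariant $Y\subseteq X$. $F(\alpha,u)=\ell^1(G,C_0(X))$ has norm $\|b\|_1=\sum_g\|b(g)\|_\infty$ and product $(a*b)(r)=\sum_{st=r}a(s)\alpha_s(b(t))u(s,t)$; $C_0(X)$ is identified with functions supported at $1\in G$. For a family $\mathcal R$ of representations (contractive homomorphisms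 into $B(E)$, $E$ Banach) separating points of $F(\alpha,u)$, $F_{\mathcal R}(\alpha,u)$ is the completion of $F(\alpha,u)$ in $\sup_{\psi\in\mathcal R}\|\psi(b)\|$; it is a (Banach algebra) crossed product for $(\alpha,u)$ if $E_1(b)=b(1)$ extends to a contraction $F_{\mathcal R}(\alpha,u)\to C_0(X)$. Then all $E_t(b)=b(t)$ extend to contractions $E_t^{\mathcal R}$, and it is reduced if $\bigcap_t\ker E_t^{\mathcal R}=\{0\}$. For open invariant $U$, $F_{\mathcal R^U}(\alpha^U,u^U)$ is the closure of $\ell^1(G,C_0(U))$ in $F_{\mathcal R}(\alpha,u)$. A crossed product $F_{\mathcal R}(\alpha,u)$ is residually reduced if for every open invariant $U\subseteq X$, with $Y=X\setminus U$, the quotient $F_{\mathcal R}(\alpha,u)/F_{\mathcal R^U}(\alpha^U,u^U)$ is naturally (as a completion of $F(\alpha^Y,u^Y)\cong\ell^1(G,C_0(X))/\ell^1(G,C_0(U))$ via $b\mapsto b|_Y$) a reduced crossed product for $(\alpha^Y,u^Y)$. For a Banach algebra $B$, $\mathcal I(B)$ is the lattice of closed two-sided ideals; $\mathrm{Prime}(B)$ is the set of $p\in\mathcal I(B)\setminus\{B\}$ such that $I_1\cap I_2\subseteq p$ with $I_1,I_2\in\mathcal I(B)$ implies $I_1\subseteq p$ or $I_2\subseteq p$, with topology consisting of the sets $\{p: I\not\subseteq p\}$, $I\in\mathcal I(B)$. The quasi-orbit space $\mathcal O(X)=X/{\sim}$ is the quotient topological space for $x\sim y\iff\overline{Gx}=\overline{Gy}$,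 where $\overline{Gx}=\overline{\{\varphi_t(x):t\in G\}}$. For $X$ second countable and $F_{\mathcal R}(\alpha,u)$ a crossed product, the quasi-orbit map $\varrho:\mathrm{Prime}(F_{\mathcal R}(\alpha,u))\to\mathcal O(X)$ is the well-defined map sending $P$ to the class $[x]$ with $P\cap C_0(X)=C_0(X\setminus\overline{Gx})$. *)

theory Defs
  imports "HOL-Analysis.Analysis"
    "HOL-Algebra.Group_Action" "HOL-Algebra.Module" "HOL-Algebra.QuotRing"
    "HOL-Algebra.Algebraic_Closure_Type"
begin

no_notation var (\<open>X\<index>\<close>) (* frees the name X for spaces *)

section \<open>Banach spaces and Banach algebras with explicit carriers\<close>

text \<open>
  Normed spaces and normed algebras are module records over the field of complex numbers with
  an additional norm.  The algebras are not assumed to be unital: the field \<open>one\<close> inherited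
  from ring records is never used, and for mere Banach spaces \<open>mult\<close> is not used either.
\<close>

record 'a cnormed = "(complex, 'a) module" +
  nrm :: "'a \<Rightarrow> real"

definition norm_dist :: "'a cnormed \<Rightarrow> 'a \<Rightarrow> 'a \<Rightarrow> real" where
  "norm_dist M x y =
     (if x \<in> carrier M \<and> y \<in> carrier M then nrm M (x \<ominus>\<^bsub>M\<^esub> y) else 0)"

definition norm_topology :: "'a cnormed \<Rightarrow> 'a topology" where
  "norm_topology M = Metric_space.mtopology (carrier M) (norm_dist M)"

locale cbanach_space = module "ring_of_type_algebra :: complex ring" M
    for M :: "'a cnormed" (structure) +
  assumes nrm_nonneg: "x \<in> carrier M \<Longrightarrow> 0 \<le> nrm M x"
    and nrm_eq_0: "x \<in> carrier M \<Longrightarrow> nrm M x = 0 \<longleftrightarrow> x = \<zero>\<^bsub>M\<^esub>"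
    and nrm_triangle:
      "\<lbrakk>x \<in> carrier M; y \<in> carrier M\<rbrakk> \<Longrightarrow> nrm M (x \<oplus>\<^bsub>M\<^esub> y) \<le> nrm M x + nrm M y"
    and nrm_smult: "x \<in> carrier M \<Longrightarrow> nrm M (c \<odot>\<^bsub>M\<^esub> x) = cmod c * nrm M x"
    and complete: "Metric_space.mcomplete (carrier M) (norm_dist M)"

locale cbanach_algebra = cbanach_space +
  assumes mult_closed:
      "\<lbrakk>x \<in> carrier M; y \<in> carrier M\<rbrakk> \<Longrightarrow> x \<otimes>\<^bsub>M\<^esub> y \<in> carrier M"
    and mult_assoc: "\<lbrakk>x \<in> carrier M; y \<in> carrier M; z \<in> carrier M\<rbrakk> \<Longrightarrow>
      (x \<otimes>\<^bsub>M\<^esub> y) \<otimes>\<^bsub>M\<^esub> z = x \<otimes>\<^bsub>M\<^esub> (y \<otimes>\<^bsub>M\<^esub> z)"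
    and mult_l_distr: "\<lbrakk>x \<in> carrier M; y \<in> carrier M; z \<in> carrier M\<rbrakk> \<Longrightarrow>
      (x \<oplus>\<^bsub>M\<^esub> y) \<otimes>\<^bsub>M\<^esub> z = (x \<otimes>\<^bsub>M\<^esub> z) \<oplus>\<^bsub>M\<^esub> (y \<otimes>\<^bsub>M\<^esub> z)"
    and mult_r_distr: "\<lbrakk>x \<in> carrier M; y \<in> carrier M; z \<in> carrier M\<rbrakk> \<Longrightarrow>
      z \<otimes>\<^bsub>M\<^esub> (x \<oplus>\<^bsub>M\<^esub> y) = (z \<otimes>\<^bsub>M\<^esub> x) \<oplus>\<^bsub>M\<^esub> (z \<otimes>\<^bsub>M\<^esub> y)"
    and mult_smult_left: "\<lbrakk>x \<in> carrier M; y \<in> carrier M\<rbrakk> \<Longrightarrow>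
      (c \<odot>\<^bsub>M\<^esub> x) \<otimes>\<^bsub>M\<^esub> y = c \<odot>\<^bsub>M\<^esub> (x \<otimes>\<^bsub>M\<^esub> y)"
    and mult_smult_right: "\<lbrakk>x \<in> carrier M; y \<in> carrier M\<rbrakk> \<Longrightarrow>
      x \<otimes>\<^bsub>M\<^esub> (c \<odot>\<^bsub>M\<^esub> y) = c \<odot>\<^bsub>M\<^esub> (x \<otimes>\<^bsub>M\<^esub> y)"
    and nrm_mult: "\<lbrakk>x \<in> carrier M; y \<in> carrier M\<rbrakk> \<Longrightarrow>
      nrm M (x \<otimes>\<^bsub>M\<^esub> y) \<le> nrm M x * nrm M y"

definition linear_on :: "'a cnormed \<Rightarrow> 'b cnormed \<Rightarrow> ('a \<Rightarrow> 'b) \<Rightarrow> bool" where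
  "linear_on A B f \<longleftrightarrow> f \<in> carrier A \<rightarrow> carrier B \<and>
     (\<forall>x\<in>carrier A. \<forall>y\<in>carrier A. f (x \<oplus>\<^bsub>A\<^esub> y) = f x \<oplus>\<^bsub>B\<^esub> f y) \<and>
     (\<forall>c. \<forall>x\<in>carrier A. f (c \<odot>\<^bsub>A\<^esub> x) = c \<odot>\<^bsub>B\<^esub> f x)"

definition multiplicative_on :: "'a cnormed \<Rightarrow> 'b cnormed \<Rightarrow> ('a \<Rightarrow> 'b) \<Rightarrow> bool" where
  "multiplicative_on A B f \<longleftrightarrow>
     (\<forall>x\<in>carrier A. \<forall>y\<in>carrier A. f (x \<otimes>\<^bsub>A\<^esub> y) = f x \<otimes>\<^bsub>B\<^esub> f y)"

definition contractive_on :: "'a cnormed \<Rightarrow> 'b cnormed \<Rightarrow> ('a \<Rightarrow> 'b) \<Rightarrow> bool" where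
  "contractive_on A B f \<longleftrightarrow> (\<forall>x\<in>carrier A. nrm B (f x) \<le> nrm A x)"

text \<open>The algebra \<open>B(E)\<close>; operators are extensional functions on the carrier of \<open>E\<close>.\<close>

definition bounded_operators :: "'e cnormed \<Rightarrow> ('e \<Rightarrow> 'e) cnormed" where
  "bounded_operators E = \<lparr>
     carrier = {T. T \<in> extensional (carrier E) \<and> linear_on E E T \<and>
                   (\<exists>C. \<forall>x\<in>carrier E. nrm E (T x) \<le> C * nrm E x)},
     monoid.mult = (\<lambda>S T. compose (carrier E) S T),
     one = (\<lambda>x\<in>carrier E. x),
     ring.zero = (\<lambda>x\<in>carrier E. \<zero>\<^bsub>E\<^esub>),
     add = (\<lambda>S T. \<lambda>x\<in>carrier E. S x \<oplus>\<^bsub>E\<^esub> T x),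
     smult = (\<lambda>c T. \<lambda>x\<in>carrier E. c \<odot>\<^bsub>E\<^esub> T x),
     nrm = (\<lambda>T. Sup {nrm E (T x) | x. x \<in> carrier E \<and> nrm E x \<le> 1}) \<rparr>"

definition closed_ideals :: "'a cnormed \<Rightarrow> 'a set set" where
  "closed_ideals B = {I. submodule I (ring_of_type_algebra :: complex ring) B \<and>
     (\<forall>x\<in>I. \<forall>b\<in>carrier B. b \<otimes>\<^bsub>B\<^esub> x \<in> I \<and> x \<otimes>\<^bsub>B\<^esub> b \<in> I) \<and>
     closedin (norm_topology B) I}"

definition prime_ideals :: "'a cnormed \<Rightarrow> 'a set set" where
  "prime_ideals B = {p \<in> closed_ideals B - {carrier B}.
     \<forall>I\<in>closed_ideals B. \<forall>J\<in>closed_ideals B. I \<inter> J \<subseteq> p \<longrightarrow> I \<subseteq> p \<or> J \<subseteq> p}"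

definition prime_space :: "'a cnormed \<Rightarrow> 'a set topology" where
  "prime_space B =
     topology (\<lambda>S. \<exists>I\<in>closed_ideals B. S = {p \<in> prime_ideals B. \<not> I \<subseteq> p})"

definition quotient_algebra :: "'a cnormed \<Rightarrow> 'a set \<Rightarrow> 'a set cnormed" where
  "quotient_algebra B J = \<lparr>
     carrier = carrier (B Quot J),
     monoid.mult = monoid.mult (B Quot J),
     one = one (B Quot J),
     ring.zero = ring.zero (B Quot J),
     add = add (B Quot J),
     smult = (\<lambda>c A. \<Union>a\<in>A. J +>\<^bsub>B\<^esub> (c \<odot>\<^bsub>B\<^esub> a)),
     nrm = (\<lambda>A. Inf (nrm B ` A)) \<rparr>"

text \<open>The following facts show that \<^const>\<open>norm_topology\<close> and \<^const>\<open>prime_space\<close> are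
  what their definitions suggest.\<close>

lemma (in cbanach_space) Metric_space_norm_dist: "Metric_space (carrier M) (norm_dist M)"
proof
  have neg: "\<ominus>\<^bsub>M\<^esub> x = (-1) \<odot>\<^bsub>M\<^esub> x" if "x \<in> carrier M" for x
  proof -
    have "(1 + (-1)) \<odot>\<^bsub>M\<^esub> x = 1 \<odot>\<^bsub>M\<^esub> x \<oplus>\<^bsub>M\<^esub> (-1) \<odot>\<^bsub>M\<^esub> x"
      using smult_l_distr[of 1 "-1" x] that by (simp add: ring_of_type_algebra_def)
    moreover have "0 \<odot>\<^bsub>M\<^esub> x = \<zero>\<^bsub>M\<^esub>" "1 \<odot>\<^bsub>M\<^esub> x = x"
      using smult_l_null[OF that] smult_one[OF that] by (simp_all add: ring_of_type_algebra_def)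
    ultimately have "x \<oplus>\<^bsub>M\<^esub> (-1) \<odot>\<^bsub>M\<^esub> x = \<zero>\<^bsub>M\<^esub>"
      by simp
    moreover have "(-1) \<odot>\<^bsub>M\<^esub> x \<in> carrier M"
      using smult_closed[of "-1" x] that by (simp add: ring_of_type_algebra_def)
    ultimately show ?thesis
      by (metis M.add.inv_comm M.minus_equality that)
  qed
  show "0 \<le> norm_dist M x y" for x y
    by (simp add: norm_dist_def nrm_nonneg)
  show "norm_dist M x y = norm_dist M y x" for x y
  proof (cases "x \<in> carrier M \<and> y \<in> carrier M")
    case True
    then have "y \<ominus>\<^bsub>M\<^esub> x = \<ominus>\<^bsub>M\<^esub> (x \<ominus>\<^bsub>M\<^esub> y)"
      by (simp add: M.minus_eq M.minus_add M.a_comm)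
    also have "\<dots> = (-1) \<odot>\<^bsub>M\<^esub> (x \<ominus>\<^bsub>M\<^esub> y)"
      using True by (intro neg) simp
    finally have "nrm M (y \<ominus>\<^bsub>M\<^esub> x) = nrm M (x \<ominus>\<^bsub>M\<^esub> y)"
      using nrm_smult[of "x \<ominus>\<^bsub>M\<^esub> y" "-1"] True by simp
    then show ?thesis
      by (simp add: norm_dist_def)
  qed (auto simp: norm_dist_def)
  show "norm_dist M x y = 0 \<longleftrightarrow> x = y" if "x \<in> carrier M" "y \<in> carrier M" for x y
  proof -
    have "x \<ominus>\<^bsub>M\<^esub> y = \<zero>\<^bsub>M\<^esub> \<longleftrightarrow> x = y"
      using that by (metis M.add.inv_closed M.minus_eq M.minus_minus M.minus_equality M.r_neg)
    then show ?thesis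
      using that nrm_eq_0[of "x \<ominus>\<^bsub>M\<^esub> y"] by (simp add: norm_dist_def)
  qed
  show "norm_dist M x z \<le> norm_dist M x y + norm_dist M y z"
    if "x \<in> carrier M" "y \<in> carrier M" "z \<in> carrier M" for x y z
  proof -
    have "(x \<ominus>\<^bsub>M\<^esub> y) \<oplus>\<^bsub>M\<^esub> (y \<ominus>\<^bsub>M\<^esub> z) = x \<ominus>\<^bsub>M\<^esub> z"
      using that by (simp add: M.minus_eq M.a_assoc M.r_neg1 M.r_neg2)
    then show ?thesis
      using nrm_triangle[of "x \<ominus>\<^bsub>M\<^esub> y" "y \<ominus>\<^bsub>M\<^esub> z"] that by (simp add: norm_dist_def)
  qed
qed

lemma (in cbanach_algebra) carrier_in_closed_ideals: "carrier M \<in> closed_ideals M"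
proof -
  have "closedin (norm_topology M) (carrier M)"
    by (metis Metric_space.topspace_mtopology Metric_space_norm_dist closedin_topspace
        norm_topology_def)
  then show ?thesis
    by (simp add: closed_ideals_def carrier_is_submodule mult_closed)
qed

lemma (in cbanach_algebra) Inter_in_closed_ideals:
  assumes "\<I> \<subseteq> closed_ideals M" "\<I> \<noteq> {}"
  shows "\<Inter>\<I> \<in> closed_ideals M"
proof -
  have "submodule (\<Inter>\<I>) (ring_of_type_algebra :: complex ring) M"
  proof (rule submoduleI)
    have sub: "submodule I (ring_of_type_algebra :: complex ring) M" if "I \<in> \<I>" for I
      using assms that by (auto simp: closed_ideals_def)
    show "\<Inter>\<I> \<subseteq> carrier M"
      using sub assms(2) submoduleE(1) by blast
    show "\<zero>\<^bsub>M\<^esub> \<in> \<Inter>\<I>"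
      using subgroup.one_closed[OF submodule.axioms(1)[OF sub]] by simp
    show "\<ominus>\<^bsub>M\<^esub> a \<in> \<Inter>\<I>" if "a \<in> \<Inter>\<I>" for a
      using sub that submoduleE(3) by blast
    show "a \<oplus>\<^bsub>M\<^esub> b \<in> \<Inter>\<I>" if "a \<in> \<Inter>\<I>" "b \<in> \<Inter>\<I>" for a b
      using sub that submoduleE(5) by blast
    show "a \<odot>\<^bsub>M\<^esub> x \<in> \<Inter>\<I>"
      if "a \<in> carrier (ring_of_type_algebra :: complex ring)" "x \<in> \<Inter>\<I>" for a x
      using sub that submoduleE(4) by blast
  qed
  moreover have "closedin (norm_topology M) (\<Inter>\<I>)"
    using assms by (intro closedin_Inter) (auto simp: closed_ideals_def)
  ultimately show ?thesis
    using assms by (auto simp: closed_ideals_def)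
qed

lemma (in cbanach_algebra) openin_prime_space:
  "openin (prime_space M) S \<longleftrightarrow>
     (\<exists>I\<in>closed_ideals M. S = {p \<in> prime_ideals M. \<not> I \<subseteq> p})"
proof -
  let ?h = "\<lambda>I. {p \<in> prime_ideals M. \<not> I \<subseteq> p}"
  have int: "\<exists>K\<in>closed_ideals M. ?h I \<inter> ?h J = ?h K"
    if "I \<in> closed_ideals M" "J \<in> closed_ideals M" for I J
  proof
    show "I \<inter> J \<in> closed_ideals M"
      using Inter_in_closed_ideals[of "{I, J}"] that by simp
    show "?h I \<inter> ?h J = ?h (I \<inter> J)"
      using that by (auto simp: prime_ideals_def)
  qed
  have un: "\<exists>K\<in>closed_ideals M. \<Union>\<K> = ?h K"
    if "\<And>S. S \<in> \<K> \<Longrightarrow> \<exists>I\<in>closed_ideals M. S = ?h I" for \<K>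
  proof -
    have "\<forall>S\<in>\<K>. \<exists>I. I \<in> closed_ideals M \<and> S = ?h I"
      using that by blast
    from bchoice[OF this]
    obtain i where i: "\<And>S. S \<in> \<K> \<Longrightarrow> i S \<in> closed_ideals M \<and> S = ?h (i S)"
      by blast
    let ?K = "{K \<in> closed_ideals M. \<Union>(i ` \<K>) \<subseteq> K}"
    have sub: "I \<subseteq> carrier M" if "I \<in> closed_ideals M" for I
      using that submoduleE(1) by (auto simp: closed_ideals_def)
    have "carrier M \<in> ?K"
      using carrier_in_closed_ideals i sub by blast
    then have mem: "\<Inter>?K \<in> closed_ideals M"
      by (intro Inter_in_closed_ideals) auto
    have eq: "\<Inter>?K \<subseteq> p \<longleftrightarrow> (\<forall>S\<in>\<K>. i S \<subseteq> p)" if "p \<in> prime_ideals M" for p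
    proof
      show "\<forall>S\<in>\<K>. i S \<subseteq> p" if "\<Inter>?K \<subseteq> p"
        using that by blast
      show "\<Inter>?K \<subseteq> p" if "\<forall>S\<in>\<K>. i S \<subseteq> p"
        using that \<open>p \<in> prime_ideals M\<close> by (intro Inter_lower) (auto simp: prime_ideals_def)
    qed
    have "\<Union>\<K> = (\<Union>S\<in>\<K>. S)"
      by simp
    also have "\<dots> = (\<Union>S\<in>\<K>. ?h (i S))"
      using i by (intro SUP_cong) simp_all
    also have "\<dots> = {p \<in> prime_ideals M. \<not> (\<forall>S\<in>\<K>. i S \<subseteq> p)}"
      by blast
    also have "\<dots> = ?h (\<Inter>?K)"
      using eq by (intro Collect_cong conj_cong refl) simp
    finally show ?thesis
      using mem by blast
  qed
  have "istopology (\<lambda>S. \<exists>I\<in>closed_ideals M. S = ?h I)"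
    unfolding istopology_def
  proof (intro conjI allI impI)
    fix S T
    assume "\<exists>I\<in>closed_ideals M. S = ?h I" "\<exists>I\<in>closed_ideals M. T = ?h I"
    then show "\<exists>I\<in>closed_ideals M. S \<inter> T = ?h I"
      using int by (elim bexE) simp
  next
    fix \<K>
    assume "\<forall>K\<in>\<K>. \<exists>I\<in>closed_ideals M. K = ?h I"
    then show "\<exists>I\<in>closed_ideals M. \<Union>\<K> = ?h I"
      by (intro un) simp
  qed
  then show ?thesis
    by (simp add: prime_space_def)
qed

section \<open>Group actions on spaces\<close>

text \<open>
  Functions on a space \<open>X\<close> are represented by functions on the underlying type that vanish
  outside \<open>topspace X\<close>.  In this way \<open>C\<^sub>0(U) \<subseteq> C\<^sub>0(X)\<close> holds literally for open \<open>U \<subseteq> X\<close>.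
\<close>

definition C0 :: "'x topology \<Rightarrow> ('x \<Rightarrow> complex) set" where
  "C0 X = {a. continuous_map X euclidean a \<and> (\<forall>x. x \<notin> topspace X \<longrightarrow> a x = 0) \<and>
              (\<forall>e>0. compactin X {x \<in> topspace X. e \<le> cmod (a x)})}"

definition sup_norm :: "('x \<Rightarrow> complex) \<Rightarrow> real" where
  "sup_norm a = (SUP x. cmod (a x))"

definition C0_algebra :: "'x topology \<Rightarrow> ('x \<Rightarrow> complex) cnormed" where
  "C0_algebra X = \<lparr>
     carrier = C0 X,
     monoid.mult = (\<lambda>a b x. a x * b x),
     one = undefined,
     ring.zero = (\<lambda>x. 0),
     add = (\<lambda>a b x. a x + b x),
     smult = (\<lambda>c a x. c * a x),
     nrm = sup_norm \<rparr>"

definition Cu :: "'x topology \<Rightarrow> ('x \<Rightarrow> complex) set" where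
  "Cu X = {a. continuous_map X euclidean a \<and> (\<forall>x. x \<notin> topspace X \<longrightarrow> a x = 0) \<and>
              (\<forall>x\<in>topspace X. cmod (a x) = 1)}"

definition restr :: "'x set \<Rightarrow> ('x \<Rightarrow> complex) \<Rightarrow> 'x \<Rightarrow> complex" where
  "restr V a = (\<lambda>x. if x \<in> V then a x else 0)"

locale homeo_action = group_action G "topspace X" \<phi>
    for G :: "('g, 'm) monoid_scheme" (structure) and X :: "'x topology" and \<phi> +
  assumes homeo: "g \<in> carrier G \<Longrightarrow> homeomorphic_map X X (\<phi> g)"

definition invariant_set ::
    "('g, 'm) monoid_scheme \<Rightarrow> 'x topology \<Rightarrow> ('g \<Rightarrow> 'x \<Rightarrow> 'x) \<Rightarrow> 'x set \<Rightarrow> bool" where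
  "invariant_set G X \<phi> V \<longleftrightarrow> V \<subseteq> topspace X \<and> (\<forall>t\<in>carrier G. \<phi> t ` V = V)"

definition restr_action :: "'x set \<Rightarrow> ('g \<Rightarrow> 'x \<Rightarrow> 'x) \<Rightarrow> 'g \<Rightarrow> 'x \<Rightarrow> 'x" where
  "restr_action V \<phi> = (\<lambda>t. restrict (\<phi> t) V)"

definition restr_cocycle :: "'x set \<Rightarrow> ('g \<Rightarrow> 'g \<Rightarrow> 'x \<Rightarrow> complex) \<Rightarrow> 'g \<Rightarrow> 'g \<Rightarrow> 'x \<Rightarrow> complex" where
  "restr_cocycle V u = (\<lambda>s t. restr V (u s t))"

definition topologically_free ::
    "('g, 'm) monoid_scheme \<Rightarrow> 'x topology \<Rightarrow> ('g \<Rightarrow> 'x \<Rightarrow> 'x) \<Rightarrow> bool" where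
  "topologically_free G X \<phi> \<longleftrightarrow>
     (\<forall>t\<in>carrier G. t \<noteq> \<one>\<^bsub>G\<^esub> \<longrightarrow> X interior_of (invariants (topspace X) \<phi> t) = {})"

definition residually_topologically_free ::
    "('g, 'm) monoid_scheme \<Rightarrow> 'x topology \<Rightarrow> ('g \<Rightarrow> 'x \<Rightarrow> 'x) \<Rightarrow> bool" where
  "residually_topologically_free G X \<phi> \<longleftrightarrow>
     (\<forall>Y. closedin X Y \<and> invariant_set G X \<phi> Y \<longrightarrow>
          topologically_free G (subtopology X Y) (restr_action Y \<phi>))"

definition dual_action ::
    "('g, 'm) monoid_scheme \<Rightarrow> 'x topology \<Rightarrow> ('g \<Rightarrow> 'x \<Rightarrow> 'x) \<Rightarrow> 'g \<Rightarrow> ('x \<Rightarrow> complex) \<Rightarrow> 'x \<Rightarrow> complex"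
  where "dual_action G X \<phi> s a = restr (topspace X) (a \<circ> \<phi> (inv\<^bsub>G\<^esub> s))"

definition cocycles ::
    "('g, 'm) monoid_scheme \<Rightarrow> 'x topology \<Rightarrow> ('g \<Rightarrow> 'x \<Rightarrow> 'x) \<Rightarrow> ('g \<Rightarrow> 'g \<Rightarrow> 'x \<Rightarrow> complex) set"
  where
  "cocycles G X \<phi> = {u.
     (\<forall>s\<in>carrier G. \<forall>t\<in>carrier G. u s t \<in> Cu X) \<and>
     (\<forall>r\<in>carrier G. \<forall>s\<in>carrier G. \<forall>t\<in>carrier G. \<forall>x\<in>topspace X.
        dual_action G X \<phi> r (u s t) x * u r (s \<otimes>\<^bsub>G\<^esub> t) x = u r s x * u (r \<otimes>\<^bsub>G\<^esub> s) t x) \<and>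
     (\<forall>x\<in>topspace X. u \<one>\<^bsub>G\<^esub> \<one>\<^bsub>G\<^esub> x = 1)}"

definition quotient_topology :: "'x topology \<Rightarrow> ('x \<Rightarrow> 'c) \<Rightarrow> 'c topology" where
  "quotient_topology X q =
     topology (\<lambda>W. W \<subseteq> q ` topspace X \<and> openin X {x \<in> topspace X. q x \<in> W})"

lemma openin_quotient_topology:
  "openin (quotient_topology X q) W \<longleftrightarrow>
     W \<subseteq> q ` topspace X \<and> openin X {x \<in> topspace X. q x \<in> W}"
proof -
  have "istopology (\<lambda>W. W \<subseteq> q ` topspace X \<and> openin X {x \<in> topspace X. q x \<in> W})"
    unfolding istopology_def
  proof (intro conjI allI impI)
    fix S T
    assume "S \<subseteq> q ` topspace X \<and> openin X {x \<in> topspace X. q x \<in> S}"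
      and "T \<subseteq> q ` topspace X \<and> openin X {x \<in> topspace X. q x \<in> T}"
    moreover have "{x \<in> topspace X. q x \<in> S \<inter> T} =
        {x \<in> topspace X. q x \<in> S} \<inter> {x \<in> topspace X. q x \<in> T}"
      by auto
    ultimately show "openin X {x \<in> topspace X. q x \<in> S \<inter> T}"
      by auto
  next
    fix \<K>
    assume "\<forall>K\<in>\<K>. K \<subseteq> q ` topspace X \<and> openin X {x \<in> topspace X. q x \<in> K}"
    then have "openin X (\<Union>K\<in>\<K>. {x \<in> topspace X. q x \<in> K})"
      by auto
    moreover have "{x \<in> topspace X. q x \<in> \<Union>\<K>} = (\<Union>K\<in>\<K>. {x \<in> topspace X. q x \<in> K})"
      by auto
    ultimately show "openin X {x \<in> topspace X. q x \<in> \<Union>\<K>}"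
      by simp
  qed auto
  then show ?thesis
    by (simp add: quotient_topology_def)
qed

definition quasi_orbit ::
    "('g, 'm) monoid_scheme \<Rightarrow> 'x topology \<Rightarrow> ('g \<Rightarrow> 'x \<Rightarrow> 'x) \<Rightarrow> 'x \<Rightarrow> 'x set" where
  "quasi_orbit G X \<phi> x =
     {y \<in> topspace X. X closure_of (orbit G \<phi> x) = X closure_of (orbit G \<phi> y)}"

definition quasi_orbit_space ::
    "('g, 'm) monoid_scheme \<Rightarrow> 'x topology \<Rightarrow> ('g \<Rightarrow> 'x \<Rightarrow> 'x) \<Rightarrow> 'x set topology" where
  "quasi_orbit_space G X \<phi> = quotient_topology X (quasi_orbit G X \<phi>)"

section \<open>Crossed products\<close>

text \<open>
  The sum over \<open>st = r\<close> in the product converges absolutely in \<open>C\<^sub>0(X)\<close>, so that it can be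
  computed pointwise.
\<close>

definition twisted_l1 ::
    "('g, 'm) monoid_scheme \<Rightarrow> 'x topology \<Rightarrow> ('g \<Rightarrow> 'x \<Rightarrow> 'x) \<Rightarrow> ('g \<Rightarrow> 'g \<Rightarrow> 'x \<Rightarrow> complex) \<Rightarrow>
     ('g \<Rightarrow> 'x \<Rightarrow> complex) cnormed" where
  "twisted_l1 G X \<phi> u = \<lparr>
     carrier = {b. (\<forall>g\<in>carrier G. b g \<in> C0 X) \<and> (\<forall>g. g \<notin> carrier G \<longrightarrow> b g = (\<lambda>x. 0)) \<and>
                   (\<lambda>g. sup_norm (b g)) summable_on carrier G},
     monoid.mult = (\<lambda>a b r x.
        \<Sum>\<^sub>\<infinity>(s, t)\<in>{(s, t). s \<in> carrier G \<and> t \<in> carrier G \<and> s \<otimes>\<^bsub>G\<^esub> t = r}.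
          a s x * dual_action G X \<phi> s (b t) x * u s t x),
     one = undefined,
     ring.zero = (\<lambda>g x. 0),
     add = (\<lambda>a b g x. a g x + b g x),
     smult = (\<lambda>c a g x. c * a g x),
     nrm = (\<lambda>b. \<Sum>\<^sub>\<infinity>g\<in>carrier G. sup_norm (b g)) \<rparr>"

definition at_unit ::
    "('g, 'm) monoid_scheme \<Rightarrow> ('x \<Rightarrow> complex) \<Rightarrow> 'g \<Rightarrow> 'x \<Rightarrow> complex" where
  "at_unit G a = (\<lambda>g. if g = \<one>\<^bsub>G\<^esub> then a else (\<lambda>x. 0))"

text \<open>
  A family of representations is a set of pairs \<open>(E, \<psi>)\<close>.  The carriers of the Banach spaces
  \<open>E\<close> are arbitrary subsets of a type \<open>'v\<close>, which serves as a universe.  As soon as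
  \<open>nat \<Rightarrow> 'g \<Rightarrow> 'x \<Rightarrow> complex\<close> embeds into \<open>'v\<close>, restricting representations to cyclic
  subspaces shows that all norms induced by families on Banach spaces of any size occur.
\<close>

definition representation :: "'f cnormed \<Rightarrow> 'v cnormed \<Rightarrow> ('f \<Rightarrow> 'v \<Rightarrow> 'v) \<Rightarrow> bool" where
  "representation F E \<psi> \<longleftrightarrow> cbanach_space E \<and> linear_on F (bounded_operators E) \<psi> \<and>
     multiplicative_on F (bounded_operators E) \<psi> \<and> contractive_on F (bounded_operators E) \<psi>"

definition separating_family ::
    "'f cnormed \<Rightarrow> ('v cnormed \<times> ('f \<Rightarrow> 'v \<Rightarrow> 'v)) set \<Rightarrow> bool" where
  "separating_family F R \<longleftrightarrow> (\<forall>(E, \<psi>)\<in>R. representation F E \<psi>) \<and>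
     (\<forall>b\<in>carrier F. \<forall>c\<in>carrier F. b \<noteq> c \<longrightarrow> (\<exists>(E, \<psi>)\<in>R. \<psi> b \<noteq> \<psi> c))"

text \<open>Inserting \<open>0\<close> matters only for the empty family, which separates points iff \<open>F = 0\<close>.\<close>

definition family_norm :: "('v cnormed \<times> ('f \<Rightarrow> 'v \<Rightarrow> 'v)) set \<Rightarrow> 'f \<Rightarrow> real" where
  "family_norm R b = Sup (insert 0 ((\<lambda>(E, \<psi>). nrm (bounded_operators E) (\<psi> b)) ` R))"

text \<open>
  A completion of \<open>F\<close> is a Banach algebra \<open>B\<close> together with the canonical map \<open>\<iota>\<close> of \<open>F\<close> onto
  a dense subalgebra; it is unique up to isometric isomorphism over \<open>F\<close>.
\<close>

definition completion_of :: "'f cnormed \<Rightarrow> ('f \<Rightarrow> real) \<Rightarrow> 'b cnormed \<Rightarrow> ('f \<Rightarrow> 'b) \<Rightarrow> bool" where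
  "completion_of F N B \<iota> \<longleftrightarrow> cbanach_algebra B \<and> linear_on F B \<iota> \<and> multiplicative_on F B \<iota> \<and>
     (\<forall>b\<in>carrier F. nrm B (\<iota> b) = N b) \<and>
     norm_topology B closure_of (\<iota> ` carrier F) = carrier B"

definition coeff_extension ::
    "('g, 'm) monoid_scheme \<Rightarrow> 'x topology \<Rightarrow> ('g \<Rightarrow> 'x \<Rightarrow> 'x) \<Rightarrow> ('g \<Rightarrow> 'g \<Rightarrow> 'x \<Rightarrow> complex) \<Rightarrow>
     'b cnormed \<Rightarrow> (('g \<Rightarrow> 'x \<Rightarrow> complex) \<Rightarrow> 'b) \<Rightarrow> 'g \<Rightarrow> ('b \<Rightarrow> 'x \<Rightarrow> complex) \<Rightarrow> bool" where
  "coeff_extension G X \<phi> u B \<iota> t \<E> \<longleftrightarrow>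
     linear_on B (C0_algebra X) \<E> \<and> contractive_on B (C0_algebra X) \<E> \<and>
     (\<forall>b\<in>carrier (twisted_l1 G X \<phi> u). \<E> (\<iota> b) = b t)"

definition crossed_product ::
    "('g, 'm) monoid_scheme \<Rightarrow> 'x topology \<Rightarrow> ('g \<Rightarrow> 'x \<Rightarrow> 'x) \<Rightarrow> ('g \<Rightarrow> 'g \<Rightarrow> 'x \<Rightarrow> complex) \<Rightarrow>
     ('v cnormed \<times> (('g \<Rightarrow> 'x \<Rightarrow> complex) \<Rightarrow> 'v \<Rightarrow> 'v)) set \<Rightarrow>
     'b cnormed \<Rightarrow> (('g \<Rightarrow> 'x \<Rightarrow> complex) \<Rightarrow> 'b) \<Rightarrow> bool" where
  "crossed_product G X \<phi> u R B \<iota> \<longleftrightarrow>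
     separating_family (twisted_l1 G X \<phi> u) R \<and>
     completion_of (twisted_l1 G X \<phi> u) (family_norm R) B \<iota> \<and>
     (\<exists>\<E>. coeff_extension G X \<phi> u B \<iota> \<one>\<^bsub>G\<^esub> \<E>)"

definition reduced_crossed_product ::
    "('g, 'm) monoid_scheme \<Rightarrow> 'x topology \<Rightarrow> ('g \<Rightarrow> 'x \<Rightarrow> 'x) \<Rightarrow> ('g \<Rightarrow> 'g \<Rightarrow> 'x \<Rightarrow> complex) \<Rightarrow>
     ('v cnormed \<times> (('g \<Rightarrow> 'x \<Rightarrow> complex) \<Rightarrow> 'v \<Rightarrow> 'v)) set \<Rightarrow>
     'b cnormed \<Rightarrow> (('g \<Rightarrow> 'x \<Rightarrow> complex) \<Rightarrow> 'b) \<Rightarrow> bool" where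
  "reduced_crossed_product G X \<phi> u R B \<iota> \<longleftrightarrow> crossed_product G X \<phi> u R B \<iota> \<and>
     (\<exists>\<E>. (\<forall>t\<in>carrier G. coeff_extension G X \<phi> u B \<iota> t (\<E> t)) \<and>
          {x \<in> carrier B. \<forall>t\<in>carrier G. \<E> t x = (\<lambda>_. 0)} = {\<zero>\<^bsub>B\<^esub>})"

definition ideal_of_open ::
    "('g, 'm) monoid_scheme \<Rightarrow> 'x topology \<Rightarrow> ('g \<Rightarrow> 'x \<Rightarrow> 'x) \<Rightarrow> ('g \<Rightarrow> 'g \<Rightarrow> 'x \<Rightarrow> complex) \<Rightarrow>
     'b cnormed \<Rightarrow> (('g \<Rightarrow> 'x \<Rightarrow> complex) \<Rightarrow> 'b) \<Rightarrow> 'x set \<Rightarrow> 'b set" where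
  "ideal_of_open G X \<phi> u B \<iota> U = norm_topology B closure_of
     (\<iota> ` carrier (twisted_l1 G (subtopology X U) (restr_action U \<phi>) (restr_cocycle U u)))"

text \<open>
  The quotient is regarded as a completion of \<open>F(\<alpha>\<^sup>Y, u\<^sup>Y)\<close> via the map \<open>\<kappa>\<close> that sends \<open>b|\<^sub>Y\<close>
  to the coset of \<open>b\<close>; since restriction of functions from \<open>X\<close> to the closed set \<open>Y\<close> maps
  \<open>F(\<alpha>, u)\<close> onto \<open>F(\<alpha>\<^sup>Y, u\<^sup>Y)\<close>, this determines \<open>\<kappa>\<close>.
\<close>

definition residually_reduced_crossed_product ::
    "('g, 'm) monoid_scheme \<Rightarrow> 'x topology \<Rightarrow> ('g \<Rightarrow> 'x \<Rightarrow> 'x) \<Rightarrow> ('g \<Rightarrow> 'g \<Rightarrow> 'x \<Rightarrow> complex) \<Rightarrow>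
     ('v cnormed \<times> (('g \<Rightarrow> 'x \<Rightarrow> complex) \<Rightarrow> 'v \<Rightarrow> 'v)) set \<Rightarrow>
     'b cnormed \<Rightarrow> (('g \<Rightarrow> 'x \<Rightarrow> complex) \<Rightarrow> 'b) \<Rightarrow> bool" where
  "residually_reduced_crossed_product G X \<phi> u R B \<iota> \<longleftrightarrow> crossed_product G X \<phi> u R B \<iota> \<and>
     (\<forall>U. openin X U \<and> invariant_set G X \<phi> U \<longrightarrow>
        (let Y = topspace X - U; J = ideal_of_open G X \<phi> u B \<iota> U in
         \<exists>(S :: ('v cnormed \<times> (('g \<Rightarrow> 'x \<Rightarrow> complex) \<Rightarrow> 'v \<Rightarrow> 'v)) set) \<kappa>.
           reduced_crossed_product G (subtopology X Y) (restr_action Y \<phi>) (restr_cocycle Y u)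
             S (quotient_algebra B J) \<kappa> \<and>
           (\<forall>b\<in>carrier (twisted_l1 G X \<phi> u). \<kappa> (\<lambda>g. restr Y (b g)) = J +>\<^bsub>B\<^esub> \<iota> b)))"

definition quasi_orbit_map ::
    "('g, 'm) monoid_scheme \<Rightarrow> 'x topology \<Rightarrow> ('g \<Rightarrow> 'x \<Rightarrow> 'x) \<Rightarrow>
     (('g \<Rightarrow> 'x \<Rightarrow> complex) \<Rightarrow> 'b) \<Rightarrow> 'b set \<Rightarrow> 'x set" where
  "quasi_orbit_map G X \<phi> \<iota> P = (THE c. \<exists>x\<in>topspace X. c = quasi_orbit G X \<phi> x \<and>
     {a \<in> C0 X. \<iota> (at_unit G a) \<in> P} =
       C0 (subtopology X (topspace X - X closure_of (orbit G \<phi> x))))"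

end

theory Submission
  imports Defs
begin

text \<open>
  If \<open>\<phi>\<close> is residually topologically free, then modulo \<open>C\<^sub>0(U)\<close>, where \<open>C\<^sub>0(U)\<close> is the intersection of
  a closed ideal \<open>I\<close> with \<open>C\<^sub>0(X)\<close>, one can compress with functions of small support around points
  that are displaced by finitely many group elements; this isolates the coefficient at \<open>1\<close> and
  shows that the coefficients of elements of \<open>I\<close> vanish off \<open>U\<close>.  As the crossed product is
  residually reduced, \<open>I\<close> is generated by \<open>C\<^sub>0(U)\<close>.  So prime ideals correspond to irreducible closed
  invariant sets, which are orbit closures by Baire's theorem.

  Conversely, let \<open>t \<noteq> 1\<close> fix every point of a relatively open neighbourhood of \<open>x\<close> in a closed
  invariant set.  The algebra \<open>\<ell>\<^sup>1(G, C\<^sub>0(X))\<close> with trivial cocycle is itself a residually reduced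
  crossed product, represented isometrically on itself.  For a function \<open>\<theta>\<close> carried by the
  stabiliser of \<open>x\<close>, the elements \<open>b\<close> such that \<open>\<Sum>\<^sub>g \<theta>(g) (a * b)(g)(x) = 0\<close> for all \<open>a\<close> form a
  left ideal, modular because every \<open>f \<in> C\<^sub>0(X)\<close> with \<open>f(x) = 1\<close> is a right unit modulo it.  The
  primitive ideal of a maximal left ideal above it is prime and lies over the quasi-orbit of \<open>x\<close>.
  With \<open>f\<close> supported close to \<open>x\<close>, this primitive ideal contains \<open>f - f \<delta>\<^sub>t\<close> when \<open>\<theta>\<close> is the
  indicator function of the stabiliser, but not when \<open>\<theta>\<close> is a character of the group generated by
  \<open>t\<close>, extended by zero, with \<open>\<theta>(t) \<noteq> 1\<close>.  So the quasi-orbit map is not injective.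
\<close>

section \<open>Functions vanishing at infinity\<close>

text \<open>The crossed products carry no involution, so norm estimates replace positivity. The
  decisive one: if an element of a closed ideal lies at distance less than 1 from a function
  \<open>m\<close>, then every function \<open>f\<close> with \<open>m f = f\<close> belongs to the
  ideal. Compression yields such an element because near a displaced point only the coefficient at
  the identity survives, and there it is almost constant. The functions in an ideal say little about
  its other elements until the coefficient maps are faithful on every quotient by an open invariant
  set. In the converse the cocycle is trivial because a twisted group need not have one-dimensional
  representations. The character lives on the group generated by t, since it may fail to extend to
  the stabiliser; extension by zero amounts to inducing from the cyclic group. The indicator
  function uses the whole stabiliser so as to be invariant under all conjugates of t that fix x.
  Maximality of the left ideal is what makes the two-sided ideal below it prime.\<close>

lemma continuous_map_euclidean_iff_tendsto:
  "continuous_map X euclidean f \<longleftrightarrow> (\<forall>x\<in>topspace X. (f \<longlongrightarrow> f x) (atin X x))"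
  by (simp add: continuous_map_atin)

lemma continuous_map_mult_euclidean:
  fixes f g :: "'x \<Rightarrow> complex"
  assumes "continuous_map X euclidean f" "continuous_map X euclidean g"
  shows "continuous_map X euclidean (\<lambda>x. f x * g x)"
  using assms by (auto simp: continuous_map_euclidean_iff_tendsto intro!: tendsto_mult)

lemma C0_continuous_map: "a \<in> C0 X \<Longrightarrow> continuous_map X euclidean a"
  and C0_outside: "a \<in> C0 X \<Longrightarrow> x \<notin> topspace X \<Longrightarrow> a x = 0"
  and C0_compactin: "a \<in> C0 X \<Longrightarrow> 0 < e \<Longrightarrow> compactin X {x \<in> topspace X. e \<le> cmod (a x)}"
  by (auto simp: C0_def)

lemma closedin_norm_ge:
  fixes f :: "'x \<Rightarrow> complex"
  assumes "continuous_map X euclidean f"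
  shows "closedin X {x \<in> topspace X. e \<le> cmod (f x)}"
  using closedin_continuous_map_preimage[OF continuous_map_norm[OF assms], of "{e..}"] by simp

lemma C0I:
  assumes f: "continuous_map X euclidean f" and "\<And>x. x \<notin> topspace X \<Longrightarrow> f x = 0"
    and K: "\<And>e. e > 0 \<Longrightarrow> \<exists>K. compactin X K \<and> (\<forall>x\<in>topspace X - K. cmod (f x) < e)"
  shows "f \<in> C0 X"
proof -
  have "compactin X {x \<in> topspace X. e \<le> cmod (f x)}" if e: "e > 0" for e
  proof -
    obtain K where "compactin X K" "\<forall>x\<in>topspace X - K. cmod (f x) < e"
      using K[OF e] by blast
    then show ?thesis
      by (intro closed_compactin[OF _ _ closedin_norm_ge[OF f]]) force+
  qed
  with assms show ?thesis
    by (auto simp: C0_def)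
qed

lemma C0_small_outside_compact:
  assumes "a \<in> C0 X" "e > 0"
  obtains K where "compactin X K" "\<And>x. x \<notin> K \<Longrightarrow> cmod (a x) < e"
proof
  show "compactin X {x \<in> topspace X. e \<le> cmod (a x)}"
    using assms by (rule C0_compactin)
  show "cmod (a x) < e" if "x \<notin> {x \<in> topspace X. e \<le> cmod (a x)}" for x
    using that C0_outside[OF assms(1), of x] assms(2) by (cases "x \<in> topspace X") auto
qed

lemma C0_bdd_above:
  assumes "a \<in> C0 X"
  shows "bdd_above (range (\<lambda>x. cmod (a x)))"
proof -
  obtain K where K: "compactin X K" "\<And>x. x \<notin> K \<Longrightarrow> cmod (a x) < 1"
    using C0_small_outside_compact[OF assms, of 1] by auto
  have "compactin euclidean (a ` K)"
    using K(1) C0_continuous_map[OF assms] by (rule image_compactin)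
  then have "bounded (a ` K)"
    by (simp add: compact_imp_bounded)
  then obtain M where M: "\<And>x. x \<in> K \<Longrightarrow> cmod (a x) \<le> M"
    by (auto simp: bounded_iff)
  have "cmod (a x) \<le> max M 1" for x
    using M[of x] K(2)[of x] by (cases "x \<in> K") auto
  then show ?thesis
    by (auto simp: bdd_above_def)
qed

lemma norm_le_sup_norm: "a \<in> C0 X \<Longrightarrow> cmod (a x) \<le> sup_norm a"
  unfolding sup_norm_def by (rule cSUP_upper[OF _ C0_bdd_above]) auto

lemma sup_norm_le: "(\<And>x. cmod (a x) \<le> M) \<Longrightarrow> sup_norm a \<le> M"
  unfolding sup_norm_def by (rule cSUP_least) auto

lemma sup_norm_nonneg: "a \<in> C0 X \<Longrightarrow> 0 \<le> sup_norm a"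
  by (meson norm_ge_zero norm_le_sup_norm order_trans)

lemma sup_norm_zero [simp]: "sup_norm (\<lambda>x. 0) = 0"
  by (simp add: sup_norm_def)

lemma sup_norm_eq_0_iff:
  assumes "a \<in> C0 X"
  shows "sup_norm a = 0 \<longleftrightarrow> a = (\<lambda>x. 0)"
proof
  assume "sup_norm a = 0"
  then have "cmod (a x) \<le> 0" for x
    using norm_le_sup_norm[OF assms, of x] by simp
  then show "a = (\<lambda>x. 0)"
    by auto
qed auto

lemma C0_zero [simp]: "(\<lambda>x. 0) \<in> C0 X"
  by (rule C0I) (auto intro!: exI[of _ "{}"])

lemma C0_uniform_limit:
  assumes lim: "\<And>e. e > 0 \<Longrightarrow> \<exists>a\<in>C0 X. \<forall>x. cmod (f x - a x) < e"
  shows "f \<in> C0 X"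
proof (rule C0I)
  show "f x = 0" if "x \<notin> topspace X" for x
  proof (rule ccontr)
    assume "f x \<noteq> 0"
    then obtain a where "a \<in> C0 X" "cmod (f x - a x) < cmod (f x)"
      using lim[of "cmod (f x)"] by auto
    then show False
      using C0_outside that by fastforce
  qed
  show "\<exists>K. compactin X K \<and> (\<forall>x\<in>topspace X - K. cmod (f x) < e)" if e: "e > 0" for e
  proof -
    obtain a where a: "a \<in> C0 X" "\<And>x. cmod (f x - a x) < e/2"
      using lim[of "e/2"] e by auto
    obtain K where K: "compactin X K" "\<And>x. x \<notin> K \<Longrightarrow> cmod (a x) < e/2"
      using C0_small_outside_compact[OF a(1), of "e/2"] e by auto
    have "cmod (f x) < e" if "x \<notin> K" for x
      using a(2)[of x] K(2)[OF that] norm_triangle_sub[of "f x" "a x"] by simp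
    then show ?thesis
      using K by blast
  qed
  show "continuous_map X euclidean f"
    unfolding continuous_map_euclidean_iff_tendsto
  proof (intro ballI tendstoI)
    fix x and e :: real assume x: "x \<in> topspace X" and e: "e > 0"
    obtain a where a: "a \<in> C0 X" "\<And>x. cmod (f x - a x) < e/3"
      using lim[of "e/3"] e by auto
    have "(a \<longlongrightarrow> a x) (atin X x)"
      using C0_continuous_map[OF a(1)] x by (simp add: continuous_map_euclidean_iff_tendsto)
    then have "\<forall>\<^sub>F y in atin X x. dist (a y) (a x) < e/3"
      using e by (intro tendstoD) auto
    then show "\<forall>\<^sub>F y in atin X x. dist (f y) (f x) < e"
    proof (rule eventually_mono)
      fix y assume "dist (a y) (a x) < e/3"
      then have "cmod (a y - a x) < e/3" by (simp add: dist_norm)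
      have eq: "f y - f x = (f y - a y) + ((a y - a x) - (f x - a x))"
        by simp
      have "cmod (f y - f x) \<le> cmod (f y - a y) + cmod ((a y - a x) - (f x - a x))"
        by (subst eq) (rule norm_triangle_ineq)
      also have "\<dots> \<le> cmod (f y - a y) + (cmod (a y - a x) + cmod (f x - a x))"
        by (intro add_left_mono norm_triangle_ineq4)
      finally show "dist (f y) (f x) < e"
        using a(2)[of x] a(2)[of y] \<open>cmod (a y - a x) < e/3\<close> by (simp add: dist_norm)
    qed
  qed
qed

lemma C0_mult_bounded:
  assumes a: "a \<in> C0 X" and f: "continuous_map X euclidean f"
    and M: "\<And>x. x \<in> topspace X \<Longrightarrow> cmod (f x) \<le> M"
  shows "(\<lambda>x. a x * f x) \<in> C0 X"
proof (rule C0I)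
  show "continuous_map X euclidean (\<lambda>x. a x * f x)"
    using C0_continuous_map[OF a] f by (rule continuous_map_mult_euclidean)
  show "\<exists>K. compactin X K \<and> (\<forall>x\<in>topspace X - K. cmod (a x * f x) < e)" if e: "e > 0" for e
  proof -
    define N where "N = max M 1"
    obtain K where K: "compactin X K" "\<And>x. x \<notin> K \<Longrightarrow> cmod (a x) < e / N"
      using C0_small_outside_compact[OF a, of "e / N"] e by (auto simp: N_def)
    have "cmod (a x * f x) < e" if "x \<in> topspace X - K" for x
    proof -
      have "cmod (a x * f x) \<le> cmod (a x) * N"
        using M[of x] that by (auto simp: norm_mult N_def intro!: mult_left_mono)
      also have "\<dots> < e"
        using K(2)[of x] that e by (simp add: N_def field_simps)
      finally show ?thesis .
    qed
    with K show ?thesis by blast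
  qed
qed (simp add: C0_outside[OF a])

lemma C0_mult: "a \<in> C0 X \<Longrightarrow> b \<in> C0 X \<Longrightarrow> (\<lambda>x. a x * b x) \<in> C0 X"
  by (rule C0_mult_bounded[OF _ C0_continuous_map norm_le_sup_norm])

lemma C0_cmult: "a \<in> C0 X \<Longrightarrow> (\<lambda>x. c * a x) \<in> C0 X"
  using C0_mult_bounded[of a X "\<lambda>_. c" "cmod c"] by (simp add: mult.commute)

lemma C0_add:
  assumes a: "a \<in> C0 X" and b: "b \<in> C0 X"
  shows "(\<lambda>x. a x + b x) \<in> C0 X"
proof (rule C0I)
  show "continuous_map X euclidean (\<lambda>x. a x + b x)"
    using assms[THEN C0_continuous_map]
    by (auto simp: continuous_map_euclidean_iff_tendsto intro!: tendsto_add)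
  show "\<exists>K. compactin X K \<and> (\<forall>x\<in>topspace X - K. cmod (a x + b x) < e)" if e: "e > 0" for e
  proof -
    obtain K where K: "compactin X K" "\<And>x. x \<notin> K \<Longrightarrow> cmod (a x) < e/2"
      using C0_small_outside_compact[OF a, of "e/2"] e by auto
    obtain L where L: "compactin X L" "\<And>x. x \<notin> L \<Longrightarrow> cmod (b x) < e/2"
      using C0_small_outside_compact[OF b, of "e/2"] e by auto
    have "cmod (a x + b x) < e" if "x \<notin> K \<union> L" for x
      using K(2)[of x] L(2)[of x] that norm_triangle_ineq[of "a x" "b x"] by simp
    then show ?thesis
      using compactin_Un[OF K(1) L(1)] by blast
  qed
qed (simp add: C0_outside[OF a] C0_outside[OF b])

lemma C0_uminus: "a \<in> C0 X \<Longrightarrow> (\<lambda>x. - a x) \<in> C0 X"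
  using C0_cmult[of a X "-1"] by simp

lemma C0_diff: "a \<in> C0 X \<Longrightarrow> b \<in> C0 X \<Longrightarrow> (\<lambda>x. a x - b x) \<in> C0 X"
  using C0_add[of a X "\<lambda>x. - b x"] by (simp add: C0_uminus)

lemma C0_cnj: "a \<in> C0 X \<Longrightarrow> (\<lambda>x. cnj (a x)) \<in> C0 X"
  by (auto simp: C0_def continuous_map_euclidean_iff_tendsto intro!: tendsto_cnj)

lemma C0_sum: "(\<And>i. i \<in> I \<Longrightarrow> a i \<in> C0 X) \<Longrightarrow> (\<lambda>x. \<Sum>i\<in>I. a i x) \<in> C0 X"
  by (induction I rule: infinite_finite_induct) (auto intro!: C0_add)

lemma sup_norm_add: "a \<in> C0 X \<Longrightarrow> b \<in> C0 X \<Longrightarrow> sup_norm (\<lambda>x. a x + b x) \<le> sup_norm a + sup_norm b"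
  by (intro sup_norm_le norm_triangle_le add_mono norm_le_sup_norm)

lemma sup_norm_cmult:
  assumes a: "a \<in> C0 X"
  shows "sup_norm (\<lambda>x. c * a x) = cmod c * sup_norm a"
proof (rule antisym)
  show "sup_norm (\<lambda>x. c * a x) \<le> cmod c * sup_norm a"
    by (rule sup_norm_le) (auto simp: norm_mult intro!: mult_left_mono norm_le_sup_norm[OF a])
  show "cmod c * sup_norm a \<le> sup_norm (\<lambda>x. c * a x)"
  proof (cases "c = 0")
    case False
    have "cmod (a x) \<le> sup_norm (\<lambda>x. c * a x) / cmod c" for x
      using norm_le_sup_norm[OF C0_cmult[OF a], of c x] False by (simp add: norm_mult field_simps)
    then have "sup_norm a \<le> sup_norm (\<lambda>x. c * a x) / cmod c"
      by (rule sup_norm_le)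
    then show ?thesis
      using False by (simp add: field_simps)
  qed simp
qed

lemma sup_norm_uminus: "sup_norm (\<lambda>x. - a x) = sup_norm a"
  by (simp add: sup_norm_def)

lemma sup_norm_diff: "a \<in> C0 X \<Longrightarrow> b \<in> C0 X \<Longrightarrow> sup_norm (\<lambda>x. a x - b x) \<le> sup_norm a + sup_norm b"
  using sup_norm_add[of a X "\<lambda>x. - b x"] by (simp add: C0_uminus sup_norm_uminus)

lemma C0_subtopology_open:
  assumes X: "Hausdorff_space X" and U: "openin X U"
  shows "C0 (subtopology X U) = {a \<in> C0 X. \<forall>x. x \<notin> U \<longrightarrow> a x = 0}" (is "?L = ?R")
proof
  have top: "topspace (subtopology X U) = U"
    using openin_subset[OF U] by (simp add: inf.absorb2)
  show "?L \<subseteq> ?R"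
  proof
    fix a assume a: "a \<in> ?L"
    have out: "a x = 0" if "x \<notin> U" for x
      using C0_outside[OF a, of x] that top by simp
    have cpt: "compactin X {x \<in> U. e \<le> cmod (a x)}" if "e > 0" for e
      using C0_compactin[OF a that] unfolding top by (simp add: compactin_subtopology)
    have "a \<in> C0 X"
    proof (rule C0I)
      show "a x = 0" if "x \<notin> topspace X" for x
        using out that openin_subset[OF U] by auto
      show "\<exists>K. compactin X K \<and> (\<forall>x\<in>topspace X - K. cmod (a x) < e)" if "e > 0" for e
        using cpt[OF that] out that by (intro exI[of _ "{x \<in> U. e \<le> cmod (a x)}"]) force
      show "continuous_map X euclidean a"
        unfolding continuous_map_def
      proof (intro conjI allI impI)
        fix W :: "complex set" assume "openin euclidean W"
        then have W: "open W" by simp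
        have "openin (subtopology X U) {x \<in> U. a x \<in> W}"
          using openin_continuous_map_preimage[OF C0_continuous_map[OF a], of W] W unfolding top by simp
        then have 1: "openin X {x \<in> U. a x \<in> W}"
          using U by (simp add: openin_open_subtopology)
        show "openin X {x \<in> topspace X. a x \<in> W}"
        proof (cases "0 \<in> W")
          case False
          then have "x \<in> U" if "a x \<in> W" for x
            using out[of x] that by metis
          then have "{x \<in> topspace X. a x \<in> W} = {x \<in> U. a x \<in> W}"
            using openin_subset[OF U] by blast
          then show ?thesis using 1 by simp
        next
          case True
          then obtain e where e: "e > 0" "ball 0 e \<subseteq> W"
            using W open_contains_ball by blast
          have "openin X (topspace X - {x \<in> U. e \<le> cmod (a x)})"
            using compactin_imp_closedin[OF X cpt[OF e(1)]] by blast
          moreover have "{x \<in> topspace X. a x \<in> W} =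
              {x \<in> U. a x \<in> W} \<union> (topspace X - {x \<in> U. e \<le> cmod (a x)})"
          proof -
            have "x \<in> U \<and> e \<le> cmod (a x)" if "a x \<notin> W" for x
              using out[of x] e True that
              by (cases "x \<in> U") (auto simp: subset_iff simp flip: not_le)
            then show ?thesis
              using openin_subset[OF U] by blast
          qed
          ultimately show ?thesis
            using 1 by auto
        qed
      qed auto
    qed
    with out show "a \<in> ?R" by simp
  qed
  show "?R \<subseteq> ?L"
  proof safe
    fix a assume a: "a \<in> C0 X" "\<forall>x. x \<notin> U \<longrightarrow> a x = 0"
    show "a \<in> C0 (subtopology X U)"
    proof (rule C0I[OF continuous_map_from_subtopology[OF C0_continuous_map[OF a(1)]]])
      show "a x = 0" if "x \<notin> topspace (subtopology X U)" for x
        using a(2) that unfolding top by blast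
      show "\<exists>K. compactin (subtopology X U) K \<and>
          (\<forall>x\<in>topspace (subtopology X U) - K. cmod (a x) < e)" if e: "e > 0" for e
      proof (intro exI conjI ballI)
        have "{x \<in> topspace X. e \<le> cmod (a x)} \<subseteq> U"
          using a(2) e by (metis (no_types, lifting) mem_Collect_eq norm_zero not_le subsetI)
        then show "compactin (subtopology X U) {x \<in> topspace X. e \<le> cmod (a x)}"
          using C0_compactin[OF a(1) e] by (simp add: compactin_subtopology)
        show "cmod (a x) < e"
          if "x \<in> topspace (subtopology X U) - {x \<in> topspace X. e \<le> cmod (a x)}" for x
          using that by auto
      qed
    qed
  qed
qed

lemma C0_restr_closed:
  assumes Y: "closedin X Y" and a: "a \<in> C0 X"
  shows "restr Y a \<in> C0 (subtopology X Y)"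
proof (rule C0I)
  have top: "topspace (subtopology X Y) = Y"
    using closedin_subset[OF Y] by (simp add: inf.absorb2)
  have "continuous_map (subtopology X Y) euclidean a"
    using C0_continuous_map[OF a] by (rule continuous_map_from_subtopology)
  then show "continuous_map (subtopology X Y) euclidean (restr Y a)"
    by (rule continuous_map_eq) (auto simp: restr_def)
  show "restr Y a x = 0" if "x \<notin> topspace (subtopology X Y)" for x
    using that by (simp only: top) (simp add: restr_def)
  show "\<exists>K. compactin (subtopology X Y) K \<and>
         (\<forall>x\<in>topspace (subtopology X Y) - K. cmod (restr Y a x) < e)" if e: "e > 0" for e
  proof -
    obtain K where K: "compactin X K" "\<And>x. x \<notin> K \<Longrightarrow> cmod (a x) < e"
      using C0_small_outside_compact[OF a e] by auto
    have "compactin (subtopology X Y) (K \<inter> Y)"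
      using compact_Int_closedin[OF K(1) Y] by (simp add: compactin_subtopology)
    then show ?thesis
      using K(2) e by (intro exI[of _ "K \<inter> Y"]) (auto simp: restr_def)
  qed
qed

lemma sup_norm_restr_le: "a \<in> C0 X \<Longrightarrow> sup_norm (restr Y a) \<le> sup_norm a"
  by (rule sup_norm_le) (auto simp: restr_def norm_le_sup_norm sup_norm_nonneg)

text \<open>The Urysohn function is made to vanish off \<open>U \<inter> V\<close>, where
  \<open>V\<close> is an open neighbourhood of \<open>K\<close> inside a compact set
  \<open>L\<close>; so it is zero off \<open>L\<close>, which gives the decay at infinity.\<close>

lemma C0_bump:
  assumes X: "locally_compact_space X" "Hausdorff_space X"
    and K: "compactin X K" and U: "openin X U" "K \<subseteq> U"
  obtains h where "h \<in> C0 X" "\<And>x. cmod (h x) \<le> 1" "\<And>x. x \<in> K \<Longrightarrow> h x = 1" "\<And>x. x \<notin> U \<Longrightarrow> h x = 0"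
proof -
  obtain V L where VL: "openin X V" "compactin X L" "closedin X L" "K \<subseteq> V" "V \<subseteq> L"
    using X K locally_compact_space_compact_closed_compact by metis
  have cr: "completely_regular_space X"
    using X locally_compact_regular_imp_completely_regular_space by blast
  have "closedin X (topspace X - U \<inter> V)"
    using U VL by blast
  moreover have "disjnt K (topspace X - U \<inter> V)"
    using VL(4) U(2) by (auto simp: disjnt_def)
  ultimately obtain f where f: "continuous_map X (subtopology euclidean {0..1::real}) f"
      "f ` (topspace X - U \<inter> V) \<subseteq> {0}" "f ` K \<subseteq> {1}"
    using Urysohn_completely_regular_closed_compact[OF zero_le_one cr, of "topspace X - U \<inter> V" K] K
    by (metis disjnt_sym Urysohn_completely_regular_compact_closed cr zero_le_one)
  define h where "h x = (if x \<in> topspace X then complex_of_real (f x) else 0)" for x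
  have f01: "0 \<le> f x" "f x \<le> 1" if "x \<in> topspace X" for x
    using continuous_map_image_subset_topspace[OF f(1)] that by auto
  have f0: "f x = 0" if "x \<in> topspace X" "x \<notin> U \<inter> V" for x
    using f(2) that by auto
  have "continuous_map X euclidean f"
    using f(1) by (simp add: continuous_map_in_subtopology)
  then have "continuous_map X euclidean (\<lambda>x. complex_of_real (f x))"
    by (auto simp: continuous_map_euclidean_iff_tendsto intro!: tendsto_of_real)
  then have "continuous_map X euclidean h"
    by (rule continuous_map_eq) (simp add: h_def)
  then have "h \<in> C0 X"
  proof (rule C0I)
    show "\<exists>K. compactin X K \<and> (\<forall>x\<in>topspace X - K. cmod (h x) < e)" if "e > 0" for e
    proof (intro exI conjI ballI)
      show "cmod (h x) < e" if x: "x \<in> topspace X - L" for x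
        using f0[of x] x VL(5) \<open>e > 0\<close> by (cases "x \<in> V") (auto simp: h_def)
    qed (fact VL(2))
  qed (simp add: h_def)
  then show thesis
    using f01 f0 f(3) compactin_subset_topspace[OF K] openin_subset[OF U(1)]
    by (intro that[of h]) (auto simp: h_def subset_iff)
qed

text \<open>Tietze's theorem on the one-point compactification: the value 0 at \<open>None\<close>
  makes \<open>a\<close> continuous on the closed set \<open>S\<close>, and any extension then
  vanishes at infinity. The bound on the sup norm later makes the quotient norm of l^1(G, C0(X))
  equal to the l^1 norm over the closed set.\<close>

lemma C0_extend:
  assumes X: "locally_compact_space X" "Hausdorff_space X"
    and Y: "closedin X Y" and a: "a \<in> C0 (subtopology X Y)"
  obtains b where "b \<in> C0 X" "restr Y b = a" "sup_norm b \<le> sup_norm a"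
proof -
  define Z where "Z = Alexandroff_compactification X"
  define S where "S = insert None (Some ` Y)"
  define f where "f = case_option 0 a"
  have top: "topspace (subtopology X Y) = Y"
    using closedin_subset[OF Y] by (simp add: inf.absorb2)
  have out: "a x = 0" if "x \<notin> Y" for x
    using C0_outside[OF a] that top by simp
  have YX: "Y \<subseteq> topspace X"
    using closedin_subset[OF Y] .
  have Seq: "S = topspace Z - Some ` (topspace X - Y)"
    using YX by (auto simp: S_def Z_def)
  have S: "closedin Z S"
    unfolding Seq Z_def closedin_Alexandroff_compactification using openin_diff[OF openin_topspace Y] by blast
  have "Hausdorff_space Z"
    using X by (simp add: Z_def Hausdorff_space_Alexandroff_compactification)
  moreover have "compact_space Z"
    by (simp add: Z_def)
  ultimately have normal: "normal_space Z"
    using compact_Hausdorff_or_regular_imp_normal_space by blast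
  have topS: "topspace (subtopology Z S) = S"
    using closedin_subset[OF S] by (simp add: inf.absorb2)
  have "continuous_map (subtopology Z S) euclidean f"
    unfolding continuous_map_def
  proof (intro conjI allI impI)
    fix W :: "complex set" assume "openin euclidean W"
    then have W: "open W" by simp
    show "openin (subtopology Z S) {x \<in> topspace (subtopology Z S). f x \<in> W}"
    proof (cases "0 \<in> W")
      case False
      have "openin (subtopology X Y) {x \<in> Y. a x \<in> W}"
        using openin_continuous_map_preimage[OF C0_continuous_map[OF a], of W] W unfolding top by simp
      then obtain O1 where O1: "openin X O1" "{x \<in> Y. a x \<in> W} = O1 \<inter> Y"
        by (auto simp: openin_subtopology)
      have "{x \<in> topspace (subtopology Z S). f x \<in> W} = Some ` O1 \<inter> S"
        unfolding topS using False O1(2) by (auto simp: S_def f_def)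
      moreover have "openin Z (Some ` O1)"
        using O1(1) by (simp add: Z_def)
      ultimately show ?thesis
        by (auto simp: openin_subtopology)
    next
      case True
      then obtain e where e: "e > 0" "ball 0 e \<subseteq> W"
        using W open_contains_ball by blast
      have "closedin (subtopology X Y) {x \<in> Y. a x \<in> - W}"
        using closedin_continuous_map_preimage[OF C0_continuous_map[OF a], of "- W"] W
        unfolding top by (simp add: closed_Compl)
      moreover have "compactin (subtopology X Y) {x \<in> Y. e \<le> cmod (a x)}"
        using C0_compactin[OF a e(1)] unfolding top by simp
      moreover have "{x \<in> Y. a x \<in> - W} \<subseteq> {x \<in> Y. e \<le> cmod (a x)}"
        using e by (auto simp: subset_iff not_le[symmetric])
      ultimately have "compactin (subtopology X Y) {x \<in> Y. a x \<in> - W}"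
        using closed_compactin by blast
      then have C: "compactin X {x \<in> Y. a x \<in> - W}"
        by (simp add: compactin_subtopology)
      have "{x \<in> topspace (subtopology Z S). f x \<in> W} =
          insert None (Some ` (topspace X - {x \<in> Y. a x \<in> - W})) \<inter> S"
        unfolding topS using True YX by (auto simp: S_def f_def)
      moreover have "openin Z (insert None (Some ` (topspace X - {x \<in> Y. a x \<in> - W})))"
        using C compactin_imp_closedin[OF X(2) C]
        unfolding Z_def openin_Alexandroff_compactification by blast
      ultimately show ?thesis
        by (auto simp: openin_subtopology)
    qed
  qed auto
  then have ReIm: "continuous_map (subtopology Z S) euclideanreal (\<lambda>z. Re (f z))"
     "continuous_map (subtopology Z S) euclideanreal (\<lambda>z. Im (f z))"
    by (auto simp: continuous_map_euclidean_iff_tendsto intro!: tendsto_Re tendsto_Im)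
  obtain g1 where g1: "continuous_map Z euclideanreal g1" "\<And>x. x \<in> S \<Longrightarrow> g1 x = Re (f x)"
    using Tietze_extension_realinterval[OF normal S, of UNIV] ReIm(1) by auto
  obtain g2 where g2: "continuous_map Z euclideanreal g2" "\<And>x. x \<in> S \<Longrightarrow> g2 x = Im (f x)"
    using Tietze_extension_realinterval[OF normal S, of UNIV] ReIm(2) by auto
  define g where "g z = Complex (g1 z) (g2 z)" for z
  have gS: "g z = f z" if "z \<in> S" for z
    using g1(2) g2(2) that by (simp add: g_def complex_eq_iff)
  have gcont: "continuous_map Z euclidean g"
    using g1(1) g2(1)
    unfolding continuous_map_euclidean_iff_tendsto g_def by (blast intro: tendsto_Complex)
  have ga: "g (Some x) = a x" if "x \<in> Y" for x
    using gS that by (simp add: S_def f_def)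
  have "g None = 0"
    using gS by (simp add: S_def f_def)
  define c where "c x = (if x \<in> topspace X then g (Some x) else 0)" for x
  have "continuous_map X euclidean (\<lambda>x. g (Some x))"
    using continuous_map_compose[OF continuous_map_Some[of X] gcont[unfolded Z_def]]
    by (simp add: o_def)
  then have ccont: "continuous_map X euclidean c"
    by (rule continuous_map_eq) (simp add: c_def)
  have c: "c \<in> C0 X"
  proof (rule C0I[OF ccont])
    fix e :: real assume e: "e > 0"
    let ?C = "{z \<in> topspace Z. e \<le> cmod (g z)}"
    have "closedin Z ?C"
      by (rule closedin_norm_ge[OF gcont])
    moreover have "None \<notin> ?C"
      using \<open>g None = 0\<close> e by simp
    ultimately obtain K where K: "compactin X K" "?C = Some ` K"
      unfolding Z_def closedin_Alexandroff_compactification by auto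
    have "cmod (c x) < e" if "x \<in> topspace X - K" for x
    proof -
      have "Some x \<notin> ?C"
        using K(2) that by auto
      then show ?thesis
        using that by (auto simp: Z_def c_def)
    qed
    with K(1) show "\<exists>K. compactin X K \<and> (\<forall>x\<in>topspace X - K. cmod (c x) < e)"
      by blast
  qed (simp add: c_def)
  define M where "M = sup_norm a"
  have M: "M \<ge> 0"
    using sup_norm_nonneg[OF a] by (simp add: M_def)
  show thesis
  proof (cases "M = 0")
    case True
    then have "a = (\<lambda>x. 0)"
      using sup_norm_eq_0_iff[OF a] by (simp add: M_def)
    then show ?thesis
      using sup_norm_nonneg[OF a] by (intro that[of "\<lambda>x. 0"]) (auto simp: restr_def fun_eq_iff)
  next
    case False
    then have M: "M > 0" using M by simp
    \<comment> \<open>Multiplying by \<open>r\<close> retracts the plane radially onto the disc of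
      radius \<open>M\<close>; the values on \<open>Y\<close> already lie in that disc and stay
      fixed.\<close>
    define r where "r x = complex_of_real (M / max M (cmod (c x)))" for x
    have "continuous_map X euclidean r"
      unfolding continuous_map_euclidean_iff_tendsto r_def
    proof
      fix x assume "x \<in> topspace X"
      then have "(c \<longlongrightarrow> c x) (atin X x)"
        using ccont by (simp add: continuous_map_euclidean_iff_tendsto)
      then show "((\<lambda>x. complex_of_real (M / max M (cmod (c x)))) \<longlongrightarrow>
          complex_of_real (M / max M (cmod (c x)))) (atin X x)"
        using M by (intro tendsto_intros) auto
    qed
    moreover have "cmod (r x) \<le> 1" for x
      unfolding r_def norm_of_real using M by (simp add: field_simps)
    ultimately have "(\<lambda>x. c x * r x) \<in> C0 X"
      using C0_mult_bounded[OF c, of r 1] by simp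
    moreover have "cmod (c x * r x) \<le> M" for x
    proof -
      have "cmod (c x) * M \<le> M * max M (cmod (c x))"
        using M by (simp add: mult.commute)
      then show ?thesis
        unfolding norm_mult r_def norm_of_real using M by (simp add: field_simps)
    qed
    moreover have "c x * r x = a x" if "x \<in> Y" for x
    proof -
      have "c x = a x"
        using ga that YX by (auto simp: c_def)
      then show ?thesis
        using norm_le_sup_norm[OF a, of x] M by (simp add: r_def M_def max_absorb1)
    qed
    ultimately show ?thesis
      using out by (intro that[of "\<lambda>x. c x * r x"]) (auto simp: restr_def fun_eq_iff M_def intro!: sup_norm_le)
  qed
qed

section \<open>Normed modules and Banach algebras\<close>

text \<open>This is \<open>cbanach_space\<close> without completeness, so that the algebraic and
  metric facts are available while completeness of a space is still being proved.\<close>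

locale cnormed_space = module "ring_of_type_algebra :: complex ring" M
    for M :: "'a cnormed" (structure) +
  assumes nrm_nonneg: "x \<in> carrier M \<Longrightarrow> 0 \<le> nrm M x"
    and nrm_eq_0: "x \<in> carrier M \<Longrightarrow> nrm M x = 0 \<longleftrightarrow> x = \<zero>\<^bsub>M\<^esub>"
    and nrm_triangle:
      "\<lbrakk>x \<in> carrier M; y \<in> carrier M\<rbrakk> \<Longrightarrow> nrm M (x \<oplus>\<^bsub>M\<^esub> y) \<le> nrm M x + nrm M y"
    and nrm_smult: "x \<in> carrier M \<Longrightarrow> nrm M (c \<odot>\<^bsub>M\<^esub> x) = cmod c * nrm M x"

sublocale cbanach_space \<subseteq> cnormed_space
  by unfold_locales (fact nrm_nonneg nrm_eq_0 nrm_triangle nrm_smult)+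

lemma carrier_complex_ring [simp]: "carrier (ring_of_type_algebra :: complex ring) = UNIV"
  and add_complex_ring [simp]: "a \<oplus>\<^bsub>(ring_of_type_algebra :: complex ring)\<^esub> b = a + b"
  and mult_complex_ring [simp]: "a \<otimes>\<^bsub>(ring_of_type_algebra :: complex ring)\<^esub> b = a * b"
  and zero_complex_ring [simp]: "\<zero>\<^bsub>(ring_of_type_algebra :: complex ring)\<^esub> = 0"
  and one_complex_ring [simp]: "\<one>\<^bsub>(ring_of_type_algebra :: complex ring)\<^esub> = 1"
  by (simp_all add: ring_of_type_algebra_def)

lemma cring_complex_ring: "cring (ring_of_type_algebra :: complex ring)"
  by (rule cring_from_type_algebra)

context cnormed_space
begin

lemma smult_in_carrier [simp]: "x \<in> carrier M \<Longrightarrow> c \<odot>\<^bsub>M\<^esub> x \<in> carrier M"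
  using smult_closed[of c x] by simp

lemma minus_eq_smult: "x \<in> carrier M \<Longrightarrow> \<ominus>\<^bsub>M\<^esub> x = (-1) \<odot>\<^bsub>M\<^esub> x"
proof -
  assume x: "x \<in> carrier M"
  have "(1 + (-1)) \<odot>\<^bsub>M\<^esub> x = 1 \<odot>\<^bsub>M\<^esub> x \<oplus>\<^bsub>M\<^esub> (-1) \<odot>\<^bsub>M\<^esub> x"
    using smult_l_distr[of 1 "-1" x] x by simp
  then have "x \<oplus>\<^bsub>M\<^esub> (-1) \<odot>\<^bsub>M\<^esub> x = \<zero>\<^bsub>M\<^esub>"
    using smult_l_null[OF x] smult_one[OF x] by simp
  then show ?thesis
    using x by (metis M.add.inv_comm M.minus_equality smult_in_carrier)
qed

lemma nrm_zero [simp]: "nrm M \<zero>\<^bsub>M\<^esub> = 0"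
  using nrm_eq_0[of "\<zero>\<^bsub>M\<^esub>"] by simp

lemma nrm_minus: "x \<in> carrier M \<Longrightarrow> nrm M (\<ominus>\<^bsub>M\<^esub> x) = nrm M x"
  using nrm_smult[of x "-1"] by (simp add: minus_eq_smult)

lemma diff_eq_0_iff: "x \<in> carrier M \<Longrightarrow> y \<in> carrier M \<Longrightarrow> x \<ominus>\<^bsub>M\<^esub> y = \<zero>\<^bsub>M\<^esub> \<longleftrightarrow> x = y"
  by (metis M.add.inv_closed M.minus_eq M.minus_minus M.minus_equality M.r_neg)

lemma diff_add_diff: "x \<in> carrier M \<Longrightarrow> y \<in> carrier M \<Longrightarrow> z \<in> carrier M \<Longrightarrow>
    (x \<ominus>\<^bsub>M\<^esub> y) \<oplus>\<^bsub>M\<^esub> (y \<ominus>\<^bsub>M\<^esub> z) = x \<ominus>\<^bsub>M\<^esub> z"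
  by (simp add: M.minus_eq M.a_assoc M.r_neg1 M.r_neg2)

lemma add_diff_add: "x \<in> carrier M \<Longrightarrow> y \<in> carrier M \<Longrightarrow> x' \<in> carrier M \<Longrightarrow> y' \<in> carrier M \<Longrightarrow>
    (x \<oplus>\<^bsub>M\<^esub> y) \<ominus>\<^bsub>M\<^esub> (x' \<oplus>\<^bsub>M\<^esub> y') = (x \<ominus>\<^bsub>M\<^esub> x') \<oplus>\<^bsub>M\<^esub> (y \<ominus>\<^bsub>M\<^esub> y')"
  by (simp add: M.minus_eq M.minus_add M.a_ac)

lemma minus_diff: "x \<in> carrier M \<Longrightarrow> y \<in> carrier M \<Longrightarrow> \<ominus>\<^bsub>M\<^esub> (x \<ominus>\<^bsub>M\<^esub> y) = y \<ominus>\<^bsub>M\<^esub> x"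
  by (simp add: M.minus_eq M.minus_add M.a_comm)

lemma diff_add_cancel: "x \<in> carrier M \<Longrightarrow> y \<in> carrier M \<Longrightarrow> (x \<ominus>\<^bsub>M\<^esub> y) \<oplus>\<^bsub>M\<^esub> y = x"
  by (simp add: M.minus_eq M.a_assoc M.l_neg)

lemma smult_diff: "x \<in> carrier M \<Longrightarrow> y \<in> carrier M \<Longrightarrow>
    c \<odot>\<^bsub>M\<^esub> (x \<ominus>\<^bsub>M\<^esub> y) = c \<odot>\<^bsub>M\<^esub> x \<ominus>\<^bsub>M\<^esub> c \<odot>\<^bsub>M\<^esub> y"
  by (simp add: M.minus_eq smult_r_distr smult_r_minus)

lemma nrm_diff_commute: "x \<in> carrier M \<Longrightarrow> y \<in> carrier M \<Longrightarrow> nrm M (x \<ominus>\<^bsub>M\<^esub> y) = nrm M (y \<ominus>\<^bsub>M\<^esub> x)"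
  using nrm_minus[of "x \<ominus>\<^bsub>M\<^esub> y"] by (simp add: minus_diff)

lemma nrm_diff_triangle: "x \<in> carrier M \<Longrightarrow> y \<in> carrier M \<Longrightarrow> z \<in> carrier M \<Longrightarrow>
    nrm M (x \<ominus>\<^bsub>M\<^esub> z) \<le> nrm M (x \<ominus>\<^bsub>M\<^esub> y) + nrm M (y \<ominus>\<^bsub>M\<^esub> z)"
  using nrm_triangle[of "x \<ominus>\<^bsub>M\<^esub> y" "y \<ominus>\<^bsub>M\<^esub> z"] by (simp add: diff_add_diff)

lemma nrm_le_diff: "x \<in> carrier M \<Longrightarrow> y \<in> carrier M \<Longrightarrow> nrm M x \<le> nrm M (x \<ominus>\<^bsub>M\<^esub> y) + nrm M y"
  using nrm_triangle[of "x \<ominus>\<^bsub>M\<^esub> y" y] by (simp add: diff_add_cancel)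

lemma Metric_space_norm: "Metric_space (carrier M) (norm_dist M)"
proof
  show "norm_dist M x y = 0 \<longleftrightarrow> x = y" if "x \<in> carrier M" "y \<in> carrier M" for x y
    using that nrm_eq_0[of "x \<ominus>\<^bsub>M\<^esub> y"] by (simp add: norm_dist_def diff_eq_0_iff)
qed (auto simp: norm_dist_def nrm_nonneg nrm_diff_commute nrm_diff_triangle)

lemma topspace_norm_topology [simp]: "topspace (norm_topology M) = carrier M"
  by (simp add: norm_topology_def Metric_space.topspace_mtopology[OF Metric_space_norm])

lemma closure_of_norm_topology:
  "norm_topology M closure_of S =
     {x \<in> carrier M. \<forall>e>0. \<exists>y\<in>S. y \<in> carrier M \<and> nrm M (x \<ominus>\<^bsub>M\<^esub> y) < e}"
proof -
  interpret MS: Metric_space "carrier M" "norm_dist M"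
    by (rule Metric_space_norm)
  show ?thesis
    unfolding norm_topology_def MS.metric_closure_of
    by (auto simp: MS.in_mball norm_dist_def)
qed

lemma closedin_norm_topology_iff:
  "closedin (norm_topology M) S \<longleftrightarrow> S \<subseteq> carrier M \<and>
     (\<forall>x\<in>carrier M. (\<forall>e>0. \<exists>y\<in>S. nrm M (x \<ominus>\<^bsub>M\<^esub> y) < e) \<longrightarrow> x \<in> S)"
proof -
  have "closedin (norm_topology M) S \<longleftrightarrow> S \<subseteq> carrier M \<and> norm_topology M closure_of S \<subseteq> S"
    by (metis closure_of_subset_eq topspace_norm_topology)
  also have "\<dots> \<longleftrightarrow> S \<subseteq> carrier M \<and>
     (\<forall>x\<in>carrier M. (\<forall>e>0. \<exists>y\<in>S. nrm M (x \<ominus>\<^bsub>M\<^esub> y) < e) \<longrightarrow> x \<in> S)"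
    unfolding closure_of_norm_topology by blast
  finally show ?thesis .
qed

definition Cauchy_seq :: "(nat \<Rightarrow> 'a) \<Rightarrow> bool" where
  "Cauchy_seq q \<longleftrightarrow> range q \<subseteq> carrier M \<and>
     (\<forall>e>0. \<exists>N. \<forall>m\<ge>N. \<forall>n\<ge>N. nrm M (q m \<ominus>\<^bsub>M\<^esub> q n) < e)"

definition limit_seq :: "(nat \<Rightarrow> 'a) \<Rightarrow> 'a \<Rightarrow> bool" where
  "limit_seq q l \<longleftrightarrow> l \<in> carrier M \<and> (\<forall>e>0. \<exists>N. \<forall>n\<ge>N. nrm M (q n \<ominus>\<^bsub>M\<^esub> l) < e)"

lemma mcomplete_norm_dist_iff:
  "Metric_space.mcomplete (carrier M) (norm_dist M) \<longleftrightarrow> (\<forall>q. Cauchy_seq q \<longrightarrow> (\<exists>l. limit_seq q l))"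
proof -
  interpret MS: Metric_space "carrier M" "norm_dist M"
    by (rule Metric_space_norm)
  have C: "MS.MCauchy q \<longleftrightarrow> Cauchy_seq q" for q
  proof (cases "range q \<subseteq> carrier M")
    case True
    then have "norm_dist M (q m) (q n) = nrm M (q m \<ominus>\<^bsub>M\<^esub> q n)" for m n
      by (auto simp: norm_dist_def)
    with True show ?thesis
      by (simp add: MS.MCauchy_def Cauchy_seq_def)
  qed (simp add: MS.MCauchy_def Cauchy_seq_def)
  have L: "limitin MS.mtopology q l sequentially \<longleftrightarrow> limit_seq q l" if "Cauchy_seq q" for q l
  proof -
    have "q n \<in> carrier M" for n
      using that by (auto simp: Cauchy_seq_def)
    then show ?thesis
      by (auto simp: MS.limitin_metric limit_seq_def norm_dist_def eventually_sequentially)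
  qed
  show ?thesis
    unfolding MS.mcomplete_def using C L by metis
qed

end

lemma (in cbanach_space) Cauchy_seq_limit: "Cauchy_seq q \<Longrightarrow> \<exists>l. limit_seq q l"
  using complete by (simp add: mcomplete_norm_dist_iff)

lemma (in cnormed_space) cbanach_spaceI:
  "(\<And>q. Cauchy_seq q \<Longrightarrow> \<exists>l. limit_seq q l) \<Longrightarrow> cbanach_space M"
  by (intro cbanach_space.intro module_axioms cbanach_space_axioms.intro)
    (simp_all add: nrm_nonneg nrm_eq_0 nrm_triangle nrm_smult mcomplete_norm_dist_iff)

context cbanach_algebra
begin

lemma mult_minus_left: "x \<in> carrier M \<Longrightarrow> y \<in> carrier M \<Longrightarrow> (\<ominus>\<^bsub>M\<^esub> x) \<otimes>\<^bsub>M\<^esub> y = \<ominus>\<^bsub>M\<^esub> (x \<otimes>\<^bsub>M\<^esub> y)"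
  by (simp add: minus_eq_smult mult_smult_left mult_closed)

lemma mult_minus_right: "x \<in> carrier M \<Longrightarrow> y \<in> carrier M \<Longrightarrow> x \<otimes>\<^bsub>M\<^esub> (\<ominus>\<^bsub>M\<^esub> y) = \<ominus>\<^bsub>M\<^esub> (x \<otimes>\<^bsub>M\<^esub> y)"
  by (simp add: minus_eq_smult mult_smult_right mult_closed)

lemma mult_diff_left: "x \<in> carrier M \<Longrightarrow> y \<in> carrier M \<Longrightarrow> z \<in> carrier M \<Longrightarrow>
    (x \<ominus>\<^bsub>M\<^esub> y) \<otimes>\<^bsub>M\<^esub> z = x \<otimes>\<^bsub>M\<^esub> z \<ominus>\<^bsub>M\<^esub> y \<otimes>\<^bsub>M\<^esub> z"
  by (simp add: M.minus_eq mult_l_distr mult_minus_left)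

lemma mult_diff_right: "x \<in> carrier M \<Longrightarrow> y \<in> carrier M \<Longrightarrow> z \<in> carrier M \<Longrightarrow>
    z \<otimes>\<^bsub>M\<^esub> (x \<ominus>\<^bsub>M\<^esub> y) = z \<otimes>\<^bsub>M\<^esub> x \<ominus>\<^bsub>M\<^esub> z \<otimes>\<^bsub>M\<^esub> y"
  by (simp add: M.minus_eq mult_r_distr mult_minus_right)

lemma nrm_mult_le: "x \<in> carrier M \<Longrightarrow> y \<in> carrier M \<Longrightarrow> nrm M x \<le> p \<Longrightarrow> nrm M y \<le> q \<Longrightarrow>
    nrm M (x \<otimes>\<^bsub>M\<^esub> y) \<le> p * q"
  by (meson mult_mono nrm_mult nrm_nonneg order_trans)

lemma closed_idealsI:
  assumes "S \<subseteq> carrier M" "\<zero>\<^bsub>M\<^esub> \<in> S"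
    and "\<And>x y. x \<in> S \<Longrightarrow> y \<in> S \<Longrightarrow> x \<oplus>\<^bsub>M\<^esub> y \<in> S"
    and smult: "\<And>c x. x \<in> S \<Longrightarrow> c \<odot>\<^bsub>M\<^esub> x \<in> S"
    and "\<And>x b. x \<in> S \<Longrightarrow> b \<in> carrier M \<Longrightarrow> b \<otimes>\<^bsub>M\<^esub> x \<in> S"
    and "\<And>x b. x \<in> S \<Longrightarrow> b \<in> carrier M \<Longrightarrow> x \<otimes>\<^bsub>M\<^esub> b \<in> S"
    and "\<And>x. x \<in> carrier M \<Longrightarrow> (\<And>e. e > 0 \<Longrightarrow> \<exists>y\<in>S. nrm M (x \<ominus>\<^bsub>M\<^esub> y) < e) \<Longrightarrow> x \<in> S"
  shows "S \<in> closed_ideals M"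
proof -
  have "submodule S (ring_of_type_algebra :: complex ring) M"
  proof (rule submoduleI)
    show "\<ominus>\<^bsub>M\<^esub> a \<in> S" if "a \<in> S" for a
      using smult[OF that, of "-1"] that assms(1) by (simp add: minus_eq_smult subset_iff)
  qed (use assms in auto)
  with assms show ?thesis
    by (auto simp: closed_ideals_def closedin_norm_topology_iff)
qed

lemma closed_idealsD:
  assumes "S \<in> closed_ideals M"
  shows closed_ideal_subset: "S \<subseteq> carrier M"
    and closed_ideal_zero: "\<zero>\<^bsub>M\<^esub> \<in> S"
    and closed_ideal_add: "\<And>x y. x \<in> S \<Longrightarrow> y \<in> S \<Longrightarrow> x \<oplus>\<^bsub>M\<^esub> y \<in> S"
    and closed_ideal_smult: "\<And>c x. x \<in> S \<Longrightarrow> c \<odot>\<^bsub>M\<^esub> x \<in> S"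
    and closed_ideal_mult_left: "\<And>x b. x \<in> S \<Longrightarrow> b \<in> carrier M \<Longrightarrow> b \<otimes>\<^bsub>M\<^esub> x \<in> S"
    and closed_ideal_mult_right: "\<And>x b. x \<in> S \<Longrightarrow> b \<in> carrier M \<Longrightarrow> x \<otimes>\<^bsub>M\<^esub> b \<in> S"
    and closed_ideal_limit:
      "\<And>x. x \<in> carrier M \<Longrightarrow> (\<And>e. e > 0 \<Longrightarrow> \<exists>y\<in>S. nrm M (x \<ominus>\<^bsub>M\<^esub> y) < e) \<Longrightarrow> x \<in> S"
proof -
  have sub: "submodule S (ring_of_type_algebra :: complex ring) M"
    using assms by (simp add: closed_ideals_def)
  show 1: "S \<subseteq> carrier M" "\<And>x y. x \<in> S \<Longrightarrow> y \<in> S \<Longrightarrow> x \<oplus>\<^bsub>M\<^esub> y \<in> S"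
    using submoduleE[OF sub] by auto
  show "\<And>c x. x \<in> S \<Longrightarrow> c \<odot>\<^bsub>M\<^esub> x \<in> S"
    using submoduleE(4)[OF sub] by simp
  show "\<zero>\<^bsub>M\<^esub> \<in> S"
    using subgroup.one_closed[OF submodule.axioms(1)[OF sub]] by simp
  show "\<And>x b. x \<in> S \<Longrightarrow> b \<in> carrier M \<Longrightarrow> b \<otimes>\<^bsub>M\<^esub> x \<in> S"
    "\<And>x b. x \<in> S \<Longrightarrow> b \<in> carrier M \<Longrightarrow> x \<otimes>\<^bsub>M\<^esub> b \<in> S"
    using assms by (auto simp: closed_ideals_def)
  have "closedin (norm_topology M) S"
    using assms by (simp add: closed_ideals_def)
  then show "\<And>x. x \<in> carrier M \<Longrightarrow> (\<And>e. e > 0 \<Longrightarrow> \<exists>y\<in>S. nrm M (x \<ominus>\<^bsub>M\<^esub> y) < e) \<Longrightarrow> x \<in> S"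
    by (simp add: closedin_norm_topology_iff)
qed

text \<open>Used with \<open>D\<close> the dense image of l^1(G, C0(X)) in a crossed product, where
  the elements supported in an invariant set form an ideal only of that image. Products are
  approximated in both factors at once.\<close>

lemma closed_ideals_closure:
  assumes S: "S \<subseteq> carrier M" "\<zero>\<^bsub>M\<^esub> \<in> S"
    and add: "\<And>x y. x \<in> S \<Longrightarrow> y \<in> S \<Longrightarrow> x \<oplus>\<^bsub>M\<^esub> y \<in> S"
    and smult: "\<And>c x. x \<in> S \<Longrightarrow> c \<odot>\<^bsub>M\<^esub> x \<in> S"
    and D: "D \<subseteq> carrier M" "norm_topology M closure_of D = carrier M"
    and left: "\<And>x d. x \<in> S \<Longrightarrow> d \<in> D \<Longrightarrow> d \<otimes>\<^bsub>M\<^esub> x \<in> S"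
    and right: "\<And>x d. x \<in> S \<Longrightarrow> d \<in> D \<Longrightarrow> x \<otimes>\<^bsub>M\<^esub> d \<in> S"
  shows "norm_topology M closure_of S \<in> closed_ideals M" (is "?C \<in> _")
proof (rule closed_idealsI)
  have cl: "x \<in> ?C \<longleftrightarrow> x \<in> carrier M \<and> (\<forall>e>0. \<exists>y\<in>S. nrm M (x \<ominus>\<^bsub>M\<^esub> y) < e)" for x
    unfolding closure_of_norm_topology using S(1) by blast
  have clos: "closedin (norm_topology M) ?C"
    by (rule closedin_closure_of)
  show "?C \<subseteq> carrier M"
    using cl by blast
  show "\<zero>\<^bsub>M\<^esub> \<in> ?C"
    using closure_of_subset[of S "norm_topology M"] S by auto
  show lim: "x \<in> ?C" if "x \<in> carrier M" "\<And>e. e > 0 \<Longrightarrow> \<exists>y\<in>?C. nrm M (x \<ominus>\<^bsub>M\<^esub> y) < e" for x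
    using clos that unfolding closedin_norm_topology_iff by blast
  show "x \<oplus>\<^bsub>M\<^esub> y \<in> ?C" if xy: "x \<in> ?C" "y \<in> ?C" for x y
    unfolding cl
  proof (intro conjI allI impI)
    fix e :: real assume e: "e > 0"
    obtain x' y' where x': "x' \<in> S" "nrm M (x \<ominus>\<^bsub>M\<^esub> x') < e/2" and y': "y' \<in> S" "nrm M (y \<ominus>\<^bsub>M\<^esub> y') < e/2"
      using xy e unfolding cl by (meson half_gt_zero)
    have "nrm M ((x \<oplus>\<^bsub>M\<^esub> y) \<ominus>\<^bsub>M\<^esub> (x' \<oplus>\<^bsub>M\<^esub> y')) \<le> nrm M (x \<ominus>\<^bsub>M\<^esub> x') + nrm M (y \<ominus>\<^bsub>M\<^esub> y')"
      using x' y' xy S(1) cl nrm_triangle[of "x \<ominus>\<^bsub>M\<^esub> x'" "y \<ominus>\<^bsub>M\<^esub> y'"] by (auto simp: add_diff_add subset_iff)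
    then show "\<exists>z\<in>S. nrm M ((x \<oplus>\<^bsub>M\<^esub> y) \<ominus>\<^bsub>M\<^esub> z) < e"
      using add[OF x'(1) y'(1)] x' y' by (intro bexI[of _ "x' \<oplus>\<^bsub>M\<^esub> y'"]) auto
  qed (use xy cl in auto)
  show "c \<odot>\<^bsub>M\<^esub> x \<in> ?C" if x: "x \<in> ?C" for c x
    unfolding cl
  proof (intro conjI allI impI)
    fix e :: real assume e: "e > 0"
    define k where "k = cmod c + 1"
    have k: "k > 0" "cmod c \<le> k" by (simp_all add: k_def add.commute add_pos_nonneg)
    obtain x' where x': "x' \<in> S" "nrm M (x \<ominus>\<^bsub>M\<^esub> x') < e/k"
      using x e k unfolding cl by (meson divide_pos_pos)
    have "nrm M (c \<odot>\<^bsub>M\<^esub> x \<ominus>\<^bsub>M\<^esub> c \<odot>\<^bsub>M\<^esub> x') = cmod c * nrm M (x \<ominus>\<^bsub>M\<^esub> x')"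
      using x x' S(1) cl by (subst nrm_smult[symmetric]) (auto simp: smult_diff)
    also have "\<dots> \<le> k * nrm M (x \<ominus>\<^bsub>M\<^esub> x')"
      using k x x' S(1) cl by (intro mult_right_mono nrm_nonneg) auto
    also have "\<dots> < e"
      using x' k by (simp add: field_simps)
    finally show "\<exists>z\<in>S. nrm M (c \<odot>\<^bsub>M\<^esub> x \<ominus>\<^bsub>M\<^esub> z) < e"
      using smult[OF x'(1)] by blast
  qed (use x cl in auto)
  have approx: "\<exists>d\<in>D. nrm M (b \<ominus>\<^bsub>M\<^esub> d) < e" if "b \<in> carrier M" "e > 0" for b e
    using that D(2) unfolding closure_of_norm_topology by blast
  \<comment> \<open>Both approximants are also kept within distance 1, which bounds their norms;
    adding 1 to the norms keeps the divisors positive.\<close>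
  have nearby: "\<exists>x'\<in>S. \<exists>d\<in>D. nrm M (x \<ominus>\<^bsub>M\<^esub> x') * (nrm M b + 1) + (nrm M x + 1) * nrm M (b \<ominus>\<^bsub>M\<^esub> d) < e
      \<and> nrm M x' \<le> nrm M x + 1 \<and> nrm M d \<le> nrm M b + 1"
    if x: "x \<in> ?C" and b: "b \<in> carrier M" and e: "e > 0" for x b e
  proof -
    have xM: "x \<in> carrier M" using x cl by blast
    have pos: "nrm M b + 1 > 0" "nrm M x + 1 > 0"
      using nrm_nonneg[OF b] nrm_nonneg[OF xM] by auto
    obtain x' where x': "x' \<in> S" "nrm M (x \<ominus>\<^bsub>M\<^esub> x') < min 1 (e / 2 / (nrm M b + 1))"
      using x e pos unfolding cl by (metis divide_pos_pos half_gt_zero min_less_iff_conj zero_less_one)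
    obtain d where d: "d \<in> D" "nrm M (b \<ominus>\<^bsub>M\<^esub> d) < min 1 (e / 2 / (nrm M x + 1))"
      using approx[OF b, of "min 1 (e / 2 / (nrm M x + 1))"] e pos by auto
    have in_M: "x' \<in> carrier M" "d \<in> carrier M"
      using x' d S(1) D(1) by auto
    have "nrm M (x \<ominus>\<^bsub>M\<^esub> x') * (nrm M b + 1) < e/2" "(nrm M x + 1) * nrm M (b \<ominus>\<^bsub>M\<^esub> d) < e/2"
      using x'(2) d(2) pos by (simp_all add: field_simps)
    moreover have "nrm M x' \<le> nrm M x + 1" "nrm M d \<le> nrm M b + 1"
      using nrm_le_diff[of x' x] nrm_le_diff[of d b] nrm_diff_commute[of x x'] nrm_diff_commute[of b d]
        x'(2) d(2) in_M xM b by auto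
    ultimately show ?thesis
      using x'(1) d(1) by force
  qed
  show "b \<otimes>\<^bsub>M\<^esub> x \<in> ?C" if x: "x \<in> ?C" and b: "b \<in> carrier M" for x b
    unfolding cl
  proof (intro conjI allI impI)
    fix e :: real assume e: "e > 0"
    obtain x' d where *: "x' \<in> S" "d \<in> D"
      "nrm M (x \<ominus>\<^bsub>M\<^esub> x') * (nrm M b + 1) + (nrm M x + 1) * nrm M (b \<ominus>\<^bsub>M\<^esub> d) < e"
      "nrm M x' \<le> nrm M x + 1" "nrm M d \<le> nrm M b + 1"
      using nearby[OF x b e] by blast
    have in_M: "x \<in> carrier M" "x' \<in> carrier M" "d \<in> carrier M"
      using x cl * S(1) D(1) by auto
    have "nrm M (b \<otimes>\<^bsub>M\<^esub> x \<ominus>\<^bsub>M\<^esub> d \<otimes>\<^bsub>M\<^esub> x') \<le>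
        nrm M (b \<otimes>\<^bsub>M\<^esub> x \<ominus>\<^bsub>M\<^esub> d \<otimes>\<^bsub>M\<^esub> x) + nrm M (d \<otimes>\<^bsub>M\<^esub> x \<ominus>\<^bsub>M\<^esub> d \<otimes>\<^bsub>M\<^esub> x')"
      using b in_M by (intro nrm_diff_triangle mult_closed)
    also have "\<dots> = nrm M ((b \<ominus>\<^bsub>M\<^esub> d) \<otimes>\<^bsub>M\<^esub> x) + nrm M (d \<otimes>\<^bsub>M\<^esub> (x \<ominus>\<^bsub>M\<^esub> x'))"
      using b in_M by (simp add: mult_diff_left mult_diff_right)
    also have "\<dots> \<le> nrm M (b \<ominus>\<^bsub>M\<^esub> d) * (nrm M x + 1) + (nrm M b + 1) * nrm M (x \<ominus>\<^bsub>M\<^esub> x')"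
      using b in_M * by (intro add_mono nrm_mult_le) auto
    also have "\<dots> < e"
      using * by (simp add: mult.commute)
    finally show "\<exists>z\<in>S. nrm M (b \<otimes>\<^bsub>M\<^esub> x \<ominus>\<^bsub>M\<^esub> z) < e"
      using left[OF *(1,2)] by blast
  qed (use x b cl mult_closed in auto)
  show "x \<otimes>\<^bsub>M\<^esub> b \<in> ?C" if x: "x \<in> ?C" and b: "b \<in> carrier M" for x b
    unfolding cl
  proof (intro conjI allI impI)
    fix e :: real assume e: "e > 0"
    obtain x' d where *: "x' \<in> S" "d \<in> D"
      "nrm M (x \<ominus>\<^bsub>M\<^esub> x') * (nrm M b + 1) + (nrm M x + 1) * nrm M (b \<ominus>\<^bsub>M\<^esub> d) < e"
      "nrm M x' \<le> nrm M x + 1" "nrm M d \<le> nrm M b + 1"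
      using nearby[OF x b e] by blast
    have in_M: "x \<in> carrier M" "x' \<in> carrier M" "d \<in> carrier M"
      using x cl * S(1) D(1) by auto
    have "nrm M (x \<otimes>\<^bsub>M\<^esub> b \<ominus>\<^bsub>M\<^esub> x' \<otimes>\<^bsub>M\<^esub> d) \<le>
        nrm M (x \<otimes>\<^bsub>M\<^esub> b \<ominus>\<^bsub>M\<^esub> x \<otimes>\<^bsub>M\<^esub> d) + nrm M (x \<otimes>\<^bsub>M\<^esub> d \<ominus>\<^bsub>M\<^esub> x' \<otimes>\<^bsub>M\<^esub> d)"
      using b in_M by (intro nrm_diff_triangle mult_closed)
    also have "\<dots> = nrm M (x \<otimes>\<^bsub>M\<^esub> (b \<ominus>\<^bsub>M\<^esub> d)) + nrm M ((x \<ominus>\<^bsub>M\<^esub> x') \<otimes>\<^bsub>M\<^esub> d)"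
      using b in_M by (simp add: mult_diff_left mult_diff_right)
    also have "\<dots> \<le> (nrm M x + 1) * nrm M (b \<ominus>\<^bsub>M\<^esub> d) + nrm M (x \<ominus>\<^bsub>M\<^esub> x') * (nrm M b + 1)"
      using b in_M * by (intro add_mono nrm_mult_le) auto
    also have "\<dots> < e"
      using * by simp
    finally show "\<exists>z\<in>S. nrm M (x \<otimes>\<^bsub>M\<^esub> b \<ominus>\<^bsub>M\<^esub> z) < e"
      using right[OF *(1,2)] by blast
  qed (use x b cl mult_closed in auto)
qed

end

text \<open>Isometric isomorphisms out of a Banach algebra equip their codomain, a mere record, with
  the structure of a Banach algebra.\<close>

definition isometric_iso :: "'a cnormed \<Rightarrow> 'b cnormed \<Rightarrow> ('a \<Rightarrow> 'b) \<Rightarrow> bool" where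
  "isometric_iso A B f \<longleftrightarrow> bij_betw f (carrier A) (carrier B) \<and> f \<zero>\<^bsub>A\<^esub> = \<zero>\<^bsub>B\<^esub> \<and>
     linear_on A B f \<and> multiplicative_on A B f \<and> (\<forall>x\<in>carrier A. nrm B (f x) = nrm A x)"

lemma cbanach_algebra_isometric_iso:
  assumes A: "cbanach_algebra A" and f: "isometric_iso A B f"
  shows "cbanach_algebra B"
proof -
  interpret A: cbanach_algebra A by fact
  have bij: "bij_betw f (carrier A) (carrier B)" and zero: "\<zero>\<^bsub>B\<^esub> = f \<zero>\<^bsub>A\<^esub>"
    and add: "\<And>x y. x \<in> carrier A \<Longrightarrow> y \<in> carrier A \<Longrightarrow> f x \<oplus>\<^bsub>B\<^esub> f y = f (x \<oplus>\<^bsub>A\<^esub> y)"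
    and smult: "\<And>c x. x \<in> carrier A \<Longrightarrow> c \<odot>\<^bsub>B\<^esub> f x = f (c \<odot>\<^bsub>A\<^esub> x)"
    and mult: "\<And>x y. x \<in> carrier A \<Longrightarrow> y \<in> carrier A \<Longrightarrow> f x \<otimes>\<^bsub>B\<^esub> f y = f (x \<otimes>\<^bsub>A\<^esub> y)"
    and nrm: "\<And>x. x \<in> carrier A \<Longrightarrow> nrm B (f x) = nrm A x"
    using f by (auto simp: isometric_iso_def linear_on_def multiplicative_on_def)
  have cB: "carrier B = f ` carrier A"
    using bij by (simp add: bij_betw_def)
  have inj: "f x = f y \<longleftrightarrow> x = y" if "x \<in> carrier A" "y \<in> carrier A" for x y
    using bij that by (auto simp: bij_betw_def inj_on_def)
  note simps = cB zero add smult mult nrm inj A.mult_closed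
  have ab: "abelian_group B"
  proof (rule abelian_groupI)
    fix x assume "x \<in> carrier B"
    then obtain x' where x': "x' \<in> carrier A" "x = f x'"
      by (auto simp: cB)
    then show "\<exists>y\<in>carrier B. y \<oplus>\<^bsub>B\<^esub> x = \<zero>\<^bsub>B\<^esub>"
      by (intro bexI[of _ "f (\<ominus>\<^bsub>A\<^esub> x')"]) (auto simp: simps A.M.l_neg)
  qed (auto simp: simps A.M.a_assoc intro: A.M.a_comm)
  have mod: "module (ring_of_type_algebra :: complex ring) B"
  proof (rule moduleI[OF cring_complex_ring ab])
    fix a b :: complex and x y assume "x \<in> carrier B" "y \<in> carrier B"
    then show "a \<odot>\<^bsub>B\<^esub> (x \<oplus>\<^bsub>B\<^esub> y) = a \<odot>\<^bsub>B\<^esub> x \<oplus>\<^bsub>B\<^esub> a \<odot>\<^bsub>B\<^esub> y"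
      by (auto simp: simps A.smult_r_distr)
  next
    fix a b :: complex and x assume "x \<in> carrier B"
    then show "(a \<oplus>\<^bsub>ring_of_type_algebra\<^esub> b) \<odot>\<^bsub>B\<^esub> x = a \<odot>\<^bsub>B\<^esub> x \<oplus>\<^bsub>B\<^esub> b \<odot>\<^bsub>B\<^esub> x"
      "(a \<otimes>\<^bsub>ring_of_type_algebra\<^esub> b) \<odot>\<^bsub>B\<^esub> x = a \<odot>\<^bsub>B\<^esub> (b \<odot>\<^bsub>B\<^esub> x)"
      "\<one>\<^bsub>(ring_of_type_algebra :: complex ring)\<^esub> \<odot>\<^bsub>B\<^esub> x = x"
      using A.smult_l_distr[of a b] A.smult_assoc1[of a b] A.smult_one by (auto simp: simps)
  qed (auto simp: simps)
  interpret B: module "ring_of_type_algebra :: complex ring" B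
    by fact
  interpret B: cnormed_space B
  proof
    fix x y assume "x \<in> carrier B" "y \<in> carrier B"
    then show "nrm B (x \<oplus>\<^bsub>B\<^esub> y) \<le> nrm B x + nrm B y"
      by (auto simp: simps A.nrm_triangle)
  qed (auto simp: simps A.nrm_nonneg A.nrm_eq_0 A.nrm_smult)
  have diff: "f x \<ominus>\<^bsub>B\<^esub> f y = f (x \<ominus>\<^bsub>A\<^esub> y)" if "x \<in> carrier A" "y \<in> carrier A" for x y
  proof -
    have "f x \<ominus>\<^bsub>B\<^esub> f y = f x \<oplus>\<^bsub>B\<^esub> (-1) \<odot>\<^bsub>B\<^esub> f y"
      using that by (simp add: B.M.minus_eq B.minus_eq_smult cB)
    then show ?thesis
      using that by (simp add: smult add A.M.minus_eq A.minus_eq_smult)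
  qed
  interpret B: cbanach_space B
  proof (rule B.cbanach_spaceI)
    fix q assume q: "B.Cauchy_seq q"
    define p where "p n = inv_into (carrier A) f (q n)" for n
    have "q n \<in> f ` carrier A" for n
      using q by (auto simp: B.Cauchy_seq_def cB)
    then have p: "p n \<in> carrier A" "f (p n) = q n" for n
      by (auto simp: p_def inv_into_into f_inv_into_f)
    have "nrm B (q m \<ominus>\<^bsub>B\<^esub> q n) = nrm A (p m \<ominus>\<^bsub>A\<^esub> p n)" for m n
      using p(1)[of m] p(1)[of n] by (simp add: p(2)[symmetric] diff nrm)
    then have "A.Cauchy_seq p"
      using q p by (auto simp: A.Cauchy_seq_def B.Cauchy_seq_def)
    then obtain l where l: "A.limit_seq p l"
      using A.Cauchy_seq_limit by blast
    then have "nrm B (q n \<ominus>\<^bsub>B\<^esub> f l) = nrm A (p n \<ominus>\<^bsub>A\<^esub> l)" for n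
      using p(1)[of n] by (simp add: p(2)[symmetric] diff nrm A.limit_seq_def)
    then have "B.limit_seq q (f l)"
      using l by (auto simp: A.limit_seq_def B.limit_seq_def cB)
    then show "\<exists>l. B.limit_seq q l" ..
  qed
  show ?thesis
  proof
    fix c x y assume "x \<in> carrier B" "y \<in> carrier B"
    then show "x \<otimes>\<^bsub>B\<^esub> y \<in> carrier B" "nrm B (x \<otimes>\<^bsub>B\<^esub> y) \<le> nrm B x * nrm B y"
      "(c \<odot>\<^bsub>B\<^esub> x) \<otimes>\<^bsub>B\<^esub> y = c \<odot>\<^bsub>B\<^esub> (x \<otimes>\<^bsub>B\<^esub> y)" "x \<otimes>\<^bsub>B\<^esub> (c \<odot>\<^bsub>B\<^esub> y) = c \<odot>\<^bsub>B\<^esub> (x \<otimes>\<^bsub>B\<^esub> y)"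
      by (auto simp: simps A.nrm_mult A.mult_smult_left A.mult_smult_right)
  next
    fix x y z assume "x \<in> carrier B" "y \<in> carrier B" "z \<in> carrier B"
    then show "(x \<otimes>\<^bsub>B\<^esub> y) \<otimes>\<^bsub>B\<^esub> z = x \<otimes>\<^bsub>B\<^esub> (y \<otimes>\<^bsub>B\<^esub> z)"
      "(x \<oplus>\<^bsub>B\<^esub> y) \<otimes>\<^bsub>B\<^esub> z = (x \<otimes>\<^bsub>B\<^esub> z) \<oplus>\<^bsub>B\<^esub> (y \<otimes>\<^bsub>B\<^esub> z)"
      "z \<otimes>\<^bsub>B\<^esub> (x \<oplus>\<^bsub>B\<^esub> y) = (z \<otimes>\<^bsub>B\<^esub> x) \<oplus>\<^bsub>B\<^esub> (z \<otimes>\<^bsub>B\<^esub> y)"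
      by (auto simp: simps A.mult_assoc A.mult_l_distr A.mult_r_distr)
  qed
qed

section \<open>The twisted convolution algebra\<close>

text \<open>The Weierstrass test: the majorant makes the pointwise sum a uniform limit of finite
  partial sums.\<close>

lemma C0_infsum:
  assumes f: "\<And>s. s \<in> S \<Longrightarrow> f s \<in> C0 X" and c: "c summable_on S"
    and le: "\<And>s. s \<in> S \<Longrightarrow> sup_norm (f s) \<le> c s"
  shows "(\<lambda>x. \<Sum>\<^sub>\<infinity>s\<in>S. f s x) \<in> C0 X"
    and "sup_norm (\<lambda>x. \<Sum>\<^sub>\<infinity>s\<in>S. f s x) \<le> infsum c S"
    and "(\<lambda>s. cmod (f s x)) summable_on S"
proof -
  have fc: "cmod (f s x) \<le> c s" if "s \<in> S" for s x
    using norm_le_sup_norm[OF f[OF that], of x] le[OF that] by simp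
  have sum: "(\<lambda>s. cmod (f s x)) summable_on S" for x
    by (rule summable_on_comparison_test[OF c]) (auto simp: fc)
  then show "(\<lambda>s. cmod (f s x)) summable_on S" .
  have bound: "cmod (\<Sum>\<^sub>\<infinity>s\<in>T. f s x) \<le> infsum c T" if "T \<subseteq> S" for x T
  proof -
    have T: "(\<lambda>s. cmod (f s x)) summable_on T"
      by (rule summable_on_subset[OF sum that])
    then have "cmod (\<Sum>\<^sub>\<infinity>s\<in>T. f s x) \<le> (\<Sum>\<^sub>\<infinity>s\<in>T. cmod (f s x))"
      by (rule norm_infsum_bound)
    also have "\<dots> \<le> infsum c T"
      using that by (intro infsum_mono T summable_on_subset[OF c]) (auto intro: fc)
    finally show ?thesis .
  qed
  show "sup_norm (\<lambda>x. \<Sum>\<^sub>\<infinity>s\<in>S. f s x) \<le> infsum c S"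
    by (intro sup_norm_le bound) simp
  show "(\<lambda>x. \<Sum>\<^sub>\<infinity>s\<in>S. f s x) \<in> C0 X"
  proof (rule C0_uniform_limit)
    fix e :: real assume e: "e > 0"
    obtain F where F: "finite F" "F \<subseteq> S" "dist (sum c F) (infsum c S) \<le> e/2"
      using infsum_finite_approximation[OF c, of "e/2"] e by auto
    have "cmod ((\<Sum>\<^sub>\<infinity>s\<in>S. f s x) - (\<Sum>s\<in>F. f s x)) < e" for x
    proof -
      have "(\<Sum>\<^sub>\<infinity>s\<in>S. f s x) = (\<Sum>\<^sub>\<infinity>s\<in>F \<union> (S - F). f s x)"
        using F(2) by (simp add: Un_absorb1)
      also have "\<dots> = (\<Sum>s\<in>F. f s x) + (\<Sum>\<^sub>\<infinity>s\<in>S-F. f s x)"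
        using F(1) abs_summable_summable[OF sum]
        by (subst infsum_Un_disjoint) (auto intro: summable_on_subset_banach)
      finally have "cmod ((\<Sum>\<^sub>\<infinity>s\<in>S. f s x) - (\<Sum>s\<in>F. f s x)) \<le> infsum c (S - F)"
        using bound[of "S - F" x] by simp
      also have "infsum c S = sum c F + infsum c (S - F)"
      proof -
        have "infsum c S = infsum c (F \<union> (S - F))"
          using F(2) by (simp add: Un_absorb1)
        then show ?thesis
          using F(1) c by (subst (asm) infsum_Un_disjoint) (auto intro: summable_on_subset_banach)
      qed
      then have "infsum c (S - F) \<le> e/2"
        using F(3) by (simp add: dist_real_def)
      finally show ?thesis
        using e by simp
    qed
    then show "\<exists>a\<in>C0 X. \<forall>x. cmod ((\<Sum>\<^sub>\<infinity>s\<in>S. f s x) - a x) < e"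
      using F(2) f by (intro bexI[of _ "\<lambda>x. \<Sum>s\<in>F. f s x"] C0_sum) auto
  qed
qed

context group
begin

text \<open>The substitution \<open>t = inv s \<otimes> r\<close> turns the double sum into the
  product of two sums, so Fubini gives all four claims.\<close>

lemma convolution_summable:
  fixes f h :: "'a \<Rightarrow> real"
  assumes f: "f summable_on carrier G" and h: "h summable_on carrier G"
    and f0: "\<And>g. g \<in> carrier G \<Longrightarrow> 0 \<le> f g" and h0: "\<And>g. g \<in> carrier G \<Longrightarrow> 0 \<le> h g"
  shows "(\<lambda>(r, s). f s * h (inv s \<otimes> r)) summable_on carrier G \<times> carrier G" (is ?A)
    and "r \<in> carrier G \<Longrightarrow> (\<lambda>s. f s * h (inv s \<otimes> r)) summable_on carrier G"
    and "(\<lambda>r. \<Sum>\<^sub>\<infinity>s\<in>carrier G. f s * h (inv s \<otimes> r)) summable_on carrier G"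
    and "(\<Sum>\<^sub>\<infinity>r\<in>carrier G. \<Sum>\<^sub>\<infinity>s\<in>carrier G. f s * h (inv s \<otimes> r)) =
      infsum f (carrier G) * infsum h (carrier G)"
proof -
  have prod: "(\<lambda>(s, t). f s * h t) summable_on carrier G \<times> carrier G"
  proof (rule summable_on_SigmaI)
    show "((\<lambda>t. case (s, t) of (s, t) \<Rightarrow> f s * h t) has_sum f s * infsum h (carrier G)) (carrier G)"
      for s
      using has_sum_cmult_right[OF has_sum_infsum[OF h], of "f s"] by simp
    show "(\<lambda>s. f s * infsum h (carrier G)) summable_on carrier G"
      using f by (rule summable_on_cmult_left)
  qed (use f0 h0 in auto)
  have bij: "bij_betw (\<lambda>(r, s). (s, inv s \<otimes> r)) (carrier G \<times> carrier G) (carrier G \<times> carrier G)"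
    by (rule bij_betwI[where g="\<lambda>(s, t). (s \<otimes> t, s)"]) (auto simp: m_assoc[symmetric])
  have eq: "(\<lambda>(r, s). f s * h (inv s \<otimes> r)) =
      (\<lambda>p. (\<lambda>(s, t). f s * h t) ((\<lambda>(r, s). (s, inv s \<otimes> r)) p))"
    by (auto simp: fun_eq_iff)
  show A: ?A
    unfolding eq summable_on_reindex_bij_betw[OF bij] by (rule prod)
  show "(\<lambda>s. f s * h (inv s \<otimes> r)) summable_on carrier G" if "r \<in> carrier G"
    using summable_on_SigmaD1[OF A] that by simp
  show "(\<lambda>r. \<Sum>\<^sub>\<infinity>s\<in>carrier G. f s * h (inv s \<otimes> r)) summable_on carrier G"
    using summable_on_Sigma_banach[OF A] .
  have "(\<Sum>\<^sub>\<infinity>r\<in>carrier G. \<Sum>\<^sub>\<infinity>s\<in>carrier G. f s * h (inv s \<otimes> r)) =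
      infsum (\<lambda>(r, s). f s * h (inv s \<otimes> r)) (carrier G \<times> carrier G)"
    by (rule infsum_Sigma'_banach[OF A])
  also have "\<dots> = infsum (\<lambda>(s, t). f s * h t) (carrier G \<times> carrier G)"
    unfolding eq by (rule infsum_reindex_bij_betw[OF bij])
  also have "\<dots> = (\<Sum>\<^sub>\<infinity>s\<in>carrier G. \<Sum>\<^sub>\<infinity>t\<in>carrier G. f s * h t)"
    by (rule infsum_Sigma'_banach[OF prod, symmetric])
  also have "\<dots> = infsum f (carrier G) * infsum h (carrier G)"
    by (simp add: infsum_cmult_right' infsum_cmult_left')
  finally show "(\<Sum>\<^sub>\<infinity>r\<in>carrier G. \<Sum>\<^sub>\<infinity>s\<in>carrier G. f s * h (inv s \<otimes> r)) =
      infsum f (carrier G) * infsum h (carrier G)" .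
qed

lemma bij_betw_mult_left: "s \<in> carrier G \<Longrightarrow> bij_betw (\<lambda>t. s \<otimes> t) (carrier G) (carrier G)"
  by (rule bij_betwI[where g="\<lambda>t. inv s \<otimes> t"]) (auto simp: m_assoc[symmetric])

lemma bij_betw_mult_right: "s \<in> carrier G \<Longrightarrow> bij_betw (\<lambda>t. t \<otimes> s) (carrier G) (carrier G)"
  by (rule bij_betwI[where g="\<lambda>t. t \<otimes> inv s"]) (simp_all add: m_assoc)

end

locale twisted_action = homeo_action G X \<phi>
    for G :: "('g, 'm) monoid_scheme" (structure) and X :: "'x topology" and \<phi> +
  fixes u :: "'g \<Rightarrow> 'g \<Rightarrow> 'x \<Rightarrow> complex"
  assumes locally_compact: "locally_compact_space X" and Hausdorff: "Hausdorff_space X"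
    and cocycle: "u \<in> cocycles G X \<phi>"

context homeo_action
begin

lemma group_G: "group G"
  using group_hom group_hom.axioms(1) by auto

lemma action_closed: "g \<in> carrier G \<Longrightarrow> x \<in> topspace X \<Longrightarrow> \<phi> g x \<in> topspace X"
  using element_image by blast

lemma action_one: "x \<in> topspace X \<Longrightarrow> \<phi> \<one> x = x"
  using id_eq_one by (metis restrict_apply')

lemma action_inv_cancel: "g \<in> carrier G \<Longrightarrow> x \<in> topspace X \<Longrightarrow> \<phi> (inv g) (\<phi> g x) = x"
  using orbit_sym_aux by blast

lemma action_cancel_inv: "g \<in> carrier G \<Longrightarrow> x \<in> topspace X \<Longrightarrow> \<phi> g (\<phi> (inv g) x) = x"
  using action_inv_cancel[of "inv g" x] group.inv_inv[OF group_G] group.inv_closed[OF group_G] by simp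

lemma action_continuous: "g \<in> carrier G \<Longrightarrow> continuous_map X X (\<phi> g)"
  using homeo homeomorphic_imp_continuous_map by blast

lemma dual_action_C0:
  assumes g: "g \<in> carrier G" and a: "a \<in> C0 X"
  shows "dual_action G X \<phi> g a \<in> C0 X"
proof (rule C0I)
  have g': "inv g \<in> carrier G"
    using g group_G by (simp add: group.inv_closed)
  have "continuous_map X euclidean (a \<circ> \<phi> (inv g))"
    using continuous_map_compose[OF action_continuous[OF g'] C0_continuous_map[OF a]] .
  then show "continuous_map X euclidean (dual_action G X \<phi> g a)"
    by (rule continuous_map_eq) (simp add: dual_action_def restr_def)
  show "\<exists>K. compactin X K \<and> (\<forall>x\<in>topspace X - K. cmod (dual_action G X \<phi> g a x) < e)"
    if e: "e > 0" for e
  proof -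
    obtain K where K: "compactin X K" "\<And>x. x \<notin> K \<Longrightarrow> cmod (a x) < e"
      using C0_small_outside_compact[OF a e] by auto
    have "\<phi> (inv g) x \<notin> K" if "x \<in> topspace X - \<phi> g ` K" for x
      using that action_cancel_inv[OF g] by force
    then show ?thesis
      using image_compactin[OF K(1) action_continuous[OF g]] K(2)
      by (intro exI[of _ "\<phi> g ` K"]) (auto simp: dual_action_def restr_def)
  qed
qed (simp add: dual_action_def restr_def)

end

context twisted_action
begin

sublocale group G
  by (rule group_G)

abbreviation "F \<equiv> twisted_l1 G X \<phi> u"
abbreviation "dual \<equiv> dual_action G X \<phi>"

lemma dual_apply: "x \<in> topspace X \<Longrightarrow> dual s a x = a (\<phi> (inv s) x)"
  by (simp add: dual_action_def restr_def)

lemma cocycle_Cu: "s \<in> carrier G \<Longrightarrow> t \<in> carrier G \<Longrightarrow> u s t \<in> Cu X"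
  using cocycle by (simp add: cocycles_def)

lemma cocycle_continuous: "s \<in> carrier G \<Longrightarrow> t \<in> carrier G \<Longrightarrow> continuous_map X euclidean (u s t)"
  and cocycle_norm: "s \<in> carrier G \<Longrightarrow> t \<in> carrier G \<Longrightarrow> x \<in> topspace X \<Longrightarrow> cmod (u s t x) = 1"
  using cocycle_Cu[of s t] by (auto simp: Cu_def)

lemma cocycle_eq: "r \<in> carrier G \<Longrightarrow> s \<in> carrier G \<Longrightarrow> t \<in> carrier G \<Longrightarrow> x \<in> topspace X \<Longrightarrow>
    u s t (\<phi> (inv r) x) * u r (s \<otimes> t) x = u r s x * u (r \<otimes> s) t x"
  using cocycle by (auto simp: cocycles_def dual_action_def restr_def)

lemma cocycle_one_one: "x \<in> topspace X \<Longrightarrow> u \<one> \<one> x = 1"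
  using cocycle by (simp add: cocycles_def)

text \<open>By the cocycle identity at \<open>(g, \<one>, \<one>)\<close> this number is its own
  square, and it has modulus 1.\<close>

lemma cocycle_one_right:
  assumes g: "g \<in> carrier G" and x: "x \<in> topspace X"
  shows "u g \<one> x = 1"
proof -
  have "u g \<one> x = u g \<one> x * u g \<one> x"
    using cocycle_eq[OF g one_closed one_closed x] g x
    by (simp add: cocycle_one_one action_closed)
  moreover have "u g \<one> x \<noteq> 0"
    using cocycle_norm[OF g one_closed x] by auto
  ultimately show ?thesis by simp
qed

lemma cocycle_one_left:
  assumes g: "g \<in> carrier G" and x: "x \<in> topspace X"
  shows "u \<one> g x = 1"
proof -
  have "u \<one> g x * u \<one> g x = u \<one> g x"
    using cocycle_eq[OF one_closed one_closed g x] g x by (simp add: cocycle_one_one action_one)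
  moreover have "u \<one> g x \<noteq> 0"
    using cocycle_norm[OF one_closed g x] by auto
  ultimately show ?thesis by simp
qed

lemma carrier_F: "b \<in> carrier F \<longleftrightarrow> (\<forall>g\<in>carrier G. b g \<in> C0 X) \<and>
    (\<forall>g. g \<notin> carrier G \<longrightarrow> b g = (\<lambda>x. 0)) \<and> (\<lambda>g. sup_norm (b g)) summable_on carrier G"
  by (simp add: twisted_l1_def)

lemma F_C0: "b \<in> carrier F \<Longrightarrow> b g \<in> C0 X"
  by (cases "g \<in> carrier G") (auto simp: carrier_F)

lemma F_summable: "b \<in> carrier F \<Longrightarrow> (\<lambda>g. sup_norm (b g)) summable_on carrier G"
  by (simp add: carrier_F)

lemma F_outside: "b \<in> carrier F \<Longrightarrow> g \<notin> carrier G \<Longrightarrow> b g x = 0"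
  by (simp add: carrier_F)

lemma F_outside_space: "b \<in> carrier F \<Longrightarrow> x \<notin> topspace X \<Longrightarrow> b g x = 0"
  by (rule C0_outside[OF F_C0])

lemma F_simps [simp]:
  "\<zero>\<^bsub>F\<^esub> = (\<lambda>g x. 0)" "a \<oplus>\<^bsub>F\<^esub> b = (\<lambda>g x. a g x + b g x)" "c \<odot>\<^bsub>F\<^esub> a = (\<lambda>g x. c * a g x)"
  "nrm F a = (\<Sum>\<^sub>\<infinity>g\<in>carrier G. sup_norm (a g))"
  by (simp_all add: twisted_l1_def)

lemma F_carrierI:
  assumes "\<And>g. g \<in> carrier G \<Longrightarrow> b g \<in> C0 X" "\<And>g x. g \<notin> carrier G \<Longrightarrow> b g x = 0"
    and "c summable_on carrier G" "\<And>g. g \<in> carrier G \<Longrightarrow> sup_norm (b g) \<le> c g"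
  shows "b \<in> carrier F"
proof -
  have "(\<lambda>g. sup_norm (b g)) summable_on carrier G"
    using assms(3) assms(4) sup_norm_nonneg[OF assms(1)] by (rule summable_on_comparison_test)
  with assms show ?thesis
    by (auto simp: carrier_F)
qed

lemma F_sup_norm_nonneg: "b \<in> carrier F \<Longrightarrow> 0 \<le> sup_norm (b g)"
  by (rule sup_norm_nonneg[OF F_C0])

lemma sup_norm_le_nrm: "b \<in> carrier F \<Longrightarrow> sup_norm (b g) \<le> nrm F b"
proof (cases "g \<in> carrier G")
  case True
  assume b: "b \<in> carrier F"
  show ?thesis
    using finite_sum_le_infsum[OF F_summable[OF b], of "{g}"] True F_sup_norm_nonneg[OF b] by simp
next
  case False
  assume "b \<in> carrier F"
  with False show ?thesis
    using F_sup_norm_nonneg by (auto simp: carrier_F intro!: infsum_nonneg)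
qed

lemma nrm_F_le:
  assumes "b \<in> carrier F" "c summable_on carrier G" "\<And>g. g \<in> carrier G \<Longrightarrow> sup_norm (b g) \<le> c g"
  shows "nrm F b \<le> infsum c (carrier G)"
  using assms by (simp add: F_summable infsum_mono)

text \<open>The summand of the product at \<open>r\<close> is indexed by \<open>s\<close> alone,
  with \<open>t = inv s \<otimes> r\<close>, so that every sum runs over the fixed set
  \<open>carrier G\<close>.\<close>

definition conv_term :: "('g \<Rightarrow> 'x \<Rightarrow> complex) \<Rightarrow> ('g \<Rightarrow> 'x \<Rightarrow> complex) \<Rightarrow> 'g \<Rightarrow> 'g \<Rightarrow> 'x \<Rightarrow> complex" where
  "conv_term a b r s = (\<lambda>x. a s x * dual s (b (inv s \<otimes> r)) x * u s (inv s \<otimes> r) x)"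

lemma conv_term_C0:
  assumes "a \<in> carrier F" "b \<in> carrier F" "r \<in> carrier G" "s \<in> carrier G"
  shows "conv_term a b r s \<in> C0 X"
  unfolding conv_term_def using assms
  by (intro C0_mult_bounded[where M=1] C0_mult dual_action_C0 F_C0 cocycle_continuous)
    (auto simp: cocycle_norm)

lemma conv_term_le:
  assumes "a \<in> carrier F" "b \<in> carrier F" "r \<in> carrier G" "s \<in> carrier G"
  shows "sup_norm (conv_term a b r s) \<le> sup_norm (a s) * sup_norm (b (inv s \<otimes> r))"
proof (rule sup_norm_le)
  fix x
  show "cmod (conv_term a b r s x) \<le> sup_norm (a s) * sup_norm (b (inv s \<otimes> r))"
  proof (cases "x \<in> topspace X")
    case True
    then show ?thesis
      using assms by (auto simp: conv_term_def norm_mult cocycle_norm dual_apply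
        intro!: mult_mono norm_le_sup_norm F_C0 sup_norm_nonneg)
  next
    case False
    then show ?thesis
      using assms by (auto simp: conv_term_def F_outside_space intro!: mult_nonneg_nonneg sup_norm_nonneg F_C0)
  qed
qed

lemma F_mult:
  assumes r: "r \<in> carrier G"
  shows "(a \<otimes>\<^bsub>F\<^esub> b) r x = (\<Sum>\<^sub>\<infinity>s\<in>carrier G. conv_term a b r s x)"
proof -
  have bij: "bij_betw (\<lambda>s. (s, inv s \<otimes> r)) (carrier G)
      {(s, t). s \<in> carrier G \<and> t \<in> carrier G \<and> s \<otimes> t = r}"
    using r by (intro bij_betwI[where g=fst]) (auto simp: m_assoc[symmetric])
  show ?thesis
    using infsum_reindex_bij_betw[OF bij, of "\<lambda>(s, t). a s x * dual s (b t) x * u s t x"]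
    by (simp add: twisted_l1_def conv_term_def)
qed

lemma F_mult_outside: "r \<notin> carrier G \<Longrightarrow> (a \<otimes>\<^bsub>F\<^esub> b) r x = 0"
proof -
  assume "r \<notin> carrier G"
  then have "{(s, t). s \<in> carrier G \<and> t \<in> carrier G \<and> s \<otimes> t = r} = {}"
    by auto
  then show ?thesis
    by (simp only: twisted_l1_def monoid.simps) simp
qed

lemma F_convolution_summable:
  assumes a: "a \<in> carrier F" and b: "b \<in> carrier F"
  shows "(\<lambda>(r, s). sup_norm (a s) * sup_norm (b (inv s \<otimes> r))) summable_on carrier G \<times> carrier G"
    and "r \<in> carrier G \<Longrightarrow> (\<lambda>s. sup_norm (a s) * sup_norm (b (inv s \<otimes> r))) summable_on carrier G"
    and "(\<lambda>r. \<Sum>\<^sub>\<infinity>s\<in>carrier G. sup_norm (a s) * sup_norm (b (inv s \<otimes> r))) summable_on carrier G"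
    and "(\<Sum>\<^sub>\<infinity>r\<in>carrier G. \<Sum>\<^sub>\<infinity>s\<in>carrier G. sup_norm (a s) * sup_norm (b (inv s \<otimes> r))) =
      nrm F a * nrm F b"
  unfolding F_simps
  by (rule convolution_summable[OF F_summable[OF a] F_summable[OF b]
      F_sup_norm_nonneg[OF a] F_sup_norm_nonneg[OF b]]; assumption)+

lemma F_mult_abs_summable:
  assumes "a \<in> carrier F" "b \<in> carrier F" "r \<in> carrier G"
  shows "(\<lambda>s. cmod (conv_term a b r s x)) summable_on carrier G"
  by (rule C0_infsum(3)[OF conv_term_C0[OF assms] F_convolution_summable(2)[OF assms] conv_term_le[OF assms]])

lemma F_mult_at:
  assumes a: "a \<in> carrier F" and b: "b \<in> carrier F" and r: "r \<in> carrier G"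
  shows "(a \<otimes>\<^bsub>F\<^esub> b) r \<in> C0 X"
    and "sup_norm ((a \<otimes>\<^bsub>F\<^esub> b) r) \<le> (\<Sum>\<^sub>\<infinity>s\<in>carrier G. sup_norm (a s) * sup_norm (b (inv s \<otimes> r)))"
proof -
  have eq: "(a \<otimes>\<^bsub>F\<^esub> b) r = (\<lambda>x. \<Sum>\<^sub>\<infinity>s\<in>carrier G. conv_term a b r s x)"
    using F_mult[OF r] by (simp add: fun_eq_iff)
  show "(a \<otimes>\<^bsub>F\<^esub> b) r \<in> C0 X"
    "sup_norm ((a \<otimes>\<^bsub>F\<^esub> b) r) \<le> (\<Sum>\<^sub>\<infinity>s\<in>carrier G. sup_norm (a s) * sup_norm (b (inv s \<otimes> r)))"
    unfolding eq
    using C0_infsum(1,2)[of "carrier G" "conv_term a b r", OF conv_term_C0[OF a b r]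
      F_convolution_summable(2)[OF a b r] conv_term_le[OF a b r]] by auto
qed

lemma F_mult_closed: "a \<in> carrier F \<Longrightarrow> b \<in> carrier F \<Longrightarrow> a \<otimes>\<^bsub>F\<^esub> b \<in> carrier F"
  by (rule F_carrierI[OF _ _ F_convolution_summable(3)[of a b]]) (simp_all add: F_mult_at F_mult_outside)

lemma F_nrm_mult: "a \<in> carrier F \<Longrightarrow> b \<in> carrier F \<Longrightarrow> nrm F (a \<otimes>\<^bsub>F\<^esub> b) \<le> nrm F a * nrm F b"
  using nrm_F_le[OF F_mult_closed F_convolution_summable(3)[of a b], of a b]
  by (simp only: F_mult_at F_convolution_summable(4))

lemma F_add_closed:
  assumes a: "a \<in> carrier F" and b: "b \<in> carrier F"
  shows "a \<oplus>\<^bsub>F\<^esub> b \<in> carrier F"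
  unfolding F_simps
proof (rule F_carrierI)
  show "(\<lambda>g. sup_norm (a g) + sup_norm (b g)) summable_on carrier G"
    using F_summable[OF a] F_summable[OF b] by (rule summable_on_add)
  show "(\<lambda>x. a g x + b g x) \<in> C0 X"
    "sup_norm (\<lambda>x. a g x + b g x) \<le> sup_norm (a g) + sup_norm (b g)" for g
    using C0_add sup_norm_add F_C0[OF a] F_C0[OF b] by blast+
qed (simp add: F_outside[OF a] F_outside[OF b])

lemma F_smult_closed:
  assumes a: "a \<in> carrier F"
  shows "c \<odot>\<^bsub>F\<^esub> a \<in> carrier F"
  unfolding F_simps
proof (rule F_carrierI)
  show "(\<lambda>g. cmod c * sup_norm (a g)) summable_on carrier G"
    using F_summable[OF a] by (rule summable_on_cmult_right)
  show "(\<lambda>x. c * a g x) \<in> C0 X" for g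
    by (rule C0_cmult[OF F_C0[OF a]])
  show "sup_norm (\<lambda>x. c * a g x) \<le> cmod c * sup_norm (a g)" for g
    using sup_norm_cmult[OF F_C0[OF a], of c g] by simp
qed (simp add: F_outside[OF a])

text \<open>Both bracketings are iterated sums of one absolutely summable family
  \<open>H s p\<close>, with \<open>p\<close> the product of the first two group elements. After
  exchanging the sums, \<open>p = s \<otimes> t\<close> and the cocycle identity turn the inner sum
  into a term of the product of \<open>a\<close> with \<open>b \<otimes> c\<close>.\<close>

lemma F_mult_assoc:
  assumes a: "a \<in> carrier F" and b: "b \<in> carrier F" and c: "c \<in> carrier F"
  shows "(a \<otimes>\<^bsub>F\<^esub> b) \<otimes>\<^bsub>F\<^esub> c = a \<otimes>\<^bsub>F\<^esub> (b \<otimes>\<^bsub>F\<^esub> c)"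
proof (intro ext)
  fix r x
  show "((a \<otimes>\<^bsub>F\<^esub> b) \<otimes>\<^bsub>F\<^esub> c) r x = (a \<otimes>\<^bsub>F\<^esub> (b \<otimes>\<^bsub>F\<^esub> c)) r x"
  proof (cases "r \<in> carrier G \<and> x \<in> topspace X")
    case False
    then show ?thesis
      using F_outside_space[OF F_mult_closed[OF F_mult_closed[OF a b] c], of x r]
        F_outside_space[OF F_mult_closed[OF a F_mult_closed[OF b c]], of x r] by (auto simp: F_mult_outside)
  next
    case True
    then have r: "r \<in> carrier G" and x: "x \<in> topspace X" by auto
    define H where "H s p = a s x * b (inv s \<otimes> p) (\<phi> (inv s) x) * u s (inv s \<otimes> p) x *
        c (inv p \<otimes> r) (\<phi> (inv p) x) * u p (inv p \<otimes> r) x" for s p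
    define C where "C = nrm F c"
    have summ: "(\<lambda>z. cmod (case z of (p, s) \<Rightarrow> H s p)) summable_on carrier G \<times> carrier G"
    proof (rule summable_on_comparison_test)
      \<comment> \<open>Each coefficient of \<open>c\<close> is bounded by the norm of
        \<open>c\<close>; what remains is the convolution of the coefficient norms of
        \<open>a\<close> and \<open>b\<close>.\<close>
      show "(\<lambda>(p, s). sup_norm (a s) * sup_norm (b (inv s \<otimes> p)) * C) summable_on carrier G \<times> carrier G"
        using summable_on_cmult_left[OF F_convolution_summable(1)[OF a b], of C]
        by (simp add: case_prod_unfold)
      fix z assume "z \<in> carrier G \<times> carrier G"
      then obtain p s where z: "z = (p, s)" "p \<in> carrier G" "s \<in> carrier G" by auto
      have "cmod (H s p) = cmod (a s x) * cmod (b (inv s \<otimes> p) (\<phi> (inv s) x)) * cmod (c (inv p \<otimes> r) (\<phi> (inv p) x))"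
        using z r x by (simp add: H_def norm_mult cocycle_norm)
      also have "\<dots> \<le> sup_norm (a s) * sup_norm (b (inv s \<otimes> p)) * C"
        unfolding C_def
        by (intro mult_mono norm_le_sup_norm[OF F_C0[OF a]] norm_le_sup_norm[OF F_C0[OF b]]
            order_trans[OF norm_le_sup_norm[OF F_C0[OF c]] sup_norm_le_nrm[OF c]] mult_nonneg_nonneg
            sup_norm_nonneg[OF F_C0[OF a]] sup_norm_nonneg[OF F_C0[OF b]]) auto
      finally show "cmod (case z of (p, s) \<Rightarrow> H s p) \<le> (\<lambda>(p, s). sup_norm (a s) * sup_norm (b (inv s \<otimes> p)) * C) z"
        by (simp add: z)
    qed auto
    have "((a \<otimes>\<^bsub>F\<^esub> b) \<otimes>\<^bsub>F\<^esub> c) r x = (\<Sum>\<^sub>\<infinity>p\<in>carrier G. \<Sum>\<^sub>\<infinity>s\<in>carrier G. H s p)"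
      unfolding F_mult[OF r]
    proof (rule infsum_cong)
      fix p assume p: "p \<in> carrier G"
      have "conv_term (a \<otimes>\<^bsub>F\<^esub> b) c r p x =
          (\<Sum>\<^sub>\<infinity>s\<in>carrier G. conv_term a b p s x) * (c (inv p \<otimes> r) (\<phi> (inv p) x) * u p (inv p \<otimes> r) x)"
        unfolding conv_term_def[of "a \<otimes>\<^bsub>F\<^esub> b"] using x by (simp add: F_mult[OF p] dual_apply)
      also have "\<dots> = (\<Sum>\<^sub>\<infinity>s\<in>carrier G. conv_term a b p s x * (c (inv p \<otimes> r) (\<phi> (inv p) x) * u p (inv p \<otimes> r) x))"
        by (rule infsum_cmult_left'[symmetric])
      also have "\<dots> = (\<Sum>\<^sub>\<infinity>s\<in>carrier G. H s p)"
        using x by (intro infsum_cong) (simp add: conv_term_def H_def dual_apply)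
      finally show "conv_term (a \<otimes>\<^bsub>F\<^esub> b) c r p x = (\<Sum>\<^sub>\<infinity>s\<in>carrier G. H s p)" .
    qed
    also have "\<dots> = (\<Sum>\<^sub>\<infinity>s\<in>carrier G. \<Sum>\<^sub>\<infinity>p\<in>carrier G. H s p)"
      by (rule infsum_swap_banach) (rule abs_summable_summable[OF summ])
    also have "\<dots> = (a \<otimes>\<^bsub>F\<^esub> (b \<otimes>\<^bsub>F\<^esub> c)) r x"
      unfolding F_mult[OF r]
    proof (rule infsum_cong)
      fix s assume s: "s \<in> carrier G"
      have sx: "\<phi> (inv s) x \<in> topspace X"
        using s x action_closed by simp
      have sr: "inv s \<otimes> r \<in> carrier G"
        using s r by simp
      have "(\<Sum>\<^sub>\<infinity>p\<in>carrier G. H s p) = (\<Sum>\<^sub>\<infinity>t\<in>carrier G. H s (s \<otimes> t))"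
        by (rule infsum_reindex_bij_betw[OF bij_betw_mult_left[OF s], symmetric])
      also have "\<dots> = (\<Sum>\<^sub>\<infinity>t\<in>carrier G. a s x * u s (inv s \<otimes> r) x * conv_term b c (inv s \<otimes> r) t (\<phi> (inv s) x))"
      proof (rule infsum_cong)
        fix t assume t: "t \<in> carrier G"
        define w where "w = inv t \<otimes> (inv s \<otimes> r)"
        have w1: "w \<in> carrier G" "inv (s \<otimes> t) \<otimes> r = w"
          using s t r by (simp_all add: w_def inv_mult_group m_assoc)
        have w2: "t \<otimes> w = inv s \<otimes> r" "inv s \<otimes> (s \<otimes> t) = t"
          using s t r by (simp_all add: w_def m_assoc[symmetric])
        note w = w1 w2
        have "\<phi> (inv (s \<otimes> t)) x = \<phi> (inv t) (\<phi> (inv s) x)"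
          using s t x by (simp add: inv_mult_group composition_rule)
        then show "H s (s \<otimes> t) = a s x * u s (inv s \<otimes> r) x * conv_term b c (inv s \<otimes> r) t (\<phi> (inv s) x)"
          using cocycle_eq[OF s t w(1) x] sx
          by (simp add: H_def conv_term_def w dual_apply flip: w_def) (simp add: algebra_simps)
      qed
      also have "\<dots> = a s x * u s (inv s \<otimes> r) x * (\<Sum>\<^sub>\<infinity>t\<in>carrier G. conv_term b c (inv s \<otimes> r) t (\<phi> (inv s) x))"
        by (rule infsum_cmult_right')
      also have "\<dots> = conv_term a (b \<otimes>\<^bsub>F\<^esub> c) r s x"
        unfolding conv_term_def[of a] using x by (simp add: F_mult[OF sr] dual_apply)
      finally show "(\<Sum>\<^sub>\<infinity>p\<in>carrier G. H s p) = conv_term a (b \<otimes>\<^bsub>F\<^esub> c) r s x" .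
    qed
    finally show ?thesis .
  qed
qed

lemma F_mult_add_left:
  assumes a: "a \<in> carrier F" and b: "b \<in> carrier F" and c: "c \<in> carrier F"
  shows "(a \<oplus>\<^bsub>F\<^esub> b) \<otimes>\<^bsub>F\<^esub> c = (a \<otimes>\<^bsub>F\<^esub> c) \<oplus>\<^bsub>F\<^esub> (b \<otimes>\<^bsub>F\<^esub> c)"
proof (intro ext)
  fix r x
  show "((a \<oplus>\<^bsub>F\<^esub> b) \<otimes>\<^bsub>F\<^esub> c) r x = ((a \<otimes>\<^bsub>F\<^esub> c) \<oplus>\<^bsub>F\<^esub> (b \<otimes>\<^bsub>F\<^esub> c)) r x"
  proof (cases "r \<in> carrier G")
    case True
    have "conv_term (a \<oplus>\<^bsub>F\<^esub> b) c r s x = conv_term a c r s x + conv_term b c r s x" for s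
      by (simp add: conv_term_def distrib_right)
    then show ?thesis
      using abs_summable_summable[OF F_mult_abs_summable[OF a c True, of x]]
        abs_summable_summable[OF F_mult_abs_summable[OF b c True, of x]]
      unfolding F_simps(2)[of "a \<otimes>\<^bsub>F\<^esub> c"] F_mult[OF True]
      by (simp only: infsum_add)
  qed (simp add: F_mult_outside)
qed

lemma F_mult_add_right:
  assumes a: "a \<in> carrier F" and b: "b \<in> carrier F" and c: "c \<in> carrier F"
  shows "c \<otimes>\<^bsub>F\<^esub> (a \<oplus>\<^bsub>F\<^esub> b) = (c \<otimes>\<^bsub>F\<^esub> a) \<oplus>\<^bsub>F\<^esub> (c \<otimes>\<^bsub>F\<^esub> b)"
proof (intro ext)
  fix r x
  show "(c \<otimes>\<^bsub>F\<^esub> (a \<oplus>\<^bsub>F\<^esub> b)) r x = ((c \<otimes>\<^bsub>F\<^esub> a) \<oplus>\<^bsub>F\<^esub> (c \<otimes>\<^bsub>F\<^esub> b)) r x"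
  proof (cases "r \<in> carrier G")
    case True
    have "conv_term c (a \<oplus>\<^bsub>F\<^esub> b) r s x = conv_term c a r s x + conv_term c b r s x" for s
      by (cases "x \<in> topspace X")
        (simp_all add: conv_term_def dual_apply distrib_right distrib_left C0_outside[OF F_C0[OF c]])
    then show ?thesis
      using abs_summable_summable[OF F_mult_abs_summable[OF c a True, of x]]
        abs_summable_summable[OF F_mult_abs_summable[OF c b True, of x]]
      unfolding F_simps(2)[of "c \<otimes>\<^bsub>F\<^esub> a"] F_mult[OF True]
      by (simp only: infsum_add)
  qed (simp add: F_mult_outside)
qed

lemma F_mult_smult_left: "(k \<odot>\<^bsub>F\<^esub> a) \<otimes>\<^bsub>F\<^esub> b = k \<odot>\<^bsub>F\<^esub> (a \<otimes>\<^bsub>F\<^esub> b)"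
proof (intro ext)
  fix r x
  have *: "conv_term (k \<odot>\<^bsub>F\<^esub> a) b r s x = k * conv_term a b r s x" for s
    by (simp add: conv_term_def)
  show "((k \<odot>\<^bsub>F\<^esub> a) \<otimes>\<^bsub>F\<^esub> b) r x = (k \<odot>\<^bsub>F\<^esub> (a \<otimes>\<^bsub>F\<^esub> b)) r x"
  proof (cases "r \<in> carrier G")
    case True
    show ?thesis
      unfolding F_simps(3)[of k "a \<otimes>\<^bsub>F\<^esub> b"] F_mult[OF True] * by (rule infsum_cmult_right')
  qed (simp add: F_mult_outside)
qed

lemma F_mult_smult_right: "a \<otimes>\<^bsub>F\<^esub> (k \<odot>\<^bsub>F\<^esub> b) = k \<odot>\<^bsub>F\<^esub> (a \<otimes>\<^bsub>F\<^esub> b)"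
proof (intro ext)
  fix r x
  have *: "conv_term a (k \<odot>\<^bsub>F\<^esub> b) r s x = k * conv_term a b r s x" for s
    by (simp add: conv_term_def dual_action_def restr_def mult.left_commute)
  show "(a \<otimes>\<^bsub>F\<^esub> (k \<odot>\<^bsub>F\<^esub> b)) r x = (k \<odot>\<^bsub>F\<^esub> (a \<otimes>\<^bsub>F\<^esub> b)) r x"
  proof (cases "r \<in> carrier G")
    case True
    show ?thesis
      unfolding F_simps(3)[of k "a \<otimes>\<^bsub>F\<^esub> b"] F_mult[OF True] * by (rule infsum_cmult_right')
  qed (simp add: F_mult_outside)
qed

end

section \<open>Completeness of the convolution algebra\<close>

context twisted_action
begin

lemma F_zero_closed: "(\<lambda>g x. 0) \<in> carrier F"
  by (simp add: carrier_F)

lemma F_nrm_zero_iff: "b \<in> carrier F \<Longrightarrow> nrm F b = 0 \<longleftrightarrow> b = \<zero>\<^bsub>F\<^esub>"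
proof
  assume b: "b \<in> carrier F" and "nrm F b = 0"
  then have "sup_norm (b g) = 0" for g
    using sup_norm_le_nrm[OF b, of g] sup_norm_nonneg[OF F_C0[OF b], of g] by simp
  then show "b = \<zero>\<^bsub>F\<^esub>"
    using sup_norm_eq_0_iff[OF F_C0[OF b]] by (simp add: fun_eq_iff)
qed simp

lemma F_cnormed_space: "cnormed_space F"
proof -
  have ab: "abelian_group F"
  proof (rule abelian_groupI)
    show "\<exists>y\<in>carrier F. y \<oplus>\<^bsub>F\<^esub> x = \<zero>\<^bsub>F\<^esub>" if "x \<in> carrier F" for x
      using F_smult_closed[OF that, of "-1"] by (intro bexI[of _ "\<lambda>g y. - x g y"]) auto
  qed (use F_add_closed F_zero_closed in \<open>auto simp: algebra_simps\<close>)
  have "module (ring_of_type_algebra :: complex ring) F"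
    by (rule moduleI[OF cring_complex_ring ab]) (use F_smult_closed in \<open>auto simp: algebra_simps\<close>)
  then interpret module "ring_of_type_algebra :: complex ring" F .
  show ?thesis
  proof
    fix x y assume "x \<in> carrier F" "y \<in> carrier F"
    then show "nrm F (x \<oplus>\<^bsub>F\<^esub> y) \<le> nrm F x + nrm F y"
      using nrm_F_le[OF F_add_closed[of x y] summable_on_add[OF F_summable[of x] F_summable[of y]]]
      by (simp add: infsum_add F_summable sup_norm_add[OF F_C0[of x] F_C0[of y]])
  next
    fix x c assume x: "x \<in> carrier F"
    show "nrm F (c \<odot>\<^bsub>F\<^esub> x) = cmod c * nrm F x"
      unfolding F_simps sup_norm_cmult[OF F_C0[OF x]] by (rule infsum_cmult_right')
  next
    fix x assume "x \<in> carrier F"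
    then show "0 \<le> nrm F x" "nrm F x = 0 \<longleftrightarrow> x = \<zero>\<^bsub>F\<^esub>"
      using F_nrm_zero_iff by (auto intro!: infsum_nonneg sup_norm_nonneg F_C0)
  qed
qed

lemma F_diff: "b \<in> carrier F \<Longrightarrow> c \<in> carrier F \<Longrightarrow> b \<ominus>\<^bsub>F\<^esub> c = (\<lambda>g x. b g x - c g x)"
proof -
  interpret F: cnormed_space F by (rule F_cnormed_space)
  assume "b \<in> carrier F" "c \<in> carrier F"
  then show ?thesis
    by (simp add: F.M.minus_eq F.minus_eq_smult)
qed

lemma F_cbanach_algebra: "cbanach_algebra F"
proof -
  interpret F: cnormed_space F by (rule F_cnormed_space)
  have "cbanach_space F"
  proof (rule F.cbanach_spaceI)
    fix q assume q: "F.Cauchy_seq q"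
    have qF: "q n \<in> carrier F" for n
      using q by (auto simp: F.Cauchy_seq_def)
    define D where "D m n g = sup_norm (\<lambda>x. q m g x - q n g x)" for m n g
    have dF: "(\<lambda>g x. q m g x - q n g x) \<in> carrier F" for m n
      using F.M.minus_closed[OF qF[of m] qF[of n]] by (simp add: F_diff qF)
    have nD: "nrm F (q m \<ominus>\<^bsub>F\<^esub> q n) = infsum (D m n) (carrier G)" for m n
      by (simp add: F_diff qF D_def[abs_def])
    have Cau: "\<exists>N. \<forall>m\<ge>N. \<forall>n\<ge>N. infsum (D m n) (carrier G) < e" if e: "e > 0" for e
      using q e unfolding F.Cauchy_seq_def nD by blast
    have D_ge: "cmod (q m g x - q n g x) \<le> infsum (D m n) (carrier G)" for m n g x
      using norm_le_sup_norm[OF F_C0[OF dF[of m n], of g], of x] sup_norm_le_nrm[OF dF[of m n], of g]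
      by (simp add: D_def[abs_def])
    have "\<exists>l. (\<lambda>n. q n g x) \<longlonglongrightarrow> l" for g x
    proof -
      have "Cauchy (\<lambda>n. q n g x)"
      proof (rule metric_CauchyI)
        fix e :: real assume "e > 0"
        then obtain N where "\<forall>m\<ge>N. \<forall>n\<ge>N. infsum (D m n) (carrier G) < e"
          using Cau by blast
        then show "\<exists>N. \<forall>m\<ge>N. \<forall>n\<ge>N. dist (q m g x) (q n g x) < e"
          by (intro exI[of _ N]) (auto simp: dist_norm intro!: order_le_less_trans[OF D_ge])
      qed
      then show ?thesis
        using Cauchy_convergent convergent_def by blast
    qed
    then obtain l where l: "\<And>g x. (\<lambda>n. q n g x) \<longlonglongrightarrow> l g x"
      by metis
    define L where "L n g = sup_norm (\<lambda>x. q n g x - l g x)" for n g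
    have uniform: "\<exists>N. \<forall>n\<ge>N. \<forall>g x. cmod (q n g x - l g x) \<le> e" if e: "e > 0" for e
    proof -
      obtain N where N: "\<And>m n. m \<ge> N \<Longrightarrow> n \<ge> N \<Longrightarrow> infsum (D m n) (carrier G) < e"
        using Cau[OF e] by blast
      have "cmod (q n g x - l g x) \<le> e" if "n \<ge> N" for n g x
      proof (rule LIMSEQ_le_const2)
        show "(\<lambda>m. cmod (q n g x - q m g x)) \<longlonglongrightarrow> cmod (q n g x - l g x)"
          by (intro tendsto_intros l)
        show "\<exists>N. \<forall>m\<ge>N. cmod (q n g x - q m g x) \<le> e"
          using N[OF that] D_ge[of n g x] by (meson less_imp_le order_trans)
      qed
      then show ?thesis by blast
    qed
    have lC0: "l g \<in> C0 X" for g
    proof (rule C0_uniform_limit)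
      fix e :: real assume e: "e > 0"
      then obtain N where "\<And>n x. n \<ge> N \<Longrightarrow> cmod (q n g x - l g x) \<le> e/2"
        using uniform[of "e/2"] by auto
      then have "cmod (l g x - q N g x) < e" for x
        using order_le_less_trans[of "cmod (q N g x - l g x)" "e/2" e] e by (simp add: norm_minus_commute)
      then show "\<exists>a\<in>C0 X. \<forall>x. cmod (l g x - a x) < e"
        using F_C0[OF qF] by blast
    qed
    have LC0: "(\<lambda>x. q n g x - l g x) \<in> C0 X" for n g
      by (intro C0_diff F_C0 qF lC0)
    have Lnonneg: "0 \<le> L n g" for n g
      unfolding L_def by (rule sup_norm_nonneg[OF LC0])
    have Llim: "(\<lambda>n. L n g) \<longlonglongrightarrow> 0" for g
    proof (rule LIMSEQ_I)
      fix e :: real assume e: "e > 0"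
      then obtain N where "\<And>n x. n \<ge> N \<Longrightarrow> cmod (q n g x - l g x) \<le> e/2"
        using uniform[of "e/2"] by auto
      then have "L n g \<le> e/2" if "n \<ge> N" for n
        unfolding L_def using that by (intro sup_norm_le) auto
      then show "\<exists>N. \<forall>n\<ge>N. norm (L n g - 0) < e"
        using Lnonneg e by (intro exI[of _ N]) fastforce
    qed
    \<comment> \<open>A Fatou argument: \<open>L n\<close> is at most \<open>D n m + L m\<close>,
      and on a fixed finite set \<open>L m\<close> tends to 0. So the Cauchy bound survives with a
      constant independent of the finite set and passes to the infinite sum.\<close>
    have Lsum: "\<exists>N. \<forall>n\<ge>N. \<forall>S. finite S \<and> S \<subseteq> carrier G \<longrightarrow> sum (L n) S \<le> e" if e: "e > 0" for e
    proof -
      obtain N where N: "\<And>m n. m \<ge> N \<Longrightarrow> n \<ge> N \<Longrightarrow> infsum (D m n) (carrier G) < e"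
        using Cau[OF e] by blast
      have "sum (L n) S \<le> e" if n: "n \<ge> N" and S: "finite S" "S \<subseteq> carrier G" for n S
      proof (rule LIMSEQ_le_const)
        have "(\<lambda>m. e + sum (L m) S) \<longlonglongrightarrow> e + (\<Sum>g\<in>S. 0)"
          by (intro tendsto_intros tendsto_sum Llim)
        then show "(\<lambda>m. e + sum (L m) S) \<longlonglongrightarrow> e"
          by simp
        have "sum (L n) S \<le> e + sum (L m) S" if m: "m \<ge> N" for m
        proof -
          have "L n g \<le> D n m g + L m g" for g
            using sup_norm_add[OF F_C0[OF dF[of n m], of g] LC0[of m g]] by (simp add: L_def D_def)
          then have "sum (L n) S \<le> sum (D n m) S + sum (L m) S"
            by (simp add: sum.distrib[symmetric] sum_mono)
          moreover have "sum (D n m) S \<le> infsum (D n m) (carrier G)"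
            using F_summable[OF dF[of n m]] S sup_norm_nonneg[OF F_C0[OF dF[of n m]]]
            by (intro finite_sum_le_infsum) (auto simp: D_def[abs_def])
          ultimately show ?thesis
            using N[OF n m] by simp
        qed
        then show "\<exists>N. \<forall>m\<ge>N. sum (L n) S \<le> e + sum (L m) S"
          by blast
      qed
      then show ?thesis by blast
    qed
    have Lsummable: "\<exists>N. \<forall>n\<ge>N. L n summable_on carrier G \<and> infsum (L n) (carrier G) \<le> e" if e: "e > 0" for e
    proof -
      obtain N where N: "\<And>n S. n \<ge> N \<Longrightarrow> finite S \<and> S \<subseteq> carrier G \<Longrightarrow> sum (L n) S \<le> e"
        using Lsum[OF e] by blast
      have "L n summable_on carrier G \<and> infsum (L n) (carrier G) \<le> e" if n: "n \<ge> N" for n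
      proof
        show "L n summable_on carrier G"
          using N[OF n] Lnonneg by (intro nonneg_bdd_above_summable_on) (auto simp: bdd_above_def)
        then show "infsum (L n) (carrier G) \<le> e"
          using N[OF n] by (intro infsum_le_finite_sums) auto
      qed
      then show ?thesis by blast
    qed
    have l0: "l g x = 0" if "g \<notin> carrier G" for g x
      using l[of g x] F_outside[OF qF that] by (simp add: LIMSEQ_const_iff)
    obtain N where N: "L N summable_on carrier G"
      using Lsummable[of 1] by auto
    have lF: "l \<in> carrier F"
    proof (rule F_carrierI)
      show "(\<lambda>g. sup_norm (q N g) + L N g) summable_on carrier G"
        by (intro summable_on_add F_summable qF N)
      show "sup_norm (l g) \<le> sup_norm (q N g) + L N g" for g
        using sup_norm_diff[OF F_C0[OF qF[of N], of g] LC0[of N g]] by (simp add: L_def)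
    qed (use lC0 l0 in auto)
    have "nrm F (q n \<ominus>\<^bsub>F\<^esub> l) = infsum (L n) (carrier G)" for n
      by (simp add: F_diff qF lF L_def[abs_def])
    moreover have "\<exists>N. \<forall>n\<ge>N. infsum (L n) (carrier G) < e" if e: "e > 0" for e
    proof -
      obtain N where "\<forall>n\<ge>N. infsum (L n) (carrier G) \<le> e/2"
        using Lsummable[of "e/2"] e by auto
      then show ?thesis
        using e by (intro exI[of _ N]) fastforce
    qed
    ultimately have "F.limit_seq q l"
      unfolding F.limit_seq_def using lF by simp
    then show "\<exists>l. F.limit_seq q l" by blast
  qed
  then show ?thesis
    by (intro cbanach_algebra.intro cbanach_algebra_axioms.intro F_mult_closed F_mult_assoc
        F_mult_add_left F_mult_add_right F_mult_smult_left F_mult_smult_right F_nrm_mult)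
qed

end

section \<open>Point masses, truncations, approximate units and supports\<close>

context twisted_action
begin

sublocale F: cbanach_algebra F
  by (rule F_cbanach_algebra)

text \<open>The element usually written f \<delta>_g; for \<open>g = \<one>\<close> these elements
  form the copy of C0(X).\<close>

definition single :: "'g \<Rightarrow> ('x \<Rightarrow> complex) \<Rightarrow> 'g \<Rightarrow> 'x \<Rightarrow> complex" where
  "single g f = (\<lambda>h. if h = g then f else (\<lambda>x. 0))"

lemma at_unit_eq_single: "at_unit G f = single \<one> f"
  by (simp add: at_unit_def single_def)

lemma infsum_single:
  fixes f :: "'g \<Rightarrow> 'b :: {topological_comm_monoid_add, t2_space}"
  assumes "g \<in> carrier G" "\<And>h. h \<in> carrier G \<Longrightarrow> h \<noteq> g \<Longrightarrow> f h = 0"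
  shows "infsum f (carrier G) = f g"
proof -
  have "infsum f (carrier G) = infsum f {g}"
    using assms by (intro infsum_cong_neutral) auto
  then show ?thesis by simp
qed

lemma single_closed:
  assumes g: "g \<in> carrier G" and f: "f \<in> C0 X"
  shows "single g f \<in> carrier F"
proof -
  have "(\<lambda>h. sup_norm (single g f h)) summable_on {g}"
    by simp
  then have "(\<lambda>h. sup_norm (single g f h)) summable_on carrier G"
    using g by (subst summable_on_cong_neutral[of "{g}" _ _ "\<lambda>h. sup_norm (single g f h)"])
      (auto simp: single_def)
  with assms show ?thesis
    by (auto simp: carrier_F single_def)
qed

lemma nrm_single: "g \<in> carrier G \<Longrightarrow> nrm F (single g f) = sup_norm f"
  by (subst F_simps, subst infsum_single[of g]) (auto simp: single_def)

lemma single_add: "single g f \<oplus>\<^bsub>F\<^esub> single g f' = single g (\<lambda>x. f x + f' x)"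
  by (auto simp: single_def fun_eq_iff)

lemma single_smult: "c \<odot>\<^bsub>F\<^esub> single g f = single g (\<lambda>x. c * f x)"
  by (auto simp: single_def fun_eq_iff)

lemma mult_single_right:
  assumes c: "c \<in> carrier F" and h: "h \<in> carrier G" and r: "r \<in> carrier G" and x: "x \<in> topspace X"
  shows "(c \<otimes>\<^bsub>F\<^esub> single h b) r x = c (r \<otimes> inv h) x * b (\<phi> (inv (r \<otimes> inv h)) x) * u (r \<otimes> inv h) h x"
proof -
  have 1: "inv (r \<otimes> inv h) \<otimes> r = h"
    using r h by (simp add: inv_mult_group m_assoc)
  have 2: "inv s \<otimes> r \<noteq> h" if "s \<in> carrier G" "s \<noteq> r \<otimes> inv h" for s
    using that r h by (metis inv_solve_left inv_solve_right m_closed inv_closed)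
  have "(c \<otimes>\<^bsub>F\<^esub> single h b) r x = conv_term c (single h b) r (r \<otimes> inv h) x"
    unfolding F_mult[OF r] using r h x 2
    by (intro infsum_single) (auto simp: conv_term_def single_def dual_apply)
  then show ?thesis
    using x by (simp add: conv_term_def 1 dual_apply) (simp add: single_def)
qed

lemma mult_single_left:
  assumes c: "c \<in> carrier F" and h: "h \<in> carrier G" and r: "r \<in> carrier G" and x: "x \<in> topspace X"
  shows "(single h b \<otimes>\<^bsub>F\<^esub> c) r x = b x * c (inv h \<otimes> r) (\<phi> (inv h) x) * u h (inv h \<otimes> r) x"
proof -
  have "(single h b \<otimes>\<^bsub>F\<^esub> c) r x = conv_term (single h b) c r h x"
    unfolding F_mult[OF r] using h
    by (intro infsum_single) (auto simp: conv_term_def single_def)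
  then show ?thesis
    using x by (simp add: conv_term_def dual_apply) (simp add: single_def)
qed

lemma mult_single_one_left:
  assumes c: "c \<in> carrier F" and a: "a \<in> C0 X"
  shows "single \<one> a \<otimes>\<^bsub>F\<^esub> c = (\<lambda>r x. a x * c r x)"
proof (intro ext)
  fix r x
  have "single \<one> a \<otimes>\<^bsub>F\<^esub> c \<in> carrier F"
    using assms by (intro F_mult_closed single_closed) auto
  then show "(single \<one> a \<otimes>\<^bsub>F\<^esub> c) r x = a x * c r x"
    using mult_single_left[OF c one_closed, of r x a] F_outside[OF c, of r x] F_outside_space[OF c, of x r]
      F_outside_space[of "single \<one> a \<otimes>\<^bsub>F\<^esub> c" x r] F_mult_outside[of r "single \<one> a" c x]
    by (cases "r \<in> carrier G"; cases "x \<in> topspace X") (auto simp: action_one cocycle_one_left)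
qed

lemma mult_single_one_right:
  assumes c: "c \<in> carrier F" and r: "r \<in> carrier G" and x: "x \<in> topspace X"
  shows "(c \<otimes>\<^bsub>F\<^esub> single \<one> a) r x = c r x * a (\<phi> (inv r) x)"
  using mult_single_right[OF c one_closed r x, of a] r x by (simp add: cocycle_one_right)

lemma single_mult_single:
  assumes g: "g \<in> carrier G" and h: "h \<in> carrier G" and a: "a \<in> C0 X" and b: "b \<in> C0 X"
  shows "single g a \<otimes>\<^bsub>F\<^esub> single h b = single (g \<otimes> h) (\<lambda>x. a x * dual g b x * u g h x)"
proof (intro ext)
  fix r x
  have in_F: "single g a \<in> carrier F" "single h b \<in> carrier F"
    using assms by (auto intro: single_closed)
  note out = F_outside_space[OF F_mult_closed[OF in_F], of x r] F_mult_outside[of r "single g a" "single h b" x]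
  consider "r \<notin> carrier G" | "x \<notin> topspace X" | "r \<in> carrier G" "x \<in> topspace X"
    by blast
  then show "(single g a \<otimes>\<^bsub>F\<^esub> single h b) r x = single (g \<otimes> h) (\<lambda>x. a x * dual g b x * u g h x) r x"
  proof cases
    case 1
    then have "r \<noteq> g \<otimes> h" using g h by auto
    then show ?thesis using out(2)[OF 1] by (simp add: single_def)
  next
    case 2
    then show ?thesis using out(1)[OF 2] C0_outside[OF a 2] by (simp add: single_def)
  next
    case 3
    have "r \<otimes> inv h = g \<longleftrightarrow> r = g \<otimes> h"
      using g h 3 by (metis inv_solve_right)
    then show ?thesis
      using mult_single_right[OF in_F(1) h 3, of b] g h 3
      by (cases "r = g \<otimes> h") (auto simp: single_def dual_apply m_assoc)
  qed
qed

definition cut :: "'g set \<Rightarrow> ('g \<Rightarrow> 'x \<Rightarrow> complex) \<Rightarrow> 'g \<Rightarrow> 'x \<Rightarrow> complex" where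
  "cut S b = (\<lambda>g. if g \<in> S then b g else (\<lambda>x. 0))"

lemma cut_closed:
  assumes b: "b \<in> carrier F"
  shows "cut S b \<in> carrier F"
proof (rule F_carrierI[OF _ _ F_summable[OF b]])
  show "cut S b g \<in> C0 X" for g
    using F_C0[OF b, of g] by (simp add: cut_def)
  show "cut S b g x = 0" if "g \<notin> carrier G" for g x
    using F_outside[OF b that, of x] by (simp add: cut_def)
  show "sup_norm (cut S b g) \<le> sup_norm (b g)" for g
    using F_sup_norm_nonneg[OF b, of g] by (simp add: cut_def)
qed

lemma cut_approx:
  assumes b: "b \<in> carrier F" and e: "e > 0"
  obtains S where "finite S" "S \<subseteq> carrier G" "nrm F (b \<ominus>\<^bsub>F\<^esub> cut S b) < e"
proof -
  let ?N = "\<lambda>g. sup_norm (b g)"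
  obtain S where S: "finite S" "S \<subseteq> carrier G" "dist (sum ?N S) (infsum ?N (carrier G)) \<le> e/2"
    using infsum_finite_approximation[OF F_summable[OF b], of "e/2"] e by auto
  have "infsum ?N (carrier G) = infsum ?N (S \<union> (carrier G - S))"
    using S(2) by (simp add: Un_absorb1)
  also have "\<dots> = sum ?N S + infsum ?N (carrier G - S)"
    using S(1) summable_on_subset_banach[OF F_summable[OF b], of "carrier G - S"]
    by (subst infsum_Un_disjoint) auto
  finally have "infsum ?N (carrier G - S) \<le> e/2"
    using S(3) by (simp add: dist_real_def)
  moreover have "nrm F (b \<ominus>\<^bsub>F\<^esub> cut S b) = infsum ?N (carrier G - S)"
    unfolding F_diff[OF b cut_closed[OF b]] F_simps
    by (rule infsum_cong_neutral) (auto simp: cut_def)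
  ultimately show thesis
    using e by (intro that[OF S(1,2)]) simp
qed

text \<open>The bound \<open>2 \<bar>c\<bar>\<close> is the one satisfied by \<open>d = c - a c\<close> when \<open>\<bar>a\<bar> \<le> 1\<close>.\<close>

lemma compact_approx:
  assumes c: "c \<in> carrier F" and e: "e > 0"
  shows "\<exists>S K. finite S \<and> S \<subseteq> carrier G \<and> (\<forall>g\<in>S. compactin X (K g)) \<and>
    (\<forall>g\<in>S. \<forall>x\<in>K g. c g x \<noteq> 0) \<and>
    (\<forall>d\<in>carrier F. (\<forall>g x. cmod (d g x) \<le> 2 * cmod (c g x)) \<longrightarrow>
       (\<forall>g\<in>S. \<forall>x\<in>K g. d g x = 0) \<longrightarrow> nrm F d < e)"
proof -
  obtain S where S: "finite S" "S \<subseteq> carrier G" "nrm F (c \<ominus>\<^bsub>F\<^esub> cut S c) < e/4"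
    using cut_approx[OF c, of "e/4"] e by auto
  \<comment> \<open>With this \<delta> the part over \<open>S\<close> contributes at most 2 \<delta>
    card S \<le> e/2, and the tail less than 2 (e/4); the added 1 covers an empty
    \<open>S\<close>.\<close>
  define \<delta> where "\<delta> = e / (4 * (real (card S) + 1))"
  have \<delta>: "\<delta> > 0"
    using e by (simp add: \<delta>_def)
  define K where "K g = {x \<in> topspace X. \<delta> \<le> cmod (c g x)}" for g
  show ?thesis
  proof (intro exI conjI ballI impI)
    show "finite S" "S \<subseteq> carrier G" by fact+
    show "compactin X (K g)" for g
      unfolding K_def using C0_compactin[OF F_C0[OF c] \<delta>] .
    show "c g x \<noteq> 0" if "x \<in> K g" for g x
      using that \<delta> by (auto simp: K_def)
    fix d assume d: "d \<in> carrier F" and "\<forall>g x. cmod (d g x) \<le> 2 * cmod (c g x)"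
      and "\<forall>g\<in>S. \<forall>x\<in>K g. d g x = 0"
    then have le: "\<And>g x. cmod (d g x) \<le> 2 * cmod (c g x)"
      and 0: "\<And>g x. g \<in> S \<Longrightarrow> x \<in> K g \<Longrightarrow> d g x = 0" by auto
    define r where "r = c \<ominus>\<^bsub>F\<^esub> cut S c"
    have rF: "r \<in> carrier F"
      using cut_closed[OF c] c by (simp add: r_def)
    have r: "r g x = (if g \<in> S then 0 else c g x)" for g x
      unfolding r_def F_diff[OF c cut_closed[OF c]] by (simp add: cut_def)
    have sumS: "(\<lambda>g. if g \<in> S then 2 * \<delta> else 0) summable_on carrier G"
      "infsum (\<lambda>g. if g \<in> S then 2 * \<delta> else 0) (carrier G) = 2 * \<delta> * card S"
    proof -
      have "(\<lambda>g. if g \<in> S then 2 * \<delta> else 0) summable_on S"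
        using S(1) by simp
      then show "(\<lambda>g. if g \<in> S then 2 * \<delta> else 0) summable_on carrier G"
        using S(2) by (subst summable_on_cong_neutral[of S _ _ "\<lambda>g. if g \<in> S then 2 * \<delta> else 0"]) auto
      have "infsum (\<lambda>g. if g \<in> S then 2 * \<delta> else 0) (carrier G) = infsum (\<lambda>g. 2 * \<delta>) S"
        using S(2) by (intro infsum_cong_neutral) auto
      then show "infsum (\<lambda>g. if g \<in> S then 2 * \<delta> else 0) (carrier G) = 2 * \<delta> * card S"
        using S(1) by simp
    qed
    have "nrm F d \<le> infsum (\<lambda>g. (if g \<in> S then 2 * \<delta> else 0) + 2 * sup_norm (r g)) (carrier G)"
    proof (rule nrm_F_le[OF d])
      show "(\<lambda>g. (if g \<in> S then 2 * \<delta> else 0) + 2 * sup_norm (r g)) summable_on carrier G"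
        by (intro summable_on_add summable_on_cmult_right sumS F_summable rF)
      fix g
      have "cmod (d g x) \<le> (if g \<in> S then 2 * \<delta> else 0) + 2 * sup_norm (r g)" for x
      proof (cases "g \<in> S")
        case True
        have "cmod (d g x) \<le> 2 * \<delta>"
        proof (cases "x \<in> topspace X \<and> x \<notin> K g")
          case True
          then have "cmod (c g x) < \<delta>"
            by (auto simp: K_def)
          then show ?thesis
            using le[of g x] by simp
        next
          case False
          then have "d g x = 0"
            using 0[OF True] F_outside_space[OF d] by blast
          then show ?thesis using \<delta> by simp
        qed
        then show ?thesis
          using True F_sup_norm_nonneg[OF rF, of g] by simp
      next
        case False
        then have "cmod (c g x) \<le> sup_norm (r g)"
          using norm_le_sup_norm[OF F_C0[OF rF], of g x] by (simp add: r)
        then show ?thesis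
          using False le[of g x] by simp
      qed
      then show "sup_norm (d g) \<le> (if g \<in> S then 2 * \<delta> else 0) + 2 * sup_norm (r g)"
        by (rule sup_norm_le)
    qed
    also have "\<dots> = 2 * \<delta> * card S + 2 * nrm F r"
      using sumS F_summable[OF rF]
      by (subst infsum_add) (simp_all add: summable_on_cmult_right infsum_cmult_right')
    also have "\<dots> < e"
    proof -
      have "\<delta> * card S \<le> e / 4"
        using e by (simp add: \<delta>_def field_simps)
      then show ?thesis
        using S(3) unfolding r_def by linarith
    qed
    finally show "nrm F d < e" .
  qed
qed

lemma compact_approx_union:
  assumes "finite S" "\<forall>g\<in>S. compactin X (K g)"
  shows "compactin X (\<Union>g\<in>S. K g)"
  using assms by (intro compactin_Union) auto

text \<open>The function is 1 on the compact sets supplied by \<open>compact_approx\<close> and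
  vanishes off \<open>V\<close>. Having the unit inside C0(V) is what lets C0(V) generate the ideal
  of elements supported in \<open>V\<close>.\<close>

lemma approx_unit_left:
  assumes c: "c \<in> carrier F" and V: "openin X V" and cV: "\<And>g x. x \<notin> V \<Longrightarrow> c g x = 0" and e: "e > 0"
  obtains a where "a \<in> C0 X" "\<And>x. x \<notin> V \<Longrightarrow> a x = 0" "\<And>x. cmod (a x) \<le> 1"
    "nrm F (c \<ominus>\<^bsub>F\<^esub> single \<one> a \<otimes>\<^bsub>F\<^esub> c) < e"
proof -
  obtain S K where S: "finite S" "S \<subseteq> carrier G"
    "\<forall>g\<in>S. compactin X (K g)" "\<forall>g\<in>S. \<forall>x\<in>K g. c g x \<noteq> 0"
    and "\<forall>d\<in>carrier F. (\<forall>g x. cmod (d g x) \<le> 2 * cmod (c g x)) \<longrightarrow>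
       (\<forall>g\<in>S. \<forall>x\<in>K g. d g x = 0) \<longrightarrow> nrm F d < e"
    using compact_approx[OF c e] by (elim exE conjE) (rule that)
  then have small: "\<And>d. d \<in> carrier F \<Longrightarrow> (\<And>g x. cmod (d g x) \<le> 2 * cmod (c g x)) \<Longrightarrow>
       (\<And>g x. g \<in> S \<Longrightarrow> x \<in> K g \<Longrightarrow> d g x = 0) \<Longrightarrow> nrm F d < e"
    by simp
  have "(\<Union>g\<in>S. K g) \<subseteq> V"
    using S(4) cV by blast
  then obtain a where a: "a \<in> C0 X" "\<And>x. cmod (a x) \<le> 1" "\<And>x. x \<in> (\<Union>g\<in>S. K g) \<Longrightarrow> a x = 1"
      "\<And>x. x \<notin> V \<Longrightarrow> a x = 0"
    using C0_bump[OF locally_compact Hausdorff compact_approx_union[OF S(1,3)] V] by blast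
  have prod: "single \<one> a \<otimes>\<^bsub>F\<^esub> c \<in> carrier F"
    using a(1) c by (intro F_mult_closed single_closed) auto
  have eq: "(c \<ominus>\<^bsub>F\<^esub> single \<one> a \<otimes>\<^bsub>F\<^esub> c) g x = (1 - a x) * c g x" for g x
    unfolding F_diff[OF c prod] unfolding mult_single_one_left[OF c a(1)] by (simp add: algebra_simps)
  have "nrm F (c \<ominus>\<^bsub>F\<^esub> single \<one> a \<otimes>\<^bsub>F\<^esub> c) < e"
  proof (rule small)
    show "c \<ominus>\<^bsub>F\<^esub> single \<one> a \<otimes>\<^bsub>F\<^esub> c \<in> carrier F"
      using c prod by simp
    show "cmod ((c \<ominus>\<^bsub>F\<^esub> single \<one> a \<otimes>\<^bsub>F\<^esub> c) g x) \<le> 2 * cmod (c g x)" for g x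
      unfolding eq norm_mult using a(2)[of x] norm_triangle_ineq4[of 1 "a x"]
      by (intro mult_right_mono) auto
    show "(c \<ominus>\<^bsub>F\<^esub> single \<one> a \<otimes>\<^bsub>F\<^esub> c) g x = 0" if "g \<in> S" "x \<in> K g" for g x
      using a(3)[of x] that unfolding eq by auto
  qed
  with a show thesis
    by (intro that)
qed

lemma approx_unit_right:
  assumes c: "c \<in> carrier F" and e: "e > 0"
  obtains a where "a \<in> C0 X" "\<And>x. cmod (a x) \<le> 1" "nrm F (c \<ominus>\<^bsub>F\<^esub> c \<otimes>\<^bsub>F\<^esub> single \<one> a) < e"
proof -
  obtain S K where S: "finite S" "S \<subseteq> carrier G"
    "\<forall>g\<in>S. compactin X (K g)" "\<forall>g\<in>S. \<forall>x\<in>K g. c g x \<noteq> 0"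
    and "\<forall>d\<in>carrier F. (\<forall>g x. cmod (d g x) \<le> 2 * cmod (c g x)) \<longrightarrow>
       (\<forall>g\<in>S. \<forall>x\<in>K g. d g x = 0) \<longrightarrow> nrm F d < e"
    using compact_approx[OF c e] by (elim exE conjE) (rule that)
  then have small: "\<And>d. d \<in> carrier F \<Longrightarrow> (\<And>g x. cmod (d g x) \<le> 2 * cmod (c g x)) \<Longrightarrow>
       (\<And>g x. g \<in> S \<Longrightarrow> x \<in> K g \<Longrightarrow> d g x = 0) \<Longrightarrow> nrm F d < e"
    by simp
  \<comment> \<open>Right multiplication by a function multiplies the coefficient at
    \<open>g\<close> by a translate of it, so the function has to be 1 on the inverse translates of
    the compact sets.\<close>
  have "compactin X (\<phi> (inv g) ` K g)" if "g \<in> S" for g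
    using S(2,3) that by (intro image_compactin[OF _ action_continuous]) auto
  then have cpt: "compactin X (\<Union>g\<in>S. \<phi> (inv g) ` K g)"
    using S(1) by (intro compact_approx_union) auto
  obtain a where a: "a \<in> C0 X" "\<And>x. cmod (a x) \<le> 1" "\<And>x. x \<in> (\<Union>g\<in>S. \<phi> (inv g) ` K g) \<Longrightarrow> a x = 1"
    using C0_bump[OF locally_compact Hausdorff cpt openin_topspace compactin_subset_topspace[OF cpt]] by metis
  have prod: "c \<otimes>\<^bsub>F\<^esub> single \<one> a \<in> carrier F"
    using a(1) c by (intro F_mult_closed single_closed) auto
  have eq: "(c \<ominus>\<^bsub>F\<^esub> c \<otimes>\<^bsub>F\<^esub> single \<one> a) g x =
      (if g \<in> carrier G \<and> x \<in> topspace X then (1 - a (\<phi> (inv g) x)) * c g x else 0)" for g x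
    using F_outside[OF c, of g x] F_outside_space[OF c, of x g] F_outside[OF prod, of g x]
      F_outside_space[OF prod, of x g] mult_single_one_right[OF c, of g x a]
    unfolding F_diff[OF c prod] by (auto simp: algebra_simps)
  have "nrm F (c \<ominus>\<^bsub>F\<^esub> c \<otimes>\<^bsub>F\<^esub> single \<one> a) < e"
  proof (rule small)
    show "c \<ominus>\<^bsub>F\<^esub> c \<otimes>\<^bsub>F\<^esub> single \<one> a \<in> carrier F"
      using c prod by simp
    show "cmod ((c \<ominus>\<^bsub>F\<^esub> c \<otimes>\<^bsub>F\<^esub> single \<one> a) g x) \<le> 2 * cmod (c g x)" for g x
    proof -
      have "cmod (1 - a (\<phi> (inv g) x)) \<le> 2"
        using a(2)[of "\<phi> (inv g) x"] norm_triangle_ineq4[of 1 "a (\<phi> (inv g) x)"] by simp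
      then have "cmod ((1 - a (\<phi> (inv g) x)) * c g x) \<le> 2 * cmod (c g x)"
        unfolding norm_mult by (intro mult_right_mono) auto
      then show ?thesis
        unfolding eq by simp
    qed
    show "(c \<ominus>\<^bsub>F\<^esub> c \<otimes>\<^bsub>F\<^esub> single \<one> a) g x = 0" if "g \<in> S" "x \<in> K g" for g x
      using a(3)[of "\<phi> (inv g) x"] that unfolding eq by auto
  qed
  with a show thesis
    by (intro that)
qed

definition supported :: "'x set \<Rightarrow> ('g \<Rightarrow> 'x \<Rightarrow> complex) set" where
  "supported V = {b \<in> carrier F. \<forall>g x. x \<notin> V \<longrightarrow> b g x = 0}"

lemma carrier_twisted_l1_open:
  assumes V: "openin X V"
  shows "carrier (twisted_l1 G (subtopology X V) \<phi>' u') = supported V"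
  unfolding twisted_l1_def supported_def
  by (auto simp: C0_subtopology_open[OF Hausdorff V] carrier_F)

lemma supported_mult:
  assumes V: "invariant_set G X \<phi> V" and c: "c \<in> supported V" and d: "d \<in> carrier F"
  shows "d \<otimes>\<^bsub>F\<^esub> c \<in> supported V" and "c \<otimes>\<^bsub>F\<^esub> d \<in> supported V"
proof -
  have cF: "c \<in> carrier F" and cV: "\<And>g x. x \<notin> V \<Longrightarrow> c g x = 0"
    using c by (auto simp: supported_def)
  have inv: "\<phi> (inv s) x \<notin> V" if "s \<in> carrier G" "x \<in> topspace X" "x \<notin> V" for s x
  proof
    assume "\<phi> (inv s) x \<in> V"
    then have "\<phi> s (\<phi> (inv s) x) \<in> V"
      using V that(1) by (auto simp: invariant_set_def)
    then show False
      using that by (simp add: action_cancel_inv)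
  qed
  have "(d \<otimes>\<^bsub>F\<^esub> c) r x = 0 \<and> (c \<otimes>\<^bsub>F\<^esub> d) r x = 0" if x: "x \<notin> V" for r x
  proof (cases "r \<in> carrier G \<and> x \<in> topspace X")
    case True
    then have "conv_term d c r s x = 0" if "s \<in> carrier G" for s
      using inv[OF that _ x] cV by (simp add: conv_term_def dual_apply)
    moreover have "conv_term c d r s x = 0" for s
      using cV[OF x] by (simp add: conv_term_def)
    ultimately show ?thesis
      using True by (simp add: F_mult cong: infsum_cong)
  next
    case False
    then show ?thesis
      using F_mult_outside F_outside_space[OF F_mult_closed[OF d cF]]
        F_outside_space[OF F_mult_closed[OF cF d]] by blast
  qed
  then show "d \<otimes>\<^bsub>F\<^esub> c \<in> supported V" "c \<otimes>\<^bsub>F\<^esub> d \<in> supported V"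
    using F_mult_closed[OF cF d] F_mult_closed[OF d cF] by (auto simp: supported_def)
qed

lemma supported_subspace:
  shows "(\<lambda>g x. 0) \<in> supported V"
    and "c \<in> supported V \<Longrightarrow> d \<in> supported V \<Longrightarrow> c \<oplus>\<^bsub>F\<^esub> d \<in> supported V"
    and "c \<in> supported V \<Longrightarrow> k \<odot>\<^bsub>F\<^esub> c \<in> supported V"
  using F_zero_closed F_add_closed[of c d] F_smult_closed[of c k] by (auto simp: supported_def)

end

section \<open>Completions and ideals\<close>

text \<open>A Neumann series without a unit. If f = r + i with i in \<open>I\<close>, then f = m f =
  (m - k) r + (k r + m i); the last bracket lies in \<open>I\<close>, and the remainder has shrunk
  by the factor |m - k| < 1. Iterating approximates \<open>f\<close> from \<open>I\<close>.\<close>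

lemma (in cbanach_algebra) absorb_in_closed_ideal:
  assumes I: "I \<in> closed_ideals M" and m: "m \<in> carrier M" and f: "f \<in> carrier M"
    and mf: "m \<otimes>\<^bsub>M\<^esub> f = f" and k: "k \<in> I" and q: "nrm M (m \<ominus>\<^bsub>M\<^esub> k) < 1"
  shows "f \<in> I"
proof (rule closed_ideal_limit[OF I f])
  define t where "t = nrm M (m \<ominus>\<^bsub>M\<^esub> k)"
  have kM: "k \<in> carrier M"
    using closed_ideal_subset[OF I] k by blast
  have t0: "0 \<le> t"
    unfolding t_def using m kM by (intro nrm_nonneg) simp
  have step: "\<exists>i\<in>I. nrm M (f \<ominus>\<^bsub>M\<^esub> i) \<le> t ^ n * nrm M f" for n
  proof (induction n)
    case 0
    have "f \<ominus>\<^bsub>M\<^esub> \<zero>\<^bsub>M\<^esub> = f"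
      using f by (simp add: M.minus_eq)
    then show ?case
      using closed_ideal_zero[OF I] by (intro bexI[of _ "\<zero>\<^bsub>M\<^esub>"]) simp_all
  next
    case (Suc n)
    then obtain i where i: "i \<in> I" "nrm M (f \<ominus>\<^bsub>M\<^esub> i) \<le> t ^ n * nrm M f"
      by blast
    have iM: "i \<in> carrier M"
      using closed_ideal_subset[OF I] i by blast
    define r where "r = f \<ominus>\<^bsub>M\<^esub> i"
    have r: "r \<in> carrier M" "f = r \<oplus>\<^bsub>M\<^esub> i"
      using f iM by (simp_all add: r_def diff_add_cancel)
    define i' where "i' = k \<otimes>\<^bsub>M\<^esub> r \<oplus>\<^bsub>M\<^esub> m \<otimes>\<^bsub>M\<^esub> i"
    have i': "i' \<in> I"
      unfolding i'_def using I r(1) k i(1) m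
      by (intro closed_ideal_add[OF I] closed_ideal_mult_right[OF I] closed_ideal_mult_left[OF I])
    have "f = m \<otimes>\<^bsub>M\<^esub> r \<oplus>\<^bsub>M\<^esub> m \<otimes>\<^bsub>M\<^esub> i"
      using mult_r_distr[OF r(1) iM m] mf r(2) by simp
    then have "f \<ominus>\<^bsub>M\<^esub> i' = (m \<otimes>\<^bsub>M\<^esub> r \<ominus>\<^bsub>M\<^esub> k \<otimes>\<^bsub>M\<^esub> r) \<oplus>\<^bsub>M\<^esub> (m \<otimes>\<^bsub>M\<^esub> i \<ominus>\<^bsub>M\<^esub> m \<otimes>\<^bsub>M\<^esub> i)"
      unfolding i'_def using r(1) iM m kM by (simp add: add_diff_add mult_closed)
    also have "\<dots> = (m \<ominus>\<^bsub>M\<^esub> k) \<otimes>\<^bsub>M\<^esub> r"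
      using r(1) iM m kM by (simp add: mult_diff_left diff_eq_0_iff mult_closed)
    finally have "nrm M (f \<ominus>\<^bsub>M\<^esub> i') \<le> t * (t ^ n * nrm M f)"
      using nrm_mult_le[of "m \<ominus>\<^bsub>M\<^esub> k" r t "t ^ n * nrm M f"] i(2) r(1) m kM
      by (simp add: t_def r_def)
    with i' show ?case
      by (auto simp: mult.assoc)
  qed
  fix e :: real assume e: "e > 0"
  have "(\<lambda>n. t ^ n * nrm M f) \<longlonglongrightarrow> 0 * nrm M f"
    using t0 q by (intro tendsto_intros LIMSEQ_power_zero) (simp add: t_def)
  then have "\<forall>\<^sub>F n in sequentially. t ^ n * nrm M f < e"
    using e by (intro order_tendstoD) auto
  then obtain n where "t ^ n * nrm M f < e"
    by (auto simp: eventually_sequentially)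
  then show "\<exists>i\<in>I. nrm M (f \<ominus>\<^bsub>M\<^esub> i) < e"
    using step[of n] by (auto intro: le_less_trans)
qed

context twisted_action
begin

lemma bump_at:
  assumes "openin X U" "x \<in> U"
  obtains h where "h \<in> C0 X" "\<And>y. cmod (h y) \<le> 1" "h x = 1" "\<And>y. y \<notin> U \<Longrightarrow> h y = 0"
proof -
  have "compactin X {x}"
    using assms openin_subset by fastforce
  then show thesis
    using C0_bump[OF locally_compact Hausdorff, of "{x}" U] assms that by (metis empty_subsetI insert_subset singletonI)
qed

lemma invariant_setI:
  assumes "V \<subseteq> topspace X" "\<And>g x. g \<in> carrier G \<Longrightarrow> x \<in> V \<Longrightarrow> \<phi> g x \<in> V"
  shows "invariant_set G X \<phi> V"
  unfolding invariant_set_def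
proof (intro conjI ballI assms(1))
  fix g assume g: "g \<in> carrier G"
  show "\<phi> g ` V = V"
  proof
    show "V \<subseteq> \<phi> g ` V"
    proof
      fix x assume x: "x \<in> V"
      then show "x \<in> \<phi> g ` V"
        using assms(2)[OF inv_closed[OF g] x] action_cancel_inv[OF g] assms(1) by (metis imageI subsetD)
    qed
  qed (use assms(2)[OF g] in auto)
qed

end

text \<open>Of a completion only a contractive homomorphism with dense range is recorded, so that
  crossed products and isometric copies of l^1(G, C0(X)) are instances alike.\<close>

locale completed_twisted_action = twisted_action G X \<phi> u
    for G :: "('g, 'm) monoid_scheme" (structure) and X :: "'x topology" and \<phi> u +
  fixes B :: "'b cnormed" and \<iota> :: "('g \<Rightarrow> 'x \<Rightarrow> complex) \<Rightarrow> 'b"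
  assumes algebra_B: "cbanach_algebra B"
    and linear: "linear_on F B \<iota>" and multiplicative: "multiplicative_on F B \<iota>"
    and contractive: "b \<in> carrier F \<Longrightarrow> nrm B (\<iota> b) \<le> nrm F b"
    and dense: "norm_topology B closure_of (\<iota> ` carrier F) = carrier B"
begin

sublocale B: cbanach_algebra B
  by (rule algebra_B)

lemma iota_closed: "b \<in> carrier F \<Longrightarrow> \<iota> b \<in> carrier B"
  and iota_add: "b \<in> carrier F \<Longrightarrow> c \<in> carrier F \<Longrightarrow> \<iota> (b \<oplus>\<^bsub>F\<^esub> c) = \<iota> b \<oplus>\<^bsub>B\<^esub> \<iota> c"
  and iota_smult: "b \<in> carrier F \<Longrightarrow> \<iota> (k \<odot>\<^bsub>F\<^esub> b) = k \<odot>\<^bsub>B\<^esub> \<iota> b"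
  and iota_mult: "b \<in> carrier F \<Longrightarrow> c \<in> carrier F \<Longrightarrow> \<iota> (b \<otimes>\<^bsub>F\<^esub> c) = \<iota> b \<otimes>\<^bsub>B\<^esub> \<iota> c"
  using linear multiplicative unfolding linear_on_def multiplicative_on_def by auto

lemma iota_diff:
  assumes "b \<in> carrier F" "c \<in> carrier F"
  shows "\<iota> (b \<ominus>\<^bsub>F\<^esub> c) = \<iota> b \<ominus>\<^bsub>B\<^esub> \<iota> c"
  using assms iota_add[of b "(-1) \<odot>\<^bsub>F\<^esub> c"] iota_smult[of c "-1"] iota_closed F_smult_closed[of c "-1"]
  unfolding F.M.minus_eq B.M.minus_eq by (simp only: F.minus_eq_smult B.minus_eq_smult)

lemma iota_zero: "\<iota> (\<lambda>g x. 0) = \<zero>\<^bsub>B\<^esub>"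
proof -
  have "\<iota> (\<lambda>g x. 0) = 0 \<odot>\<^bsub>B\<^esub> \<iota> (\<lambda>g x. 0)"
    using iota_smult[OF F_zero_closed, of 0] by simp
  then show ?thesis
    using B.smult_l_null iota_closed[OF F_zero_closed] by simp
qed

lemma iota_approx:
  assumes "b \<in> carrier B" "e > 0"
  obtains c where "c \<in> carrier F" "nrm B (b \<ominus>\<^bsub>B\<^esub> \<iota> c) < e"
proof -
  have "b \<in> norm_topology B closure_of (\<iota> ` carrier F)"
    using assms dense by simp
  then show thesis
    using assms(2) that unfolding B.closure_of_norm_topology by auto
qed

lemma nrm_iota_diff:
  "b \<in> carrier F \<Longrightarrow> c \<in> carrier F \<Longrightarrow> nrm B (\<iota> b \<ominus>\<^bsub>B\<^esub> \<iota> c) \<le> nrm F (b \<ominus>\<^bsub>F\<^esub> c)"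
  using contractive[of "b \<ominus>\<^bsub>F\<^esub> c"] by (simp only: iota_diff F.M.minus_closed)

definition emb :: "('x \<Rightarrow> complex) \<Rightarrow> 'b" where
  "emb a = \<iota> (single \<one> a)"

lemma emb_closed: "a \<in> C0 X \<Longrightarrow> emb a \<in> carrier B"
  unfolding emb_def by (intro iota_closed single_closed) auto

lemma emb_add: "a \<in> C0 X \<Longrightarrow> b \<in> C0 X \<Longrightarrow> emb (\<lambda>x. a x + b x) = emb a \<oplus>\<^bsub>B\<^esub> emb b"
  unfolding emb_def single_add[symmetric] by (intro iota_add single_closed) auto

lemma emb_smult: "a \<in> C0 X \<Longrightarrow> emb (\<lambda>x. k * a x) = k \<odot>\<^bsub>B\<^esub> emb a"
  unfolding emb_def single_smult[symmetric] by (intro iota_smult single_closed) auto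

lemma emb_mult:
  assumes "a \<in> C0 X" "b \<in> C0 X"
  shows "emb (\<lambda>x. a x * b x) = emb a \<otimes>\<^bsub>B\<^esub> emb b"
proof -
  have "single \<one> a \<otimes>\<^bsub>F\<^esub> single \<one> b = single \<one> (\<lambda>x. a x * b x)"
    unfolding mult_single_one_left[OF single_closed[OF one_closed assms(2)] assms(1)]
    by (auto simp: single_def fun_eq_iff)
  then show ?thesis
    unfolding emb_def using assms by (subst iota_mult[symmetric]) (auto intro: single_closed)
qed

lemma nrm_emb_le: "a \<in> C0 X \<Longrightarrow> nrm B (emb a) \<le> sup_norm a"
  unfolding emb_def using contractive[OF single_closed[OF one_closed]] nrm_single[OF one_closed] by metis

lemma emb_diff: "a \<in> C0 X \<Longrightarrow> b \<in> C0 X \<Longrightarrow> emb a \<ominus>\<^bsub>B\<^esub> emb b = emb (\<lambda>x. a x - b x)"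
  using emb_add[of a "\<lambda>x. (-1) * b x"] emb_smult[of b "-1"] C0_cmult[of b X "-1"]
  by (simp add: B.M.minus_eq B.minus_eq_smult emb_closed)

text \<open>For open \<open>V\<close> this is \<open>ideal_of_open\<close>, by
  \<open>carrier_twisted_l1_open\<close>; supports are compared inside one algebra, so that no
  restricted action has to be carried along.\<close>

definition J :: "'x set \<Rightarrow> 'b set" where
  "J V = norm_topology B closure_of (\<iota> ` supported V)"

lemma supported_subset: "supported V \<subseteq> carrier F"
  by (auto simp: supported_def)

lemma J_iff: "b \<in> J V \<longleftrightarrow> b \<in> carrier B \<and> (\<forall>e>0. \<exists>c\<in>supported V. nrm B (b \<ominus>\<^bsub>B\<^esub> \<iota> c) < e)"
  unfolding J_def B.closure_of_norm_topology using iota_closed supported_subset by blast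

lemma iota_supported_in_J: "c \<in> supported V \<Longrightarrow> \<iota> c \<in> J V"
  unfolding J_def using closure_of_subset[of "\<iota> ` supported V" "norm_topology B"] iota_closed supported_subset
  by auto

lemma J_mono: "V \<subseteq> W \<Longrightarrow> J V \<subseteq> J W"
  unfolding J_def by (intro closure_of_mono image_mono) (auto simp: supported_def)

lemma single_supported: "a \<in> C0 X \<Longrightarrow> (\<And>x. x \<notin> V \<Longrightarrow> a x = 0) \<Longrightarrow> single \<one> a \<in> supported V"
  unfolding supported_def using single_closed[OF one_closed] by (auto simp: single_def)

lemma emb_in_J: "a \<in> C0 X \<Longrightarrow> (\<And>x. x \<notin> V \<Longrightarrow> a x = 0) \<Longrightarrow> emb a \<in> J V"
  unfolding emb_def by (intro iota_supported_in_J single_supported)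

lemma J_closed_ideal:
  assumes V: "invariant_set G X \<phi> V"
  shows "J V \<in> closed_ideals B"
  unfolding J_def
proof (rule B.closed_ideals_closure[where D="\<iota> ` carrier F"])
  note sF = subsetD[OF supported_subset]
  show "\<iota> ` supported V \<subseteq> carrier B" "\<iota> ` carrier F \<subseteq> carrier B"
    using iota_closed sF by auto
  show "\<zero>\<^bsub>B\<^esub> \<in> \<iota> ` supported V"
    using iota_zero supported_subspace(1) by (metis imageI)
  show "norm_topology B closure_of \<iota> ` carrier F = carrier B"
    by (rule dense)
  fix x y assume x: "x \<in> \<iota> ` supported V"
  then obtain c where c: "c \<in> supported V" "x = \<iota> c" by blast
  show "x \<oplus>\<^bsub>B\<^esub> y \<in> \<iota> ` supported V" if y: "y \<in> \<iota> ` supported V"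
  proof -
    obtain d where d: "d \<in> supported V" "y = \<iota> d" using y by blast
    then show ?thesis
      using c iota_add[OF sF[OF c(1)] sF[OF d(1)]] supported_subspace(2)[OF c(1) d(1)] by (metis imageI)
  qed
  show "k \<odot>\<^bsub>B\<^esub> x \<in> \<iota> ` supported V" for k
    using c iota_smult[OF sF[OF c(1)], of k] supported_subspace(3)[OF c(1), of k] by (metis imageI)
  show "d \<otimes>\<^bsub>B\<^esub> x \<in> \<iota> ` supported V" "x \<otimes>\<^bsub>B\<^esub> d \<in> \<iota> ` supported V" if dF: "d \<in> \<iota> ` carrier F" for d
  proof -
    obtain d' where d': "d' \<in> carrier F" "d = \<iota> d'" using dF by blast
    then show "d \<otimes>\<^bsub>B\<^esub> x \<in> \<iota> ` supported V" "x \<otimes>\<^bsub>B\<^esub> d \<in> \<iota> ` supported V"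
      using c supported_mult[OF V c(1) d'(1)] iota_mult[OF sF[OF c(1)] d'(1)] iota_mult[OF d'(1) sF[OF c(1)]]
      by (metis imageI)+
  qed
qed

text \<open>An element \<open>c\<close> supported in \<open>V\<close> is a limit of products
  \<open>a c\<close> with \<open>a\<close> in C0(V), so a closed ideal containing C0(V) contains all
  of \<open>J V\<close>.\<close>

lemma J_subset:
  assumes I: "I \<in> closed_ideals B" and V: "openin X V"
    and sub: "\<And>a. a \<in> C0 X \<Longrightarrow> (\<And>x. x \<notin> V \<Longrightarrow> a x = 0) \<Longrightarrow> emb a \<in> I"
  shows "J V \<subseteq> I"
proof -
  have "\<iota> c \<in> I" if c: "c \<in> supported V" for c
  proof (rule B.closed_ideal_limit[OF I])
    have cF: "c \<in> carrier F" and cV: "\<And>g x. x \<notin> V \<Longrightarrow> c g x = 0"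
      using c by (auto simp: supported_def)
    show "\<iota> c \<in> carrier B"
      using cF by (rule iota_closed)
    fix e :: real assume e: "e > 0"
    obtain a where a: "a \<in> C0 X" "\<And>x. x \<notin> V \<Longrightarrow> a x = 0"
      "nrm F (c \<ominus>\<^bsub>F\<^esub> single \<one> a \<otimes>\<^bsub>F\<^esub> c) < e"
      using approx_unit_left[OF cF V cV e] by metis
    have s: "single \<one> a \<in> carrier F"
      using a(1) by (intro single_closed) auto
    have "\<iota> (single \<one> a \<otimes>\<^bsub>F\<^esub> c) = emb a \<otimes>\<^bsub>B\<^esub> \<iota> c"
      using s cF by (simp only: iota_mult emb_def)
    moreover have "emb a \<otimes>\<^bsub>B\<^esub> \<iota> c \<in> I"
      using B.closed_ideal_mult_right[OF I sub[OF a(1,2)] iota_closed[OF cF]] by blast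
    moreover have "nrm B (\<iota> c \<ominus>\<^bsub>B\<^esub> \<iota> (single \<one> a \<otimes>\<^bsub>F\<^esub> c)) < e"
      using nrm_iota_diff[OF cF F_mult_closed[OF s cF]] a(3) by linarith
    ultimately show "\<exists>y\<in>I. nrm B (\<iota> c \<ominus>\<^bsub>B\<^esub> y) < e"
      by auto
  qed
  moreover have "closedin (norm_topology B) I"
    using I by (simp add: closed_ideals_def)
  ultimately show ?thesis
    unfolding J_def by (intro closure_of_minimal) auto
qed

text \<open>Prime ideals are defined here through intersections, so these have to be compared with
  intersections of open sets. If \<open>c\<close> and \<open>c'\<close> approximate \<open>b\<close>
  from \<open>V\<close> and from \<open>W\<close>, and \<open>a\<close> in C0(V) nearly fixes
  \<open>c\<close>, then \<open>b\<close>, \<open>c\<close>, \<open>a c\<close> and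
  \<open>a c'\<close> are close to each other, and \<open>a c'\<close> is supported in V \<inter>
  W.\<close>

lemma J_Int_subset:
  assumes I: "I \<in> closed_ideals B" and V: "openin X V" and W: "openin X W"
    and sub: "\<And>a. a \<in> C0 X \<Longrightarrow> (\<And>x. x \<notin> V \<inter> W \<Longrightarrow> a x = 0) \<Longrightarrow> emb a \<in> I"
  shows "J V \<inter> J W \<subseteq> I"
proof
  fix b assume b: "b \<in> J V \<inter> J W"
  have J_sub: "J (V \<inter> W) \<subseteq> I"
    by (rule J_subset[OF I openin_Int[OF V W] sub]) auto
  have bB: "b \<in> carrier B"
    using b by (simp add: J_iff)
  show "b \<in> I"
  proof (rule B.closed_ideal_limit[OF I bB])
    fix e :: real assume e: "e > 0"
    \<comment> \<open>Four errors of size \<open>d\<close> occur: one from \<open>b\<close> to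
      \<open>c\<close>, one from \<open>c\<close> to \<open>a c\<close>, and two in comparing
      \<open>c\<close> with \<open>c'\<close> through \<open>b\<close>.\<close>
    define d where "d = e / 4"
    have d: "d > 0" using e by (simp add: d_def)
    obtain c where c: "c \<in> supported V" "nrm B (b \<ominus>\<^bsub>B\<^esub> \<iota> c) < d"
      using b d by (auto simp: J_iff)
    obtain c' where c': "c' \<in> supported W" "nrm B (b \<ominus>\<^bsub>B\<^esub> \<iota> c') < d"
      using b d by (auto simp: J_iff)
    have cF: "c \<in> carrier F" "c' \<in> carrier F" and cV: "\<And>g x. x \<notin> V \<Longrightarrow> c g x = 0"
      and cW: "\<And>g x. x \<notin> W \<Longrightarrow> c' g x = 0"
      using c c' by (auto simp: supported_def)
    obtain a where a: "a \<in> C0 X" "\<And>x. x \<notin> V \<Longrightarrow> a x = 0" "\<And>x. cmod (a x) \<le> 1"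
      "nrm F (c \<ominus>\<^bsub>F\<^esub> single \<one> a \<otimes>\<^bsub>F\<^esub> c) < d"
      using approx_unit_left[OF cF(1) V cV d] by metis
    have s: "single \<one> a \<in> carrier F"
      using a(1) by (intro single_closed) auto
    have a1: "nrm B (emb a) \<le> 1"
      using nrm_emb_le[OF a(1)] sup_norm_le[of a 1] a(3) by (meson order_trans)
    let ?a = "emb a"
    have in_B: "?a \<in> carrier B" "\<iota> c \<in> carrier B" "\<iota> c' \<in> carrier B"
      using a(1) cF by (auto intro: emb_closed iota_closed)
    have 1: "nrm B (b \<ominus>\<^bsub>B\<^esub> ?a \<otimes>\<^bsub>B\<^esub> \<iota> c') \<le> nrm B (b \<ominus>\<^bsub>B\<^esub> \<iota> c) + nrm B (\<iota> c \<ominus>\<^bsub>B\<^esub> ?a \<otimes>\<^bsub>B\<^esub> \<iota> c')"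
      using bB in_B by (intro B.nrm_diff_triangle B.mult_closed)
    have 2: "nrm B (\<iota> c \<ominus>\<^bsub>B\<^esub> ?a \<otimes>\<^bsub>B\<^esub> \<iota> c') \<le>
        nrm B (\<iota> c \<ominus>\<^bsub>B\<^esub> ?a \<otimes>\<^bsub>B\<^esub> \<iota> c) + nrm B (?a \<otimes>\<^bsub>B\<^esub> \<iota> c \<ominus>\<^bsub>B\<^esub> ?a \<otimes>\<^bsub>B\<^esub> \<iota> c')"
      using bB in_B by (intro B.nrm_diff_triangle B.mult_closed)
    have "?a \<otimes>\<^bsub>B\<^esub> \<iota> c \<ominus>\<^bsub>B\<^esub> ?a \<otimes>\<^bsub>B\<^esub> \<iota> c' = ?a \<otimes>\<^bsub>B\<^esub> (\<iota> c \<ominus>\<^bsub>B\<^esub> \<iota> c')"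
      using in_B by (simp add: B.mult_diff_right)
    moreover have "nrm B (?a \<otimes>\<^bsub>B\<^esub> (\<iota> c \<ominus>\<^bsub>B\<^esub> \<iota> c')) \<le> 1 * nrm B (\<iota> c \<ominus>\<^bsub>B\<^esub> \<iota> c')"
      using in_B a1 by (intro B.nrm_mult_le) auto
    ultimately have 3: "nrm B (?a \<otimes>\<^bsub>B\<^esub> \<iota> c \<ominus>\<^bsub>B\<^esub> ?a \<otimes>\<^bsub>B\<^esub> \<iota> c') \<le> nrm B (\<iota> c \<ominus>\<^bsub>B\<^esub> \<iota> c')"
      by simp
    have 4: "nrm B (\<iota> c \<ominus>\<^bsub>B\<^esub> \<iota> c') \<le> nrm B (\<iota> c \<ominus>\<^bsub>B\<^esub> b) + nrm B (b \<ominus>\<^bsub>B\<^esub> \<iota> c')"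
      using bB in_B by (intro B.nrm_diff_triangle)
    have 5: "nrm B (\<iota> c \<ominus>\<^bsub>B\<^esub> b) = nrm B (b \<ominus>\<^bsub>B\<^esub> \<iota> c)"
      using bB in_B by (intro B.nrm_diff_commute)
    have 6: "nrm B (\<iota> c \<ominus>\<^bsub>B\<^esub> ?a \<otimes>\<^bsub>B\<^esub> \<iota> c) \<le> nrm F (c \<ominus>\<^bsub>F\<^esub> single \<one> a \<otimes>\<^bsub>F\<^esub> c)"
      unfolding emb_def iota_mult[OF s cF(1), symmetric]
      by (rule nrm_iota_diff[OF cF(1) F_mult_closed[OF s cF(1)]])
    have "nrm B (b \<ominus>\<^bsub>B\<^esub> ?a \<otimes>\<^bsub>B\<^esub> \<iota> c') < e"
      using 1 2 3 4 5 6 c(2) c'(2) a(4) unfolding d_def by linarith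
    moreover have "?a \<otimes>\<^bsub>B\<^esub> \<iota> c' \<in> I"
    proof -
      have "single \<one> a \<otimes>\<^bsub>F\<^esub> c' \<in> supported (V \<inter> W)"
        using F_mult_closed[OF s cF(2)] a(2) cW
        unfolding supported_def mult_single_one_left[OF cF(2) a(1)] by auto
      then have "\<iota> (single \<one> a \<otimes>\<^bsub>F\<^esub> c') \<in> I"
        using J_sub iota_supported_in_J by blast
      then show ?thesis
        by (simp only: iota_mult[OF s cF(2)] emb_def)
    qed
    ultimately show "\<exists>y\<in>I. nrm B (b \<ominus>\<^bsub>B\<^esub> y) < e" ..
  qed
qed

lemma J_topspace: "J (topspace X) = carrier B"
proof -
  have "supported (topspace X) = carrier F"
    using F_outside_space by (auto simp: supported_def)
  then show ?thesis
    by (simp add: J_def dense)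
qed

text \<open>By \<open>emb_in_ideal_iff\<close> this is the open set \<open>U\<close> for which the
  functions in \<open>I\<close> are those of C0(U).\<close>

definition ideal_support :: "'b set \<Rightarrow> 'x set" where
  "ideal_support I = {x. \<exists>a\<in>C0 X. emb a \<in> I \<and> a x \<noteq> 0}"

lemma openin_ideal_support: "openin X (ideal_support I)"
proof (subst openin_subopen, intro ballI)
  fix x assume "x \<in> ideal_support I"
  then obtain a where a: "a \<in> C0 X" "emb a \<in> I" "a x \<noteq> 0"
    by (auto simp: ideal_support_def)
  have "openin X {x \<in> topspace X. a x \<in> - {0}}"
    by (rule openin_continuous_map_preimage[OF C0_continuous_map[OF a(1)]]) auto
  then show "\<exists>T. openin X T \<and> x \<in> T \<and> T \<subseteq> ideal_support I"
    using a C0_outside[OF a(1), of x] by (intro exI[of _ "{x \<in> topspace X. a x \<in> - {0}}"]) (auto simp: ideal_support_def)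
qed

lemma ideal_support_subset: "ideal_support I \<subseteq> topspace X"
  using openin_subset[OF openin_ideal_support] .

text \<open>If \<open>h\<close> is 1 at \<open>\<phi> g x\<close> and \<open>k\<close> is 1 at
  \<open>x\<close>, the product of h \<delta>_g, a and k \<delta>_{g^-1} is a function in the ideal
  whose value at \<open>\<phi> g x\<close> is \<open>a x\<close> up to a factor of modulus
  1.\<close>

lemma ideal_support_invariant:
  assumes I: "I \<in> closed_ideals B"
  shows "invariant_set G X \<phi> (ideal_support I)"
proof (rule invariant_setI[OF ideal_support_subset])
  fix g x assume g: "g \<in> carrier G" and "x \<in> ideal_support I"
  then obtain a where a: "a \<in> C0 X" "emb a \<in> I" "a x \<noteq> 0"
    by (auto simp: ideal_support_def)
  have x: "x \<in> topspace X"
    using C0_outside[OF a(1), of x] a(3) by blast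
  have y: "\<phi> g x \<in> topspace X"
    using g x by (rule action_closed)
  obtain h where h: "h \<in> C0 X" "h (\<phi> g x) = 1"
    using bump_at[OF openin_topspace y] by metis
  obtain k where k: "k \<in> C0 X" "k x = 1"
    using bump_at[OF openin_topspace x] by metis
  have g': "inv g \<in> carrier G" using g by simp
  define p where "p = (\<lambda>z. h z * dual g a z * u g \<one> z)"
  define r where "r = (\<lambda>z. p z * dual g k z * u g (inv g) z)"
  have dC: "dual g a \<in> C0 X" "dual g k \<in> C0 X"
    using dual_action_C0[OF g] a(1) k(1) by auto
  have pC: "p \<in> C0 X"
    unfolding p_def using h(1) dC g
    by (intro C0_mult_bounded[where M=1] C0_mult cocycle_continuous) (auto simp: cocycle_norm)
  have rC: "r \<in> C0 X"
    unfolding r_def using pC dC g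
    by (intro C0_mult_bounded[where M=1] C0_mult cocycle_continuous) (auto simp: cocycle_norm)
  have sF: "single g h \<in> carrier F" "single \<one> a \<in> carrier F" "single (inv g) k \<in> carrier F" "single g p \<in> carrier F"
    using g h(1) a(1) k(1) pC by (auto intro: single_closed)
  have "single g h \<otimes>\<^bsub>F\<^esub> single \<one> a = single g p"
    using single_mult_single[OF g one_closed h(1) a(1)] g by (simp add: p_def)
  moreover have "single g p \<otimes>\<^bsub>F\<^esub> single (inv g) k = single \<one> r"
    using single_mult_single[OF g g' pC k(1)] g by (simp add: r_def)
  ultimately have "emb r = (\<iota> (single g h) \<otimes>\<^bsub>B\<^esub> emb a) \<otimes>\<^bsub>B\<^esub> \<iota> (single (inv g) k)"
    unfolding emb_def using iota_mult[OF sF(1,2)] iota_mult[OF sF(4,3)] by simp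
  then have "emb r \<in> I"
    using B.closed_ideal_mult_right[OF I B.closed_ideal_mult_left[OF I a(2) iota_closed[OF sF(1)]]
        iota_closed[OF sF(3)]] by simp
  moreover have "r (\<phi> g x) \<noteq> 0"
    using g g' x y h(2) k(2) a(3) cocycle_norm[OF g one_closed y] cocycle_norm[OF g g' y]
    by (auto simp: r_def p_def dual_apply action_inv_cancel)
  ultimately show "\<phi> g x \<in> ideal_support I"
    using rC by (auto simp: ideal_support_def)
qed

text \<open>The classification of closed ideals of C0(X), applied to the preimage of
  \<open>I\<close>. Finitely many functions of the ideal cover the compact set where
  \<open>a\<close> is not small. The sum \<rho> of their squared moduli again belongs to the ideal,
  because C0(X) is closed under conjugation, and a \<rho>/(\<rho> + \<epsilon>) approximates
  \<open>a\<close>.\<close>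

lemma emb_in_ideal_iff:
  assumes I: "I \<in> closed_ideals B" and a: "a \<in> C0 X"
  shows "emb a \<in> I \<longleftrightarrow> (\<forall>x. x \<notin> ideal_support I \<longrightarrow> a x = 0)"
proof
  show "emb a \<in> I \<Longrightarrow> \<forall>x. x \<notin> ideal_support I \<longrightarrow> a x = 0"
    using a by (auto simp: ideal_support_def)
  assume a0: "\<forall>x. x \<notin> ideal_support I \<longrightarrow> a x = 0"
  show "emb a \<in> I"
  proof (rule B.closed_ideal_limit[OF I emb_closed[OF a]])
    fix e :: real assume e: "e > 0"
    define K where "K = {x \<in> topspace X. e/2 \<le> cmod (a x)}"
    have K: "compactin X K"
      unfolding K_def using C0_compactin[OF a, of "e/2"] e by simp
    define H where "H = {h \<in> C0 X. emb h \<in> I}"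
    define W where "W h = {x \<in> topspace X. 1 < cmod (h x)}" for h :: "'x \<Rightarrow> complex"
    have openW: "openin X (W h)" if "h \<in> H" for h
    proof -
      have "continuous_map X euclideanreal (\<lambda>x. cmod (h x))"
        using that by (intro continuous_map_norm C0_continuous_map) (simp add: H_def)
      then show ?thesis
        using openin_continuous_map_preimage[of X euclideanreal _ "{1<..}"] by (simp add: W_def)
    qed
    have "K \<subseteq> \<Union>(W ` H)"
    proof
      fix x assume x: "x \<in> K"
      then have "a x \<noteq> 0" using e by (auto simp: K_def)
      then obtain h where h: "h \<in> C0 X" "emb h \<in> I" "h x \<noteq> 0"
        using a0 by (auto simp: ideal_support_def)
      \<comment> \<open>The rescaled function has modulus 2 at \<open>x\<close>, above the threshold
        1 in \<open>W\<close>.\<close>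
      define k where "k = complex_of_real (2 / cmod (h x))"
      have "(\<lambda>x. k * h x) \<in> H"
        using h emb_smult[OF h(1), of k] B.closed_ideal_smult[OF I h(2), of k]
        by (simp add: H_def C0_cmult)
      moreover have "x \<in> W (\<lambda>x. k * h x)"
        using x h(3) by (simp add: W_def K_def norm_mult k_def norm_divide)
      ultimately show "x \<in> \<Union>(W ` H)" by blast
    qed
    then obtain T' where T': "finite T'" "T' \<subseteq> W ` H" "K \<subseteq> \<Union>T'"
      using compactinD[OF K, of "W ` H"] openW by auto
    then obtain T where T: "finite T" "T \<subseteq> H" "K \<subseteq> \<Union>(W ` T)"
      using finite_subset_image[OF T'(1,2)] by metis
    define h where "h x = (\<Sum>k\<in>T. cnj (k x) * k x)" for x
    have hr: "h x = complex_of_real (\<Sum>k\<in>T. (cmod (k x))\<^sup>2)" for x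
      unfolding h_def of_real_sum
      by (intro sum.cong refl) (simp only: complex_norm_square mult.commute)
    define \<rho> where "\<rho> x = (\<Sum>k\<in>T. (cmod (k x))\<^sup>2)" for x
    have \<rho>0: "\<rho> x \<ge> 0" for x
      unfolding \<rho>_def by (simp add: sum_nonneg)
    have \<rho>1: "\<rho> x \<ge> 1" if x: "x \<in> K" for x
    proof -
      obtain k where k: "k \<in> T" "1 < cmod (k x)"
        using T(3) x by (auto simp: W_def)
      have "1 \<le> (cmod (k x))\<^sup>2"
        using k(2) by (simp add: power2_eq_square less_1_mult less_imp_le)
      also have "\<dots> \<le> \<rho> x"
        unfolding \<rho>_def using T(1) k(1) by (intro member_le_sum) auto
      finally show ?thesis .
    qed
    have hI: "(\<lambda>x. \<Sum>k\<in>S. cnj (k x) * k x) \<in> C0 X \<and> emb (\<lambda>x. \<Sum>k\<in>S. cnj (k x) * k x) \<in> I"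
      if "finite S" "S \<subseteq> T" for S
      using that
    proof (induction S)
      case empty
      have "emb (\<lambda>x. 0) = \<zero>\<^bsub>B\<^esub>"
        using emb_smult[of "\<lambda>x. 0" 0] B.smult_l_null[OF emb_closed[of "\<lambda>x. 0"]] by simp
      then show ?case
        using B.closed_ideal_zero[OF I] by simp
    next
      case (insert k S)
      have k: "k \<in> C0 X" "emb k \<in> I"
        using insert.prems T(2) by (auto simp: H_def)
      have IH: "(\<lambda>x. \<Sum>k\<in>S. cnj (k x) * k x) \<in> C0 X" "emb (\<lambda>x. \<Sum>k\<in>S. cnj (k x) * k x) \<in> I"
        using insert by auto
      have 1: "(\<lambda>x. cnj (k x) * k x) \<in> C0 X"
        using k(1) by (intro C0_mult C0_cnj)
      moreover have "emb (\<lambda>x. cnj (k x) * k x) \<in> I"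
        using emb_mult[OF C0_cnj[OF k(1)] k(1)] B.closed_ideal_mult_left[OF I k(2) emb_closed[OF C0_cnj[OF k(1)]]]
        by simp
      ultimately show ?case
        using IH C0_add[OF 1 IH(1)] emb_add[OF 1 IH(1)] B.closed_ideal_add[OF I _ IH(2)] insert.hyps
        by simp
    qed
    have h: "h \<in> C0 X" "emb h \<in> I"
      using hI[OF T(1) order_refl] unfolding h_def[abs_def] by auto
    define M where "M = sup_norm a"
    have M: "M \<ge> 0" using sup_norm_nonneg[OF a] by (simp add: M_def)
    \<comment> \<open>On \<open>K\<close>, where \<rho> is at least 1, the error is at most M
      \<epsilon> \<le> e/2; elsewhere \<open>a\<close> itself is below e/2. The added 1 allows M =
      0.\<close>
    define \<epsilon> where "\<epsilon> = e / (2 * (M + 1))"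
    have \<epsilon>: "\<epsilon> > 0" using e M by (simp add: \<epsilon>_def)
    define w where "w x = complex_of_real (1 / (\<rho> x + \<epsilon>))" for x
    have pos: "\<rho> x + \<epsilon> > 0" for x using \<rho>0[of x] \<epsilon> by simp
    have \<rho>h: "\<rho> x = Re (h x)" for x
      by (simp add: hr \<rho>_def)
    have "continuous_map X euclidean w"
      unfolding continuous_map_euclidean_iff_tendsto w_def \<rho>h
    proof
      fix x assume "x \<in> topspace X"
      then have "(h \<longlongrightarrow> h x) (atin X x)"
        using C0_continuous_map[OF h(1)] by (simp add: continuous_map_euclidean_iff_tendsto)
      then show "((\<lambda>x. complex_of_real (1 / (Re (h x) + \<epsilon>))) \<longlongrightarrow> complex_of_real (1 / (Re (h x) + \<epsilon>))) (atin X x)"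
        using pos[of x] by (intro tendsto_intros) (auto simp: \<rho>h)
    qed
    moreover have "cmod (w x) \<le> 1 / \<epsilon>" for x
      unfolding w_def norm_of_real using pos[of x] \<rho>0[of x] \<epsilon> by (simp add: frac_le)
    ultimately have aw: "(\<lambda>x. a x * w x) \<in> C0 X"
      by (intro C0_mult_bounded[OF a])
    define a' where "a' = (\<lambda>x. (a x * w x) * h x)"
    have a'C: "a' \<in> C0 X"
      unfolding a'_def using aw h(1) by (rule C0_mult)
    have "emb a' \<in> I"
      unfolding a'_def emb_mult[OF aw h(1)] using B.closed_ideal_mult_left[OF I h(2) emb_closed[OF aw]] .
    moreover have "cmod (a x - a' x) \<le> e/2" for x
    proof -
      have "w x * h x = complex_of_real (\<rho> x / (\<rho> x + \<epsilon>))"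
        by (simp add: w_def hr \<rho>_def)
      then have "a x - a' x = a x * complex_of_real (1 - \<rho> x / (\<rho> x + \<epsilon>))"
        by (simp add: a'_def algebra_simps)
      also have "1 - \<rho> x / (\<rho> x + \<epsilon>) = \<epsilon> / (\<rho> x + \<epsilon>)"
        using pos[of x] by (simp add: field_simps)
      finally have "a x - a' x = a x * complex_of_real (\<epsilon> / (\<rho> x + \<epsilon>))" .
      then have eq: "cmod (a x - a' x) = cmod (a x) * (\<epsilon> / (\<rho> x + \<epsilon>))"
        using pos[of x] \<epsilon> by (simp only: norm_mult norm_of_real abs_of_pos divide_pos_pos)
      show ?thesis
      proof (cases "x \<in> K")
        case True
        have "\<epsilon> / (\<rho> x + \<epsilon>) \<le> \<epsilon>"
          using divide_left_mono[of 1 "\<rho> x + \<epsilon>" \<epsilon>] \<rho>1[OF True] \<epsilon> by simp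
        then have "cmod (a x) * (\<epsilon> / (\<rho> x + \<epsilon>)) \<le> M * \<epsilon>"
          using norm_le_sup_norm[OF a, of x] M \<epsilon> pos[of x] by (intro mult_mono) (auto simp: M_def)
        also have "\<dots> \<le> e/2"
          using M e by (simp add: \<epsilon>_def field_simps)
        finally show ?thesis by (simp add: eq)
      next
        case False
        have "\<epsilon> / (\<rho> x + \<epsilon>) \<le> 1"
          using \<rho>0[of x] \<epsilon> by (simp add: field_simps)
        moreover have "cmod (a x) \<le> e/2"
          using False C0_outside[OF a, of x] e by (cases "x \<in> topspace X") (auto simp: K_def)
        ultimately have "cmod (a x) * (\<epsilon> / (\<rho> x + \<epsilon>)) \<le> e/2 * 1"
          using pos[of x] \<epsilon> e by (intro mult_mono) auto
        then show ?thesis by (simp add: eq)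
      qed
    qed
    then have "nrm B (emb a \<ominus>\<^bsub>B\<^esub> emb a') < e"
      using nrm_emb_le[OF C0_diff[OF a a'C]] sup_norm_le[of "\<lambda>x. a x - a' x" "e/2"] e
      unfolding emb_diff[OF a a'C] by fastforce
    ultimately show "\<exists>y\<in>I. nrm B (emb a \<ominus>\<^bsub>B\<^esub> y) < e" ..
  qed
qed

text \<open>The maps \<open>E t\<close> play the role of the coefficient maps of \<open>B / J V\<close>, composed with the
  quotient map.\<close>

definition coefficient_family :: "'x set \<Rightarrow> ('g \<Rightarrow> 'b \<Rightarrow> 'x \<Rightarrow> complex) \<Rightarrow> bool" where
  "coefficient_family V E \<longleftrightarrow>
      (\<forall>t\<in>carrier G. \<forall>b\<in>carrier B. \<forall>y. cmod (E t b y) \<le> nrm B b) \<and>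
      (\<forall>t\<in>carrier G. \<forall>b\<in>carrier B. \<forall>c\<in>carrier B. \<forall>y. E t (b \<ominus>\<^bsub>B\<^esub> c) y = E t b y - E t c y) \<and>
      (\<forall>t\<in>carrier G. \<forall>c\<in>carrier F. \<forall>y\<in>topspace X - V. E t (\<iota> c) y = c t y) \<and>
      (\<forall>b\<in>carrier B. (\<forall>t\<in>carrier G. \<forall>y\<in>topspace X - V. E t b y = 0) \<longrightarrow> b \<in> J V)"

lemma coefficient_familyD:
  assumes "coefficient_family V E"
  shows "\<And>t b y. t \<in> carrier G \<Longrightarrow> b \<in> carrier B \<Longrightarrow> cmod (E t b y) \<le> nrm B b"
    and "\<And>t b c y. t \<in> carrier G \<Longrightarrow> b \<in> carrier B \<Longrightarrow> c \<in> carrier B \<Longrightarrow> E t (b \<ominus>\<^bsub>B\<^esub> c) y = E t b y - E t c y"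
    and "\<And>t c y. t \<in> carrier G \<Longrightarrow> c \<in> carrier F \<Longrightarrow> y \<in> topspace X - V \<Longrightarrow> E t (\<iota> c) y = c t y"
    and "\<And>b. b \<in> carrier B \<Longrightarrow> (\<And>t y. t \<in> carrier G \<Longrightarrow> y \<in> topspace X - V \<Longrightarrow> E t b y = 0) \<Longrightarrow> b \<in> J V"
  using assms unfolding coefficient_family_def by simp_all

end

section \<open>Orbit closures and prime ideals\<close>

context twisted_action
begin

abbreviation "orbit_closure x \<equiv> X closure_of (orbit G \<phi> x)"

definition off_orbit :: "'x \<Rightarrow> 'x set" where
  "off_orbit x = topspace X - orbit_closure x"

lemma invariantD: "invariant_set G X \<phi> V \<Longrightarrow> g \<in> carrier G \<Longrightarrow> x \<in> V \<Longrightarrow> \<phi> g x \<in> V"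
  by (auto simp: invariant_set_def)

lemma invariant_iff:
  assumes V: "invariant_set G X \<phi> V" and g: "g \<in> carrier G" and x: "x \<in> topspace X"
  shows "\<phi> g x \<in> V \<longleftrightarrow> x \<in> V"
  using invariantD[OF V g, of x] invariantD[OF V inv_closed[OF g], of "\<phi> g x"] action_inv_cancel[OF g x]
  by auto

lemma openin_preimage_action: "g \<in> carrier G \<Longrightarrow> openin X V \<Longrightarrow> openin X {x \<in> topspace X. \<phi> g x \<in> V}"
  using openin_continuous_map_preimage[OF action_continuous] .

lemma openin_off_orbit: "openin X (off_orbit x)"
  unfolding off_orbit_def by (intro openin_diff) auto

lemma in_orbit_closure: "x \<in> topspace X \<Longrightarrow> x \<in> orbit_closure x"
  using orbit_refl[of x] by (auto simp: in_closure_of)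

lemma not_in_off_orbit: "x \<notin> off_orbit x"
  using in_orbit_closure by (auto simp: off_orbit_def)

lemma invariant_off_orbit:
  assumes x: "x \<in> topspace X"
  shows "invariant_set G X \<phi> (off_orbit x)"
proof (rule invariant_setI)
  show "off_orbit x \<subseteq> topspace X"
    by (auto simp: off_orbit_def)
  fix g y assume g: "g \<in> carrier G" and y: "y \<in> off_orbit x"
  have yX: "y \<in> topspace X" and y_not: "y \<notin> orbit_closure x"
    using y by (auto simp: off_orbit_def)
  have "\<phi> g y \<notin> orbit_closure x"
  proof
    assume cl: "\<phi> g y \<in> orbit_closure x"
    have "y \<in> orbit_closure x"
      unfolding in_closure_of
    proof (intro conjI allI impI yX)
      fix T assume T: "y \<in> T \<and> openin X T"
      have "\<phi> g y \<in> {z \<in> topspace X. \<phi> (inv g) z \<in> T}"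
        using T g yX by (simp add: action_closed action_inv_cancel)
      moreover have "openin X {z \<in> topspace X. \<phi> (inv g) z \<in> T}"
        using T g by (intro openin_preimage_action) auto
      ultimately have "\<exists>z. z \<in> orbit G \<phi> x \<and> z \<in> {z \<in> topspace X. \<phi> (inv g) z \<in> T}"
        using cl[unfolded in_closure_of, THEN conjunct2, rule_format, of "{z \<in> topspace X. \<phi> (inv g) z \<in> T}"]
        by simp
      then obtain z where z: "z \<in> orbit G \<phi> x" "\<phi> (inv g) z \<in> T"
        by auto
      obtain h where h: "h \<in> carrier G" "z = \<phi> h x"
        using z(1) by (auto simp: orbit_def)
      have "\<phi> (inv g) z = \<phi> (inv g \<otimes> h) x"
        using g h x by (simp add: composition_rule)
      then have "\<phi> (inv g) z \<in> orbit G \<phi> x"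
        using g h by (auto simp: orbit_def)
      with z(2) show "\<exists>y. y \<in> orbit G \<phi> x \<and> y \<in> T" by blast
    qed
    with y_not show False ..
  qed
  then show "\<phi> g y \<in> off_orbit x"
    using action_closed[OF g yX] by (simp add: off_orbit_def)
qed

text \<open>An open set that meets the closure of an orbit meets the orbit, and if it is invariant
  it then contains \<open>x\<close>. This turns inclusions between ideals into membership of a
  single point.\<close>

lemma open_invariant_subset_off_orbit_iff:
  assumes V: "openin X V" "invariant_set G X \<phi> V" and x: "x \<in> topspace X"
  shows "V \<subseteq> off_orbit x \<longleftrightarrow> x \<notin> V"
proof
  show "V \<subseteq> off_orbit x \<Longrightarrow> x \<notin> V"
    using not_in_off_orbit by blast
  assume "x \<notin> V"
  show "V \<subseteq> off_orbit x"
  proof (rule ccontr)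
    assume "\<not> V \<subseteq> off_orbit x"
    then obtain z where "z \<in> V" "z \<in> orbit_closure x"
      using openin_subset[OF V(1)] by (auto simp: off_orbit_def)
    then obtain g where "g \<in> carrier G" "\<phi> g x \<in> V"
      using V(1) unfolding in_closure_of orbit_def by blast
    then show False
      using \<open>x \<notin> V\<close> invariant_iff[OF V(2) _ x] by blast
  qed
qed

definition saturation :: "'x set \<Rightarrow> 'x set" where
  "saturation W = {x \<in> topspace X. \<exists>g\<in>carrier G. \<phi> g x \<in> W}"

lemma openin_saturation:
  assumes "openin X W"
  shows "openin X (saturation W)"
proof -
  have "saturation W = (\<Union>g\<in>carrier G. {x \<in> topspace X. \<phi> g x \<in> W})"
    by (auto simp: saturation_def)
  then show ?thesis
    using openin_preimage_action[OF _ assms] by auto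
qed

lemma subset_saturation: "W \<subseteq> topspace X \<Longrightarrow> W \<subseteq> saturation W"
  using one_closed action_one by (force simp: saturation_def)

lemma invariant_saturation: "invariant_set G X \<phi> (saturation W)"
proof (rule invariant_setI)
  fix h x assume h: "h \<in> carrier G" and "x \<in> saturation W"
  then obtain g where x: "x \<in> topspace X" and g: "g \<in> carrier G" "\<phi> g x \<in> W"
    by (auto simp: saturation_def)
  have "\<phi> (g \<otimes> inv h) (\<phi> h x) = \<phi> g x"
    using g h x by (simp add: composition_rule action_closed action_inv_cancel)
  then show "\<phi> h x \<in> saturation W"
    using g h x by (auto simp: saturation_def action_closed intro!: bexI[of _ "g \<otimes> inv h"])
qed (auto simp: saturation_def)

text \<open>Baire category in the locally compact space \<open>X - V\<close>: the saturations of the members of a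
  countable base are dense, and a point in all of them has a dense orbit.\<close>

lemma irreducible_imp_orbit_closure:
  assumes sc: "second_countable X" and V: "openin X V" "invariant_set G X \<phi> V" "V \<noteq> topspace X"
    and irred: "\<And>A A'. openin X A \<Longrightarrow> invariant_set G X \<phi> A \<Longrightarrow> openin X A' \<Longrightarrow>
      invariant_set G X \<phi> A' \<Longrightarrow> A \<inter> A' \<subseteq> V \<Longrightarrow> A \<subseteq> V \<or> A' \<subseteq> V"
  shows "\<exists>x\<in>topspace X. V = off_orbit x"
proof -
  define Y where "Y = topspace X - V"
  have VX: "V \<subseteq> topspace X"
    using openin_subset[OF V(1)] .
  have Y: "closedin X Y" "Y \<noteq> {}" "Y \<subseteq> topspace X"
    using V VX by (auto simp: Y_def)
  obtain \<B> where "countable \<B>" "\<forall>W\<in>\<B>. openin X W"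
    "\<forall>U x. openin X U \<and> x \<in> U \<longrightarrow> (\<exists>W\<in>\<B>. x \<in> W \<and> W \<subseteq> U)"
    using sc unfolding second_countable_def by (elim exE conjE) (rule that)
  then have \<B>: "countable \<B>" "\<And>W. W \<in> \<B> \<Longrightarrow> openin X W"
    "\<And>U x. openin X U \<Longrightarrow> x \<in> U \<Longrightarrow> \<exists>W\<in>\<B>. x \<in> W \<and> W \<subseteq> U"
    by simp_all
  define T where "T = subtopology X Y"
  have topT: "topspace T = Y"
    using Y(3) by (simp add: T_def inf.absorb2)
  \<comment> \<open>Members of the base that miss \<open>Y\<close> are left out: their saturations
    miss \<open>Y\<close> too and would not be dense.\<close>
  define \<D> where "\<D> = (\<lambda>W. Y \<inter> saturation W) ` {W \<in> \<B>. W \<inter> Y \<noteq> {}}"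
  have "T closure_of \<Inter>\<D> = topspace T"
  proof (rule Baire_category)
    show "completely_metrizable_space T \<or> locally_compact_space T \<and> regular_space T"
      unfolding T_def
      using locally_compact_space_closed_subset[OF locally_compact Y(1)] regular_space_subtopology
        locally_compact_Hausdorff_imp_regular_space[OF locally_compact Hausdorff] by blast
    show "countable \<D>"
      unfolding \<D>_def using \<B>(1) by (intro countable_image countable_Collect)
    fix D assume "D \<in> \<D>"
    then obtain W where W: "W \<in> \<B>" "W \<inter> Y \<noteq> {}" "D = Y \<inter> saturation W"
      by (auto simp: \<D>_def)
    have "y \<in> T closure_of D" if y: "y \<in> Y" for y
      unfolding in_closure_of
    proof (intro conjI allI impI)
      show "y \<in> topspace T"
        using y topT by simp
      fix N assume N: "y \<in> N \<and> openin T N"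
      then obtain N' where N': "openin X N'" "N = N' \<inter> Y"
        by (auto simp: T_def openin_subtopology)
      show "\<exists>z. z \<in> D \<and> z \<in> N"
      proof (rule ccontr)
        assume none: "\<not> (\<exists>z. z \<in> D \<and> z \<in> N)"
        \<comment> \<open>A common point off \<open>V\<close> could be moved into \<open>N'\<close>
          while staying in \<open>Y\<close> and in the saturation of \<open>W\<close>, against
          \<open>none\<close>. Irreducibility then forces \<open>W\<close> or \<open>N'\<close> into
          \<open>V\<close>, although both meet \<open>Y\<close>.\<close>
        have "saturation W \<inter> saturation N' \<subseteq> V"
        proof (rule ccontr)
          assume "\<not> saturation W \<inter> saturation N' \<subseteq> V"
          then obtain z where z: "z \<in> saturation W" "z \<in> saturation N'" "z \<notin> V"
            by blast
          then obtain g where g: "z \<in> topspace X" "g \<in> carrier G" "\<phi> g z \<in> N'"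
            by (auto simp: saturation_def)
          have "\<phi> g z \<in> Y"
            using z(3) g invariant_iff[OF V(2) g(2,1)] by (simp add: Y_def action_closed)
          moreover have "\<phi> g z \<in> saturation W"
            using invariantD[OF invariant_saturation g(2) z(1)] .
          ultimately show False
            using none g(3) W(3) N'(2) by blast
        qed
        then have "saturation W \<subseteq> V \<or> saturation N' \<subseteq> V"
          using W(1) N'(1) \<B>(2) by (intro irred openin_saturation invariant_saturation) auto
        moreover have "W \<subseteq> saturation W" "N' \<subseteq> saturation N'"
          using subset_saturation openin_subset \<B>(2)[OF W(1)] N'(1) by auto
        ultimately show False
          using W(2) N N'(2) y by (auto simp: Y_def)
      qed
    qed
    moreover have "openin T D"
      using openin_saturation[OF \<B>(2)[OF W(1)]] W(3) by (auto simp: T_def openin_subtopology)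
    ultimately show "openin T D \<and> T closure_of D = topspace T"
      using closure_of_subset_topspace[of T D] topT by blast
  qed
  then obtain x where x: "x \<in> Y" "x \<in> \<Inter>\<D>"
    using Y(2) topT unfolding in_closure_of set_eq_iff by (metis openin_topspace ex_in_conv)
  have xX: "x \<in> topspace X"
    using x(1) Y(3) by blast
  have "orbit_closure x \<subseteq> Y"
  proof (rule closure_of_minimal[OF _ Y(1)])
    show "orbit G \<phi> x \<subseteq> Y"
      using x(1) invariant_iff[OF V(2) _ xX] action_closed[OF _ xX] by (auto simp: orbit_def Y_def)
  qed
  moreover have "Y \<subseteq> orbit_closure x"
  proof
    fix y assume y: "y \<in> Y"
    show "y \<in> orbit_closure x"
      unfolding in_closure_of
    proof (intro conjI allI impI)
      show "y \<in> topspace X" using y Y(3) by blast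
      fix N assume "y \<in> N \<and> openin X N"
      then obtain W where W: "W \<in> \<B>" "y \<in> W" "W \<subseteq> N"
        using \<B>(3) by blast
      then have "Y \<inter> saturation W \<in> \<D>"
        using y unfolding \<D>_def by blast
      then have "x \<in> saturation W"
        using x(2) by blast
      then show "\<exists>z. z \<in> orbit G \<phi> x \<and> z \<in> N"
        using W(3) by (auto simp: saturation_def orbit_def)
    qed
  qed
  ultimately have "V = off_orbit x"
    using VX by (auto simp: off_orbit_def Y_def)
  with xX show ?thesis by blast
qed

lemma quasi_orbit_eq_iff:
  assumes "x \<in> topspace X" "y \<in> topspace X"
  shows "quasi_orbit G X \<phi> x = quasi_orbit G X \<phi> y \<longleftrightarrow> orbit_closure x = orbit_closure y"
  using assms by (auto simp: quasi_orbit_def)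

lemma off_orbit_eq_iff: "off_orbit x = off_orbit y \<longleftrightarrow> orbit_closure x = orbit_closure y"
  using closure_of_subset_topspace[of X "orbit G \<phi> x"] closure_of_subset_topspace[of X "orbit G \<phi> y"]
  by (auto simp: off_orbit_def)

text \<open>On the closed invariant set X - V the fixed points of each non-trivial element of
  \<open>S\<close> form a closed set without interior. By Baire's theorem these finitely many sets
  cannot cover the non-empty relatively open set W - V.\<close>

lemma free_point:
  assumes rtf: "residually_topologically_free G X \<phi>"
    and V: "openin X V" "invariant_set G X \<phi> V" and S: "finite S" "S \<subseteq> carrier G"
    and W: "openin X W" "\<not> W \<subseteq> V"
  shows "\<exists>y\<in>W - V. \<forall>g\<in>S. g \<noteq> \<one> \<longrightarrow> \<phi> g y \<noteq> y"
proof -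
  define Y where "Y = topspace X - V"
  have Y: "closedin X Y" "Y \<subseteq> topspace X"
    using V by (auto simp: Y_def)
  have invY: "invariant_set G X \<phi> Y"
    using invariant_iff[OF V(2)] by (intro invariant_setI) (auto simp: Y_def action_closed)
  define T where "T = subtopology X Y"
  have topT: "topspace T = Y"
    using Y(2) by (simp add: T_def inf.absorb2)
  define Fix where "Fix g = {y \<in> Y. \<phi> g y = y}" for g
  have "topologically_free G T (restr_action Y \<phi>)"
    using rtf Y(1) invY by (simp add: residually_topologically_free_def T_def)
  moreover have "invariants (topspace T) (restr_action Y \<phi>) g = Fix g" for g
    by (auto simp: invariants_def restr_action_def Fix_def topT)
  ultimately have int: "T interior_of (Fix g) = {}" if "g \<in> carrier G" "g \<noteq> \<one>" for g
    using that by (simp add: topologically_free_def)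
  have clo: "closedin T (Fix g)" if g: "g \<in> carrier G" for g
  proof -
    have "closedin X {x \<in> topspace X. \<phi> g x = x}"
      using closedin_continuous_maps_eq[OF Hausdorff action_continuous[OF g] continuous_map_id]
      by simp
    moreover have "Fix g = {x \<in> topspace X. \<phi> g x = x} \<inter> Y"
      using Y(2) by (auto simp: Fix_def)
    ultimately show ?thesis
      by (auto simp: T_def closedin_subtopology)
  qed
  have "T interior_of \<Union>(Fix ` (S - {\<one>})) = {}"
  proof (rule Baire_category_alt)
    show "completely_metrizable_space T \<or> locally_compact_space T \<and> regular_space T"
      unfolding T_def
      using locally_compact_space_closed_subset[OF locally_compact Y(1)] regular_space_subtopology
        locally_compact_Hausdorff_imp_regular_space[OF locally_compact Hausdorff] by blast
    show "countable (Fix ` (S - {\<one>}))"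
      using S(1) by (intro countable_finite) auto
  qed (use int clo S(2) in auto)
  moreover have "openin T (W \<inter> Y)"
    using W(1) by (auto simp: T_def openin_subtopology)
  moreover have "W \<inter> Y \<noteq> {}"
    using W openin_subset[OF W(1)] by (auto simp: Y_def)
  ultimately have "\<not> W \<inter> Y \<subseteq> \<Union>(Fix ` (S - {\<one>}))"
    using interior_of_maximal by fastforce
  then obtain y where "y \<in> W" "y \<in> Y" "\<And>g. g \<in> S \<Longrightarrow> g \<noteq> \<one> \<Longrightarrow> y \<notin> Fix g"
    by blast
  then show ?thesis
    by (intro bexI[of _ y]) (auto simp: Y_def Fix_def)
qed

text \<open>A function supported in \<open>N\<close> has product zero with its translates by the
  non-trivial elements of \<open>S\<close>, so compressing by it on both sides removes the
  coefficients at those elements.\<close>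

lemma displaced_neighbourhood:
  assumes S: "finite S" "S \<subseteq> carrier G" and W: "openin X W" "y \<in> W"
    and free: "\<And>g. g \<in> S \<Longrightarrow> g \<noteq> \<one> \<Longrightarrow> \<phi> g y \<noteq> y"
  obtains N where "openin X N" "y \<in> N" "N \<subseteq> W"
    "\<And>g x. g \<in> S \<Longrightarrow> g \<noteq> \<one> \<Longrightarrow> x \<in> N \<Longrightarrow> \<phi> (inv g) x \<notin> N"
proof -
  have y: "y \<in> topspace X"
    using W openin_subset by blast
  have "\<exists>N. openin X N \<and> y \<in> N \<and> (\<forall>x\<in>N. \<phi> (inv g) x \<notin> N)" if g: "g \<in> S - {\<one>}" for g
  proof -
    have gG: "g \<in> carrier G" "inv g \<in> carrier G"
      using g S(2) by auto
    have "\<phi> (inv g) y \<noteq> y"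
      using free[of g] g action_cancel_inv[OF gG(1) y] by (metis Diff_iff singletonI)
    then obtain A A' where A: "openin X A" "openin X A'" "y \<in> A" "\<phi> (inv g) y \<in> A'" "disjnt A A'"
      using Hausdorff y action_closed[OF gG(2) y] unfolding Hausdorff_space_def by metis
    show ?thesis
    proof (intro exI conjI ballI)
      show "openin X (A \<inter> {x \<in> topspace X. \<phi> (inv g) x \<in> A'})"
        using A(1,2) gG(2) by (intro openin_Int openin_preimage_action)
      show "y \<in> A \<inter> {x \<in> topspace X. \<phi> (inv g) x \<in> A'}"
        using A y by blast
      show "\<phi> (inv g) x \<notin> A \<inter> {x \<in> topspace X. \<phi> (inv g) x \<in> A'}"
        if "x \<in> A \<inter> {x \<in> topspace X. \<phi> (inv g) x \<in> A'}" for x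
        using that A(5) by (auto simp: disjnt_def)
    qed
  qed
  then obtain N where N: "\<And>g. g \<in> S - {\<one>} \<Longrightarrow> openin X (N g) \<and> y \<in> N g \<and> (\<forall>x\<in>N g. \<phi> (inv g) x \<notin> N g)"
    by metis
  show thesis
  proof (rule that[of "W \<inter> (\<Inter>g\<in>S-{\<one>}. N g) \<inter> W"])
    have "openin X (\<Inter>(insert W (N ` (S - {\<one>}))))"
      using N S(1) W(1) by (intro openin_Inter) auto
    then show "openin X (W \<inter> (\<Inter>g\<in>S-{\<one>}. N g) \<inter> W)"
      by (simp add: inf.commute inf.left_commute)
  qed (use N W in auto)
qed

end

section \<open>Topological freeness and the ideal structure\<close>

text \<open>Residual reducedness in the form used below: every quotient by \<open>J V\<close> has
  contractive coefficient maps that jointly separate its points.\<close>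

locale reduced_twisted_action = completed_twisted_action G X \<phi> u B \<iota>
    for G :: "('g, 'm) monoid_scheme" (structure) and X :: "'x topology" and \<phi> u
    and B :: "'b cnormed" and \<iota> +
  assumes coefficients: "openin X V \<Longrightarrow> invariant_set G X \<phi> V \<Longrightarrow>
    \<exists>E. coefficient_family V E"
begin

text \<open>The coefficient map at the identity is contractive and vanishes off \<open>V\<close> on
  elements supported in \<open>V\<close>, so the distance from a function to \<open>J V\<close> is
  at least its modulus at each point off \<open>V\<close>.\<close>

lemma emb_in_J_iff:
  assumes V: "openin X V" "invariant_set G X \<phi> V" and a: "a \<in> C0 X"
  shows "emb a \<in> J V \<longleftrightarrow> (\<forall>x. x \<notin> V \<longrightarrow> a x = 0)"
proof
  show "\<forall>x. x \<notin> V \<longrightarrow> a x = 0 \<Longrightarrow> emb a \<in> J V"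
    using emb_in_J[OF a] by blast
  assume aJ: "emb a \<in> J V"
  obtain E where "coefficient_family V E"
    using coefficients[OF V] by blast
  note E = coefficient_familyD[OF this]
  have "a y = 0" if y: "y \<in> topspace X - V" for y
  proof (rule ccontr)
    assume "a y \<noteq> 0"
    then have "0 < cmod (a y)"
      by simp
    then obtain c where c: "c \<in> supported V" "nrm B (emb a \<ominus>\<^bsub>B\<^esub> \<iota> c) < cmod (a y)"
      using aJ unfolding J_iff by blast
    have cF: "c \<in> carrier F" and cy: "c \<one> y = 0"
      using c(1) y by (auto simp: supported_def)
    have "E \<one> (emb a \<ominus>\<^bsub>B\<^esub> \<iota> c) y = a y"
      using E(2)[OF one_closed emb_closed[OF a] iota_closed[OF cF], of y] E(3)[OF one_closed cF y]
        E(3)[OF one_closed single_closed[OF one_closed a] y] cy by (simp add: emb_def single_def)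
    then show False
      using E(1)[OF one_closed, of "emb a \<ominus>\<^bsub>B\<^esub> \<iota> c" y] c(2) emb_closed[OF a] iota_closed[OF cF] by simp
  qed
  then show "\<forall>x. x \<notin> V \<longrightarrow> a x = 0"
    using C0_outside[OF a] by blast
qed

lemma J_subset_iff:
  assumes V: "openin X V" "invariant_set G X \<phi> V" and W: "openin X W" "invariant_set G X \<phi> W"
  shows "J V \<subseteq> J W \<longleftrightarrow> V \<subseteq> W"
proof
  assume sub: "J V \<subseteq> J W"
  show "V \<subseteq> W"
  proof
    fix x assume x: "x \<in> V"
    obtain h where h: "h \<in> C0 X" "h x = 1" "\<And>y. y \<notin> V \<Longrightarrow> h y = 0"
      using bump_at[OF V(1) x] by metis
    then have "emb h \<in> J W"
      using sub emb_in_J by blast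
    then show "x \<in> W"
      using emb_in_J_iff[OF W h(1)] h(2) by auto
  qed
qed (rule J_mono)

text \<open>Approximate \<open>b\<close> by a finitely supported \<open>c\<close>. If the
  coefficient did not vanish at \<open>y\<close>, there would be a point y' off \<open>V\<close>
  displaced by the non-trivial part of the support of \<open>c\<close>, and a bump \<open>h\<close>
  at y' for which h c h is a function close to z h^2 with a constant z. Then \<open>I\<close>
  contains an element close to h^2, hence a function not vanishing at y', although y' is outside the
  support of \<open>I\<close>.\<close>

lemma conv_identity_coefficient_zero:
  assumes rtf: "residually_topologically_free G X \<phi>" and I: "I \<in> closed_ideals B"
    and V: "V = ideal_support I"
    and E: "\<And>b y. b \<in> carrier B \<Longrightarrow> cmod (E b y) \<le> nrm B b"
      "\<And>b c y. b \<in> carrier B \<Longrightarrow> c \<in> carrier B \<Longrightarrow> E (b \<ominus>\<^bsub>B\<^esub> c) y = E b y - E c y"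
      "\<And>c y. c \<in> carrier F \<Longrightarrow> y \<in> topspace X - V \<Longrightarrow> E (\<iota> c) y = c \<one> y"
    and b: "b \<in> I" and y: "y \<in> topspace X - V"
  shows "E b y = 0"
proof (rule ccontr)
  assume "E b y \<noteq> 0"
  define \<epsilon> where "\<epsilon> = cmod (E b y) / 8"
  have \<epsilon>: "\<epsilon> > 0"
    using \<open>E b y \<noteq> 0\<close> by (simp add: \<epsilon>_def)
  have V_op: "openin X V" "invariant_set G X \<phi> V"
    unfolding V using openin_ideal_support ideal_support_invariant[OF I] by auto
  have bB: "b \<in> carrier B"
    using b B.closed_ideal_subset[OF I] by blast
  obtain c0 where c0: "c0 \<in> carrier F" "nrm B (b \<ominus>\<^bsub>B\<^esub> \<iota> c0) < \<epsilon>"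
    using iota_approx[OF bB \<epsilon>] by blast
  obtain S where S: "finite S" "S \<subseteq> carrier G" "nrm F (c0 \<ominus>\<^bsub>F\<^esub> cut S c0) < \<epsilon>"
    using cut_approx[OF c0(1) \<epsilon>] by blast
  define c where "c = cut S c0"
  have cF: "c \<in> carrier F"
    unfolding c_def using c0(1) by (rule cut_closed)
  have cB: "\<iota> c \<in> carrier B" "\<iota> c0 \<in> carrier B"
    using cF c0(1) by (auto intro: iota_closed)
  have bc: "nrm B (b \<ominus>\<^bsub>B\<^esub> \<iota> c) < 2 * \<epsilon>"
    using B.nrm_diff_triangle[OF bB cB(2,1)] nrm_iota_diff[OF c0(1) cF] c0(2) S(3)
    unfolding c_def by linarith
  have "cmod (E b y - c \<one> y) < 2 * \<epsilon>"
    using E(1)[of "b \<ominus>\<^bsub>B\<^esub> \<iota> c" y] E(2)[OF bB cB(1), of y] E(3)[OF cF y] bc bB cB by simp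
  have cy: "cmod (c \<one> y) > 5 * \<epsilon>"
  proof -
    have "cmod (E b y) - cmod (E b y - c \<one> y) \<le> cmod (c \<one> y)"
      using norm_triangle_ineq2[of "E b y" "E b y - c \<one> y"] by simp
    moreover have "cmod (E b y) = 8 * \<epsilon>"
      by (simp add: \<epsilon>_def)
    ultimately show ?thesis
      using \<open>cmod (E b y - c \<one> y) < 2 * \<epsilon>\<close> \<epsilon> by linarith
  qed
  define W0 where "W0 = {x \<in> topspace X. 5 * \<epsilon> < cmod (c \<one> x)}"
  have "openin X W0"
    using openin_continuous_map_preimage[OF continuous_map_norm[OF C0_continuous_map[OF F_C0[OF cF, of \<one>]]],
        of "{5*\<epsilon><..}"] by (simp add: W0_def)
  moreover have "\<not> W0 \<subseteq> V"
    using y cy by (auto simp: W0_def)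
  \<comment> \<open>The point \<open>y\<close> itself may be fixed by elements of \<open>S\<close>;
    freeness only supplies another point off \<open>V\<close> at which the coefficient is still
    large.\<close>
  ultimately obtain y' where y': "y' \<in> W0 - V" "\<And>g. g \<in> S \<Longrightarrow> g \<noteq> \<one> \<Longrightarrow> \<phi> g y' \<noteq> y'"
    using free_point[OF rtf V_op S(1,2)] by blast
  have y'X: "y' \<in> topspace X"
    using y' by (simp add: W0_def)
  define z where "z = c \<one> y'"
  have z: "cmod z > 5 * \<epsilon>" "z \<noteq> 0"
    using y'(1) \<epsilon> by (auto simp: W0_def z_def)
  define W where "W = {x \<in> topspace X. c \<one> x \<in> ball z \<epsilon>}"
  have W: "openin X W" "y' \<in> W"
    using openin_continuous_map_preimage[OF C0_continuous_map[OF F_C0[OF cF, of \<one>]], of "ball z \<epsilon>"] \<epsilon> y'X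
    by (auto simp: W_def z_def)
  obtain N where N: "openin X N" "y' \<in> N" "N \<subseteq> W"
    "\<And>g x. g \<in> S \<Longrightarrow> g \<noteq> \<one> \<Longrightarrow> x \<in> N \<Longrightarrow> \<phi> (inv g) x \<notin> N"
    using displaced_neighbourhood[OF S(1,2) W y'(2)] by metis
  \<comment> \<open>Two nested neighbourhoods: \<open>h\<close> is 1 wherever \<open>f\<close> does
    not vanish, so \<open>m\<close> acts on \<open>f\<close> as a unit.\<close>
  obtain N' K where N': "openin X N'" "compactin X K" "y' \<in> N'" "N' \<subseteq> K" "K \<subseteq> N"
    using locally_compact_space_neighbourhood_base[of X] Hausdorff locally_compact N(1,2)
    unfolding neighbourhood_base_of by metis
  obtain h where h: "h \<in> C0 X" "\<And>x. cmod (h x) \<le> 1" "\<And>x. x \<in> K \<Longrightarrow> h x = 1" "\<And>x. x \<notin> N \<Longrightarrow> h x = 0"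
    using C0_bump[OF locally_compact Hausdorff N'(2) N(1) N'(5)] by metis
  obtain f where f: "f \<in> C0 X" "f y' = 1" "\<And>x. x \<notin> N' \<Longrightarrow> f x = 0"
    using bump_at[OF N'(1,3)] by metis
  define m where "m = (\<lambda>x. h x * h x)"
  have mC: "m \<in> C0 X"
    unfolding m_def using h(1) by (intro C0_mult)
  have mf: "(\<lambda>x. m x * f x) = f"
  proof
    fix x show "m x * f x = f x"
      using f(3)[of x] h(3)[of x] N'(4) by (cases "x \<in> N'") (auto simp: m_def)
  qed
  define k where "k = (emb h \<otimes>\<^bsub>B\<^esub> b) \<otimes>\<^bsub>B\<^esub> emb h"
  have kI: "k \<in> I"
    unfolding k_def using I b emb_closed[OF h(1)]
    by (intro B.closed_ideal_mult_right[OF I] B.closed_ideal_mult_left[OF I])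
  have kB: "k \<in> carrier B"
    using kI B.closed_ideal_subset[OF I] by blast
  have sh: "single \<one> h \<in> carrier F"
    using h(1) by (intro single_closed) auto
  define p where "p = (\<lambda>x. h x * c \<one> x * h x)"
  have pC: "p \<in> C0 X"
    unfolding p_def using h(1) F_C0[OF cF] by (intro C0_mult)
  have "(single \<one> h \<otimes>\<^bsub>F\<^esub> c) \<otimes>\<^bsub>F\<^esub> single \<one> h = single \<one> p"
  proof (intro ext)
    fix r x
    have hc: "single \<one> h \<otimes>\<^bsub>F\<^esub> c \<in> carrier F"
      using sh cF by (rule F_mult_closed)
    have out: "((single \<one> h \<otimes>\<^bsub>F\<^esub> c) \<otimes>\<^bsub>F\<^esub> single \<one> h) r x = 0" if "r \<notin> carrier G \<or> x \<notin> topspace X"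
      using that F_mult_outside F_outside_space[OF F_mult_closed[OF hc sh]] by metis
    show "((single \<one> h \<otimes>\<^bsub>F\<^esub> c) \<otimes>\<^bsub>F\<^esub> single \<one> h) r x = single \<one> p r x"
    proof (cases "r \<in> carrier G \<and> x \<in> topspace X")
      case False
      moreover have "single \<one> p r x = 0"
        using False C0_outside[OF pC, of x] by (auto simp: single_def)
      ultimately show ?thesis using out by auto
    next
      case True
      then have eq: "((single \<one> h \<otimes>\<^bsub>F\<^esub> c) \<otimes>\<^bsub>F\<^esub> single \<one> h) r x = h x * c r x * h (\<phi> (inv r) x)"
        using mult_single_one_right[OF hc, of r x h] mult_single_one_left[OF cF h(1)] by simp
      show ?thesis
      proof (cases "r = \<one>")
        case r: True
        then show ?thesis
          using True unfolding eq by (simp add: single_def p_def action_one)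
      next
        case r: False
        \<comment> \<open>For \<open>r\<close> in \<open>S\<close> the displacement makes one of the
          two factors \<open>h\<close> vanish; for other \<open>r\<close> the truncated
          \<open>c\<close> has no coefficient.\<close>
        have "h x * c r x * h (\<phi> (inv r) x) = 0"
        proof (cases "r \<in> S \<and> x \<in> N")
          case True
          then show ?thesis using N(4)[of r x] r h(4) by simp
        next
          case False
          then show ?thesis using h(4)[of x] by (auto simp: c_def cut_def)
        qed
        then show ?thesis
          using r unfolding eq by (simp add: single_def)
      qed
    qed
  qed
  then have emb_p: "emb p = (emb h \<otimes>\<^bsub>B\<^esub> \<iota> c) \<otimes>\<^bsub>B\<^esub> emb h"
    unfolding emb_def using iota_mult[OF sh cF] iota_mult[OF F_mult_closed[OF sh cF] sh] by simp
  have h1: "nrm B (emb h) \<le> 1"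
    using nrm_emb_le[OF h(1)] sup_norm_le[of h 1] h(2) by (meson order_trans)
  have hB: "emb h \<in> carrier B" "emb p \<in> carrier B" "emb m \<in> carrier B" "emb f \<in> carrier B"
    using h(1) pC mC f(1) by (auto intro: emb_closed)
  have "emb p \<ominus>\<^bsub>B\<^esub> k = (emb h \<otimes>\<^bsub>B\<^esub> (\<iota> c \<ominus>\<^bsub>B\<^esub> b)) \<otimes>\<^bsub>B\<^esub> emb h"
    unfolding emb_p k_def using hB bB cB by (simp add: B.mult_diff_left B.mult_diff_right B.mult_closed)
  moreover have "nrm B ((emb h \<otimes>\<^bsub>B\<^esub> (\<iota> c \<ominus>\<^bsub>B\<^esub> b)) \<otimes>\<^bsub>B\<^esub> emb h) \<le> (1 * nrm B (\<iota> c \<ominus>\<^bsub>B\<^esub> b)) * 1"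
    using hB bB cB h1 by (intro B.nrm_mult_le B.mult_closed) auto
  ultimately have pk: "nrm B (emb p \<ominus>\<^bsub>B\<^esub> k) < 2 * \<epsilon>"
    using bc B.nrm_diff_commute[OF bB cB(1)] by simp
  have zmC: "(\<lambda>x. z * m x) \<in> C0 X"
    using mC by (rule C0_cmult)
  have "cmod (z * m x - p x) \<le> \<epsilon>" for x
  proof (cases "x \<in> N")
    case True
    then have "cmod (z - c \<one> x) \<le> \<epsilon>"
      using N(3) by (auto simp: W_def dist_norm)
    moreover have "z * m x - p x = (z - c \<one> x) * (h x * h x)"
      by (simp add: m_def p_def algebra_simps)
    moreover have "cmod (h x * h x) \<le> 1"
      using h(2)[of x] by (simp add: norm_mult mult_le_one)
    ultimately show ?thesis
      using mult_mono[of "cmod (z - c \<one> x)" \<epsilon> "cmod (h x * h x)" 1] \<epsilon> by (simp add: norm_mult)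
  next
    case False
    then show ?thesis using h(4)[of x] \<epsilon> by (simp add: m_def p_def)
  qed
  then have zp: "nrm B (emb (\<lambda>x. z * m x) \<ominus>\<^bsub>B\<^esub> emb p) \<le> \<epsilon>"
    unfolding emb_diff[OF zmC pC] using nrm_emb_le[OF C0_diff[OF zmC pC]] sup_norm_le[of "\<lambda>x. z * m x - p x" \<epsilon>]
    by (meson order_trans)
  have zk: "nrm B (emb (\<lambda>x. z * m x) \<ominus>\<^bsub>B\<^esub> k) < 3 * \<epsilon>"
    using B.nrm_diff_triangle[OF emb_closed[OF zmC] hB(2) kB] zp pk by linarith
  \<comment> \<open>Division by \<open>z\<close>, whose modulus exceeds 5 \<epsilon>, brings the
    distance 3 \<epsilon> below 1, as \<open>absorb_in_closed_ideal\<close> requires.\<close>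
  define w where "w = inverse z \<odot>\<^bsub>B\<^esub> k"
  have wI: "w \<in> I"
    unfolding w_def by (rule B.closed_ideal_smult[OF I kI])
  have "emb m = inverse z \<odot>\<^bsub>B\<^esub> emb (\<lambda>x. z * m x)"
    using emb_smult[OF zmC, of "inverse z"] z(2) by (simp add: mult.assoc[symmetric])
  then have "emb m \<ominus>\<^bsub>B\<^esub> w = inverse z \<odot>\<^bsub>B\<^esub> (emb (\<lambda>x. z * m x) \<ominus>\<^bsub>B\<^esub> k)"
    unfolding w_def using emb_closed[OF zmC] kB by (simp add: B.smult_diff)
  then have "nrm B (emb m \<ominus>\<^bsub>B\<^esub> w) = nrm B (emb (\<lambda>x. z * m x) \<ominus>\<^bsub>B\<^esub> k) / cmod z"
    using B.nrm_smult[of "emb (\<lambda>x. z * m x) \<ominus>\<^bsub>B\<^esub> k" "inverse z"] emb_closed[OF zmC] kB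
    by (simp add: norm_inverse divide_inverse mult.commute)
  then have "nrm B (emb m \<ominus>\<^bsub>B\<^esub> w) < 1"
    using zk z \<epsilon> by simp
  moreover have "emb m \<otimes>\<^bsub>B\<^esub> emb f = emb f"
    using emb_mult[OF mC f(1)] mf by simp
  ultimately have "emb f \<in> I"
    using B.absorb_in_closed_ideal[OF I hB(3,4) _ wI] by blast
  then have "y' \<in> V"
    using f(1,2) unfolding V ideal_support_def by force
  with y'(1) show False by blast
qed

text \<open>Right multiplication by k \<delta>_{t^-1} moves the coefficient at \<open>t\<close> to
  the identity, up to a factor of modulus 1 at \<open>y\<close>. So
  \<open>conv_identity_coefficient_zero\<close> makes all coefficients vanish off \<open>V\<close>,
  and faithfulness of the coefficient maps modulo \<open>J V\<close> gives membership in
  \<open>J V\<close>.\<close>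

theorem closed_ideal_eq_J:
  assumes rtf: "residually_topologically_free G X \<phi>" and I: "I \<in> closed_ideals B"
  shows "I = J (ideal_support I)"
proof
  define V where "V = ideal_support I"
  have V: "openin X V" "invariant_set G X \<phi> V"
    unfolding V_def using openin_ideal_support ideal_support_invariant[OF I] by auto
  show "J (ideal_support I) \<subseteq> I"
    by (rule J_subset[OF I openin_ideal_support]) (use emb_in_ideal_iff[OF I] in blast)
  obtain E where "coefficient_family V E"
    using coefficients[OF V] by blast
  note E = coefficient_familyD[OF this]
  show "I \<subseteq> J (ideal_support I)"
    unfolding V_def[symmetric]
  proof (intro subsetI E(4))
    fix b assume b: "b \<in> I"
    show bB: "b \<in> carrier B"
      using b B.closed_ideal_subset[OF I] by blast
    fix t y assume t: "t \<in> carrier G" and y: "y \<in> topspace X - V"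
    have t': "inv t \<in> carrier G" using t by simp
    have y1: "y \<in> topspace X" "\<phi> (inv t) y \<in> topspace X"
      using y t by (auto intro: action_closed)
    obtain k where k: "k \<in> C0 X" "k (\<phi> (inv t) y) = 1"
      using bump_at[OF openin_topspace y1(2)] by metis
    define s where "s = single (inv t) k"
    have s: "s \<in> carrier F" "\<iota> s \<in> carrier B"
      unfolding s_def using single_closed[OF t' k(1)] iota_closed by auto
    have "E \<one> (b \<otimes>\<^bsub>B\<^esub> \<iota> s) y = 0"
      using conv_identity_coefficient_zero[OF rtf I V_def E(1)[OF one_closed] E(2)[OF one_closed] E(3)[OF one_closed]
        B.closed_ideal_mult_right[OF I b s(2)] y] by blast
    have "cmod (E t b y) < e" if e: "e > 0" for e
    proof -
      \<comment> \<open>The relation between the two coefficients is explicit only on l^1, so it is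
        applied to an approximant \<open>c\<close>; the error \<delta> enters once directly and once
        multiplied by the norm of the image of \<open>s\<close>.\<close>
      define \<delta> where "\<delta> = e / (nrm B (\<iota> s) + 1)"
      have ns: "nrm B (\<iota> s) \<ge> 0" using s(2) by (rule B.nrm_nonneg)
      have \<delta>: "\<delta> > 0" using e ns by (simp add: \<delta>_def)
      obtain c where c: "c \<in> carrier F" "nrm B (b \<ominus>\<^bsub>B\<^esub> \<iota> c) < \<delta>"
        using iota_approx[OF bB \<delta>] by blast
      have cB: "\<iota> c \<in> carrier B" using c(1) by (rule iota_closed)
      have "(c \<otimes>\<^bsub>F\<^esub> s) \<one> y = c t y * k (\<phi> (inv t) y) * u t (inv t) y"
        using mult_single_right[OF c(1) t' one_closed y1(1), of k] t by (simp add: s_def)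
      then have cs: "cmod ((c \<otimes>\<^bsub>F\<^esub> s) \<one> y) = cmod (c t y)"
        using k(2) cocycle_norm[OF t t' y1(1)] by (simp add: norm_mult)
      have "E \<one> (\<iota> (c \<otimes>\<^bsub>F\<^esub> s)) y = (c \<otimes>\<^bsub>F\<^esub> s) \<one> y"
        by (rule E(3)[OF one_closed F_mult_closed[OF c(1) s(1)] y])
      moreover have "E \<one> (b \<otimes>\<^bsub>B\<^esub> \<iota> s \<ominus>\<^bsub>B\<^esub> \<iota> c \<otimes>\<^bsub>B\<^esub> \<iota> s) y = E \<one> (b \<otimes>\<^bsub>B\<^esub> \<iota> s) y - E \<one> (\<iota> c \<otimes>\<^bsub>B\<^esub> \<iota> s) y"
        using bB cB s by (intro E(2)) (auto intro: B.mult_closed)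
      ultimately have "cmod ((c \<otimes>\<^bsub>F\<^esub> s) \<one> y) = cmod (E \<one> (b \<otimes>\<^bsub>B\<^esub> \<iota> s \<ominus>\<^bsub>B\<^esub> \<iota> c \<otimes>\<^bsub>B\<^esub> \<iota> s) y)"
        using \<open>E \<one> (b \<otimes>\<^bsub>B\<^esub> \<iota> s) y = 0\<close> iota_mult[OF c(1) s(1)] by simp
      also have "\<dots> \<le> nrm B (b \<otimes>\<^bsub>B\<^esub> \<iota> s \<ominus>\<^bsub>B\<^esub> \<iota> c \<otimes>\<^bsub>B\<^esub> \<iota> s)"
        using bB cB s by (intro E(1)) (auto intro: B.mult_closed)
      also have "\<dots> = nrm B ((b \<ominus>\<^bsub>B\<^esub> \<iota> c) \<otimes>\<^bsub>B\<^esub> \<iota> s)"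
        using bB cB s by (simp add: B.mult_diff_left)
      also have "\<dots> \<le> \<delta> * nrm B (\<iota> s)"
        using bB cB s c(2) by (intro B.nrm_mult_le) auto
      finally have "cmod (c t y) \<le> \<delta> * nrm B (\<iota> s)"
        using cs by simp
      moreover have "cmod (E t b y - c t y) < \<delta>"
        using E(1)[OF t, of "b \<ominus>\<^bsub>B\<^esub> \<iota> c" y] E(2)[OF t bB cB, of y] E(3)[OF t c(1) y] c(2) bB cB by simp
      moreover have "cmod (E t b y) \<le> cmod (E t b y - c t y) + cmod (c t y)"
        using norm_triangle_sub[of "E t b y" "c t y"] by simp
      moreover have "\<delta> + \<delta> * nrm B (\<iota> s) = e"
      proof -
        have "\<delta> * (nrm B (\<iota> s) + 1) = e"
          using ns by (simp add: \<delta>_def)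
        then show ?thesis by (simp add: distrib_left)
      qed
      ultimately show ?thesis by linarith
    qed
    then show "E t b y = 0"
      using zero_less_norm_iff by blast
  qed
qed

text \<open>Through \<open>J_Int_subset\<close> and \<open>J_subset_iff\<close>, primeness of
  \<open>P\<close> becomes irreducibility of the complement of its support, which is then an orbit
  closure.\<close>

lemma prime_ideal_eq_J_off_orbit:
  assumes sc: "second_countable X" and rtf: "residually_topologically_free G X \<phi>"
    and P: "P \<in> prime_ideals B"
  shows "\<exists>x\<in>topspace X. P = J (off_orbit x)"
proof -
  have PI: "P \<in> closed_ideals B" and P_ne: "P \<noteq> carrier B"
    and prime: "\<And>I I'. I \<in> closed_ideals B \<Longrightarrow> I' \<in> closed_ideals B \<Longrightarrow> I \<inter> I' \<subseteq> P \<Longrightarrow> I \<subseteq> P \<or> I' \<subseteq> P"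
    using P by (auto simp: prime_ideals_def)
  define V where "V = ideal_support P"
  have PJ: "P = J V"
    unfolding V_def by (rule closed_ideal_eq_J[OF rtf PI])
  have V: "openin X V" "invariant_set G X \<phi> V"
    unfolding V_def using openin_ideal_support ideal_support_invariant[OF PI] by auto
  have "V \<noteq> topspace X"
    using PJ P_ne J_topspace by blast
  then have "\<exists>x\<in>topspace X. V = off_orbit x"
  proof (rule irreducible_imp_orbit_closure[OF sc V])
    fix A A' assume A: "openin X A" "invariant_set G X \<phi> A" and A': "openin X A'" "invariant_set G X \<phi> A'"
      and sub: "A \<inter> A' \<subseteq> V"
    have "J A \<inter> J A' \<subseteq> P"
      unfolding PJ using sub emb_in_J
      by (intro J_Int_subset[OF J_closed_ideal[OF V(2)] A(1) A'(1)]) blast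
    then have "J A \<subseteq> P \<or> J A' \<subseteq> P"
      using prime J_closed_ideal[OF A(2)] J_closed_ideal[OF A'(2)] by blast
    then show "A \<subseteq> V \<or> A' \<subseteq> V"
      unfolding PJ using J_subset_iff A A' V by blast
  qed
  then show ?thesis
    using PJ by blast
qed

text \<open>Open invariant sets lie in \<open>off_orbit x\<close> exactly when they miss
  \<open>x\<close>, and if an intersection of two sets misses \<open>x\<close>, one of them
  does.\<close>

lemma J_off_orbit_prime:
  assumes rtf: "residually_topologically_free G X \<phi>" and x: "x \<in> topspace X"
  shows "J (off_orbit x) \<in> prime_ideals B"
proof -
  note O = openin_off_orbit invariant_off_orbit[OF x]
  have "J (off_orbit x) \<noteq> carrier B"
  proof
    assume "J (off_orbit x) = carrier B"
    moreover have "invariant_set G X \<phi> (topspace X)"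
      by (intro invariant_setI) (auto simp: action_closed)
    ultimately have "topspace X \<subseteq> off_orbit x"
      using J_subset_iff[OF openin_topspace _ O] J_topspace by simp
    then show False using not_in_off_orbit x by blast
  qed
  moreover have "I \<subseteq> J (off_orbit x) \<or> I' \<subseteq> J (off_orbit x)"
    if I: "I \<in> closed_ideals B" and I': "I' \<in> closed_ideals B" and sub: "I \<inter> I' \<subseteq> J (off_orbit x)" for I I'
  proof -
    define V V' where "V = ideal_support I" and "V' = ideal_support I'"
    have V: "openin X V" "invariant_set G X \<phi> V" "I = J V"
      unfolding V_def using openin_ideal_support ideal_support_invariant[OF I] closed_ideal_eq_J[OF rtf I] by auto
    have V': "openin X V'" "invariant_set G X \<phi> V'" "I' = J V'"
      unfolding V'_def using openin_ideal_support ideal_support_invariant[OF I'] closed_ideal_eq_J[OF rtf I'] by auto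
    have VV: "openin X (V \<inter> V')" "invariant_set G X \<phi> (V \<inter> V')"
      using V V' by (auto intro!: invariant_setI dest: invariantD openin_subset)
    have "J (V \<inter> V') \<subseteq> J (off_orbit x)"
      using J_mono[of "V \<inter> V'" V] J_mono[of "V \<inter> V'" V'] sub V(3) V'(3) by blast
    then have "V \<inter> V' \<subseteq> off_orbit x"
      using J_subset_iff[OF VV O] by simp
    then have "x \<notin> V \<or> x \<notin> V'"
      using not_in_off_orbit by blast
    then have "V \<subseteq> off_orbit x \<or> V' \<subseteq> off_orbit x"
      using open_invariant_subset_off_orbit_iff[OF _ _ x] V V' by blast
    then show ?thesis
      using J_mono V(3) V'(3) by blast
  qed
  ultimately show ?thesis
    using J_closed_ideal[OF O(2)] by (auto simp: prime_ideals_def)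
qed

end

section \<open>Quotients by closed ideals\<close>

context cbanach_algebra
begin

lemma mem_coset_iff:
  assumes I: "I \<in> closed_ideals M" and x: "x \<in> carrier M"
  shows "y \<in> I +>\<^bsub>M\<^esub> x \<longleftrightarrow> y \<in> carrier M \<and> y \<ominus>\<^bsub>M\<^esub> x \<in> I"
proof
  assume "y \<in> I +>\<^bsub>M\<^esub> x"
  then obtain h where h: "h \<in> I" "y = h \<oplus>\<^bsub>M\<^esub> x"
    by (auto simp: a_r_coset_def')
  then have hM: "h \<in> carrier M"
    using closed_ideal_subset[OF I] by blast
  have "y \<ominus>\<^bsub>M\<^esub> x = h"
    using h(2) hM x by (simp add: M.minus_eq M.a_assoc M.r_neg)
  with h hM x show "y \<in> carrier M \<and> y \<ominus>\<^bsub>M\<^esub> x \<in> I"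
    by simp
next
  assume y: "y \<in> carrier M \<and> y \<ominus>\<^bsub>M\<^esub> x \<in> I"
  then have "y = (y \<ominus>\<^bsub>M\<^esub> x) \<oplus>\<^bsub>M\<^esub> x"
    using x by (simp add: diff_add_cancel)
  with y show "y \<in> I +>\<^bsub>M\<^esub> x"
    unfolding a_r_coset_def' by blast
qed

lemma mem_own_coset: "I \<in> closed_ideals M \<Longrightarrow> x \<in> carrier M \<Longrightarrow> x \<in> I +>\<^bsub>M\<^esub> x"
  using mem_coset_iff[of I x x] closed_ideal_zero[of I] diff_eq_0_iff[of x x] by simp

lemma coset_eq_iff:
  assumes I: "I \<in> closed_ideals M" and x: "x \<in> carrier M" and y: "y \<in> carrier M"
  shows "I +>\<^bsub>M\<^esub> x = I +>\<^bsub>M\<^esub> y \<longleftrightarrow> x \<ominus>\<^bsub>M\<^esub> y \<in> I"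
proof
  show "I +>\<^bsub>M\<^esub> x = I +>\<^bsub>M\<^esub> y \<Longrightarrow> x \<ominus>\<^bsub>M\<^esub> y \<in> I"
    using mem_own_coset[OF I x] mem_coset_iff[OF I y] by simp
  have half: "z \<ominus>\<^bsub>M\<^esub> y \<in> I" if "x \<ominus>\<^bsub>M\<^esub> y \<in> I" "z \<in> carrier M" "z \<ominus>\<^bsub>M\<^esub> x \<in> I" "x \<in> carrier M" "y \<in> carrier M" for x y z
    using closed_ideal_add[OF I that(3,1)] diff_add_diff[of z x y] that by simp
  assume xy: "x \<ominus>\<^bsub>M\<^esub> y \<in> I"
  have "\<ominus>\<^bsub>M\<^esub> (x \<ominus>\<^bsub>M\<^esub> y) \<in> I"
    using closed_ideal_smult[OF I xy, of "-1"] x y by (simp add: minus_eq_smult)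
  then have yx: "y \<ominus>\<^bsub>M\<^esub> x \<in> I"
    using x y by (simp add: minus_diff)
  show "I +>\<^bsub>M\<^esub> x = I +>\<^bsub>M\<^esub> y"
    using half[OF xy] half[OF yx] x y by (auto simp: mem_coset_iff[OF I])
qed

lemma carrier_quotient_algebra: "carrier (quotient_algebra M I) = (\<lambda>x. I +>\<^bsub>M\<^esub> x) ` carrier M"
  by (auto simp: quotient_algebra_def FactRing_def A_RCOSETS_def')

lemma zero_quotient_algebra:
  assumes I: "I \<in> closed_ideals M"
  shows "\<zero>\<^bsub>quotient_algebra M I\<^esub> = I +>\<^bsub>M\<^esub> \<zero>\<^bsub>M\<^esub>" "\<zero>\<^bsub>quotient_algebra M I\<^esub> = I"
proof -
  have "I +>\<^bsub>M\<^esub> \<zero>\<^bsub>M\<^esub> = I"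
    using closed_ideal_subset[OF I] by (auto simp: mem_coset_iff[OF I] M.minus_eq)
  then show "\<zero>\<^bsub>quotient_algebra M I\<^esub> = I +>\<^bsub>M\<^esub> \<zero>\<^bsub>M\<^esub>" "\<zero>\<^bsub>quotient_algebra M I\<^esub> = I"
    by (simp_all add: quotient_algebra_def FactRing_def)
qed

lemma add_quotient_algebra:
  assumes I: "I \<in> closed_ideals M" and x: "x \<in> carrier M" and y: "y \<in> carrier M"
  shows "(I +>\<^bsub>M\<^esub> x) \<oplus>\<^bsub>quotient_algebra M I\<^esub> (I +>\<^bsub>M\<^esub> y) = I +>\<^bsub>M\<^esub> (x \<oplus>\<^bsub>M\<^esub> y)"
proof -
  have "submodule I (ring_of_type_algebra :: complex ring) M"
    using I by (simp add: closed_ideals_def)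
  then have "abelian_subgroup I M"
    by (intro abelian_subgroupI3 additive_subgroup.intro M.abelian_group_axioms submodule.axioms(1))
  then show ?thesis
    using x y by (simp add: quotient_algebra_def FactRing_def abelian_subgroup.a_rcos_sum)
qed

lemma smult_quotient_algebra:
  assumes I: "I \<in> closed_ideals M" and x: "x \<in> carrier M"
  shows "c \<odot>\<^bsub>quotient_algebra M I\<^esub> (I +>\<^bsub>M\<^esub> x) = I +>\<^bsub>M\<^esub> (c \<odot>\<^bsub>M\<^esub> x)"
proof -
  have "I +>\<^bsub>M\<^esub> (c \<odot>\<^bsub>M\<^esub> a) = I +>\<^bsub>M\<^esub> (c \<odot>\<^bsub>M\<^esub> x)" if a: "a \<in> I +>\<^bsub>M\<^esub> x" for a
    using a x closed_ideal_smult[OF I, of "a \<ominus>\<^bsub>M\<^esub> x" c] by (simp add: mem_coset_iff[OF I] coset_eq_iff[OF I] smult_diff)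
  then have "(\<Union>a\<in>I +>\<^bsub>M\<^esub> x. I +>\<^bsub>M\<^esub> (c \<odot>\<^bsub>M\<^esub> a)) = (\<Union>a\<in>I +>\<^bsub>M\<^esub> x. I +>\<^bsub>M\<^esub> (c \<odot>\<^bsub>M\<^esub> x))"
    by (intro SUP_cong refl)
  also have "\<dots> = I +>\<^bsub>M\<^esub> (c \<odot>\<^bsub>M\<^esub> x)"
    using mem_own_coset[OF I x] by blast
  finally show ?thesis
    by (simp add: quotient_algebra_def)
qed

lemma mult_quotient_algebra:
  assumes I: "I \<in> closed_ideals M" and x: "x \<in> carrier M" and y: "y \<in> carrier M"
  shows "(I +>\<^bsub>M\<^esub> x) \<otimes>\<^bsub>quotient_algebra M I\<^esub> (I +>\<^bsub>M\<^esub> y) = I +>\<^bsub>M\<^esub> (x \<otimes>\<^bsub>M\<^esub> y)"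
proof -
  have "I +>\<^bsub>M\<^esub> (a \<otimes>\<^bsub>M\<^esub> b) = I +>\<^bsub>M\<^esub> (x \<otimes>\<^bsub>M\<^esub> y)" if a: "a \<in> I +>\<^bsub>M\<^esub> x" and b: "b \<in> I +>\<^bsub>M\<^esub> y" for a b
  proof -
    have ab: "a \<in> carrier M" "a \<ominus>\<^bsub>M\<^esub> x \<in> I" "b \<in> carrier M" "b \<ominus>\<^bsub>M\<^esub> y \<in> I"
      using a b x y by (auto simp: mem_coset_iff[OF I])
    have "(a \<ominus>\<^bsub>M\<^esub> x) \<otimes>\<^bsub>M\<^esub> b \<oplus>\<^bsub>M\<^esub> x \<otimes>\<^bsub>M\<^esub> (b \<ominus>\<^bsub>M\<^esub> y) \<in> I"
      using ab x by (intro closed_ideal_add[OF I] closed_ideal_mult_left[OF I] closed_ideal_mult_right[OF I])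
    then have "a \<otimes>\<^bsub>M\<^esub> b \<ominus>\<^bsub>M\<^esub> x \<otimes>\<^bsub>M\<^esub> y \<in> I"
      using ab x y by (simp add: mult_diff_left mult_diff_right diff_add_diff mult_closed)
    then show ?thesis
      using ab x y by (simp add: coset_eq_iff[OF I] mult_closed)
  qed
  then have "(\<Union>a\<in>I +>\<^bsub>M\<^esub> x. \<Union>b\<in>I +>\<^bsub>M\<^esub> y. I +>\<^bsub>M\<^esub> (a \<otimes>\<^bsub>M\<^esub> b)) =
      (\<Union>a\<in>I +>\<^bsub>M\<^esub> x. \<Union>b\<in>I +>\<^bsub>M\<^esub> y. I +>\<^bsub>M\<^esub> (x \<otimes>\<^bsub>M\<^esub> y))"
    by (intro SUP_cong refl)
  also have "\<dots> = I +>\<^bsub>M\<^esub> (x \<otimes>\<^bsub>M\<^esub> y)"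
    using mem_own_coset[OF I x] mem_own_coset[OF I y] by blast
  finally show ?thesis
    by (simp add: quotient_algebra_def FactRing_def rcoset_mult_def)
qed

lemma nrm_quotient_algebra: "nrm (quotient_algebra M I) A = Inf (nrm M ` A)"
  by (simp add: quotient_algebra_def)

lemma nrm_coset_le:
  assumes I: "I \<in> closed_ideals M" and x: "x \<in> carrier M"
  shows "nrm (quotient_algebra M I) (I +>\<^bsub>M\<^esub> x) \<le> nrm M x"
  unfolding nrm_quotient_algebra
proof (rule cInf_lower)
  show "nrm M x \<in> nrm M ` (I +>\<^bsub>M\<^esub> x)"
    using mem_own_coset[OF I x] by blast
  show "bdd_below (nrm M ` (I +>\<^bsub>M\<^esub> x))"
    using mem_coset_iff[OF I x] nrm_nonneg by (auto simp: bdd_below_def)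
qed

lemma topspace_prime_space: "topspace (prime_space M) = prime_ideals M"
proof
  have "openin (prime_space M) (topspace (prime_space M))"
    by (rule openin_topspace)
  then obtain I where "topspace (prime_space M) = {p \<in> prime_ideals M. \<not> I \<subseteq> p}"
    unfolding openin_prime_space by (elim bexE)
  then show "topspace (prime_space M) \<subseteq> prime_ideals M"
    by simp
  have "prime_ideals M = {p \<in> prime_ideals M. \<not> carrier M \<subseteq> p}"
    using closed_ideal_subset by (auto simp: prime_ideals_def)
  then have "openin (prime_space M) (prime_ideals M)"
    unfolding openin_prime_space using carrier_in_closed_ideals by blast
  then show "prime_ideals M \<subseteq> topspace (prime_space M)"
    by (rule openin_subset)
qed

end

section \<open>The quasi-orbit map\<close>

context twisted_action
begin

lemma topspace_quasi_orbit_space: "topspace (quasi_orbit_space G X \<phi>) = quasi_orbit G X \<phi> ` topspace X"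
proof
  have "openin (quasi_orbit_space G X \<phi>) (topspace (quasi_orbit_space G X \<phi>))"
    by (rule openin_topspace)
  then show "topspace (quasi_orbit_space G X \<phi>) \<subseteq> quasi_orbit G X \<phi> ` topspace X"
    unfolding quasi_orbit_space_def openin_quotient_topology by blast
  have "{x \<in> topspace X. quasi_orbit G X \<phi> x \<in> quasi_orbit G X \<phi> ` topspace X} = topspace X"
    by auto
  then have "openin (quasi_orbit_space G X \<phi>) (quasi_orbit G X \<phi> ` topspace X)"
    unfolding quasi_orbit_space_def openin_quotient_topology by simp
  then show "quasi_orbit G X \<phi> ` topspace X \<subseteq> topspace (quasi_orbit_space G X \<phi>)"
    by (rule openin_subset)
qed

lemma C0_subtopology_open_subset_iff:
  assumes V: "openin X V" and W: "openin X W"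
  shows "C0 (subtopology X V) \<subseteq> C0 (subtopology X W) \<longleftrightarrow> V \<subseteq> W"
proof
  assume sub: "C0 (subtopology X V) \<subseteq> C0 (subtopology X W)"
  show "V \<subseteq> W"
  proof
    fix x assume x: "x \<in> V"
    obtain h where h: "h \<in> C0 X" "h x = 1" "\<And>y. y \<notin> V \<Longrightarrow> h y = 0"
      using bump_at[OF V x] by metis
    then have "h \<in> C0 (subtopology X W)"
      using sub by (auto simp: C0_subtopology_open[OF Hausdorff V])
    then show "x \<in> W"
      using h(2) by (auto simp: C0_subtopology_open[OF Hausdorff W])
  qed
next
  assume "V \<subseteq> W"
  then show "C0 (subtopology X V) \<subseteq> C0 (subtopology X W)"
    unfolding C0_subtopology_open[OF Hausdorff V] C0_subtopology_open[OF Hausdorff W] by blast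
qed

lemma quasi_orbit_eq_iff_off_orbit:
  assumes "x \<in> topspace X" "y \<in> topspace X"
  shows "quasi_orbit G X \<phi> x = quasi_orbit G X \<phi> y \<longleftrightarrow> off_orbit x = off_orbit y"
  unfolding quasi_orbit_eq_iff[OF assms] off_orbit_eq_iff ..

text \<open>The description by \<open>THE\<close> is resolved because C0 of an open set determines
  the set, and the complement of an orbit closure determines the quasi-orbit.\<close>

lemma quasi_orbit_map_eq:
  assumes x: "x \<in> topspace X"
    and P: "\<And>a. a \<in> C0 X \<Longrightarrow> \<iota> (single \<one> a) \<in> P \<longleftrightarrow> (\<forall>y. y \<notin> off_orbit x \<longrightarrow> a y = 0)"
  shows "quasi_orbit_map G X \<phi> \<iota> P = quasi_orbit G X \<phi> x"
proof -
  have eq: "{a \<in> C0 X. \<iota> (at_unit G a) \<in> P} = C0 (subtopology X (off_orbit x))"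
    using P by (auto simp: C0_subtopology_open[OF Hausdorff openin_off_orbit] at_unit_eq_single)
  show ?thesis
    unfolding quasi_orbit_map_def off_orbit_def[symmetric] eq
  proof (rule the_equality)
    show "\<exists>x'\<in>topspace X. quasi_orbit G X \<phi> x = quasi_orbit G X \<phi> x' \<and>
        C0 (subtopology X (off_orbit x)) = C0 (subtopology X (off_orbit x'))"
      using x by blast
    fix c assume "\<exists>x'\<in>topspace X. c = quasi_orbit G X \<phi> x' \<and>
        C0 (subtopology X (off_orbit x)) = C0 (subtopology X (off_orbit x'))"
    then obtain x' where x': "x' \<in> topspace X" "c = quasi_orbit G X \<phi> x'"
        "C0 (subtopology X (off_orbit x)) = C0 (subtopology X (off_orbit x'))"
      by blast
    then have "off_orbit x = off_orbit x'"
      using C0_subtopology_open_subset_iff[OF openin_off_orbit[of x] openin_off_orbit[of x']]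
        C0_subtopology_open_subset_iff[OF openin_off_orbit[of x'] openin_off_orbit[of x]] by simp
    then show "c = quasi_orbit G X \<phi> x"
      using x'(2) quasi_orbit_eq_iff_off_orbit[OF x x'(1)] by simp
  qed
qed

end

context reduced_twisted_action
begin

text \<open>The prime ideals are the ideals \<open>J (off_orbit x)\<close>, and \<open>J V\<close>
  fails to lie in \<open>J (off_orbit x)\<close> exactly when \<open>x\<close> is in
  \<open>V\<close>. Hence the open sets on both sides correspond to the open invariant subsets of
  \<open>X\<close>.\<close>

theorem quasi_orbit_map_homeomorphic:
  assumes sc: "second_countable X" and rtf: "residually_topologically_free G X \<phi>"
  shows "homeomorphic_map (prime_space B) (quasi_orbit_space G X \<phi>) (quasi_orbit_map G X \<phi> \<iota>)"
proof -
  let ?q = "quasi_orbit_map G X \<phi> \<iota>" and ?o = "quasi_orbit G X \<phi>"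
  have q: "?q (J (off_orbit x)) = ?o x" if x: "x \<in> topspace X" for x
    by (rule quasi_orbit_map_eq[OF x])
      (rule emb_in_J_iff[OF openin_off_orbit invariant_off_orbit[OF x], unfolded emb_def])
  have primes: "prime_ideals B = (\<lambda>x. J (off_orbit x)) ` topspace X"
    using prime_ideal_eq_J_off_orbit[OF sc rtf] J_off_orbit_prime[OF rtf] by blast
  have J_sub: "J V \<subseteq> J (off_orbit x) \<longleftrightarrow> x \<notin> V"
    if "openin X V" "invariant_set G X \<phi> V" "x \<in> topspace X" for V x
    using J_subset_iff[OF that(1,2) openin_off_orbit invariant_off_orbit[OF that(3)]]
      open_invariant_subset_off_orbit_iff[OF that] by simp
  have same: "x \<in> V \<longleftrightarrow> y \<in> V" if "openin X V" "invariant_set G X \<phi> V" "x \<in> topspace X" "y \<in> topspace X"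
    "?o x = ?o y" for V x y
    using open_invariant_subset_off_orbit_iff[OF that(1,2,3)] open_invariant_subset_off_orbit_iff[OF that(1,2,4)]
      quasi_orbit_eq_iff_off_orbit[OF that(3,4)] that(5) by simp
  show ?thesis
  proof (rule bijective_open_imp_homeomorphic_map)
    show im: "?q ` topspace (prime_space B) = topspace (quasi_orbit_space G X \<phi>)"
      unfolding B.topspace_prime_space topspace_quasi_orbit_space primes image_image using q by simp
    show "inj_on ?q (topspace (prime_space B))"
      unfolding B.topspace_prime_space
    proof (rule inj_onI)
      fix p p' assume "p \<in> prime_ideals B" "p' \<in> prime_ideals B" and eq: "?q p = ?q p'"
      then obtain x y where x: "x \<in> topspace X" "p = J (off_orbit x)" and y: "y \<in> topspace X" "p' = J (off_orbit y)"
        unfolding primes by blast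
      have "?o x = ?o y"
        using eq q[OF x(1)] q[OF y(1)] x(2) y(2) by simp
      then have "off_orbit x = off_orbit y"
        using quasi_orbit_eq_iff_off_orbit[OF x(1) y(1)] by blast
      then show "p = p'"
        using x(2) y(2) by simp
    qed
    show "continuous_map (prime_space B) (quasi_orbit_space G X \<phi>) ?q"
      unfolding continuous_map_def
    proof (intro conjI allI impI)
      show "?q \<in> topspace (prime_space B) \<rightarrow> topspace (quasi_orbit_space G X \<phi>)"
        using im by blast
      fix W assume "openin (quasi_orbit_space G X \<phi>) W"
      then have W: "openin X {x \<in> topspace X. ?o x \<in> W}"
        by (simp add: quasi_orbit_space_def openin_quotient_topology)
      let ?V = "{x \<in> topspace X. ?o x \<in> W}"
      \<comment> \<open>Points of one orbit have the same orbit closure, so a union of quasi-orbits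
        is invariant.\<close>
      have V: "invariant_set G X \<phi> ?V"
      proof (rule invariant_setI)
        fix g x assume g: "g \<in> carrier G" and x: "x \<in> ?V"
        then have gx: "x \<in> topspace X" "\<phi> g x \<in> topspace X"
          by (auto simp: action_closed)
        have "x \<in> off_orbit y \<longleftrightarrow> \<phi> g x \<in> off_orbit y" if "y \<in> topspace X" for y
          using invariant_iff[OF invariant_off_orbit[OF that] g gx(1)] by simp
        then have "x \<notin> off_orbit (\<phi> g x)" "\<phi> g x \<notin> off_orbit x"
          using not_in_off_orbit gx by blast+
        then have "off_orbit (\<phi> g x) \<subseteq> off_orbit x" "off_orbit x \<subseteq> off_orbit (\<phi> g x)"
          using open_invariant_subset_off_orbit_iff[OF openin_off_orbit invariant_off_orbit[OF gx(2)] gx(1)]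
            open_invariant_subset_off_orbit_iff[OF openin_off_orbit invariant_off_orbit[OF gx(1)] gx(2)] by auto
        then have "?o (\<phi> g x) = ?o x"
          using quasi_orbit_eq_iff_off_orbit[OF gx(2,1)] by simp
        then show "\<phi> g x \<in> ?V"
          using x gx by simp
      qed auto
      have "{p \<in> topspace (prime_space B). ?q p \<in> W} = {p \<in> prime_ideals B. \<not> J ?V \<subseteq> p}"
        unfolding B.topspace_prime_space
      proof (rule Collect_cong, rule conj_cong[OF refl])
        fix p assume "p \<in> prime_ideals B"
        then obtain x where x: "x \<in> topspace X" "p = J (off_orbit x)"
          unfolding primes by blast
        then show "?q p \<in> W \<longleftrightarrow> \<not> J ?V \<subseteq> p"
          using J_sub[OF W V x(1)] q[OF x(1)] by simp
      qed
      then show "openin (prime_space B) {p \<in> topspace (prime_space B). ?q p \<in> W}"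
        unfolding B.openin_prime_space using J_closed_ideal[OF V] by blast
    qed
    show "open_map (prime_space B) (quasi_orbit_space G X \<phi>) ?q"
      unfolding open_map_def
    proof (intro allI impI)
      fix S assume "openin (prime_space B) S"
      then obtain I where I: "I \<in> closed_ideals B" "S = {p \<in> prime_ideals B. \<not> I \<subseteq> p}"
        unfolding B.openin_prime_space by blast
      define V where "V = ideal_support I"
      have V: "openin X V" "invariant_set G X \<phi> V"
        unfolding V_def using openin_ideal_support ideal_support_invariant[OF I(1)] by auto
      have VX: "V \<subseteq> topspace X"
        using openin_subset[OF V(1)] .
      have S: "S = (\<lambda>x. J (off_orbit x)) ` V"
        using J_sub[OF V] VX I(2) closed_ideal_eq_J[OF rtf I(1)] unfolding primes V_def[symmetric] by auto
      then have "?q ` S = ?o ` V"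
        unfolding S image_image using q VX by (intro image_cong refl) blast
      \<comment> \<open>An open invariant set contains with each point its whole quasi-orbit, so
        passing to the quotient and back does not enlarge \<open>V\<close>.\<close>
      moreover have "{x \<in> topspace X. ?o x \<in> ?o ` V} = V"
      proof
        show "V \<subseteq> {x \<in> topspace X. ?o x \<in> ?o ` V}"
          using VX by blast
        show "{x \<in> topspace X. ?o x \<in> ?o ` V} \<subseteq> V"
        proof clarify
          fix x y assume x: "x \<in> topspace X" and y: "y \<in> V" and "?o x = ?o y"
          then show "x \<in> V"
            using same[OF V x, of y] VX by blast
        qed
      qed
      ultimately show "openin (quasi_orbit_space G X \<phi>) (?q ` S)"
        using VX V(1) by (simp add: quasi_orbit_space_def openin_quotient_topology image_mono)
    qed
  qed
qed

end

section \<open>From crossed products to coefficient maps\<close>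

context twisted_action
begin

lemma family_norm_le:
  assumes "separating_family F R" and b: "b \<in> carrier F"
  shows "family_norm R b \<le> nrm F b"
proof -
  have "nrm (bounded_operators E) (\<psi> b) \<le> nrm F b" if "(E, \<psi>) \<in> R" for E \<psi>
    using assms that by (fastforce simp: separating_family_def representation_def contractive_on_def)
  then show ?thesis
    unfolding family_norm_def using F.nrm_nonneg[OF b] by (intro cSup_least) auto
qed

lemma completed_crossed_product:
  assumes "crossed_product G X \<phi> u R B \<iota>"
  shows "completed_twisted_action G X \<phi> u B \<iota>"
proof -
  have "separating_family F R" and comp: "completion_of F (family_norm R) B \<iota>"
    using assms by (auto simp: crossed_product_def)
  then show ?thesis
    using family_norm_le
    by (intro completed_twisted_action.intro completed_twisted_action_axioms.intro twisted_action_axioms)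
      (auto simp: completion_of_def)
qed

lemma restr_closed_carrier:
  assumes Y: "closedin X Y" and c: "c \<in> carrier F"
  shows "(\<lambda>g. restr Y (c g)) \<in> carrier (twisted_l1 G (subtopology X Y) \<phi>' u')"
proof -
  have "(\<lambda>g. sup_norm (restr Y (c g))) summable_on carrier G"
    using F_summable[OF c]
  proof (rule summable_on_comparison_test)
    fix g
    show "sup_norm (restr Y (c g)) \<le> sup_norm (c g)"
      by (rule sup_norm_restr_le[OF F_C0[OF c]])
    show "0 \<le> sup_norm (restr Y (c g))"
      by (rule sup_norm_nonneg[OF C0_restr_closed[OF Y F_C0[OF c]]])
  qed
  then show ?thesis
    using C0_restr_closed[OF Y F_C0[OF c]] F_outside[OF c] by (auto simp: twisted_l1_def restr_def fun_eq_iff)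
qed

text \<open>Naturality of \<open>\<kappa>\<close> gives the values of the coefficient maps on the
  image of l^1; reducedness of the quotient gives membership in \<open>J V\<close>, which is the
  zero coset.\<close>

lemma residually_reduced_imp_reduced_twisted_action:
  fixes R :: "('d cnormed \<times> (('g \<Rightarrow> 'x \<Rightarrow> complex) \<Rightarrow> 'd \<Rightarrow> 'd)) set"
  assumes rr: "residually_reduced_crossed_product G X \<phi> u R B \<iota>"
  shows "reduced_twisted_action G X \<phi> u B \<iota>"
proof -
  have cp: "crossed_product G X \<phi> u R B \<iota>"
    using rr by (simp add: residually_reduced_crossed_product_def)
  interpret completed_twisted_action G X \<phi> u B \<iota>
    by (rule completed_crossed_product[OF cp])
  show ?thesis
  proof
    fix V assume V: "openin X V" "invariant_set G X \<phi> V"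
    define Y where "Y = topspace X - V"
    have Y: "closedin X Y"
      using V(1) by (auto simp: Y_def)
    have JV: "ideal_of_open G X \<phi> u B \<iota> V = J V"
      unfolding ideal_of_open_def J_def carrier_twisted_l1_open[OF V(1)] ..
    note JI = J_closed_ideal[OF V(2)]
    let ?Q = "quotient_algebra B (J V)"
    let ?Y = "subtopology X Y" and ?\<phi> = "restr_action Y \<phi>" and ?u = "restr_cocycle Y u"
    have "\<forall>U. openin X U \<and> invariant_set G X \<phi> U \<longrightarrow>
        (let Y = topspace X - U; J = ideal_of_open G X \<phi> u B \<iota> U in
         \<exists>(S :: ('d cnormed \<times> (('g \<Rightarrow> 'x \<Rightarrow> complex) \<Rightarrow> 'd \<Rightarrow> 'd)) set) \<kappa>.
           reduced_crossed_product G (subtopology X Y) (restr_action Y \<phi>) (restr_cocycle Y u)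
             S (quotient_algebra B J) \<kappa> \<and>
           (\<forall>b\<in>carrier F. \<kappa> (\<lambda>g. restr Y (b g)) = J +>\<^bsub>B\<^esub> \<iota> b))"
      using rr unfolding residually_reduced_crossed_product_def by (elim conjE)
    from this[rule_format, OF conjI[OF V], unfolded Let_def JV, folded Y_def]
    obtain S :: "('d cnormed \<times> (('g \<Rightarrow> 'x \<Rightarrow> complex) \<Rightarrow> 'd \<Rightarrow> 'd)) set" and \<kappa>
      where "reduced_crossed_product G ?Y ?\<phi> ?u S ?Q \<kappa>"
      and \<kappa>: "\<forall>b\<in>carrier F. \<kappa> (\<lambda>g. restr Y (b g)) = J V +>\<^bsub>B\<^esub> \<iota> b"
      by (elim exE conjE) (rule that)
    then obtain E where E: "\<forall>t\<in>carrier G. coeff_extension G ?Y ?\<phi> ?u ?Q \<kappa> t (E t)"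
      "{x \<in> carrier ?Q. \<forall>t\<in>carrier G. E t x = (\<lambda>_. 0)} = {\<zero>\<^bsub>?Q\<^esub>}"
      unfolding reduced_crossed_product_def by (elim exE conjE) (rule that)
    have Q: "J V +>\<^bsub>B\<^esub> b \<in> carrier ?Q" if "b \<in> carrier B" for b
      using that by (simp add: B.carrier_quotient_algebra)
    have E_C0: "E t A \<in> C0 ?Y" and E_nrm: "sup_norm (E t A) \<le> nrm ?Q A"
      if "t \<in> carrier G" "A \<in> carrier ?Q" for t A
      using E(1) that
      by (auto simp: coeff_extension_def linear_on_def contractive_on_def C0_algebra_def)
    have E_add: "E t (A \<oplus>\<^bsub>?Q\<^esub> A') = (\<lambda>x. E t A x + E t A' x)" and E_smult: "E t (k \<odot>\<^bsub>?Q\<^esub> A) = (\<lambda>x. k * E t A x)"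
      if "t \<in> carrier G" "A \<in> carrier ?Q" "A' \<in> carrier ?Q" for t A A' k
      using E(1) that by (auto simp: coeff_extension_def linear_on_def C0_algebra_def)
    have E_iota: "E t (\<kappa> c) = c t" if "t \<in> carrier G" "c \<in> carrier (twisted_l1 G ?Y ?\<phi> ?u)" for t c
      using E(1) that by (auto simp: coeff_extension_def)
    have topY: "topspace ?Y = topspace X - V"
      by (auto simp: Y_def)
    have "coefficient_family V (\<lambda>t b. E t (J V +>\<^bsub>B\<^esub> b))"
      unfolding coefficient_family_def
    proof (intro conjI ballI allI impI)
      fix t b y assume t: "t \<in> carrier G" and b: "b \<in> carrier B"
      have "cmod (E t (J V +>\<^bsub>B\<^esub> b) y) \<le> sup_norm (E t (J V +>\<^bsub>B\<^esub> b))"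
        by (rule norm_le_sup_norm[OF E_C0[OF t Q[OF b]]])
      also have "\<dots> \<le> nrm B b"
        using E_nrm[OF t Q[OF b]] B.nrm_coset_le[OF JI b] by linarith
      finally show "cmod (E t (J V +>\<^bsub>B\<^esub> b) y) \<le> nrm B b" .
    next
      fix t b c y assume t: "t \<in> carrier G" and b: "b \<in> carrier B" and c: "c \<in> carrier B"
      have "J V +>\<^bsub>B\<^esub> (b \<ominus>\<^bsub>B\<^esub> c) = (J V +>\<^bsub>B\<^esub> b) \<oplus>\<^bsub>?Q\<^esub> (-1) \<odot>\<^bsub>?Q\<^esub> (J V +>\<^bsub>B\<^esub> c)"
        using b c by (simp add: B.smult_quotient_algebra[OF JI] B.add_quotient_algebra[OF JI]
          B.M.minus_eq B.minus_eq_smult)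
      moreover have "(-1) \<odot>\<^bsub>?Q\<^esub> (J V +>\<^bsub>B\<^esub> c) \<in> carrier ?Q"
        using c by (simp add: B.smult_quotient_algebra[OF JI] Q)
      ultimately show "E t (J V +>\<^bsub>B\<^esub> (b \<ominus>\<^bsub>B\<^esub> c)) y = E t (J V +>\<^bsub>B\<^esub> b) y - E t (J V +>\<^bsub>B\<^esub> c) y"
        using E_add[OF t Q[OF b]] E_smult[OF t Q[OF c] Q[OF c]] by simp
    next
      fix t c y assume t: "t \<in> carrier G" and c: "c \<in> carrier F" and y: "y \<in> topspace X - V"
      show "E t (J V +>\<^bsub>B\<^esub> \<iota> c) y = c t y"
        using E_iota[OF t restr_closed_carrier[OF Y c]] \<kappa> c y by (simp add: restr_def Y_def)
    next
      fix b assume b: "b \<in> carrier B" and 0: "\<forall>t\<in>carrier G. \<forall>y\<in>topspace X - V. E t (J V +>\<^bsub>B\<^esub> b) y = 0"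
      have "E t (J V +>\<^bsub>B\<^esub> b) = (\<lambda>_. 0)" if t: "t \<in> carrier G" for t
      proof
        fix y show "E t (J V +>\<^bsub>B\<^esub> b) y = 0"
          using 0 t C0_outside[OF E_C0[OF t Q[OF b]], of y] topY by blast
      qed
      then have "J V +>\<^bsub>B\<^esub> b \<in> {\<zero>\<^bsub>?Q\<^esub>}"
        using Q[OF b] unfolding E(2)[symmetric] by simp
      then have "J V +>\<^bsub>B\<^esub> b = J V"
        by (simp add: B.zero_quotient_algebra(2)[OF JI])
      then show "b \<in> J V"
        using B.mem_own_coset[OF JI b] by simp
    qed
    then show "\<exists>E. coefficient_family V E"
      by blast
  qed
qed

end

section \<open>Prime ideals from modular left ideals\<close>

context cbanach_algebra
begin

definition left_ideal :: "'a set \<Rightarrow> bool" where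
  "left_ideal L \<longleftrightarrow> L \<subseteq> carrier M \<and> \<zero>\<^bsub>M\<^esub> \<in> L \<and> (\<forall>x\<in>L. \<forall>y\<in>L. x \<oplus>\<^bsub>M\<^esub> y \<in> L) \<and>
     (\<forall>c. \<forall>x\<in>L. c \<odot>\<^bsub>M\<^esub> x \<in> L) \<and> (\<forall>b\<in>carrier M. \<forall>x\<in>L. b \<otimes>\<^bsub>M\<^esub> x \<in> L)"

lemma left_idealD:
  assumes "left_ideal L"
  shows left_ideal_carrier: "x \<in> L \<Longrightarrow> x \<in> carrier M"
    and left_ideal_zero: "\<zero>\<^bsub>M\<^esub> \<in> L"
    and left_ideal_add: "x \<in> L \<Longrightarrow> y \<in> L \<Longrightarrow> x \<oplus>\<^bsub>M\<^esub> y \<in> L"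
    and left_ideal_smult: "x \<in> L \<Longrightarrow> c \<odot>\<^bsub>M\<^esub> x \<in> L"
    and left_ideal_mult: "b \<in> carrier M \<Longrightarrow> x \<in> L \<Longrightarrow> b \<otimes>\<^bsub>M\<^esub> x \<in> L"
  using assms unfolding left_ideal_def by auto

lemma left_ideal_closed_ideal: "I \<in> closed_ideals M \<Longrightarrow> left_ideal I"
  unfolding left_ideal_def
  by (intro conjI ballI allI closed_ideal_subset closed_ideal_zero closed_ideal_add closed_ideal_smult
      closed_ideal_mult_left)

text \<open>If \<open>y = e - l\<close> has norm less than 1, then \<open>s = y + y\<^sup>2 + \<dots>\<close> satisfies
  \<open>y = s - s y = (s - s e) + s l\<close>, which lies in the left ideal.\<close>

lemma modular_unit_near_left_ideal:
  assumes L: "left_ideal L" and e: "e \<in> carrier M"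
    and mod: "\<And>b. b \<in> carrier M \<Longrightarrow> b \<ominus>\<^bsub>M\<^esub> b \<otimes>\<^bsub>M\<^esub> e \<in> L"
    and l: "l \<in> L" and near: "nrm M (e \<ominus>\<^bsub>M\<^esub> l) < 1"
  shows "e \<in> L"
proof -
  have lM: "l \<in> carrier M"
    by (rule left_ideal_carrier[OF L l])
  define y where "y = e \<ominus>\<^bsub>M\<^esub> l"
  define t where "t = nrm M y"
  have y: "y \<in> carrier M"
    using e lM by (simp add: y_def)
  have t: "0 \<le> t" "t < 1"
    using near nrm_nonneg[OF y] by (auto simp: t_def y_def)
  \<comment> \<open>The partial sums by Horner's rule: \<open>s n\<close> is y + y^2 + ... up to the
    power n + 1.\<close>
  define s where "s = rec_nat y (\<lambda>_ z. y \<oplus>\<^bsub>M\<^esub> z \<otimes>\<^bsub>M\<^esub> y)"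
  have s0: "s 0 = y" and sS: "\<And>n. s (Suc n) = y \<oplus>\<^bsub>M\<^esub> s n \<otimes>\<^bsub>M\<^esub> y"
    by (simp_all add: s_def)
  have sM: "s n \<in> carrier M" for n
    by (induction n) (auto simp: s0 sS y mult_closed)
  \<comment> \<open>This \<open>K\<close> solves t + K t = K, so the recursion preserves the bound
    \<open>K\<close> on the norms.\<close>
  define K where "K = t / (1 - t)"
  have K: "K \<ge> 0" "t + K * t = K"
    using t by (auto simp: K_def field_simps)
  have sK: "nrm M (s n) \<le> K" for n
  proof (induction n)
    case 0
    have "t * (1 - t) \<le> t * 1"
      using t by (intro mult_left_mono) auto
    then show ?case
      using t by (simp add: s0 K_def t_def[symmetric] field_simps)
  next
    case (Suc n)
    have "nrm M (s (Suc n)) \<le> nrm M y + nrm M (s n \<otimes>\<^bsub>M\<^esub> y)"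
      unfolding sS using sM y by (intro nrm_triangle mult_closed)
    also have "\<dots> \<le> t + K * t"
      using nrm_mult_le[OF sM y Suc.IH order_refl] by (simp add: t_def)
    finally show ?case
      using K by simp
  qed
  have diff: "nrm M (s (n + m) \<ominus>\<^bsub>M\<^esub> s n) \<le> t ^ n * (2 * K)" for n m
  proof (induction n)
    case 0
    have "nrm M (s m \<ominus>\<^bsub>M\<^esub> s 0) \<le> nrm M (s m) + nrm M (s 0)"
      using nrm_triangle[of "s m" "\<ominus>\<^bsub>M\<^esub> s 0"] sM by (simp add: M.minus_eq nrm_minus)
    then show ?case
      using sK[of m] sK[of 0] by simp
  next
    case (Suc n)
    have "s (Suc n + m) \<ominus>\<^bsub>M\<^esub> s (Suc n) = (y \<ominus>\<^bsub>M\<^esub> y) \<oplus>\<^bsub>M\<^esub> (s (n + m) \<otimes>\<^bsub>M\<^esub> y \<ominus>\<^bsub>M\<^esub> s n \<otimes>\<^bsub>M\<^esub> y)"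
      using sM y by (simp add: sS add_diff_add mult_closed)
    also have "\<dots> = (s (n + m) \<ominus>\<^bsub>M\<^esub> s n) \<otimes>\<^bsub>M\<^esub> y"
      using sM y diff_eq_0_iff[OF y y] by (simp add: mult_diff_left mult_closed)
    finally have "nrm M (s (Suc n + m) \<ominus>\<^bsub>M\<^esub> s (Suc n)) \<le> (t ^ n * (2 * K)) * t"
      using nrm_mult_le[OF _ y Suc.IH order_refl] sM by (simp add: t_def)
    then show ?case
      by (simp add: mult_ac)
  qed
  have lim0: "(\<lambda>n. t ^ n * (2 * K)) \<longlonglongrightarrow> 0"
    using tendsto_mult_left_zero[OF LIMSEQ_power_zero, of t "2 * K"] t by simp
  have "Cauchy_seq s"
    unfolding Cauchy_seq_def
  proof (intro conjI allI impI)
    show "range s \<subseteq> carrier M"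
      using sM by auto
    fix r :: real assume "r > 0"
    then obtain N where N: "\<And>n. n \<ge> N \<Longrightarrow> t ^ n * (2 * K) < r"
      using order_tendstoD(2)[OF lim0, of r] by (auto simp: eventually_sequentially)
    have le: "nrm M (s m \<ominus>\<^bsub>M\<^esub> s n) < r" if "n \<ge> N" "m \<ge> n" for m n
      using diff[of n "m - n"] N[OF that(1)] that(2) by simp
    have "nrm M (s m \<ominus>\<^bsub>M\<^esub> s n) < r" if "m \<ge> N" "n \<ge> N" for m n
      using le[of n m] le[of m n] that nrm_diff_commute[OF sM sM, of m n] by (cases "m \<ge> n") auto
    then show "\<exists>N. \<forall>m\<ge>N. \<forall>n\<ge>N. nrm M (s m \<ominus>\<^bsub>M\<^esub> s n) < r"
      by blast
  qed
  then obtain z where z: "limit_seq s z"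
    using Cauchy_seq_limit by blast
  have zM: "z \<in> carrier M"
    using z by (simp add: limit_seq_def)
  have "nrm M (z \<ominus>\<^bsub>M\<^esub> (y \<oplus>\<^bsub>M\<^esub> z \<otimes>\<^bsub>M\<^esub> y)) \<le> r" if r: "r > 0" for r
  proof -
    have "\<exists>N. \<forall>n\<ge>N. nrm M (s n \<ominus>\<^bsub>M\<^esub> z) < r / 2"
      using z r unfolding limit_seq_def by (meson half_gt_zero)
    then obtain N where N: "\<And>n. n \<ge> N \<Longrightarrow> nrm M (s n \<ominus>\<^bsub>M\<^esub> z) < r / 2"
      by blast
    have zyM: "y \<oplus>\<^bsub>M\<^esub> z \<otimes>\<^bsub>M\<^esub> y \<in> carrier M"
      using zM y by (simp add: mult_closed)
    have "s (Suc N) \<ominus>\<^bsub>M\<^esub> (y \<oplus>\<^bsub>M\<^esub> z \<otimes>\<^bsub>M\<^esub> y) = (y \<ominus>\<^bsub>M\<^esub> y) \<oplus>\<^bsub>M\<^esub> (s N \<otimes>\<^bsub>M\<^esub> y \<ominus>\<^bsub>M\<^esub> z \<otimes>\<^bsub>M\<^esub> y)"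
      using sM zM y by (simp add: sS add_diff_add mult_closed)
    also have "\<dots> = (s N \<ominus>\<^bsub>M\<^esub> z) \<otimes>\<^bsub>M\<^esub> y"
      using sM zM y diff_eq_0_iff[OF y y] by (simp add: mult_diff_left mult_closed)
    finally have "nrm M (s (Suc N) \<ominus>\<^bsub>M\<^esub> (y \<oplus>\<^bsub>M\<^esub> z \<otimes>\<^bsub>M\<^esub> y)) \<le> r / 2 * 1"
      using nrm_mult_le[of "s N \<ominus>\<^bsub>M\<^esub> z" y "r / 2" 1] N[of N] t sM zM y by (simp add: t_def)
    then show ?thesis
      using nrm_diff_triangle[OF zM sM zyM, of "Suc N"] nrm_diff_commute[OF zM sM, of "Suc N"] N[of "Suc N"]
      by simp
  qed
  then have "nrm M (z \<ominus>\<^bsub>M\<^esub> (y \<oplus>\<^bsub>M\<^esub> z \<otimes>\<^bsub>M\<^esub> y)) \<le> 0"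
    by (rule field_le_epsilon[of _ 0, simplified])
  then have "nrm M (z \<ominus>\<^bsub>M\<^esub> (y \<oplus>\<^bsub>M\<^esub> z \<otimes>\<^bsub>M\<^esub> y)) = 0"
    using nrm_nonneg[of "z \<ominus>\<^bsub>M\<^esub> (y \<oplus>\<^bsub>M\<^esub> z \<otimes>\<^bsub>M\<^esub> y)"] zM y by (simp add: mult_closed)
  then have zeq: "z = y \<oplus>\<^bsub>M\<^esub> z \<otimes>\<^bsub>M\<^esub> y"
    using nrm_eq_0[of "z \<ominus>\<^bsub>M\<^esub> (y \<oplus>\<^bsub>M\<^esub> z \<otimes>\<^bsub>M\<^esub> y)"] zM y diff_eq_0_iff by (simp add: mult_closed)
  have zy: "z \<otimes>\<^bsub>M\<^esub> y = z \<otimes>\<^bsub>M\<^esub> e \<ominus>\<^bsub>M\<^esub> z \<otimes>\<^bsub>M\<^esub> l"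
    using zM e lM by (simp add: y_def mult_diff_right)
  have zlM: "z \<otimes>\<^bsub>M\<^esub> e \<in> carrier M" "z \<otimes>\<^bsub>M\<^esub> l \<in> carrier M" "z \<otimes>\<^bsub>M\<^esub> y \<in> carrier M"
    using zM e lM y by (auto intro: mult_closed)
  have "y = z \<ominus>\<^bsub>M\<^esub> z \<otimes>\<^bsub>M\<^esub> y"
  proof -
    have "z \<ominus>\<^bsub>M\<^esub> z \<otimes>\<^bsub>M\<^esub> y = (y \<oplus>\<^bsub>M\<^esub> z \<otimes>\<^bsub>M\<^esub> y) \<ominus>\<^bsub>M\<^esub> z \<otimes>\<^bsub>M\<^esub> y"
      using zeq by simp
    also have "\<dots> = y"
      using y zlM by (simp add: M.minus_eq M.a_assoc M.r_neg)
    finally show ?thesis by simp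
  qed
  also have "\<dots> = (z \<ominus>\<^bsub>M\<^esub> z \<otimes>\<^bsub>M\<^esub> e) \<oplus>\<^bsub>M\<^esub> z \<otimes>\<^bsub>M\<^esub> l"
    unfolding zy using zM zlM by (simp add: M.minus_eq M.minus_add M.a_assoc)
  also have "\<dots> \<in> L"
    by (intro left_ideal_add[OF L] mod zM left_ideal_mult[OF L zM l])
  finally have "y \<oplus>\<^bsub>M\<^esub> l \<in> L"
    by (rule left_ideal_add[OF L _ l])
  then show ?thesis
    unfolding y_def using e lM by (simp add: diff_add_cancel)
qed

lemma left_ideal_sum:
  assumes L: "left_ideal L" and I: "left_ideal I"
  shows "left_ideal {l \<oplus>\<^bsub>M\<^esub> i | l i. l \<in> L \<and> i \<in> I}" (is "left_ideal ?S")
  unfolding left_ideal_def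
proof (intro conjI ballI allI)
  note D = left_idealD[OF L] left_idealD[OF I]
  show "?S \<subseteq> carrier M"
    using D by auto
  have "\<zero>\<^bsub>M\<^esub> = \<zero>\<^bsub>M\<^esub> \<oplus>\<^bsub>M\<^esub> \<zero>\<^bsub>M\<^esub>" by simp
  then show "\<zero>\<^bsub>M\<^esub> \<in> ?S"
    using left_ideal_zero[OF L] left_ideal_zero[OF I] by blast
  fix x assume "x \<in> ?S"
  then obtain l i where x: "x = l \<oplus>\<^bsub>M\<^esub> i" "l \<in> L" "i \<in> I" by blast
  have c: "l \<in> carrier M" "i \<in> carrier M"
    using x left_ideal_carrier[OF L] left_ideal_carrier[OF I] by auto
  show "k \<odot>\<^bsub>M\<^esub> x \<in> ?S" for k
    using smult_r_distr[of k l i] c left_ideal_smult[OF L x(2), of k] left_ideal_smult[OF I x(3), of k] x(1) by auto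
  show "x \<oplus>\<^bsub>M\<^esub> y \<in> ?S" if y: "y \<in> ?S" for y
  proof -
    obtain l' i' where y: "y = l' \<oplus>\<^bsub>M\<^esub> i'" "l' \<in> L" "i' \<in> I" using y by blast
    have c': "l' \<in> carrier M" "i' \<in> carrier M"
      using y left_ideal_carrier[OF L] left_ideal_carrier[OF I] by auto
    have "x \<oplus>\<^bsub>M\<^esub> y = (l \<oplus>\<^bsub>M\<^esub> l') \<oplus>\<^bsub>M\<^esub> (i \<oplus>\<^bsub>M\<^esub> i')"
      using c c' by (simp add: x(1) y(1) M.a_ac)
    then show ?thesis
      using left_ideal_add[OF L x(2) y(2)] left_ideal_add[OF I x(3) y(3)] by blast
  qed
  show "b \<otimes>\<^bsub>M\<^esub> x \<in> ?S" if b: "b \<in> carrier M" for b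
    using mult_r_distr[OF c b] left_ideal_mult[OF L b x(2)] left_ideal_mult[OF I b x(3)] x(1) by blast
qed

text \<open>Zorn's lemma gives \<open>L\<close>, maximal among the left ideals that contain
  \<open>L0\<close> and avoid \<open>e\<close>; the two-sided ideal is the annihilator of the module
  M / L. A left ideal not inside \<open>L\<close> allows \<open>e\<close> to be written as an
  element of \<open>L\<close> plus one of that ideal. This gives both closedness and
  primeness.\<close>

theorem prime_ideal_of_modular_left_ideal:
  assumes L0: "left_ideal L0" and e: "e \<in> carrier M" "e \<notin> L0"
    and mod: "\<And>b. b \<in> carrier M \<Longrightarrow> b \<ominus>\<^bsub>M\<^esub> b \<otimes>\<^bsub>M\<^esub> e \<in> L0"
  obtains L where "left_ideal L" "L0 \<subseteq> L" "e \<notin> L"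
    "{b \<in> carrier M. \<forall>c\<in>carrier M. b \<otimes>\<^bsub>M\<^esub> c \<in> L} \<in> prime_ideals M"
    "{b \<in> carrier M. \<forall>c\<in>carrier M. b \<otimes>\<^bsub>M\<^esub> c \<in> L} \<subseteq> L"
proof -
  define \<L> where "\<L> = {L. left_ideal L \<and> L0 \<subseteq> L \<and> e \<notin> L}"
  have "\<L> \<noteq> {}"
    using L0 e(2) by (auto simp: \<L>_def)
  moreover have "\<Union>C \<in> \<L>" if C: "C \<noteq> {}" "subset.chain \<L> C" for C
  proof -
    have sub: "C \<subseteq> \<L>" and chain: "\<And>A A'. A \<in> C \<Longrightarrow> A' \<in> C \<Longrightarrow> A \<subseteq> A' \<or> A' \<subseteq> A"
      using C(2) by (auto simp: subset.chain_def)
    then have li: "\<And>A. A \<in> C \<Longrightarrow> left_ideal A"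
      by (auto simp: \<L>_def)
    obtain A0 where A0: "A0 \<in> C"
      using C(1) by blast
    have "left_ideal (\<Union>C)"
      unfolding left_ideal_def
    proof (intro conjI ballI allI)
      show "\<Union>C \<subseteq> carrier M"
        using left_ideal_carrier[OF li] by blast
      show "\<zero>\<^bsub>M\<^esub> \<in> \<Union>C"
        using left_ideal_zero[OF li[OF A0]] A0 by blast
      fix x assume "x \<in> \<Union>C"
      then obtain A where A: "A \<in> C" "x \<in> A" by blast
      show "k \<odot>\<^bsub>M\<^esub> x \<in> \<Union>C" for k
        using left_ideal_smult[OF li[OF A(1)] A(2)] A(1) by blast
      show "b \<otimes>\<^bsub>M\<^esub> x \<in> \<Union>C" if "b \<in> carrier M" for b
        using left_ideal_mult[OF li[OF A(1)] that A(2)] A(1) by blast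
      show "x \<oplus>\<^bsub>M\<^esub> y \<in> \<Union>C" if "y \<in> \<Union>C" for y
      proof -
        obtain A' where A': "A' \<in> C" "y \<in> A'" using \<open>y \<in> \<Union>C\<close> by blast
        then have "\<exists>A''\<in>C. x \<in> A'' \<and> y \<in> A''"
          using A chain[OF A(1) A'(1)] by blast
        then show ?thesis
          using left_ideal_add[OF li] by blast
      qed
    qed
    then show ?thesis
      using sub A0 by (auto simp: \<L>_def)
  qed
  ultimately obtain L where L\<L>: "L \<in> \<L>" and max: "\<And>L'. L' \<in> \<L> \<Longrightarrow> L \<subseteq> L' \<Longrightarrow> L' = L"
    using subset_Zorn_nonempty[of \<L>] by blast
  have L: "left_ideal L" "L0 \<subseteq> L" "e \<notin> L"
    using L\<L> by (auto simp: \<L>_def)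
  have modL: "b \<ominus>\<^bsub>M\<^esub> b \<otimes>\<^bsub>M\<^esub> e \<in> L" if "b \<in> carrier M" for b
    using mod[OF that] L(2) by blast
  note LM = left_ideal_carrier[OF L(1)]
  have sum: "\<exists>l\<in>L. \<exists>i\<in>I. e = l \<oplus>\<^bsub>M\<^esub> i" if I: "left_ideal I" "\<not> I \<subseteq> L" for I
  proof (rule ccontr)
    assume no: "\<not> (\<exists>l\<in>L. \<exists>i\<in>I. e = l \<oplus>\<^bsub>M\<^esub> i)"
    define S where "S = {l \<oplus>\<^bsub>M\<^esub> i | l i. l \<in> L \<and> i \<in> I}"
    have LS: "L \<subseteq> S"
    proof
      fix l assume l: "l \<in> L"
      have "l = l \<oplus>\<^bsub>M\<^esub> \<zero>\<^bsub>M\<^esub>"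
        using LM[OF l] by simp
      then show "l \<in> S"
        unfolding S_def using l left_ideal_zero[OF I(1)] by blast
    qed
    have IS: "I \<subseteq> S"
    proof
      fix i assume i: "i \<in> I"
      have "i = \<zero>\<^bsub>M\<^esub> \<oplus>\<^bsub>M\<^esub> i"
        using left_ideal_carrier[OF I(1) i] by simp
      then show "i \<in> S"
        unfolding S_def using i left_ideal_zero[OF L(1)] by blast
    qed
    have "S \<in> \<L>"
      unfolding \<L>_def using left_ideal_sum[OF L(1) I(1)] LS L(2) no by (auto simp: S_def)
    then show False
      using max[OF _ LS] IS I(2) by blast
  qed
  define P where "P = {b \<in> carrier M. \<forall>c\<in>carrier M. b \<otimes>\<^bsub>M\<^esub> c \<in> L}"
  \<comment> \<open>Modularity allows cancelling \<open>e\<close> on the right modulo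
    \<open>L\<close>.\<close>
  have split: "b \<in> L" if "b \<in> carrier M" "b \<otimes>\<^bsub>M\<^esub> e \<in> L" for b
  proof -
    have "b = (b \<ominus>\<^bsub>M\<^esub> b \<otimes>\<^bsub>M\<^esub> e) \<oplus>\<^bsub>M\<^esub> b \<otimes>\<^bsub>M\<^esub> e"
      using that e(1) by (simp add: diff_add_cancel mult_closed)
    then show ?thesis
      using left_ideal_add[OF L(1) modL[OF that(1)] that(2)] by simp
  qed
  have PL: "P \<subseteq> L"
    using split e(1) by (auto simp: P_def)
  have PM: "P \<subseteq> carrier M"
    by (auto simp: P_def)
  have P_add: "x \<oplus>\<^bsub>M\<^esub> y \<in> P" if "x \<in> P" "y \<in> P" for x y
    using that left_ideal_add[OF L(1)] by (auto simp: P_def mult_l_distr)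
  have P_smult: "k \<odot>\<^bsub>M\<^esub> x \<in> P" if "x \<in> P" for x k
    using that left_ideal_smult[OF L(1)] by (auto simp: P_def mult_smult_left)
  have P_left: "b \<otimes>\<^bsub>M\<^esub> x \<in> P" if "x \<in> P" "b \<in> carrier M" for x b
    using that left_ideal_mult[OF L(1)] by (auto simp: P_def mult_assoc mult_closed)
  have P_right: "x \<otimes>\<^bsub>M\<^esub> b \<in> P" if "x \<in> P" "b \<in> carrier M" for x b
    using that by (auto simp: P_def mult_assoc mult_closed)
  have mult0: "\<zero>\<^bsub>M\<^esub> \<otimes>\<^bsub>M\<^esub> c = \<zero>\<^bsub>M\<^esub>" if "c \<in> carrier M" for c
    using mult_smult_left[of "\<zero>\<^bsub>M\<^esub>" c 0] that smult_l_null[of "\<zero>\<^bsub>M\<^esub>"] smult_l_null[of "\<zero>\<^bsub>M\<^esub> \<otimes>\<^bsub>M\<^esub> c"]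
    by (simp add: mult_closed)
  have P0: "\<zero>\<^bsub>M\<^esub> \<in> P"
    using left_ideal_zero[OF L(1)] by (simp add: P_def mult0)
  have absorb: "I \<subseteq> P" if "I \<in> closed_ideals M" "I \<subseteq> L" for I
    using that closed_ideal_subset[OF that(1)] closed_ideal_mult_right[OF that(1)] by (auto simp: P_def)
  let ?C = "norm_topology M closure_of P"
  have "norm_topology M closure_of carrier M = carrier M"
    by (metis closure_of_topspace topspace_norm_topology)
  then have C: "?C \<in> closed_ideals M"
    using closed_ideals_closure[OF PM P0 P_add P_smult order_refl] P_left P_right by blast
  \<comment> \<open>Otherwise e = l + i with \<open>i\<close> in the closure of \<open>P\<close>.
    Replacing \<open>i\<close> by a nearby element of \<open>P\<close> puts an element of
    \<open>L\<close> at distance less than 1 from \<open>e\<close>, which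
    \<open>modular_unit_near_left_ideal\<close> forbids. Closedness of \<open>L\<close> itself is
    never invoked.\<close>
  have "?C \<subseteq> L"
  proof (rule ccontr)
    assume "\<not> ?C \<subseteq> L"
    then obtain l i where li: "l \<in> L" "i \<in> ?C" "e = l \<oplus>\<^bsub>M\<^esub> i"
      using sum[OF left_ideal_closed_ideal[OF C]] by blast
    have "\<forall>r>0. \<exists>p\<in>P. p \<in> carrier M \<and> nrm M (i \<ominus>\<^bsub>M\<^esub> p) < r"
      using li(2) by (simp add: closure_of_norm_topology)
    then obtain p where p: "p \<in> P" "nrm M (i \<ominus>\<^bsub>M\<^esub> p) < 1"
      using zero_less_one by blast
    have "e \<ominus>\<^bsub>M\<^esub> (l \<oplus>\<^bsub>M\<^esub> p) = i \<ominus>\<^bsub>M\<^esub> p"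
    proof -
      have c: "l \<in> carrier M" "i \<in> carrier M" "p \<in> carrier M"
        using li(1) LM p(1) PM closed_ideal_subset[OF C] li(2) by auto
      then show ?thesis
        using diff_eq_0_iff[of l l] by (simp add: li(3) add_diff_add)
    qed
    moreover have "l \<oplus>\<^bsub>M\<^esub> p \<in> L"
      using left_ideal_add[OF L(1) li(1)] p(1) PL by blast
    ultimately show False
      using modular_unit_near_left_ideal[OF L(1) e(1) modL] p(2) L(3) by metis
  qed
  then have "?C \<subseteq> P"
    using absorb[OF C] by blast
  moreover have "P \<subseteq> ?C"
    using PM by (intro closure_of_subset) simp
  ultimately have PC: "P \<in> closed_ideals M"
    using C by (simp add: subset_antisym)
  have "P \<in> prime_ideals M"
    unfolding prime_ideals_def
  proof (intro CollectI conjI ballI impI DiffI)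
    show "P \<in> closed_ideals M" by fact
    show "P \<notin> {carrier M}"
      using e(1) L(3) PL by blast
    fix I I' assume I: "I \<in> closed_ideals M" and I': "I' \<in> closed_ideals M" and II: "I \<inter> I' \<subseteq> P"
    show "I \<subseteq> P \<or> I' \<subseteq> P"
    proof (rule disjCI)
      assume "\<not> I' \<subseteq> P"
      then have "\<not> I' \<subseteq> L"
        using absorb[OF I'] by blast
      then obtain l i where li: "l \<in> L" "i \<in> I'" "e = l \<oplus>\<^bsub>M\<^esub> i"
        using sum[OF left_ideal_closed_ideal[OF I']] by blast
      have iM: "i \<in> carrier M"
        using li(2) closed_ideal_subset[OF I'] by blast
      \<comment> \<open>Modulo \<open>L\<close>, an element x of \<open>I\<close> equals x e = x l +
        x i, where x l is in \<open>L\<close>, and x i lies in both ideals, hence in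
        \<open>P\<close> and in \<open>L\<close>.\<close>
      have "I \<subseteq> L"
      proof
        fix x assume x: "x \<in> I"
        then have xM: "x \<in> carrier M"
          using closed_ideal_subset[OF I] by blast
        have "x \<otimes>\<^bsub>M\<^esub> i \<in> L"
          using closed_ideal_mult_right[OF I x iM] closed_ideal_mult_left[OF I' li(2) xM] II PL by blast
        then have "x \<otimes>\<^bsub>M\<^esub> e \<in> L"
          unfolding li(3) mult_r_distr[OF LM[OF li(1)] iM xM]
          by (intro left_ideal_add[OF L(1)] left_ideal_mult[OF L(1) xM li(1)])
        then show "x \<in> L"
          by (rule split[OF xM])
      qed
      then show "I \<subseteq> P"
        by (rule absorb[OF I])
    qed
  qed
  then show thesis
    using that[OF L] PL unfolding P_def by blast
qed

end

section \<open>The left regular representation\<close>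

definition left_regular :: "'a cnormed \<Rightarrow> 'a \<Rightarrow> 'a \<Rightarrow> 'a" where
  "left_regular M b = (\<lambda>y\<in>carrier M. b \<otimes>\<^bsub>M\<^esub> y)"

context cbanach_algebra
begin

lemma left_regular_closed:
  assumes b: "b \<in> carrier M"
  shows "left_regular M b \<in> carrier (bounded_operators M)"
proof -
  have "linear_on M M (left_regular M b)"
    using b by (simp add: linear_on_def left_regular_def mult_closed mult_r_distr mult_smult_right)
  moreover have "\<forall>x\<in>carrier M. nrm M (left_regular M b x) \<le> nrm M b * nrm M x"
    using b by (simp add: left_regular_def nrm_mult)
  ultimately show ?thesis
    by (auto simp: bounded_operators_def left_regular_def)
qed

lemma left_regular_bdd:
  assumes b: "b \<in> carrier M" and A: "A = {nrm M (left_regular M b x) | x. x \<in> carrier M \<and> nrm M x \<le> 1}"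
  shows "\<And>r. r \<in> A \<Longrightarrow> r \<le> nrm M b" and "A \<noteq> {}"
proof -
  show "r \<le> nrm M b" if "r \<in> A" for r
    using that b nrm_mult_le[OF b _ order_refl, of _ 1] by (auto simp: A left_regular_def)
  show "A \<noteq> {}"
    unfolding A using nrm_zero by force
qed

lemma nrm_left_regular_le: "b \<in> carrier M \<Longrightarrow> nrm (bounded_operators M) (left_regular M b) \<le> nrm M b"
  unfolding bounded_operators_def cnormed.simps
  by (rule cSup_least[OF left_regular_bdd(2)[OF _ refl] left_regular_bdd(1)[OF _ refl]])

lemma nrm_left_regular_ge:
  assumes b: "b \<in> carrier M" and x: "x \<in> carrier M" "nrm M x \<le> 1"
  shows "nrm M (b \<otimes>\<^bsub>M\<^esub> x) \<le> nrm (bounded_operators M) (left_regular M b)"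
proof -
  have "nrm M (left_regular M b x) \<le> Sup {nrm M (left_regular M b x) | x. x \<in> carrier M \<and> nrm M x \<le> 1}"
    using left_regular_bdd(1)[OF b refl] x by (intro cSup_upper) (auto simp: bdd_above_def)
  then show ?thesis
    using x by (simp add: bounded_operators_def left_regular_def)
qed

text \<open>Right approximate units of norm at most 1 make left multiplication isometric. This is
  how the l^1 norm becomes the norm of a family of representations.\<close>

lemma nrm_left_regular:
  assumes b: "b \<in> carrier M"
    and unit: "\<And>r. r > 0 \<Longrightarrow> \<exists>x\<in>carrier M. nrm M x \<le> 1 \<and> nrm M (b \<ominus>\<^bsub>M\<^esub> b \<otimes>\<^bsub>M\<^esub> x) < r"
  shows "nrm (bounded_operators M) (left_regular M b) = nrm M b"
proof (rule antisym[OF nrm_left_regular_le[OF b]])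
  show "nrm M b \<le> nrm (bounded_operators M) (left_regular M b)"
  proof (rule field_le_epsilon)
    fix r :: real assume "r > 0"
    then obtain x where x: "x \<in> carrier M" "nrm M x \<le> 1" "nrm M (b \<ominus>\<^bsub>M\<^esub> b \<otimes>\<^bsub>M\<^esub> x) < r"
      using unit by blast
    then show "nrm M b \<le> nrm (bounded_operators M) (left_regular M b) + r"
      using nrm_le_diff[OF b mult_closed[OF b x(1)]] nrm_left_regular_ge[OF b x(1,2)] by linarith
  qed
qed

lemma representation_left_regular: "representation M M (left_regular M)"
proof -
  have "left_regular M (x \<oplus>\<^bsub>M\<^esub> y) = left_regular M x \<oplus>\<^bsub>bounded_operators M\<^esub> left_regular M y"
    "left_regular M (x \<otimes>\<^bsub>M\<^esub> y) = left_regular M x \<otimes>\<^bsub>bounded_operators M\<^esub> left_regular M y"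
    if "x \<in> carrier M" "y \<in> carrier M" for x y
    using that by (auto simp: left_regular_def bounded_operators_def fun_eq_iff mult_l_distr compose_def
        mult_assoc mult_closed)
  moreover have "left_regular M (c \<odot>\<^bsub>M\<^esub> x) = c \<odot>\<^bsub>bounded_operators M\<^esub> left_regular M x"
    if "x \<in> carrier M" for c x
    using that by (auto simp: left_regular_def bounded_operators_def fun_eq_iff mult_smult_left)
  ultimately show ?thesis
    unfolding representation_def
    using left_regular_closed nrm_left_regular_le cbanach_space_axioms
    by (simp add: linear_on_def multiplicative_on_def contractive_on_def)
qed

end

text \<open>Copies an algebra along an injection into another type. The representation spaces and
  the completion in the theorem have their carriers in the type \<open>'v\<close>, and this puts
  l^1(G, C0(X)) there.\<close>

definition transport :: "'a cnormed \<Rightarrow> ('a \<Rightarrow> 'b) \<Rightarrow> 'b cnormed" where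
  "transport A f = (let h = the_inv_into (carrier A) f in \<lparr>
     carrier = f ` carrier A,
     monoid.mult = (\<lambda>x y. f (h x \<otimes>\<^bsub>A\<^esub> h y)),
     one = undefined,
     ring.zero = f \<zero>\<^bsub>A\<^esub>,
     add = (\<lambda>x y. f (h x \<oplus>\<^bsub>A\<^esub> h y)),
     smult = (\<lambda>c x. f (c \<odot>\<^bsub>A\<^esub> h x)),
     nrm = (\<lambda>x. nrm A (h x)) \<rparr>)"

lemma isometric_iso_transport:
  assumes A: "cbanach_algebra A" and f: "inj_on f (carrier A)"
  shows "isometric_iso A (transport A f) f"
proof -
  interpret A: cbanach_algebra A by fact
  have "the_inv_into (carrier A) f (f x) = x" if "x \<in> carrier A" for x
    using the_inv_into_f_f[OF f that] .
  then show ?thesis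
    using f by (auto simp: isometric_iso_def transport_def Let_def linear_on_def multiplicative_on_def
        bij_betw_def)
qed

section \<open>The algebra \<open>\<ell>\<^sup>1(G, C\<^sub>0(X))\<close> as a residually reduced crossed product\<close>

lemma linear_on_compose:
  "linear_on A B f \<Longrightarrow> linear_on B C g \<Longrightarrow> linear_on A C (\<lambda>x. g (f x))"
  unfolding linear_on_def by (simp add: Pi_iff)

context twisted_action
begin

lemma completed_of_iso:
  assumes iso: "isometric_iso F B \<iota>"
  shows "completed_twisted_action G X \<phi> u B \<iota>"
proof -
  interpret B: cbanach_algebra B
    by (rule cbanach_algebra_isometric_iso[OF F_cbanach_algebra iso])
  have "\<iota> ` carrier F = carrier B"
    using iso by (simp add: isometric_iso_def bij_betw_def)
  moreover have "norm_topology B closure_of carrier B = carrier B"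
    by (metis closure_of_topspace B.topspace_norm_topology)
  ultimately show ?thesis
    using iso B.cbanach_algebra_axioms
    by (intro completed_twisted_action.intro completed_twisted_action_axioms.intro twisted_action_axioms)
      (simp_all add: isometric_iso_def)
qed

text \<open>The family consists of left multiplication on a copy \<open>E\<close> of the algebra
  inside \<open>'v\<close>, so its norm is the l^1 norm. \<open>D\<close> may have another type,
  because the lemma is also applied to quotient algebras, whose elements are sets.\<close>

lemma reduced_crossed_product_of_iso:
  fixes j :: "('g \<Rightarrow> 'x \<Rightarrow> complex) \<Rightarrow> 'v" and D :: "'d cnormed"
  assumes j: "inj j" and iso: "isometric_iso F D \<kappa>"
  shows "\<exists>S :: ('v cnormed \<times> (('g \<Rightarrow> 'x \<Rightarrow> complex) \<Rightarrow> 'v \<Rightarrow> 'v)) set.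
    reduced_crossed_product G X \<phi> u S D \<kappa>"
proof -
  define E where "E = transport F j"
  have isoE: "isometric_iso F E j"
    unfolding E_def using j by (intro isometric_iso_transport F_cbanach_algebra inj_on_subset[OF j]) auto
  interpret E: completed_twisted_action G X \<phi> u E j
    by (rule completed_of_iso[OF isoE])
  interpret D: completed_twisted_action G X \<phi> u D \<kappa>
    by (rule completed_of_iso[OF iso])
  have nrm_j: "nrm E (j b) = nrm F b" if "b \<in> carrier F" for b
    using isoE that by (simp add: isometric_iso_def)
  have \<kappa>: "bij_betw \<kappa> (carrier F) (carrier D)" "\<And>b. b \<in> carrier F \<Longrightarrow> nrm D (\<kappa> b) = nrm F b"
    using iso by (auto simp: isometric_iso_def)
  define \<psi> where "\<psi> b = left_regular E (j b)" for b
  have nrm_\<psi>: "nrm (bounded_operators E) (\<psi> b) = nrm F b" if b: "b \<in> carrier F" for b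
    unfolding \<psi>_def nrm_j[OF b, symmetric]
  proof (rule E.B.nrm_left_regular[OF E.iota_closed[OF b]])
    fix r :: real assume r: "r > 0"
    obtain a where a: "a \<in> C0 X" "\<And>x. cmod (a x) \<le> 1" "nrm F (b \<ominus>\<^bsub>F\<^esub> b \<otimes>\<^bsub>F\<^esub> single \<one> a) < r"
      using approx_unit_right[OF b r] by metis
    have s: "single \<one> a \<in> carrier F"
      using a(1) by (intro single_closed) auto
    have "nrm E (j (single \<one> a)) \<le> 1"
      unfolding nrm_j[OF s] nrm_single[OF one_closed] using a(2) by (rule sup_norm_le)
    moreover have "nrm E (j b \<ominus>\<^bsub>E\<^esub> j b \<otimes>\<^bsub>E\<^esub> j (single \<one> a)) < r"
      using E.nrm_iota_diff[OF b F_mult_closed[OF b s]] a(3) unfolding E.iota_mult[OF b s] by linarith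
    ultimately show "\<exists>x\<in>carrier E. nrm E x \<le> 1 \<and> nrm E (j b \<ominus>\<^bsub>E\<^esub> j b \<otimes>\<^bsub>E\<^esub> x) < r"
      using E.iota_closed[OF s] by blast
  qed
  have rep: "representation F E \<psi>"
    unfolding representation_def
  proof (intro conjI)
    have L: "representation E E (left_regular E)"
      by (rule E.B.representation_left_regular)
    show "cbanach_space E"
      using L by (simp add: representation_def)
    show lin: "linear_on F (bounded_operators E) \<psi>"
      unfolding \<psi>_def by (rule linear_on_compose[OF E.linear]) (use L in \<open>simp only: representation_def\<close>)
    show "multiplicative_on F (bounded_operators E) \<psi>"
      unfolding multiplicative_on_def \<psi>_def
    proof (intro ballI)
      fix b c assume b: "b \<in> carrier F" and c: "c \<in> carrier F"
      have "multiplicative_on E (bounded_operators E) (left_regular E)"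
        using L unfolding representation_def by blast
      then show "left_regular E (j (b \<otimes>\<^bsub>F\<^esub> c)) = left_regular E (j b) \<otimes>\<^bsub>bounded_operators E\<^esub> left_regular E (j c)"
        using E.iota_closed[OF b] E.iota_closed[OF c] unfolding E.iota_mult[OF b c] multiplicative_on_def by blast
    qed
    show "contractive_on F (bounded_operators E) \<psi>"
      using nrm_\<psi> unfolding contractive_on_def by (simp del: F_simps)
  qed
  have lin: "linear_on F (bounded_operators E) \<psi>"
    using rep unfolding representation_def by blast
  define S where "S = {(E, \<psi>)}"
  have "separating_family F S"
    unfolding separating_family_def S_def
  proof (intro conjI ballI impI)
    fix b c assume b: "b \<in> carrier F" and c: "c \<in> carrier F" and "b \<noteq> c"
    have "\<psi> b \<noteq> \<psi> c"
    proof
      assume eq: "\<psi> b = \<psi> c"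
      have mc: "(-1) \<odot>\<^bsub>F\<^esub> c \<in> carrier F" "(-1) \<odot>\<^bsub>F\<^esub> b \<in> carrier F"
        using b c F_smult_closed by blast+
      have eq2: "\<psi> ((-1) \<odot>\<^bsub>F\<^esub> c) = \<psi> ((-1) \<odot>\<^bsub>F\<^esub> b)"
        using lin b c eq unfolding linear_on_def by metis
      have "b \<ominus>\<^bsub>F\<^esub> c = b \<oplus>\<^bsub>F\<^esub> (-1) \<odot>\<^bsub>F\<^esub> c" "b \<ominus>\<^bsub>F\<^esub> b = b \<oplus>\<^bsub>F\<^esub> (-1) \<odot>\<^bsub>F\<^esub> b"
        using b c unfolding F.M.minus_eq by (simp_all only: F.minus_eq_smult)
      then have "\<psi> (b \<ominus>\<^bsub>F\<^esub> c) = \<psi> (b \<ominus>\<^bsub>F\<^esub> b)"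
        using lin b mc eq2 unfolding linear_on_def by metis
      then have "nrm F (b \<ominus>\<^bsub>F\<^esub> c) = nrm F (b \<ominus>\<^bsub>F\<^esub> b)"
        using nrm_\<psi> b c by (metis F.M.minus_closed)
      also have "b \<ominus>\<^bsub>F\<^esub> b = \<zero>\<^bsub>F\<^esub>"
        using F.diff_eq_0_iff[OF b b] by blast
      finally have "b \<ominus>\<^bsub>F\<^esub> c = \<zero>\<^bsub>F\<^esub>"
        using F.nrm_eq_0[OF F.M.minus_closed[OF b c]] F.nrm_zero by metis
      then show False
        using F.diff_eq_0_iff[OF b c] \<open>b \<noteq> c\<close> by blast
    qed
    then show "\<exists>(E, \<psi>)\<in>{(E, \<psi>)}. \<psi> b \<noteq> \<psi> c"
      by simp
  qed (use rep in auto)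
  moreover have fn: "family_norm S b = nrm F b" if b: "b \<in> carrier F" for b
  proof -
    have "family_norm S b = Sup {0, nrm F b}"
      by (simp add: family_norm_def S_def nrm_\<psi>[OF b] del: F_simps)
    also have "\<dots> = nrm F b"
      using F.nrm_nonneg[OF b] by (subst cSup_eq_Max) (simp_all del: F_simps)
    finally show ?thesis .
  qed
  moreover have "completion_of F (family_norm S) D \<kappa>"
    unfolding completion_of_def
    using D.linear D.multiplicative D.dense D.algebra_B \<kappa>(2) fn by simp
  moreover define K where "K t d = the_inv_into (carrier F) \<kappa> d t" for t d
  have K: "K t (\<kappa> b) = b t" if "b \<in> carrier F" for t b
    unfolding K_def using \<kappa>(1) that by (simp add: bij_betw_def the_inv_into_f_f)
  have D_im: "\<exists>b\<in>carrier F. d = \<kappa> b" if "d \<in> carrier D" for d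
    using \<kappa>(1) that by (auto simp: bij_betw_def)
  have coeff: "coeff_extension G X \<phi> u D \<kappa> t (K t)" for t
    unfolding coeff_extension_def
  proof (intro conjI ballI)
    show "linear_on D (C0_algebra X) (K t)"
      unfolding linear_on_def
    proof (intro conjI ballI allI funcsetI)
      fix d assume "d \<in> carrier D"
      then obtain b where b: "b \<in> carrier F" "d = \<kappa> b" using D_im by blast
      then show "K t d \<in> carrier (C0_algebra X)"
        using F_C0[OF b(1)] by (simp add: K C0_algebra_def)
      show "K t (k \<odot>\<^bsub>D\<^esub> d) = k \<odot>\<^bsub>C0_algebra X\<^esub> K t d" for k
        using b(1) K[OF F_smult_closed[OF b(1)], of t k] D.iota_smult[OF b(1), of k] K[OF b(1)]
        by (simp add: b(2) C0_algebra_def)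
      fix d' assume "d' \<in> carrier D"
      then obtain b' where b': "b' \<in> carrier F" "d' = \<kappa> b'" using D_im by blast
      show "K t (d \<oplus>\<^bsub>D\<^esub> d') = K t d \<oplus>\<^bsub>C0_algebra X\<^esub> K t d'"
        using K[OF F_add_closed[OF b(1) b'(1)], of t] D.iota_add[OF b(1) b'(1)] K[OF b(1)] K[OF b'(1)]
        by (simp add: b(2) b'(2) C0_algebra_def)
    qed
    show "contractive_on D (C0_algebra X) (K t)"
      unfolding contractive_on_def
    proof
      fix d assume "d \<in> carrier D"
      then obtain b where b: "b \<in> carrier F" "d = \<kappa> b" using D_im by blast
      then show "nrm (C0_algebra X) (K t d) \<le> nrm D d"
        using sup_norm_le_nrm[OF b(1), of t] K[OF b(1)] \<kappa>(2)[OF b(1)] by (simp add: C0_algebra_def del: F_simps)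
    qed
  qed (rule K)
  moreover have "{d \<in> carrier D. \<forall>t\<in>carrier G. K t d = (\<lambda>_. 0)} = {\<zero>\<^bsub>D\<^esub>}"
  proof
    show "{d \<in> carrier D. \<forall>t\<in>carrier G. K t d = (\<lambda>_. 0)} \<subseteq> {\<zero>\<^bsub>D\<^esub>}"
    proof
      fix d assume d: "d \<in> {d \<in> carrier D. \<forall>t\<in>carrier G. K t d = (\<lambda>_. 0)}"
      then obtain b where b: "b \<in> carrier F" "d = \<kappa> b" using D_im by blast
      have "b t x = 0" for t x
        using d K[OF b(1), of t] b F_outside[OF b(1), of t x] by (cases "t \<in> carrier G") (auto simp: fun_eq_iff)
      then have "b = (\<lambda>g x. 0)"
        by (simp add: fun_eq_iff)
      then show "d \<in> {\<zero>\<^bsub>D\<^esub>}"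
        using b(2) D.iota_zero by simp
    qed
    show "{\<zero>\<^bsub>D\<^esub>} \<subseteq> {d \<in> carrier D. \<forall>t\<in>carrier G. K t d = (\<lambda>_. 0)}"
      using K[OF F_zero_closed] D.iota_zero by auto
  qed
  ultimately have "reduced_crossed_product G X \<phi> u S D \<kappa>"
    unfolding reduced_crossed_product_def crossed_product_def by (intro conjI exI[of _ K] exI[of _ "K \<one>"]) auto
  then show ?thesis
    by blast
qed

lemma twisted_action_restrict:
  assumes Y: "closedin X Y" and invY: "invariant_set G X \<phi> Y"
  shows "twisted_action G (subtopology X Y) (restr_action Y \<phi>) (restr_cocycle Y u)"
proof -
  have YX: "Y \<subseteq> topspace X"
    using closedin_subset[OF Y] .
  have topY: "topspace (subtopology X Y) = Y"
    using YX by (simp add: inf.absorb2)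
  have r: "restr_action Y \<phi> g y = \<phi> g y" if "y \<in> Y" for g y
    using that by (simp add: restr_action_def)
  have im: "\<phi> g ` Y = Y" if "g \<in> carrier G" for g
    using invY that by (simp add: invariant_set_def)
  have Bij: "restr_action Y \<phi> g \<in> Bij Y" if g: "g \<in> carrier G" for g
  proof -
    have "inj_on (\<phi> g) Y"
      using inj_prop[OF g] YX by (rule inj_on_subset)
    then show ?thesis
      using im[OF g] by (auto simp: Bij_def restr_action_def bij_betw_def)
  qed
  have "group_hom G (BijGroup Y) (restr_action Y \<phi>)"
  proof (intro group_hom.intro group_hom_axioms.intro group_G group_BijGroup homI)
    show "restr_action Y \<phi> g \<in> carrier (BijGroup Y)" if "g \<in> carrier G" for g
      using Bij[OF that] by (simp add: BijGroup_def)
    fix g h assume g: "g \<in> carrier G" and h: "h \<in> carrier G"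
    have "restr_action Y \<phi> (g \<otimes> h) = compose Y (restr_action Y \<phi> g) (restr_action Y \<phi> h)"
    proof
      fix y show "restr_action Y \<phi> (g \<otimes> h) y = compose Y (restr_action Y \<phi> g) (restr_action Y \<phi> h) y"
        using g h YX im[OF h] composition_rule[of y g h]
        by (auto simp: compose_def restr_action_def)
    qed
    then show "restr_action Y \<phi> (g \<otimes> h) = restr_action Y \<phi> g \<otimes>\<^bsub>BijGroup Y\<^esub> restr_action Y \<phi> h"
      using Bij[OF g] Bij[OF h] by (simp add: BijGroup_def)
  qed
  moreover have "homeomorphic_map (subtopology X Y) (subtopology X Y) (restr_action Y \<phi> g)"
    if g: "g \<in> carrier G" for g
  proof (rule homeomorphic_map_eq)
    have "\<phi> g ` (topspace X \<inter> Y) = topspace X \<inter> Y"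
      using im[OF g] YX by (simp add: inf.absorb2)
    then show "homeomorphic_map (subtopology X Y) (subtopology X Y) (\<phi> g)"
      using homeomorphic_map_subtopologies[OF homeo[OF g]] by blast
  qed (simp add: restr_action_def)
  moreover have "restr_cocycle Y u \<in> cocycles G (subtopology X Y) (restr_action Y \<phi>)"
    unfolding cocycles_def topY
  proof (intro CollectI conjI ballI)
    fix s t assume s: "s \<in> carrier G" and t: "t \<in> carrier G"
    have "continuous_map (subtopology X Y) euclidean (restr Y (u s t))"
      using continuous_map_from_subtopology[OF cocycle_continuous[OF s t], of Y]
      by (rule continuous_map_eq) (simp add: restr_def)
    then show "restr_cocycle Y u s t \<in> Cu (subtopology X Y)"
      using cocycle_norm[OF s t] YX by (auto simp: Cu_def restr_cocycle_def restr_def subset_iff)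
  next
    fix r s t x assume rst: "r \<in> carrier G" "s \<in> carrier G" "t \<in> carrier G" and x: "x \<in> Y"
    have "\<phi> (inv r) x \<in> Y"
      using invariantD[OF invY _ x] rst by simp
    then show "dual_action G (subtopology X Y) (restr_action Y \<phi>) r (restr_cocycle Y u s t) x *
        restr_cocycle Y u r (s \<otimes> t) x = restr_cocycle Y u r s x * restr_cocycle Y u (r \<otimes> s) t x"
      using cocycle_eq[OF rst, of x] x YX rst
      by (auto simp: dual_action_def restr_cocycle_def restr_def r)
  next
    fix x assume "x \<in> Y"
    then show "restr_cocycle Y u \<one> \<one> x = 1"
      using YX cocycle_one_one by (auto simp: restr_cocycle_def restr_def)
  qed
  ultimately show ?thesis
    unfolding twisted_action_def twisted_action_axioms_def homeo_action_def homeo_action_axioms_def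
      group_action_def topY
    using locally_compact_space_closed_subset[OF locally_compact Y] Hausdorff_space_subtopology[OF Hausdorff]
    by blast
qed

end

context completed_twisted_action
begin

text \<open>Evaluating a coefficient at a point is contractive for the l^1 norm, so the elements
  supported in \<open>V\<close> are already closed and the closure in \<open>J\<close> adds
  nothing.\<close>

lemma J_of_iso:
  assumes iso: "isometric_iso F B \<iota>" and b: "b \<in> carrier F"
  shows "\<iota> b \<in> J V \<longleftrightarrow> b \<in> supported V"
proof
  show "b \<in> supported V \<Longrightarrow> \<iota> b \<in> J V"
    by (rule iota_supported_in_J)
  assume bJ: "\<iota> b \<in> J V"
  have "b g x = 0" if x: "x \<notin> V" for g x
  proof (rule ccontr)
    assume "b g x \<noteq> 0"
    then have "0 < cmod (b g x)" by simp
    then obtain c where c: "c \<in> supported V" "nrm B (\<iota> b \<ominus>\<^bsub>B\<^esub> \<iota> c) < cmod (b g x)"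
      using bJ unfolding J_iff by blast
    have cF: "c \<in> carrier F" and cx: "c g x = 0"
      using c(1) x by (auto simp: supported_def)
    have d: "b \<ominus>\<^bsub>F\<^esub> c \<in> carrier F"
      using b cF by (rule F.M.minus_closed)
    have "\<forall>x\<in>carrier F. nrm B (\<iota> x) = nrm F x"
      using iso unfolding isometric_iso_def by blast
    then have "nrm B (\<iota> b \<ominus>\<^bsub>B\<^esub> \<iota> c) = nrm F (b \<ominus>\<^bsub>F\<^esub> c)"
      unfolding iota_diff[OF b cF, symmetric] using d by blast
    moreover have "cmod ((b \<ominus>\<^bsub>F\<^esub> c) g x) \<le> nrm F (b \<ominus>\<^bsub>F\<^esub> c)"
      using norm_le_sup_norm[OF F_C0[OF d], of g x] sup_norm_le_nrm[OF d, of g] by linarith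
    moreover have "(b \<ominus>\<^bsub>F\<^esub> c) g x = b g x"
      using F_diff[OF b cF] cx by simp
    ultimately show False
      using c(2) by simp
  qed
  with b show "b \<in> supported V"
    by (simp add: supported_def)
qed

text \<open>Restricting coefficients to the closed set \<open>Y\<close> identifies the quotient by
  \<open>J V\<close> isometrically with l^1(G, C0(Y)), and
  \<open>reduced_crossed_product_of_iso\<close> over \<open>Y\<close> makes it a reduced crossed
  product.\<close>

theorem residually_reduced_of_iso:
  fixes j :: "('g \<Rightarrow> 'x \<Rightarrow> complex) \<Rightarrow> 'v"
  assumes j: "inj j" and iso: "isometric_iso F B \<iota>"
  shows "\<exists>R :: ('v cnormed \<times> (('g \<Rightarrow> 'x \<Rightarrow> complex) \<Rightarrow> 'v \<Rightarrow> 'v)) set.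
    residually_reduced_crossed_product G X \<phi> u R B \<iota>"
proof -
  obtain R :: "('v cnormed \<times> (('g \<Rightarrow> 'x \<Rightarrow> complex) \<Rightarrow> 'v \<Rightarrow> 'v)) set"
    where "reduced_crossed_product G X \<phi> u R B \<iota>"
    using reduced_crossed_product_of_iso[OF j iso] by blast
  then have "crossed_product G X \<phi> u R B \<iota>"
    by (simp add: reduced_crossed_product_def)
  moreover have "\<exists>(S :: ('v cnormed \<times> (('g \<Rightarrow> 'x \<Rightarrow> complex) \<Rightarrow> 'v \<Rightarrow> 'v)) set) \<kappa>.
      reduced_crossed_product G (subtopology X (topspace X - V)) (restr_action (topspace X - V) \<phi>)
        (restr_cocycle (topspace X - V) u) S (quotient_algebra B (ideal_of_open G X \<phi> u B \<iota> V)) \<kappa> \<and>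
      (\<forall>b\<in>carrier F. \<kappa> (\<lambda>g. restr (topspace X - V) (b g)) = ideal_of_open G X \<phi> u B \<iota> V +>\<^bsub>B\<^esub> \<iota> b)"
    if V: "openin X V" "invariant_set G X \<phi> V" for V
  proof -
    define Y where "Y = topspace X - V"
    have Y: "closedin X Y"
      using V(1) by (auto simp: Y_def)
    have invY: "invariant_set G X \<phi> Y"
      using invariant_iff[OF V(2)] by (intro invariant_setI) (auto simp: Y_def action_closed)
    have YX: "Y \<subseteq> topspace X" by (auto simp: Y_def)
    have topY: "topspace (subtopology X Y) = Y"
      using YX by (simp add: inf.absorb2)
    interpret Y: twisted_action G "subtopology X Y" "restr_action Y \<phi>" "restr_cocycle Y u"
      by (rule twisted_action_restrict[OF Y invY])
    have JV: "ideal_of_open G X \<phi> u B \<iota> V = J V"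
      unfolding ideal_of_open_def J_def carrier_twisted_l1_open[OF V(1)] ..
    note JI = J_closed_ideal[OF V(2)]
    let ?Q = "quotient_algebra B (J V)"
    define \<rho> where "\<rho> b = (\<lambda>g. restr Y (b g))" for b :: "'g \<Rightarrow> 'x \<Rightarrow> complex"
    have \<rho>F: "\<rho> b \<in> carrier Y.F" if "b \<in> carrier F" for b
      unfolding \<rho>_def using restr_closed_carrier[OF Y that] .
    have \<rho>_nrm: "nrm Y.F (\<rho> b) \<le> nrm F b" if b: "b \<in> carrier F" for b
      using Y.nrm_F_le[OF \<rho>F[OF b] F_summable[OF b]] sup_norm_restr_le[OF F_C0[OF b]]
      by (simp add: \<rho>_def)
    have \<rho>_eq: "\<rho> b = \<rho> c \<longleftrightarrow> b \<ominus>\<^bsub>F\<^esub> c \<in> supported V" if b: "b \<in> carrier F" and c: "c \<in> carrier F" for b c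
    proof -
      have "\<rho> b = \<rho> c \<longleftrightarrow> (\<forall>g. \<forall>x\<in>Y. b g x = c g x)"
        by (auto simp: \<rho>_def restr_def fun_eq_iff)
      also have "\<dots> \<longleftrightarrow> (\<forall>g x. x \<notin> V \<longrightarrow> b g x - c g x = 0)"
      proof (intro iffI allI impI)
        fix g x assume eq: "\<forall>g. \<forall>x\<in>Y. b g x = c g x" and x: "x \<notin> V"
        show "b g x - c g x = 0"
        proof (cases "x \<in> topspace X")
          case True
          then show ?thesis
            using eq x by (simp add: Y_def)
        next
          case False
          then show ?thesis
            using F_outside_space[OF b False, of g] F_outside_space[OF c False, of g] by simp
        qed
      qed (simp add: Y_def)
      finally have "\<rho> b = \<rho> c \<longleftrightarrow> (\<forall>g x. x \<notin> V \<longrightarrow> b g x - c g x = 0)" .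
      then show ?thesis
        using F.M.minus_closed[OF b c] F_diff[OF b c] by (simp add: supported_def)
    qed
    \<comment> \<open>Coefficients are lifted one by one with \<open>C0_extend\<close>; none of them
      gains norm, so neither does their sum.\<close>
    have surj: "\<exists>b\<in>carrier F. \<rho> b = c \<and> nrm F b \<le> nrm Y.F c" if c: "c \<in> carrier Y.F" for c
    proof -
      have "\<exists>b. b \<in> C0 X \<and> restr Y b = c g \<and> sup_norm b \<le> sup_norm (c g)" for g
        using C0_extend[OF locally_compact Hausdorff Y Y.F_C0[OF c, of g]] by metis
      then obtain e where e: "\<And>g. e g \<in> C0 X" "\<And>g. restr Y (e g) = c g" "\<And>g. sup_norm (e g) \<le> sup_norm (c g)"
        by metis
      define b where "b g = (if g \<in> carrier G then e g else (\<lambda>x. 0))" for g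
      have bF: "b \<in> carrier F"
        by (rule F_carrierI[OF _ _ Y.F_summable[OF c]]) (use e in \<open>auto simp: b_def\<close>)
      have "\<rho> b = c"
        using e(2) Y.F_outside[OF c] by (auto simp: \<rho>_def b_def restr_def fun_eq_iff)
      moreover have "nrm F b \<le> nrm Y.F c"
        using nrm_F_le[OF bF Y.F_summable[OF c]] e(3) by (simp add: b_def)
      ultimately show ?thesis
        using bF by blast
    qed
    \<comment> \<open>The coset depends only on the restriction to \<open>Y\<close>, so any lift of
      \<open>c\<close> may be chosen.\<close>
    define \<kappa> where "\<kappa> c = J V +>\<^bsub>B\<^esub> \<iota> (SOME b. b \<in> carrier F \<and> \<rho> b = c)" for c
    have coset: "J V +>\<^bsub>B\<^esub> \<iota> b = J V +>\<^bsub>B\<^esub> \<iota> c \<longleftrightarrow> \<rho> b = \<rho> c" if b: "b \<in> carrier F" and c: "c \<in> carrier F" for b c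
      unfolding B.coset_eq_iff[OF JI iota_closed[OF b] iota_closed[OF c]] iota_diff[OF b c, symmetric]
        J_of_iso[OF iso F.M.minus_closed[OF b c]] \<rho>_eq[OF b c] ..
    have \<kappa>: "\<kappa> (\<rho> b) = J V +>\<^bsub>B\<^esub> \<iota> b" if b: "b \<in> carrier F" for b
    proof -
      have "\<exists>b'. b' \<in> carrier F \<and> \<rho> b' = \<rho> b"
        using b by blast
      from someI_ex[OF this] show ?thesis
        unfolding \<kappa>_def using coset[OF _ b] by blast
    qed
    have im_B: "\<exists>b\<in>carrier F. y = \<iota> b" if "y \<in> carrier B" for y
      using iso that by (auto simp: isometric_iso_def bij_betw_def)
    have \<rho>_add: "\<rho> (b \<oplus>\<^bsub>F\<^esub> c) = \<rho> b \<oplus>\<^bsub>Y.F\<^esub> \<rho> c" and \<rho>_smult: "\<rho> (k \<odot>\<^bsub>F\<^esub> b) = k \<odot>\<^bsub>Y.F\<^esub> \<rho> b" for b c k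
      by (auto simp: \<rho>_def restr_def fun_eq_iff)
    have \<rho>_mult: "\<rho> (b \<otimes>\<^bsub>F\<^esub> c) = \<rho> b \<otimes>\<^bsub>Y.F\<^esub> \<rho> c" if b: "b \<in> carrier F" and c: "c \<in> carrier F" for b c
    proof (intro ext)
      fix r x
      show "\<rho> (b \<otimes>\<^bsub>F\<^esub> c) r x = (\<rho> b \<otimes>\<^bsub>Y.F\<^esub> \<rho> c) r x"
      proof (cases "r \<in> carrier G \<and> x \<in> Y")
        case True
        then have x: "x \<in> topspace X" and r: "r \<in> carrier G" using YX by auto
        have "Y.conv_term (\<rho> b) (\<rho> c) r s x = conv_term b c r s x" if s: "s \<in> carrier G" for s
        proof -
          have "\<phi> (inv s) x \<in> Y"
            using invariantD[OF invY, of "inv s" x] s True by simp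
          then show ?thesis
            using True unfolding Y.conv_term_def conv_term_def Y.dual_apply[unfolded topY, OF conjunct2[OF True]]
              dual_apply[OF x] by (simp add: \<rho>_def restr_def restr_cocycle_def restr_action_def)
        qed
        then have "(\<rho> b \<otimes>\<^bsub>Y.F\<^esub> \<rho> c) r x = (b \<otimes>\<^bsub>F\<^esub> c) r x"
          unfolding F_mult[OF r] Y.F_mult[OF r] by (rule infsum_cong)
        then show ?thesis
          using True by (simp add: \<rho>_def restr_def)
      next
        case False
        have "(\<rho> b \<otimes>\<^bsub>Y.F\<^esub> \<rho> c) r x = 0"
          using False Y.F_outside_space[OF Y.F_mult_closed[OF \<rho>F[OF b] \<rho>F[OF c]], of x r]
            Y.F_outside[OF Y.F_mult_closed[OF \<rho>F[OF b] \<rho>F[OF c]], of r x] unfolding topY by blast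
        then show ?thesis
          using False F_outside[OF F_mult_closed[OF b c], of r x] by (auto simp: \<rho>_def restr_def)
      qed
    qed
    \<comment> \<open>The lift from \<open>surj\<close> bounds the quotient norm from above. From
      below, all members of the coset restrict to the same element, and restriction is
      contractive.\<close>
    have nrm_Q: "nrm ?Q (J V +>\<^bsub>B\<^esub> \<iota> b) = nrm Y.F (\<rho> b)" if b: "b \<in> carrier F" for b
    proof (rule antisym)
      obtain b' where b': "b' \<in> carrier F" "\<rho> b' = \<rho> b" "nrm F b' \<le> nrm Y.F (\<rho> b)"
        using surj[OF \<rho>F[OF b]] by blast
      have "nrm ?Q (J V +>\<^bsub>B\<^esub> \<iota> b) = nrm ?Q (J V +>\<^bsub>B\<^esub> \<iota> b')"
        using coset[OF b b'(1)] b'(2) by simp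
      also have "\<dots> \<le> nrm B (\<iota> b')"
        by (rule B.nrm_coset_le[OF JI iota_closed[OF b'(1)]])
      also have "\<dots> \<le> nrm Y.F (\<rho> b)"
        using contractive[OF b'(1)] b'(3) by linarith
      finally show "nrm ?Q (J V +>\<^bsub>B\<^esub> \<iota> b) \<le> nrm Y.F (\<rho> b)" .
      show "nrm Y.F (\<rho> b) \<le> nrm ?Q (J V +>\<^bsub>B\<^esub> \<iota> b)"
        unfolding B.nrm_quotient_algebra
      proof (rule cInf_greatest)
        show "nrm B ` (J V +>\<^bsub>B\<^esub> \<iota> b) \<noteq> {}"
          using B.mem_own_coset[OF JI iota_closed[OF b]] by blast
        fix r assume "r \<in> nrm B ` (J V +>\<^bsub>B\<^esub> \<iota> b)"
        then obtain y where y: "y \<in> J V +>\<^bsub>B\<^esub> \<iota> b" "r = nrm B y" by blast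
        then have yB: "y \<in> carrier B" "y \<ominus>\<^bsub>B\<^esub> \<iota> b \<in> J V"
          using B.mem_coset_iff[OF JI iota_closed[OF b]] by auto
        obtain b' where b': "b' \<in> carrier F" "y = \<iota> b'"
          using im_B[OF yB(1)] by blast
        have "\<rho> b' = \<rho> b"
          using yB(2) coset[OF b'(1) b] B.coset_eq_iff[OF JI iota_closed[OF b'(1)] iota_closed[OF b]] b'(2) by simp
        then show "nrm Y.F (\<rho> b) \<le> r"
          using \<rho>_nrm[OF b'(1)] iso b' y(2) by (simp add: isometric_iso_def del: F_simps Y.F_simps)
      qed
    qed
    have "isometric_iso Y.F ?Q \<kappa>"
      unfolding isometric_iso_def
    proof (intro conjI ballI)
      show "bij_betw \<kappa> (carrier Y.F) (carrier ?Q)"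
        unfolding bij_betw_def
      proof
        show "inj_on \<kappa> (carrier Y.F)"
        proof (rule inj_onI)
          fix c c' assume c: "c \<in> carrier Y.F" "c' \<in> carrier Y.F" and eq: "\<kappa> c = \<kappa> c'"
          obtain b b' where b: "b \<in> carrier F" "\<rho> b = c" "b' \<in> carrier F" "\<rho> b' = c'"
            using surj[OF c(1)] surj[OF c(2)] by blast
          then show "c = c'"
            using eq \<kappa>[OF b(1)] \<kappa>[OF b(3)] coset[OF b(1,3)] by simp
        qed
        show "\<kappa> ` carrier Y.F = carrier ?Q"
          unfolding B.carrier_quotient_algebra
        proof
          show "\<kappa> ` carrier Y.F \<subseteq> (\<lambda>x. J V +>\<^bsub>B\<^esub> x) ` carrier B"
          proof clarify
            fix c assume "c \<in> carrier Y.F"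
            then obtain b where "b \<in> carrier F" "\<rho> b = c" using surj by blast
            then show "\<kappa> c \<in> (\<lambda>x. J V +>\<^bsub>B\<^esub> x) ` carrier B"
              using \<kappa> iota_closed by blast
          qed
          show "(\<lambda>x. J V +>\<^bsub>B\<^esub> x) ` carrier B \<subseteq> \<kappa> ` carrier Y.F"
          proof clarify
            fix y assume "y \<in> carrier B"
            then obtain b where b: "b \<in> carrier F" "y = \<iota> b" using im_B by blast
            then show "J V +>\<^bsub>B\<^esub> y \<in> \<kappa> ` carrier Y.F"
              using \<kappa>[OF b(1)] \<rho>F[OF b(1)] by (metis imageI)
          qed
        qed
      qed
      have "\<rho> (\<lambda>g x. 0) = (\<lambda>g x. 0)"
        by (simp add: \<rho>_def restr_def)
      then show "\<kappa> \<zero>\<^bsub>Y.F\<^esub> = \<zero>\<^bsub>?Q\<^esub>"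
        using \<kappa>[OF F_zero_closed] iota_zero B.zero_quotient_algebra(1)[OF JI] by simp
      show "linear_on Y.F ?Q \<kappa>"
        unfolding linear_on_def
      proof (intro conjI ballI allI funcsetI)
        fix c assume "c \<in> carrier Y.F"
        then obtain b where b: "b \<in> carrier F" "c = \<rho> b" using surj by metis
        show "\<kappa> c \<in> carrier ?Q"
          unfolding B.carrier_quotient_algebra b(2) \<kappa>[OF b(1)] using iota_closed[OF b(1)] by blast
        show "\<kappa> (k \<odot>\<^bsub>Y.F\<^esub> c) = k \<odot>\<^bsub>?Q\<^esub> \<kappa> c" for k
          unfolding b(2) \<rho>_smult[symmetric] \<kappa>[OF b(1)] \<kappa>[OF F_smult_closed[OF b(1)]] iota_smult[OF b(1)]
            B.smult_quotient_algebra[OF JI iota_closed[OF b(1)]] ..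
        fix c' assume "c' \<in> carrier Y.F"
        then obtain b' where b': "b' \<in> carrier F" "c' = \<rho> b'" using surj by metis
        show "\<kappa> (c \<oplus>\<^bsub>Y.F\<^esub> c') = \<kappa> c \<oplus>\<^bsub>?Q\<^esub> \<kappa> c'"
          unfolding b(2) b'(2) \<rho>_add[symmetric] \<kappa>[OF b(1)] \<kappa>[OF b'(1)] \<kappa>[OF F_add_closed[OF b(1) b'(1)]]
            iota_add[OF b(1) b'(1)] B.add_quotient_algebra[OF JI iota_closed[OF b(1)] iota_closed[OF b'(1)]] ..
      qed
      show "multiplicative_on Y.F ?Q \<kappa>"
        unfolding multiplicative_on_def
      proof (intro ballI)
        fix c c' assume "c \<in> carrier Y.F" "c' \<in> carrier Y.F"
        then obtain b b' where b: "b \<in> carrier F" "c = \<rho> b" and b': "b' \<in> carrier F" "c' = \<rho> b'"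
          using surj by metis
        show "\<kappa> (c \<otimes>\<^bsub>Y.F\<^esub> c') = \<kappa> c \<otimes>\<^bsub>?Q\<^esub> \<kappa> c'"
          unfolding b(2) b'(2) \<rho>_mult[OF b(1) b'(1), symmetric] \<kappa>[OF b(1)] \<kappa>[OF b'(1)]
            \<kappa>[OF F_mult_closed[OF b(1) b'(1)]] iota_mult[OF b(1) b'(1)]
            B.mult_quotient_algebra[OF JI iota_closed[OF b(1)] iota_closed[OF b'(1)]] ..
      qed
      fix c assume "c \<in> carrier Y.F"
      then obtain b where b: "b \<in> carrier F" "c = \<rho> b" using surj by metis
      then show "nrm ?Q (\<kappa> c) = nrm Y.F c"
        using \<kappa>[OF b(1)] nrm_Q[OF b(1)] by simp
    qed
    from Y.reduced_crossed_product_of_iso[OF j this]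
    obtain S :: "('v cnormed \<times> (('g \<Rightarrow> 'x \<Rightarrow> complex) \<Rightarrow> 'v \<Rightarrow> 'v)) set"
      where "reduced_crossed_product G (subtopology X Y) (restr_action Y \<phi>) (restr_cocycle Y u) S ?Q \<kappa>"
      by blast
    moreover have "\<forall>b\<in>carrier F. \<kappa> (\<lambda>g. restr Y (b g)) = J V +>\<^bsub>B\<^esub> \<iota> b"
      using \<kappa> by (simp add: \<rho>_def)
    ultimately show ?thesis
      unfolding JV Y_def[symmetric] by blast
  qed
  ultimately have "residually_reduced_crossed_product G X \<phi> u R B \<iota>"
    unfolding residually_reduced_crossed_product_def Let_def by blast
  then show ?thesis
    by blast
qed

end

section \<open>Prime ideals over a point with nontrivial isotropy\<close>

text \<open>A number z \<noteq> 1 of modulus 1 with z^k = 1 whenever t^k = 1 makes t^k \<mapsto> z^k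
  a well-defined character of the group generated by \<open>t\<close>. Take -1 for infinite order
  and a primitive n-th root of unity for order n.\<close>

lemma (in group) exists_character_on_powers:
  assumes t: "t \<in> carrier G" "t \<noteq> \<one>"
  obtains \<theta> :: "'a \<Rightarrow> complex" and z :: complex
  where "\<theta> \<one> = 1" "z \<noteq> 1" "\<forall>g. cmod (\<theta> g) \<le> 1" "\<forall>g\<in>carrier G. \<theta> (g \<otimes> t) = z * \<theta> g"
    "\<forall>g. \<theta> g \<noteq> 0 \<longrightarrow> (\<exists>k::int. g = t [^] k)"
proof -
  have "\<exists>z::complex. cmod z = 1 \<and> z \<noteq> 1 \<and> (\<forall>k::int. t [^] k = \<one> \<longrightarrow> z powi k = 1)"
  proof (cases "ord t = 0")
    case True
    then show ?thesis
      using int_pow_eq_id[OF t(1)] by (intro exI[of _ "- 1"]) auto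
  next
    case False
    define n where "n = ord t"
    have n: "n \<ge> 2"
      using False ord_eq_1[OF t(1)] t(2) by (auto simp: n_def le_less numeral_2_eq_2)
    define z where "z = cis (2 * pi / n)"
    have zn: "z ^ n = 1"
      using n by (simp add: z_def Complex.DeMoivre)
    have "z \<noteq> 1"
    proof
      assume "z = 1"
      then have "cos (2 * pi / n) = 1"
        by (simp add: z_def complex_eq_iff)
      then obtain k :: int where "2 * pi / n = real_of_int k * 2 * pi"
        unfolding cos_one_2pi_int by blast
      then have "1 / n = real_of_int k"
        using n by (simp add: field_simps)
      then have "real_of_int (k * int n) = real_of_int 1"
        using n by (simp add: field_simps)
      then have "k * int n = 1"
        unfolding of_int_eq_iff .
      then show False
        using n zmult_eq_1_iff[of k "int n"] by auto
    qed
    moreover have "z powi k = 1" if k: "t [^] k = \<one>" for k :: int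
    proof -
      obtain q where "k = int n * q"
        using k int_pow_eq_id[OF t(1)] by (auto simp: n_def dvd_def)
      then show ?thesis
        using zn by (simp add: power_int_mult)
    qed
    ultimately show ?thesis
      by (intro exI[of _ z]) (auto simp: z_def)
  qed
  then obtain z :: complex where z: "cmod z = 1" "z \<noteq> 1" "\<And>k::int. t [^] k = \<one> \<Longrightarrow> z powi k = 1"
    by blast
  have z0: "z \<noteq> 0"
    using z(1) by auto
  define \<theta> where "\<theta> g = (if \<exists>k::int. g = t [^] k then z powi (SOME k. g = t [^] k) else 0)" for g
  have \<theta>: "\<theta> (t [^] k) = z powi k" for k :: int
  proof -
    define l :: int where "l = (SOME l. t [^] k = t [^] l)"
    have l: "t [^] k = t [^] l"
      unfolding l_def by (rule someI[of "\<lambda>l. t [^] k = t [^] l" k, OF refl])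
    have "t [^] (k - l) = \<one>"
      using t(1) l by (simp add: int_pow_diff)
    then have "z powi (k - l) = 1"
      by (rule z(3))
    then have "z powi k = z powi l"
      using z0 by (simp add: power_int_diff)
    then show ?thesis
      by (auto simp: \<theta>_def l_def)
  qed
  show thesis
  proof (rule that[of \<theta> z])
    show "\<theta> \<one> = 1"
      using \<theta>[of 0] by simp
    show "\<forall>g. cmod (\<theta> g) \<le> 1"
      using z(1) by (simp add: \<theta>_def norm_power_int)
    show "\<forall>g\<in>carrier G. \<theta> (g \<otimes> t) = z * \<theta> g"
    proof
      fix g assume g: "g \<in> carrier G"
      show "\<theta> (g \<otimes> t) = z * \<theta> g"
      proof (cases "\<exists>k::int. g = t [^] k")
        case True
        then obtain k :: int where k: "g = t [^] k" by blast
        have "g \<otimes> t = t [^] (k + 1)"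
          using int_pow_mult[OF t(1), of k 1] int_pow_1[OF t(1)] k by simp
        then show ?thesis
          using \<theta>[of k] \<theta>[of "k + 1"] k z0 by (simp add: power_int_add)
      next
        case False
        have "\<not> (\<exists>k::int. g \<otimes> t = t [^] k)"
        proof
          assume "\<exists>k::int. g \<otimes> t = t [^] k"
          then obtain k :: int where "g \<otimes> t = t [^] k" by blast
          then have "g = t [^] k \<otimes> inv t"
            using g t(1) by (metis inv_solve_right int_pow_closed)
          also have "\<dots> = t [^] (k - 1)"
            using int_pow_diff[OF t(1), of k 1] int_pow_1[OF t(1)] by simp
          finally show False
            using False by blast
        qed
        then show ?thesis
          using False by (simp add: \<theta>_def)
      qed
    qed
  qed (use z(2) in \<open>auto simp: \<theta>_def\<close>)
qed

context twisted_action
begin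

text \<open>For \<theta> a character of a subgroup of the stabiliser, extended by zero, this is the
  functional behind the representation induced from evaluation at \<open>x\<close> and
  \<theta>.\<close>

definition functional_at :: "'x \<Rightarrow> ('g \<Rightarrow> complex) \<Rightarrow> ('g \<Rightarrow> 'x \<Rightarrow> complex) \<Rightarrow> complex" where
  "functional_at x \<theta> b = (\<Sum>\<^sub>\<infinity>g\<in>carrier G. \<theta> g * b g x)"

lemma functional_at_summable:
  assumes \<theta>: "\<And>g. cmod (\<theta> g) \<le> 1" and b: "b \<in> carrier F"
  shows "(\<lambda>g. \<theta> g * b g x) summable_on carrier G"
proof (rule abs_summable_summable, rule summable_on_comparison_test[OF F_summable[OF b]])
  fix g
  have "cmod (\<theta> g) * cmod (b g x) \<le> 1 * sup_norm (b g)"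
    by (intro mult_mono \<theta> norm_le_sup_norm[OF F_C0[OF b]]) auto
  then show "cmod (\<theta> g * b g x) \<le> sup_norm (b g)"
    by (simp add: norm_mult)
qed simp

lemma functional_at_diff:
  assumes \<theta>: "\<And>g. cmod (\<theta> g) \<le> 1" and b: "b \<in> carrier F" and c: "c \<in> carrier F"
  shows "functional_at x \<theta> (b \<ominus>\<^bsub>F\<^esub> c) = functional_at x \<theta> b - functional_at x \<theta> c"
  using infsum_add[OF functional_at_summable[of \<theta> b x, OF \<theta> b] summable_on_uminus[THEN iffD2, OF functional_at_summable[of \<theta> c x, OF \<theta> c]]]
  unfolding functional_at_def F_diff[OF b c] right_diff_distrib by (simp add: infsum_uminus)

lemma functional_at_add:
  assumes \<theta>: "\<And>g. cmod (\<theta> g) \<le> 1" and b: "b \<in> carrier F" and c: "c \<in> carrier F"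
  shows "functional_at x \<theta> (b \<oplus>\<^bsub>F\<^esub> c) = functional_at x \<theta> b + functional_at x \<theta> c"
  unfolding functional_at_def F_simps distrib_left
  by (rule infsum_add[OF functional_at_summable[OF \<theta> b] functional_at_summable[OF \<theta> c]])

lemma functional_at_smult: "functional_at x \<theta> (k \<odot>\<^bsub>F\<^esub> b) = k * functional_at x \<theta> b"
  unfolding functional_at_def F_simps mult.left_commute[of _ k] by (rule infsum_cmult_right')

lemma functional_at_eq_0: "(\<And>g. b g x = 0) \<Longrightarrow> functional_at x \<theta> b = 0"
  by (simp add: functional_at_def)

text \<open>Where \<theta> does not vanish, the group element fixes \<open>x\<close>, so the
  translate of \<open>f\<close> still has the value \<open>f x\<close> there: \<open>f\<close> acts
  from the right as a scalar.\<close>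

lemma functional_at_mult_single:
  assumes x: "x \<in> topspace X" and b: "b \<in> carrier F" and f: "f \<in> C0 X"
    and fixed: "\<And>g. \<theta> g \<noteq> 0 \<Longrightarrow> g \<in> carrier G \<and> \<phi> g x = x"
  shows "functional_at x \<theta> (b \<otimes>\<^bsub>F\<^esub> single \<one> f) = f x * functional_at x \<theta> b"
proof -
  have "\<theta> g * (b \<otimes>\<^bsub>F\<^esub> single \<one> f) g x = f x * (\<theta> g * b g x)" for g
  proof (cases "\<theta> g = 0")
    case False
    then have g: "g \<in> carrier G" "\<phi> g x = x"
      using fixed by auto
    then have "\<phi> (inv g) x = x"
      using action_inv_cancel[OF g(1) x] by simp
    then show ?thesis
      using mult_single_one_right[OF b g(1) x, of f] by simp
  qed simp
  then show ?thesis
    unfolding functional_at_def by (simp only: infsum_cmult_right')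
qed

lemma functional_at_single: "functional_at x \<theta> (single \<one> f) = \<theta> \<one> * f x"
  unfolding functional_at_def by (subst infsum_single[OF one_closed]) (simp_all add: single_def)

text \<open>Puts the sum over \<open>g\<close> inside, where for fixed \<open>s\<close> it can be
  reindexed by a translation depending on \<open>s\<close>.\<close>

lemma functional_at_mult_swap:
  assumes \<theta>: "\<And>g. cmod (\<theta> g) \<le> 1" and x: "x \<in> topspace X" and m: "m \<in> carrier F" and q: "q \<in> carrier F"
  shows "functional_at x \<theta> (m \<otimes>\<^bsub>F\<^esub> q) =
    (\<Sum>\<^sub>\<infinity>s\<in>carrier G. \<Sum>\<^sub>\<infinity>g\<in>carrier G. \<theta> g * conv_term m q g s x)"
proof -
  have "functional_at x \<theta> (m \<otimes>\<^bsub>F\<^esub> q) =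
      (\<Sum>\<^sub>\<infinity>g\<in>carrier G. \<Sum>\<^sub>\<infinity>s\<in>carrier G. \<theta> g * conv_term m q g s x)"
    unfolding functional_at_def
    by (rule infsum_cong) (simp only: F_mult infsum_cmult_right')
  also have "\<dots> = (\<Sum>\<^sub>\<infinity>s\<in>carrier G. \<Sum>\<^sub>\<infinity>g\<in>carrier G. \<theta> g * conv_term m q g s x)"
  proof (rule infsum_swap_banach, rule abs_summable_summable,
      rule summable_on_comparison_test[OF F_convolution_summable(1)[OF m q]])
    fix z assume "z \<in> carrier G \<times> carrier G"
    then obtain g s where z: "z = (g, s)" and gs: "g \<in> carrier G" "s \<in> carrier G" by auto
    have "cmod (\<theta> g) * cmod (conv_term m q g s x) \<le> 1 * (sup_norm (m s) * sup_norm (q (inv s \<otimes> g)))"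
      by (intro mult_mono \<theta> order_trans[OF norm_le_sup_norm[OF conv_term_C0[OF m q gs]] conv_term_le[OF m q gs]]) auto
    then show "cmod (case z of (g, s) \<Rightarrow> \<theta> g * conv_term m q g s x) \<le>
        (case z of (r, s) \<Rightarrow> sup_norm (m s) * sup_norm (q (inv s \<otimes> r)))"
      by (simp add: z norm_mult)
  qed simp
  finally show ?thesis .
qed

end

context completed_twisted_action
begin

text \<open>\<open>N\<close> is the left ideal of the functional, with a function \<open>f\<close>,
  \<open>f x = 1\<close>, as modular unit. The two criteria allow testing membership in
  \<open>P\<close> although \<open>L\<close> comes from Zorn's lemma: under the first,
  \<open>d c\<close> lies in \<open>N\<close> for all \<open>c\<close>; under the second,
  \<open>d\<close> equals w f modulo \<open>N\<close>, so \<open>d\<close> in \<open>P\<close> would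
  put the unit into \<open>L\<close>.\<close>

theorem prime_ideal_over_point:
  assumes iso: "isometric_iso F B \<iota>" and x: "x \<in> topspace X"
    and \<theta>: "\<theta> \<one> = 1" "\<And>g. cmod (\<theta> g) \<le> 1" "\<And>g. \<theta> g \<noteq> 0 \<Longrightarrow> g \<in> carrier G \<and> \<phi> g x = x"
  obtains P where "P \<in> prime_ideals B" "quasi_orbit_map G X \<phi> \<iota> P = quasi_orbit G X \<phi> x"
    "\<forall>d\<in>carrier F. (\<forall>a\<in>carrier F. \<forall>c\<in>carrier F. functional_at x \<theta> (a \<otimes>\<^bsub>F\<^esub> (d \<otimes>\<^bsub>F\<^esub> c)) = 0) \<longrightarrow> \<iota> d \<in> P"
    "\<forall>w. \<forall>d\<in>carrier F. w \<noteq> 0 \<longrightarrow>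
      (\<forall>a\<in>carrier F. functional_at x \<theta> (a \<otimes>\<^bsub>F\<^esub> d) = w * functional_at x \<theta> a) \<longrightarrow> \<iota> d \<notin> P"
proof -
  let ?l = "functional_at x \<theta>"
  have bij: "bij_betw \<iota> (carrier F) (carrier B)"
    using iso unfolding isometric_iso_def by blast
  have im_B: "\<exists>b\<in>carrier F. y = \<iota> b" if "y \<in> carrier B" for y
    using bij that unfolding bij_betw_def by blast
  have inj: "b = c" if "\<iota> b = \<iota> c" "b \<in> carrier F" "c \<in> carrier F" for b c
    using bij that unfolding bij_betw_def inj_on_def by blast
  define N where "N = {b \<in> carrier F. \<forall>a\<in>carrier F. ?l (a \<otimes>\<^bsub>F\<^esub> b) = 0}"
  have NF: "b \<in> carrier F" if "b \<in> N" for b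
    using that by (simp add: N_def)
  have ND: "?l (a \<otimes>\<^bsub>F\<^esub> b) = 0" if "b \<in> N" "a \<in> carrier F" for a b
    using that by (simp add: N_def)
  have NI: "b \<in> N" if "b \<in> carrier F" "\<And>a. a \<in> carrier F \<Longrightarrow> ?l (a \<otimes>\<^bsub>F\<^esub> b) = 0" for b
    unfolding N_def using that by blast
  have L0: "B.left_ideal (\<iota> ` N)"
    unfolding B.left_ideal_def
  proof (intro conjI ballI allI)
    show "\<iota> ` N \<subseteq> carrier B"
      using NF iota_closed by blast
    have "(\<lambda>g x. 0) \<in> N"
    proof (rule NI[OF F_zero_closed])
      fix a assume a: "a \<in> carrier F"
      have "a \<otimes>\<^bsub>F\<^esub> (\<lambda>g x. 0) = (\<lambda>g x. 0)"
        using F_mult_smult_right[of a 0 "\<lambda>g x. 0"] by simp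
      then show "?l (a \<otimes>\<^bsub>F\<^esub> (\<lambda>g x. 0)) = 0"
        by (simp add: functional_at_eq_0)
    qed
    then show "\<zero>\<^bsub>B\<^esub> \<in> \<iota> ` N"
      using iota_zero by (metis imageI)
    fix y assume "y \<in> \<iota> ` N"
    then obtain b where b: "b \<in> N" "y = \<iota> b" by blast
    note bF = NF[OF b(1)]
    show "k \<odot>\<^bsub>B\<^esub> y \<in> \<iota> ` N" for k
    proof -
      have "k \<odot>\<^bsub>F\<^esub> b \<in> N"
        by (rule NI[OF F_smult_closed[OF bF]])
          (simp only: F_mult_smult_right functional_at_smult ND[OF b(1)] mult_zero_right)
      then show ?thesis
        unfolding b(2) iota_smult[OF bF, symmetric] by blast
    qed
    show "y \<oplus>\<^bsub>B\<^esub> y' \<in> \<iota> ` N" if y': "y' \<in> \<iota> ` N" for y'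
    proof -
      obtain b' where b': "b' \<in> N" "y' = \<iota> b'" using y' by blast
      note b'F = NF[OF b'(1)]
      have "b \<oplus>\<^bsub>F\<^esub> b' \<in> N"
      proof (rule NI[OF F_add_closed[OF bF b'F]])
        fix a assume a: "a \<in> carrier F"
        show "?l (a \<otimes>\<^bsub>F\<^esub> (b \<oplus>\<^bsub>F\<^esub> b')) = 0"
          unfolding F_mult_add_right[OF bF b'F a]
            functional_at_add[OF \<theta>(2) F_mult_closed[OF a bF] F_mult_closed[OF a b'F]]
            ND[OF b(1) a] ND[OF b'(1) a] by simp
      qed
      then show ?thesis
        unfolding b(2) b'(2) iota_add[OF bF b'F, symmetric] by blast
    qed
    show "z \<otimes>\<^bsub>B\<^esub> y \<in> \<iota> ` N" if z: "z \<in> carrier B" for z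
    proof -
      obtain c where c: "c \<in> carrier F" "z = \<iota> c" using im_B[OF z] by blast
      have "c \<otimes>\<^bsub>F\<^esub> b \<in> N"
      proof (rule NI[OF F_mult_closed[OF c(1) bF]])
        fix a assume a: "a \<in> carrier F"
        show "?l (a \<otimes>\<^bsub>F\<^esub> (c \<otimes>\<^bsub>F\<^esub> b)) = 0"
          unfolding F_mult_assoc[OF a c(1) bF, symmetric] by (rule ND[OF b(1) F_mult_closed[OF a c(1)]])
      qed
      then show ?thesis
        unfolding b(2) c(2) iota_mult[OF c(1) bF, symmetric] by blast
    qed
  qed
  obtain f where f: "f \<in> C0 X" "f x = 1"
    using bump_at[OF openin_topspace x] by metis
  have s: "single \<one> f \<in> carrier F"
    using f(1) by (intro single_closed) auto
  have e: "emb f \<in> carrier B"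
    by (rule emb_closed[OF f(1)])
  have "emb f \<notin> \<iota> ` N"
  proof
    assume "emb f \<in> \<iota> ` N"
    then have "single \<one> f \<in> N"
      unfolding emb_def using inj[OF _ s] NF by blast
    from ND[OF this s] show False
      using functional_at_mult_single[OF x s f(1) \<theta>(3)] functional_at_single[of x \<theta> f] f(2) \<theta>(1) by simp
  qed
  have unit: "?l (a \<otimes>\<^bsub>F\<^esub> single \<one> f) = ?l a" if "a \<in> carrier F" for a
    using functional_at_mult_single[OF x that f(1) \<theta>(3)] f(2) by simp
  have mod: "b \<ominus>\<^bsub>B\<^esub> b \<otimes>\<^bsub>B\<^esub> emb f \<in> \<iota> ` N" if b: "b \<in> carrier B" for b
  proof -
    obtain c where c: "c \<in> carrier F" "b = \<iota> c" using im_B[OF b] by blast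
    note cs = F_mult_closed[OF c(1) s]
    have "c \<ominus>\<^bsub>F\<^esub> c \<otimes>\<^bsub>F\<^esub> single \<one> f \<in> N"
    proof (rule NI[OF F.M.minus_closed[OF c(1) cs]])
      fix a assume a: "a \<in> carrier F"
      note ac = F_mult_closed[OF a c(1)]
      have "a \<otimes>\<^bsub>F\<^esub> (c \<ominus>\<^bsub>F\<^esub> c \<otimes>\<^bsub>F\<^esub> single \<one> f) = a \<otimes>\<^bsub>F\<^esub> c \<ominus>\<^bsub>F\<^esub> (a \<otimes>\<^bsub>F\<^esub> c) \<otimes>\<^bsub>F\<^esub> single \<one> f"
        using F.mult_diff_right[OF c(1) cs a] F_mult_assoc[OF a c(1) s] by (simp only:)
      then show "?l (a \<otimes>\<^bsub>F\<^esub> (c \<ominus>\<^bsub>F\<^esub> c \<otimes>\<^bsub>F\<^esub> single \<one> f)) = 0"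
        using functional_at_diff[OF \<theta>(2) ac F_mult_closed[OF ac s]] unit[OF ac] by (simp only: diff_self)
    qed
    then show ?thesis
      unfolding c(2) emb_def iota_mult[OF c(1) s, symmetric] iota_diff[OF c(1) cs, symmetric] by blast
  qed
  obtain L where L: "B.left_ideal L" "\<iota> ` N \<subseteq> L" "emb f \<notin> L"
    "{b \<in> carrier B. \<forall>c\<in>carrier B. b \<otimes>\<^bsub>B\<^esub> c \<in> L} \<in> prime_ideals B"
    "{b \<in> carrier B. \<forall>c\<in>carrier B. b \<otimes>\<^bsub>B\<^esub> c \<in> L} \<subseteq> L"
    by (rule B.prime_ideal_of_modular_left_ideal[OF L0 e \<open>emb f \<notin> \<iota> ` N\<close> mod])
  define P where "P = {b \<in> carrier B. \<forall>c\<in>carrier B. b \<otimes>\<^bsub>B\<^esub> c \<in> L}"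
  have prime: "P \<in> prime_ideals B" and PL: "P \<subseteq> L"
    using L(4,5) by (auto simp: P_def)
  have PI: "P \<in> closed_ideals B"
    using prime by (simp add: prime_ideals_def)
  have mem: "\<iota> d \<in> P" if d: "d \<in> carrier F"
    "\<forall>a\<in>carrier F. \<forall>c\<in>carrier F. ?l (a \<otimes>\<^bsub>F\<^esub> (d \<otimes>\<^bsub>F\<^esub> c)) = 0" for d
  proof -
    have "\<iota> d \<otimes>\<^bsub>B\<^esub> y \<in> L" if y: "y \<in> carrier B" for y
    proof -
      obtain c where c: "c \<in> carrier F" "y = \<iota> c" using im_B[OF y] by blast
      have "d \<otimes>\<^bsub>F\<^esub> c \<in> N"
        using d c(1) by (intro NI F_mult_closed) auto
      then show ?thesis
        unfolding c(2) iota_mult[OF d(1) c(1), symmetric] using L(2) by blast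
    qed
    then show ?thesis
      using iota_closed[OF d(1)] by (simp add: P_def)
  qed
  have not_mem: "\<iota> d \<notin> P" if d: "d \<in> carrier F" and w: "w \<noteq> 0"
    and eq: "\<forall>a\<in>carrier F. ?l (a \<otimes>\<^bsub>F\<^esub> d) = w * ?l a" for w d
  proof
    assume "\<iota> d \<in> P"
    then have dL: "\<iota> d \<in> L" using PL by blast
    have ws: "w \<odot>\<^bsub>F\<^esub> single \<one> f \<in> carrier F"
      by (rule F_smult_closed[OF s])
    have "w \<odot>\<^bsub>F\<^esub> single \<one> f \<ominus>\<^bsub>F\<^esub> d \<in> N"
    proof (rule NI[OF F.M.minus_closed[OF ws d]])
      fix a assume a: "a \<in> carrier F"
      have "?l (a \<otimes>\<^bsub>F\<^esub> (w \<odot>\<^bsub>F\<^esub> single \<one> f)) = w * ?l a"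
        using unit[OF a] by (simp only: F_mult_smult_right functional_at_smult)
      moreover have "?l (a \<otimes>\<^bsub>F\<^esub> d) = w * ?l a"
        using eq a by blast
      ultimately show "?l (a \<otimes>\<^bsub>F\<^esub> (w \<odot>\<^bsub>F\<^esub> single \<one> f \<ominus>\<^bsub>F\<^esub> d)) = 0"
        using functional_at_diff[OF \<theta>(2) F_mult_closed[OF a ws] F_mult_closed[OF a d], of x]
        by (simp only: F.mult_diff_right[OF ws d a] diff_self)
    qed
    then have "\<iota> (w \<odot>\<^bsub>F\<^esub> single \<one> f) \<ominus>\<^bsub>B\<^esub> \<iota> d \<in> L"
      unfolding iota_diff[OF ws d, symmetric] using L(2) by blast
    then have "(\<iota> (w \<odot>\<^bsub>F\<^esub> single \<one> f) \<ominus>\<^bsub>B\<^esub> \<iota> d) \<oplus>\<^bsub>B\<^esub> \<iota> d \<in> L"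
      using B.left_ideal_add[OF L(1)] dL by blast
    then have "w \<odot>\<^bsub>B\<^esub> emb f \<in> L"
      using B.diff_add_cancel[OF iota_closed[OF ws] iota_closed[OF d]] iota_smult[OF s, of w]
      unfolding emb_def by argo
    then have "inverse w \<odot>\<^bsub>B\<^esub> (w \<odot>\<^bsub>B\<^esub> emb f) \<in> L"
      by (rule B.left_ideal_smult[OF L(1)])
    then have "emb f \<in> L"
      using B.smult_assoc1[of "inverse w" w "emb f"] B.smult_one[of "emb f"] e w by simp
    then show False
      using L(3) by blast
  qed
  have "ideal_support P = off_orbit x"
  proof
    have "x \<notin> ideal_support P"
    proof
      assume "x \<in> ideal_support P"
      then obtain h where h: "h \<in> C0 X" "emb h \<in> P" "h x \<noteq> 0"
        by (auto simp: ideal_support_def)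
      have "single \<one> h \<in> carrier F"
        using h(1) by (intro single_closed) auto
      moreover have "\<forall>a\<in>carrier F. ?l (a \<otimes>\<^bsub>F\<^esub> single \<one> h) = h x * ?l a"
        using functional_at_mult_single[OF x _ h(1) \<theta>(3)] by blast
      ultimately show False
        using not_mem[OF _ h(3)] h(2) unfolding emb_def by blast
    qed
    then show "ideal_support P \<subseteq> off_orbit x"
      using open_invariant_subset_off_orbit_iff[OF openin_ideal_support ideal_support_invariant[OF PI] x] by blast
    show "off_orbit x \<subseteq> ideal_support P"
    proof
      fix y assume "y \<in> off_orbit x"
      then obtain h where h: "h \<in> C0 X" "h y = 1" "\<And>z. z \<notin> off_orbit x \<Longrightarrow> h z = 0"
        using bump_at[OF openin_off_orbit] by metis
      have sh: "single \<one> h \<in> supported (off_orbit x)"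
        by (rule single_supported[OF h(1,3)])
      have "emb h \<in> P"
        unfolding emb_def
      proof (rule mem)
        show "single \<one> h \<in> carrier F"
          using sh supported_subset by blast
        show "\<forall>a\<in>carrier F. \<forall>c\<in>carrier F. ?l (a \<otimes>\<^bsub>F\<^esub> (single \<one> h \<otimes>\<^bsub>F\<^esub> c)) = 0"
        proof (intro ballI functional_at_eq_0)
          fix a c g assume a: "a \<in> carrier F" and c: "c \<in> carrier F"
          have "a \<otimes>\<^bsub>F\<^esub> (single \<one> h \<otimes>\<^bsub>F\<^esub> c) \<in> supported (off_orbit x)"
            by (intro supported_mult[OF invariant_off_orbit[OF x]] sh a c)
          then show "(a \<otimes>\<^bsub>F\<^esub> (single \<one> h \<otimes>\<^bsub>F\<^esub> c)) g x = 0"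
            using not_in_off_orbit[of x] unfolding supported_def by blast
        qed
      qed
      then show "y \<in> ideal_support P"
        using h(1,2) by (auto simp: ideal_support_def)
    qed
  qed
  then have "\<iota> (single \<one> a) \<in> P \<longleftrightarrow> (\<forall>y. y \<notin> off_orbit x \<longrightarrow> a y = 0)" if "a \<in> C0 X" for a
    using emb_in_ideal_iff[OF PI that] unfolding emb_def by simp
  then have "quasi_orbit_map G X \<phi> \<iota> P = quasi_orbit G X \<phi> x"
    by (rule quasi_orbit_map_eq[OF x])
  then show thesis
    using that[of P] prime mem not_mem by blast
qed

end

context completed_twisted_action
begin

text \<open>The assumption \<open>fixed\<close> enters twice: at \<open>x\<close> it puts
  \<open>t\<close> into the stabiliser, so that the character can be used; at the other points of
  the orbit inside \<open>V\<close> it makes f \<delta>_t indistinguishable from f in the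
  representation given by the indicator function.\<close>

theorem quasi_orbit_map_not_injective:
  assumes iso: "isometric_iso F B \<iota>"
    and triv: "\<And>r s y. r \<in> carrier G \<Longrightarrow> s \<in> carrier G \<Longrightarrow> y \<in> topspace X \<Longrightarrow> u r s y = 1"
    and Y: "invariant_set G X \<phi> Y" and t: "t \<in> carrier G" "t \<noteq> \<one>"
    and V: "openin X V" and x: "x \<in> V" "x \<in> Y"
    and fixed: "\<And>y. y \<in> V \<Longrightarrow> y \<in> Y \<Longrightarrow> \<phi> t y = y"
  shows "\<not> inj_on (quasi_orbit_map G X \<phi> \<iota>) (prime_ideals B)"
proof -
  have YX: "y \<in> topspace X" if "y \<in> Y" for y
    using Y that by (auto simp: invariant_set_def)
  note xX = YX[OF x(2)]
  obtain f where f: "f \<in> C0 X" "f x = 1" "\<And>y. y \<notin> V \<Longrightarrow> f y = 0"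
    using bump_at[OF V x(1)] by metis
  have s1: "single \<one> f \<in> carrier F" and st: "single t f \<in> carrier F"
    using single_closed[OF one_closed f(1)] single_closed[OF t(1) f(1)] by blast+
  define d where "d = single \<one> f \<ominus>\<^bsub>F\<^esub> single t f"
  have d: "d \<in> carrier F"
    unfolding d_def by (rule F.M.minus_closed[OF s1 st])
  have dc: "(d \<otimes>\<^bsub>F\<^esub> c) r y = f y * (c r y - c (inv t \<otimes> r) y)"
    if c: "c \<in> carrier F" and r: "r \<in> carrier G" and y: "y \<in> Y" for c r y
  proof -
    have "d \<otimes>\<^bsub>F\<^esub> c = single \<one> f \<otimes>\<^bsub>F\<^esub> c \<ominus>\<^bsub>F\<^esub> single t f \<otimes>\<^bsub>F\<^esub> c"
      unfolding d_def by (rule F.mult_diff_left[OF s1 st c])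
    then have "(d \<otimes>\<^bsub>F\<^esub> c) r y = (single \<one> f \<otimes>\<^bsub>F\<^esub> c) r y - (single t f \<otimes>\<^bsub>F\<^esub> c) r y"
      by (simp only: F_diff[OF F_mult_closed[OF s1 c] F_mult_closed[OF st c]])
    also have "\<dots> = f y * c r y - f y * c (inv t \<otimes> r) (\<phi> (inv t) y)"
      unfolding mult_single_one_left[OF c f(1)] mult_single_left[OF c t(1) r YX[OF y]]
      using triv[OF t(1) m_closed[OF inv_closed[OF t(1)] r] YX[OF y]] by simp
    also have "\<dots> = f y * (c r y - c (inv t \<otimes> r) y)"
    \<comment> \<open>Where \<open>f\<close> does not vanish on \<open>Y\<close>, the point is fixed
      by \<open>t\<close>, and the translation in the second term disappears.\<close>
    proof (cases "f y = 0")
      case False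
      then have "\<phi> t y = y"
        using fixed[OF _ y] f(3) by blast
      then have "\<phi> (inv t) y = y"
        using action_inv_cancel[OF t(1) YX[OF y]] by simp
      then show ?thesis
        by (simp only: right_diff_distrib)
    qed simp
    finally show ?thesis .
  qed
  define \<tau> :: "'g \<Rightarrow> complex" where "\<tau> g = (if g \<in> carrier G \<and> \<phi> g x = x then 1 else 0)" for g
  have \<tau>: "\<tau> \<one> = 1" "\<And>g. cmod (\<tau> g) \<le> 1" "\<And>g. \<tau> g \<noteq> 0 \<Longrightarrow> g \<in> carrier G \<and> \<phi> g x = x"
    using action_one[OF xX] by (auto simp: \<tau>_def split: if_splits)
  have vanish: "functional_at x \<tau> (a \<otimes>\<^bsub>F\<^esub> (d \<otimes>\<^bsub>F\<^esub> c)) = 0" if a: "a \<in> carrier F" and c: "c \<in> carrier F" for a c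
    unfolding functional_at_mult_swap[of \<tau>, OF \<tau>(2) xX a F_mult_closed[OF d c]]
  proof (rule infsum_0)
    fix s assume s: "s \<in> carrier G"
    define z where "z = \<phi> (inv s) x"
    have z: "z \<in> Y"
      unfolding z_def by (rule invariantD[OF Y inv_closed[OF s] x(2)])
    \<comment> \<open>\<open>k\<close> is the conjugate of t^-1 by \<open>s\<close>. It fixes
      \<open>x\<close> as soon as \<open>f\<close> does not vanish at z = s^-1 x, because
      \<open>t\<close> then fixes z. So \<tau> is invariant under left translation by
      \<open>k\<close>, and the two sums agree after reindexing.\<close>
    define k where "k = s \<otimes> (inv t \<otimes> inv s)"
    have k: "k \<in> carrier G"
      using s t(1) by (simp add: k_def)
    define H where "H g = \<tau> g * c (inv s \<otimes> g) z" for g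
    have term_eq: "\<tau> g * conv_term a (d \<otimes>\<^bsub>F\<^esub> c) g s x = a s x * f z * (H g - H (k \<otimes> g))" if g: "g \<in> carrier G" for g
    proof -
      have sg: "inv s \<otimes> g \<in> carrier G" using s g by simp
      have "conv_term a (d \<otimes>\<^bsub>F\<^esub> c) g s x = a s x * (d \<otimes>\<^bsub>F\<^esub> c) (inv s \<otimes> g) z"
        unfolding conv_term_def dual_apply[OF xX] z_def using triv[OF s sg xX] by simp
      also have "\<dots> = a s x * (f z * (c (inv s \<otimes> g) z - c (inv t \<otimes> (inv s \<otimes> g)) z))"
        unfolding dc[OF c sg z] ..
      finally have ct: "conv_term a (d \<otimes>\<^bsub>F\<^esub> c) g s x =
          a s x * (f z * (c (inv s \<otimes> g) z - c (inv t \<otimes> (inv s \<otimes> g)) z))" .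
      show ?thesis
      proof (cases "f z = 0")
        case True
        then show ?thesis
          unfolding ct by simp
      next
        case False
        then have "\<phi> t z = z"
          using fixed[OF _ z] f(3) by blast
        then have "\<phi> (inv t) z = z"
          using action_inv_cancel[OF t(1) YX[OF z]] by simp
        then have kx: "\<phi> k x = x"
          using composition_rule[OF xX s m_closed[OF inv_closed[OF t(1)] inv_closed[OF s]]]
            composition_rule[OF xX inv_closed[OF t(1)] inv_closed[OF s]] action_cancel_inv[OF s xX]
          by (simp add: k_def z_def)
        have "\<phi> (k \<otimes> g) x = x \<longleftrightarrow> \<phi> g x = x"
          using composition_rule[OF xX k g] kx inj_onD[OF inj_prop[OF k], of "\<phi> g x" x] action_closed[OF g xX] xX
          by auto
        then have "\<tau> (k \<otimes> g) = \<tau> g"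
          using k g by (simp add: \<tau>_def)
        moreover have "inv s \<otimes> (k \<otimes> g) = inv t \<otimes> (inv s \<otimes> g)"
          using s t(1) g by (simp add: k_def m_assoc inv_solve_left')
        ultimately show ?thesis
          unfolding ct H_def by (simp add: algebra_simps)
      qed
    qed
    have summ: "(\<lambda>g. sup_norm (c (inv s \<otimes> g))) summable_on carrier G"
      unfolding summable_on_reindex_bij_betw[OF bij_betw_mult_left[OF inv_closed[OF s]], of "\<lambda>g. sup_norm (c g)"]
      by (rule F_summable[OF c])
    have H: "H summable_on carrier G"
    proof (rule abs_summable_summable, rule summable_on_comparison_test[OF summ])
      fix g
      have "cmod (\<tau> g) * cmod (c (inv s \<otimes> g) z) \<le> 1 * sup_norm (c (inv s \<otimes> g))"
        by (intro mult_mono \<tau>(2) norm_le_sup_norm[OF F_C0[OF c]]) auto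
      then show "cmod (H g) \<le> sup_norm (c (inv s \<otimes> g))"
        by (simp add: H_def norm_mult)
    qed simp
    have Hk: "(\<lambda>g. H (k \<otimes> g)) summable_on carrier G" "infsum (\<lambda>g. H (k \<otimes> g)) (carrier G) = infsum H (carrier G)"
      using H summable_on_reindex_bij_betw[OF bij_betw_mult_left[OF k], of H]
        infsum_reindex_bij_betw[OF bij_betw_mult_left[OF k], of H] by auto
    have "(\<Sum>\<^sub>\<infinity>g\<in>carrier G. \<tau> g * conv_term a (d \<otimes>\<^bsub>F\<^esub> c) g s x) =
        (\<Sum>\<^sub>\<infinity>g\<in>carrier G. a s x * f z * (H g - H (k \<otimes> g)))"
      by (rule infsum_cong[OF term_eq])
    also have "\<dots> = a s x * f z * (\<Sum>\<^sub>\<infinity>g\<in>carrier G. H g - H (k \<otimes> g))"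
      by (rule infsum_cmult_right')
    also have "(\<Sum>\<^sub>\<infinity>g\<in>carrier G. H g - H (k \<otimes> g)) = 0"
      using infsum_add[OF H summable_on_uminus[THEN iffD2, OF Hk(1)]] Hk(2) by (simp add: infsum_uminus)
    finally show "(\<Sum>\<^sub>\<infinity>g\<in>carrier G. \<tau> g * conv_term a (d \<otimes>\<^bsub>F\<^esub> c) g s x) = 0"
      by simp
  qed
  obtain P where P: "P \<in> prime_ideals B" "quasi_orbit_map G X \<phi> \<iota> P = quasi_orbit G X \<phi> x" "\<iota> d \<in> P"
  proof -
    obtain P where P: "P \<in> prime_ideals B" "quasi_orbit_map G X \<phi> \<iota> P = quasi_orbit G X \<phi> x"
      "\<forall>d\<in>carrier F. (\<forall>a\<in>carrier F. \<forall>c\<in>carrier F. functional_at x \<tau> (a \<otimes>\<^bsub>F\<^esub> (d \<otimes>\<^bsub>F\<^esub> c)) = 0) \<longrightarrow> \<iota> d \<in> P"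
      by (rule prime_ideal_over_point[of x \<tau>, OF iso xX \<tau>])
    show thesis
      using vanish d by (intro that[of P] P(1,2) P(3)[THEN bspec, THEN mp]) auto
  qed
  obtain \<theta> z where \<theta>: "\<theta> \<one> = 1" "z \<noteq> 1" "\<forall>g. cmod (\<theta> g) \<le> 1" "\<forall>g\<in>carrier G. \<theta> (g \<otimes> t) = z * \<theta> g"
      "\<forall>g. \<theta> g \<noteq> 0 \<longrightarrow> (\<exists>k::int. g = t [^] k)"
    by (rule exists_character_on_powers[OF t])
  have bound: "cmod (\<theta> g) \<le> 1" for g
    using \<theta>(3) by blast
  have stab: "g \<in> carrier G \<and> \<phi> g x = x" if "\<theta> g \<noteq> 0" for g
  proof -
    obtain k :: int where k: "g = t [^] k"
      using \<theta>(5) \<open>\<theta> g \<noteq> 0\<close> by blast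
    have "t \<in> stabilizer G \<phi> x"
      using t(1) fixed[OF x] by (simp add: stabilizer_def)
    then have "g \<in> stabilizer G \<phi> x"
      unfolding k by (rule subgroup_int_pow_closed[OF stabilizer_subgroup[OF xX]])
    then show ?thesis
      by (simp add: stabilizer_def)
  qed
  \<comment> \<open>Reindexing by right translation with \<open>t\<close> pulls out the factor
    \<open>z\<close>: f \<delta>_t acts as \<open>z\<close> and f as 1, so \<open>d\<close> acts as
    the non-zero scalar 1 - z and is kept out of the second prime.\<close>
  have eigen: "functional_at x \<theta> (a \<otimes>\<^bsub>F\<^esub> d) = (1 - z) * functional_at x \<theta> a" if a: "a \<in> carrier F" for a
  proof -
    define K where "K g = \<theta> g * a g x" for g
    have it: "inv t \<in> carrier G" using t(1) by simp
    have "\<theta> g * (a \<otimes>\<^bsub>F\<^esub> single t f) g x = z * K (g \<otimes> inv t)" if g: "g \<in> carrier G" for g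
    proof -
      define h where "h = g \<otimes> inv t"
      have h: "h \<in> carrier G" "g = h \<otimes> t"
        using g t(1) by (simp_all add: h_def m_assoc)
      have eq: "\<theta> g = z * \<theta> h"
        using \<theta>(4) h by blast
      have val: "(a \<otimes>\<^bsub>F\<^esub> single t f) g x = a h x * f (\<phi> (inv h) x)"
        using mult_single_right[OF a t(1) g xX, of f] triv[OF h(1) t(1) xX] by (simp add: h_def)
      show ?thesis
      proof (cases "\<theta> h = 0")
        case True
        then show ?thesis
          using eq by (simp add: K_def h_def[symmetric])
      next
        case False
        then have "\<phi> (inv h) x = x"
          using stab[of h] action_inv_cancel[OF h(1) xX] by simp
        then show ?thesis
          unfolding K_def h_def[symmetric] val eq using f(2) by simp
      qed
    qed
    then have "functional_at x \<theta> (a \<otimes>\<^bsub>F\<^esub> single t f) = (\<Sum>\<^sub>\<infinity>g\<in>carrier G. z * K (g \<otimes> inv t))"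
      unfolding functional_at_def by (rule infsum_cong)
    also have "\<dots> = z * (\<Sum>\<^sub>\<infinity>g\<in>carrier G. K (g \<otimes> inv t))"
      by (rule infsum_cmult_right')
    also have "(\<Sum>\<^sub>\<infinity>g\<in>carrier G. K (g \<otimes> inv t)) = functional_at x \<theta> a"
      unfolding functional_at_def K_def[symmetric] by (rule infsum_reindex_bij_betw[OF bij_betw_mult_right[OF it]])
    finally have ft: "functional_at x \<theta> (a \<otimes>\<^bsub>F\<^esub> single t f) = z * functional_at x \<theta> a" .
    have f1: "functional_at x \<theta> (a \<otimes>\<^bsub>F\<^esub> single \<one> f) = functional_at x \<theta> a"
      using functional_at_mult_single[of x a f \<theta>, OF xX a f(1) stab] f(2) by simp
    have "functional_at x \<theta> (a \<otimes>\<^bsub>F\<^esub> d) =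
        functional_at x \<theta> (a \<otimes>\<^bsub>F\<^esub> single \<one> f) - functional_at x \<theta> (a \<otimes>\<^bsub>F\<^esub> single t f)"
      unfolding d_def F.mult_diff_right[OF s1 st a]
      by (rule functional_at_diff[of \<theta>, OF bound F_mult_closed[OF a s1] F_mult_closed[OF a st]])
    then show ?thesis
      unfolding ft f1 by (simp add: left_diff_distrib)
  qed
  obtain Q where Q: "Q \<in> prime_ideals B" "quasi_orbit_map G X \<phi> \<iota> Q = quasi_orbit G X \<phi> x" "\<iota> d \<notin> Q"
  proof -
    obtain Q where Q: "Q \<in> prime_ideals B" "quasi_orbit_map G X \<phi> \<iota> Q = quasi_orbit G X \<phi> x"
      "\<forall>w. \<forall>d\<in>carrier F. w \<noteq> 0 \<longrightarrow>
        (\<forall>a\<in>carrier F. functional_at x \<theta> (a \<otimes>\<^bsub>F\<^esub> d) = w * functional_at x \<theta> a) \<longrightarrow> \<iota> d \<notin> Q"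
      by (rule prime_ideal_over_point[of x \<theta>, OF iso xX \<theta>(1) bound stab])
    have "1 - z \<noteq> 0"
      using \<theta>(2) by simp
    then show thesis
      using eigen by (intro that[of Q] Q(1,2) Q(3)[THEN spec[of _ "1 - z"], THEN bspec, THEN mp, THEN mp] d) auto
  qed
  show ?thesis
  proof
    assume "inj_on (quasi_orbit_map G X \<phi> \<iota>) (prime_ideals B)"
    from inj_onD[OF this _ P(1) Q(1)] have "P = Q"
      using P(2) Q(2) by simp
    then show False
      using P(3) Q(3) by blast
  qed
qed

end

section \<open>The two implications of the theorem\<close>

lemma (in homeo_action) trivial_cocycle:
  "(\<lambda>s t x. if x \<in> topspace X then 1 else 0) \<in> cocycles G X \<phi>"
proof -
  have "continuous_map X euclidean (\<lambda>x. if x \<in> topspace X then 1 else 0 :: complex)"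
    by (rule continuous_map_eq[of _ _ "\<lambda>_. 1"]) auto
  moreover have "\<phi> (inv r) x \<in> topspace X" if "r \<in> carrier G" "x \<in> topspace X" for r x
    using that group.inv_closed[OF group_G] action_closed by blast
  ultimately show ?thesis
    by (simp add: cocycles_def Cu_def dual_action_def restr_def)
qed

theorem corollary6p19:
  fixes G :: "('g, 'm) monoid_scheme"
    and X :: "'x topology"
    and \<phi> :: "'g \<Rightarrow> 'x \<Rightarrow> 'x"
  assumes "homeo_action G X \<phi>"
    and "second_countable X" and "locally_compact_space X" and "Hausdorff_space X"
    and universe: "\<exists>j :: (nat \<Rightarrow> 'g \<Rightarrow> 'x \<Rightarrow> complex) \<Rightarrow> 'v. inj j"
  shows "residually_topologically_free G X \<phi> \<longleftrightarrow>
    (\<forall>u\<in>cocycles G X \<phi>.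
     \<forall>(R :: ('v cnormed \<times> (('g \<Rightarrow> 'x \<Rightarrow> complex) \<Rightarrow> 'v \<Rightarrow> 'v)) set)
      (B :: 'v cnormed) \<iota>.
       residually_reduced_crossed_product G X \<phi> u R B \<iota> \<longrightarrow>
       homeomorphic_map (prime_space B) (quasi_orbit_space G X \<phi>) (quasi_orbit_map G X \<phi> \<iota>))"
proof
  assume rtf: "residually_topologically_free G X \<phi>"
  show "\<forall>u\<in>cocycles G X \<phi>.
     \<forall>(R :: ('v cnormed \<times> (('g \<Rightarrow> 'x \<Rightarrow> complex) \<Rightarrow> 'v \<Rightarrow> 'v)) set)
      (B :: 'v cnormed) \<iota>.
       residually_reduced_crossed_product G X \<phi> u R B \<iota> \<longrightarrow>
       homeomorphic_map (prime_space B) (quasi_orbit_space G X \<phi>) (quasi_orbit_map G X \<phi> \<iota>)"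
  proof (intro ballI allI impI)
    fix u and R :: "('v cnormed \<times> (('g \<Rightarrow> 'x \<Rightarrow> complex) \<Rightarrow> 'v \<Rightarrow> 'v)) set" and B :: "'v cnormed" and \<iota>
    assume u: "u \<in> cocycles G X \<phi>" and rr: "residually_reduced_crossed_product G X \<phi> u R B \<iota>"
    have "twisted_action G X \<phi> u"
      using assms(1,3,4) u by (simp add: twisted_action_def twisted_action_axioms_def)
    from twisted_action.residually_reduced_imp_reduced_twisted_action[OF this rr]
    show "homeomorphic_map (prime_space B) (quasi_orbit_space G X \<phi>) (quasi_orbit_map G X \<phi> \<iota>)"
      using assms(2) rtf by (rule reduced_twisted_action.quasi_orbit_map_homeomorphic)
  qed
next
  assume all: "\<forall>u\<in>cocycles G X \<phi>.
     \<forall>(R :: ('v cnormed \<times> (('g \<Rightarrow> 'x \<Rightarrow> complex) \<Rightarrow> 'v \<Rightarrow> 'v)) set)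
      (B :: 'v cnormed) \<iota>.
       residually_reduced_crossed_product G X \<phi> u R B \<iota> \<longrightarrow>
       homeomorphic_map (prime_space B) (quasi_orbit_space G X \<phi>) (quasi_orbit_map G X \<phi> \<iota>)"
  show "residually_topologically_free G X \<phi>"
  proof (rule ccontr)
    assume "\<not> residually_topologically_free G X \<phi>"
    then obtain Y t x where Y: "closedin X Y" "invariant_set G X \<phi> Y"
      and t: "t \<in> carrier G" "t \<noteq> \<one>\<^bsub>G\<^esub>"
      and x: "x \<in> subtopology X Y interior_of invariants (topspace (subtopology X Y)) (restr_action Y \<phi>) t"
      unfolding residually_topologically_free_def topologically_free_def by blast
    then obtain V where V: "openin X V" "x \<in> V" "x \<in> Y"
      "V \<inter> Y \<subseteq> invariants (topspace (subtopology X Y)) (restr_action Y \<phi>) t"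
      unfolding interior_of_def openin_subtopology by blast
    have fixed: "\<phi> t y = y" if "y \<in> V" "y \<in> Y" for y
      using V(4) that by (auto simp: invariants_def restr_action_def)
    define u :: "'g \<Rightarrow> 'g \<Rightarrow> 'x \<Rightarrow> complex" where "u = (\<lambda>s t x. if x \<in> topspace X then 1 else 0)"
    have u: "u \<in> cocycles G X \<phi>"
      unfolding u_def by (rule homeo_action.trivial_cocycle[OF assms(1)])
    interpret twisted_action G X \<phi> u
      using assms(1,3,4) u by (simp add: twisted_action_def twisted_action_axioms_def)
    obtain i :: "(nat \<Rightarrow> 'g \<Rightarrow> 'x \<Rightarrow> complex) \<Rightarrow> 'v" where i: "inj i"
      using universe by blast
    define j where "j b = i (\<lambda>_. b)" for b
    have j: "inj j"
      using injD[OF i] fun_cong unfolding j_def by (intro injI) metis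
    define B where "B = transport F j"
    have iso: "isometric_iso F B j"
      unfolding B_def by (rule isometric_iso_transport[OF F_cbanach_algebra inj_on_subset[OF j subset_UNIV]])
    interpret completed_twisted_action G X \<phi> u B j
      by (rule completed_of_iso[OF iso])
    obtain R :: "('v cnormed \<times> (('g \<Rightarrow> 'x \<Rightarrow> complex) \<Rightarrow> 'v \<Rightarrow> 'v)) set"
      where R: "residually_reduced_crossed_product G X \<phi> u R B j"
      using residually_reduced_of_iso[OF j iso] by blast
    have "homeomorphic_map (prime_space B) (quasi_orbit_space G X \<phi>) (quasi_orbit_map G X \<phi> j)"
      by (rule all[rule_format, OF u R])
    then have "inj_on (quasi_orbit_map G X \<phi> j) (prime_ideals B)"
      using homeomorphic_imp_injective_map B.topspace_prime_space by metis
    moreover have "u r s y = 1" if "y \<in> topspace X" for r s y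
      using that unfolding u_def by simp
    then have "\<not> inj_on (quasi_orbit_map G X \<phi> j) (prime_ideals B)"
      using fixed by (intro quasi_orbit_map_not_injective[OF iso _ Y(2) t V(1-3)])
    ultimately show False
      by blast
  qed
qed

end
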